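(* Let $\Lambda$ be an $\mathbb{R}^d$-valued Lévy basis on $S\times\mathbb{R}^m$ with characteristic quadruplet $(\gamma,\Sigma,\nu,\pi)$ and $f:S\times\mathbb{R}^m\to M_{1\times d}(\mathbb{R})$ measurable. Suppose that for some $\delta>0$: $\int_{\|x\|>1}\|x\|^{4+\delta}\nu(dx)<\infty$, $\gamma+\int_{\|x\|>1}x\,\nu(dx)=0$ and $f\in L^2(S\times\mathbb{R}^m,\pi\otimes\lambda)\cap L^{4+\delta}(S\times\mathbb{R}^m,\pi\otimes\lambda)$. Let $X=(X_u)_{u\in\mathbb{Z}^m}$ be the real-valued mixed moving average field $X_u=\int_S\int_{\mathbb{R}^m}f(z,u-s)\Lambda(dz,ds)$. Suppose $$\hat\eta_X^{(i)}(h):=\Big(\int_S\int_{((-\frac h2,\frac h2)^m)^c}f(z,-s)\Sigma_\Lambda f(z,-s)'\,ds\,\pi(dz)\Big)^{1/2}=\mathcal{O}(h^{-\beta})$$ with $\beta>m\max\left(2,1+\frac1\delta\right)\left(\frac{3+\delta}{2+\delta}\right)$, where $\Sigma_\Lambda=\Sigma+\int_{\mathbb{R}^d}xx'\nu(dx)$. Let $k_0=0,k_1,\dots,k_r\in\mathbb{N}_0\times\mathbb{Z}^{m-1}$ be finitely many lags, $\tilde k=\max_i\|k_i\|_\infty$, and $Y_{j,k}=X_jX_{j+k}-E[X_0X_k]$, $j\in\mathbb{Z}^m$. Then $$\Xi=\sum_{l\in\mathbb{Z}^m}Cov\left(\begin{pmatrix} Y_{0,k_0} \\ \vdots \\ Y_{0,k_r}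 \end{pmatrix},\begin{pmatrix} Y_{l,k_0} \\ \vdots \\ Y_{l,k_r} \end{pmatrix}\right)=\sum_{l\in\mathbb{Z}^m}Cov\left(\begin{pmatrix} X_0X_{k_0} \\ \vdots \\ X_0X_{k_r} \end{pmatrix},\begin{pmatrix} X_lX_{l+k_0} \\ \vdots \\ X_lX_{l+k_r} \end{pmatrix}\right)$$ is finite, positive semidefinite and, with $E_n=(0,n]^m\cap\mathbb{Z}^m$, $$\frac{1}{|E_{n-\tilde k}|^{1/2}}\sum_{j\in E_{n-\tilde k}}\begin{pmatrix} Y_{j,k_0} \\ \vdots \\ Y_{j,k_r} \end{pmatrix}\xrightarrow[n\to\infty]{d}N(0,\Xi).$$
   Context: $S$ is a non-empty Polish space, $\pi$ a probability measure on it, $\lambda$ Lebesgue measure on $\mathbb{R}^m$; a prime denotes transposition. An $\mathbb{R}^d$-valued Lévy basis with characteristic quadruplet $(\gamma,\Sigma,\nu,\pi)$ is a family $\Lambda=\{\Lambda(B)\}$ of $\mathbb{R}^d$-valued random variables indexed by the bounded Borel sets $B\subset S\times\mathbb{R}^m$, with independent values on disjoint sets, almost surely $\sigma$-additive, and with $E[e^{i\langle u,\Lambda(B)\rangle}]=e^{\Phi(u)(\pi\times\lambda)(B)}$, where $\Phi(u)=i\langle\gamma,u\rangle-\frac12\langle u,\Sigma u\rangle+\int_{\mathbb{R}^d}(e^{i\langle u,x\rangle}-1-i\langle u,x\rangle\mathbb{1}_{[0,1]}(\|x\|))\nu(dx)$, $\gamma\in\mathbb{R}^d$, $\Sigma$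 symmetric positive semidefinite, $\nu$ a Lévy measure. Stochastic integrals of deterministic functions with respect to $\Lambda$ are in the sense of Rajput and Rosiński (1989). *)

theory Defs
  imports "HOL-Probability.Probability"
begin

section \<open>Levy bases\<close>

definition psd :: "real^'n^'n \<Rightarrow> bool" where
  "psd A \<longleftrightarrow> transpose A = A \<and> (\<forall>x. 0 \<le> x \<bullet> (A *v x))"

definition levy_measure :: "(real^'d) measure \<Rightarrow> bool" where
  "levy_measure \<nu> \<longleftrightarrow> sets \<nu> = sets borel \<and> emeasure \<nu> {0} = 0
     \<and> integrable \<nu> (\<lambda>x. min 1 ((norm x)\<^sup>2))"

definition levy_exponent ::
  "real^'d \<Rightarrow> real^'d^'d \<Rightarrow> (real^'d) measure \<Rightarrow> real^'d \<Rightarrow> complex" where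
  "levy_exponent \<gamma> Sig \<nu> u =
     \<i> * of_real (\<gamma> \<bullet> u) - of_real (u \<bullet> (Sig *v u)) / 2
     + (CLINT x|\<nu>. iexp (u \<bullet> x) - 1 - \<i> * of_real ((u \<bullet> x) * indicator {0..1} (norm x)))"

text \<open>The bounded Borel sets of \<open>S \<times> \<real>\<^sup>m\<close>; boundedness refers to the product metric, the class
  \<open>polish_space\<close> carrying an arbitrary complete metric on \<open>S\<close>.\<close>

definition bounded_borel :: "('a::metric_space) set set" where
  "bounded_borel = {B \<in> sets borel. bounded B}"

definition levy_basis ::
  "'w measure \<Rightarrow> (('s::polish_space \<times> (real^'m)) set \<Rightarrow> 'w \<Rightarrow> real^'d)
   \<Rightarrow> real^'d \<Rightarrow> real^'d^'d \<Rightarrow> (real^'d) measure \<Rightarrow> 's measure \<Rightarrow> bool" where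
  "levy_basis M \<Lambda> \<gamma> Sig \<nu> \<pi> \<longleftrightarrow>
     prob_space M
   \<and> psd Sig \<and> levy_measure \<nu> \<and> prob_space \<pi> \<and> sets \<pi> = sets borel
   \<and> (\<forall>B\<in>bounded_borel. \<Lambda> B \<in> borel_measurable M)
   \<and> (\<forall>B :: nat \<Rightarrow> _. range B \<subseteq> bounded_borel \<longrightarrow> disjoint_family B \<longrightarrow>
        prob_space.indep_vars M (\<lambda>_. borel) (\<lambda>n. \<Lambda> (B n)) UNIV)
   \<and> (\<forall>B :: nat \<Rightarrow> _. range B \<subseteq> bounded_borel \<longrightarrow> disjoint_family B \<longrightarrow>
        (\<Union>n. B n) \<in> bounded_borel \<longrightarrow>
        (AE \<omega> in M. (\<lambda>n. \<Lambda> (B n) \<omega>) sums \<Lambda> (\<Union>n. B n) \<omega>))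
   \<and> (\<forall>B\<in>bounded_borel. \<forall>u.
        (CLINT \<omega>|M. iexp (u \<bullet> \<Lambda> B \<omega>))
          = exp (levy_exponent \<gamma> Sig \<nu> u * of_real (measure (\<pi> \<Otimes>\<^sub>M lborel) B)))"


section \<open>Stochastic integrals in the sense of Rajput and Rosinski\<close>

definition tendsto_in_prob :: "'w measure \<Rightarrow> (nat \<Rightarrow> 'w \<Rightarrow> real) \<Rightarrow> ('w \<Rightarrow> real) \<Rightarrow> bool" where
  "tendsto_in_prob M Z Z' \<longleftrightarrow>
     (\<forall>\<epsilon>>0. (\<lambda>n. measure M {\<omega> \<in> space M. \<bar>Z n \<omega> - Z' \<omega>\<bar> > \<epsilon>}) \<longlonglongrightarrow> 0)"

text \<open>Integrands take values in the \<open>1 \<times> d\<close> matrices, represented as row vectors in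
  \<open>real^'d\<close>; the product of such a row with a column \<open>x\<close> is the inner product with \<open>x\<close>.
  A simple function \<open>\<Sum>\<^sub>j y\<^sub>j 1\<^bsub>A\<^sub>j\<^esub>\<close> with bounded Borel sets \<open>A\<^sub>j\<close> is the same as a Borel function
  with finite range and bounded support; its integral is written in the canonical
  representation, over its non-zero values.\<close>

definition levy_simple :: "('a::metric_space \<Rightarrow> real^'d) \<Rightarrow> bool" where
  "levy_simple g \<longleftrightarrow> g \<in> borel_measurable borel \<and> finite (range g) \<and> bounded {p. g p \<noteq> 0}"

definition levy_simple_integral ::
  "('a set \<Rightarrow> 'w \<Rightarrow> real^'d) \<Rightarrow> 'a set \<Rightarrow> ('a \<Rightarrow> real^'d) \<Rightarrow> 'w \<Rightarrow> real" where
  "levy_simple_integral \<Lambda> A g \<omega> = (\<Sum>y\<in>range g - {0}. y \<bullet> \<Lambda> (A \<inter> g -` {y}) \<omega>)"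

text \<open>Here \<open>N\<close> is the measure \<open>\<pi> \<times> \<lambda>\<close> on \<open>S \<times> \<real>\<^sup>m\<close>.\<close>

definition has_levy_integral ::
  "'w measure \<Rightarrow> (('a::metric_space) set \<Rightarrow> 'w \<Rightarrow> real^'d) \<Rightarrow> 'a measure
   \<Rightarrow> ('a \<Rightarrow> real^'d) \<Rightarrow> ('w \<Rightarrow> real) \<Rightarrow> bool" where
  "has_levy_integral M \<Lambda> N g Z \<longleftrightarrow>
     Z \<in> borel_measurable M \<and>
     (\<exists>gn. (\<forall>n. levy_simple (gn n))
        \<and> (AE p in N. (\<lambda>n. gn n p) \<longlonglongrightarrow> g p)
        \<and> (\<forall>A\<in>sets borel. \<exists>Z\<^sub>A\<in>borel_measurable M.
              tendsto_in_prob M (\<lambda>n. levy_simple_integral \<Lambda> A (gn n)) Z\<^sub>A)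
        \<and> tendsto_in_prob M (\<lambda>n. levy_simple_integral \<Lambda> UNIV (gn n)) Z)"

text \<open>The integral is determined only up to almost sure equality; this picks a version.\<close>

definition levy_integral ::
  "'w measure \<Rightarrow> (('a::metric_space) set \<Rightarrow> 'w \<Rightarrow> real^'d) \<Rightarrow> 'a measure
   \<Rightarrow> ('a \<Rightarrow> real^'d) \<Rightarrow> 'w \<Rightarrow> real" where
  "levy_integral M \<Lambda> N g = (SOME Z. has_levy_integral M \<Lambda> N g Z)"


section \<open>Mixed moving average fields\<close>

definition real_pt :: "int^'m \<Rightarrow> real^'m" where
  "real_pt u = (\<chi> i. real_of_int (u $ i))"

text \<open>\<open>X\<close> is an arbitrary (measurable) version of the field
  \<open>X\<^sub>u = \<integral>\<^sub>S \<integral>\<^bsub>\<real>\<^sup>m\<^esub> f(z, u - s) \<Lambda>(dz, ds)\<close>.\<close>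

definition mma_field ::
  "'w measure \<Rightarrow> (('s::polish_space \<times> (real^'m)) set \<Rightarrow> 'w \<Rightarrow> real^'d) \<Rightarrow> 's measure
   \<Rightarrow> ('s \<times> (real^'m) \<Rightarrow> real^'d) \<Rightarrow> (int^'m \<Rightarrow> 'w \<Rightarrow> real) \<Rightarrow> bool" where
  "mma_field M \<Lambda> \<pi> f X \<longleftrightarrow>
     (\<forall>u. X u \<in> borel_measurable M
        \<and> (AE \<omega> in M. X u \<omega> =
             levy_integral M \<Lambda> (\<pi> \<Otimes>\<^sub>M lborel) (\<lambda>(z, s). f (z, real_pt u - s)) \<omega>))"

definition sigma_levy :: "real^'d^'d \<Rightarrow> (real^'d) measure \<Rightarrow> real^'d^'d" where
  "sigma_levy Sig \<nu> = Sig + (LINT x|\<nu>. (\<chi> i j. x $ i * x $ j))"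

definition eta_hat ::
  "('s \<times> (real^'m) \<Rightarrow> real^'d) \<Rightarrow> real^'d^'d \<Rightarrow> (real^'d) measure \<Rightarrow> 's measure \<Rightarrow> real \<Rightarrow> real" where
  "eta_hat f Sig \<nu> \<pi> h = sqrt (LINT z|\<pi>.
     (LINT s : - {s. \<forall>i. - h / 2 < s $ i \<and> s $ i < h / 2} | lborel.
        (f (z, - s) v* sigma_levy Sig \<nu>) \<bullet> f (z, - s)))"


section \<open>Sample moments, covariances and normal limits\<close>

text \<open>A family of lags \<open>k\<^sub>0, \<dots>, k\<^sub>r\<close> is indexed by a finite type \<open>'r\<close> with \<open>r + 1\<close> elements.\<close>

definition prod_vec :: "(int^'m \<Rightarrow> 'w \<Rightarrow> real) \<Rightarrow> ('r \<Rightarrow> int^'m) \<Rightarrow> int^'m \<Rightarrow> 'w \<Rightarrow> real^'r" where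
  "prod_vec X k j \<omega> = (\<chi> q. X j \<omega> * X (j + k q) \<omega>)"

definition Y_vec ::
  "'w measure \<Rightarrow> (int^'m \<Rightarrow> 'w \<Rightarrow> real) \<Rightarrow> ('r \<Rightarrow> int^'m) \<Rightarrow> int^'m \<Rightarrow> 'w \<Rightarrow> real^'r" where
  "Y_vec M X k j \<omega> = (\<chi> q. X j \<omega> * X (j + k q) \<omega> - (LINT \<omega>'|M. X 0 \<omega>' * X (k q) \<omega>'))"

definition cross_cov ::
  "'w measure \<Rightarrow> ('w \<Rightarrow> real^'r) \<Rightarrow> ('w \<Rightarrow> real^'r) \<Rightarrow> real^'r^'r" where
  "cross_cov M V W = (\<chi> p q. LINT \<omega>|M.
     (V \<omega> $ p - (LINT \<omega>'|M. V \<omega>' $ p)) * (W \<omega> $ q - (LINT \<omega>'|M. W \<omega>' $ q)))"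

definition max_lag :: "('r::finite \<Rightarrow> int^'m) \<Rightarrow> int" where
  "max_lag k = Max {\<bar>k q $ i\<bar> | q i. True}"

definition lattice_box :: "int \<Rightarrow> (int^'m) set" where
  "lattice_box n = {j. \<forall>i. 0 < j $ i \<and> j $ i \<le> n}"

text \<open>Possibly degenerate normal laws, given by their characteristic function.\<close>

definition normal_law :: "real^'r \<Rightarrow> real^'r^'r \<Rightarrow> (real^'r) measure \<Rightarrow> bool" where
  "normal_law \<mu> C P \<longleftrightarrow> prob_space P \<and> sets P = sets borel
     \<and> (\<forall>u. (CLINT x|P. iexp (u \<bullet> x))
          = exp (\<i> * of_real (\<mu> \<bullet> u) - of_real (u \<bullet> (C *v u)) / 2))"

definition conv_in_distr ::
  "'w measure \<Rightarrow> (nat \<Rightarrow> 'w \<Rightarrow> real^'r) \<Rightarrow> (real^'r) measure \<Rightarrow> bool" where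
  "conv_in_distr M V P \<longleftrightarrow>
     (\<forall>g :: real^'r \<Rightarrow> real. continuous_on UNIV g \<longrightarrow> bounded (range g) \<longrightarrow>
        (\<lambda>n. LINT \<omega>|M. g (V n \<omega>)) \<longlonglongrightarrow> (LINT x|P. g x))"

end

theory Submission
  imports Defs
begin

text \<open>The proof reads everything off characteristic functions. For a simple integrand, independence over
disjoint sets gives \<open>E exp(iZ) = exp (\<integral> \<Phi>(g) d(\<pi>\<times>\<lambda>))\<close> for the integral \<open>Z\<close> of \<open>g\<close>, and
\<open>has_int_char\<close> extends this to every square integrable \<open>g\<close> and to whichever approximating sequence
was used to define \<open>Z\<close>. That two approximating sequences cannot produce different integrals is the
delicate point: it uses convergence of the integrals over all Borel sets, through a gliding hump
argument (\<open>gliding_hump\<close>).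

Since the basis is centred and \<open>\<nu>\<close> has a fourth moment, expanding the exponent to order four yields
second and fourth moments (\<open>has_int_moments\<close>), and polarization turns these into moments of products
(\<open>has_int_fourth_product\<close>). The covariance of \<open>X\<^sub>0 X\<^sub>k\<close> and \<open>X\<^sub>l X\<^bsub>l+k'\<^esub>\<close> is therefore a fourth
cumulant plus two products of covariances (\<open>product_covariance\<close>).

If \<open>l\<close> is large, then at every point of \<open>S \<times> \<real>\<^sup>m\<close> either the first two or the last two of the four
shifted copies of \<open>f\<close> are evaluated far from the origin (\<open>far_out\<close>), where the decay of \<open>\<eta>\<close> makes
their \<open>L\<^sup>2\<close> norm small. Interpolating with the \<open>L\<^bsup>4+\<delta>\<^esup>\<close> norm, the cumulant decays like
\<open>|l| powr (- 2\<beta>\<delta>/(2+\<delta>))\<close> and the covariance like \<open>|l| powr (- \<beta>)\<close>. The condition on \<open>\<beta>\<close> puts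
both exponents beyond \<open>m\<close> (\<open>decay_exponent_bounds\<close>), so the covariances of the products are absolutely
summable (\<open>J2_summable\<close>, \<open>J4_summable\<close>).

For the limit theorem fix a linear combination of the lagged products. Cutting \<open>f\<close> off outside a cube
changes the normalized sum by an amount whose variance is small uniformly in \<open>n\<close>, because the
covariances of the error are dominated by a summable family and tend to zero one by one
(\<open>eB_bounds\<close>). The field with the cut-off integrand has finite range: the exponent \<open>\<Phi>\<close> is additive
over integrands with disjoint supports, so the characteristic function of a sum over well separated
blocks is a power of that of one block (\<open>blk_char\<close>), and the classical computation
\<open>char_power_limit\<close> applies. The sites between the blocks contribute little if the blocks are large.
The three errors are combined in \<open>clt_by_approximation\<close> and \<open>clt_scalar\<close>.

This gives convergence of the characteristic functions in all directions. Convergence in distribution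
of the vectors follows by \<open>char_convergence.conv_in_distr\<close>, which reduces the multivariate continuity
theorem to the one-dimensional one, applied to weighted laws of single coordinates.\<close>

section \<open>Convergence in probability and in mean square\<close>

lemma norm_iexp_diff_le: "cmod (iexp x - iexp y) \<le> \<bar>x - y\<bar>"
proof -
  have "iexp x - iexp y = iexp y * (iexp (x - y) - 1)"
    by (simp add: algebra_simps flip: exp_add)
  then have "cmod (iexp x - iexp y) = cmod (iexp (x - y) - 1)"
    by (simp add: norm_mult)
  also have "\<dots> \<le> \<bar>x - y\<bar>"
    using iexp_approx1[of "x - y" 0] by simp
  finally show ?thesis .
qed

lemma (in prob_space) norm_char_diff_le_L1:
  fixes V W :: "'a \<Rightarrow> real"
  assumes [measurable]: "V \<in> borel_measurable M" "W \<in> borel_measurable M"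
    and int: "integrable M (\<lambda>\<omega>. V \<omega> - W \<omega>)"
  shows "cmod ((CLINT \<omega>|M. iexp (V \<omega>)) - (CLINT \<omega>|M. iexp (W \<omega>))) \<le> (LINT \<omega>|M. \<bar>V \<omega> - W \<omega>\<bar>)"
proof -
  have i: "integrable M (\<lambda>\<omega>. iexp (V \<omega>))" "integrable M (\<lambda>\<omega>. iexp (W \<omega>))"
    by (auto intro!: integrable_const_bound[where B=1])
  have "cmod (CLINT \<omega>|M. iexp (V \<omega>) - iexp (W \<omega>)) \<le> (LINT \<omega>|M. \<bar>V \<omega> - W \<omega>\<bar>)"
    by (intro order_trans[OF integral_norm_bound] integral_mono integrable_norm norm_iexp_diff_le
        Bochner_Integration.integrable_diff[OF i] integrable_abs[OF int])
  then show ?thesis using i by simp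
qed

text \<open>The difference of two phases is at most \<open>\<epsilon>\<close> where the variables are \<open>\<epsilon>\<close>-close, and at most 2
elsewhere.\<close>

lemma (in prob_space) tendsto_in_prob_char:
  fixes Z :: "nat \<Rightarrow> 'a \<Rightarrow> real"
  assumes [measurable]: "\<And>n. Z n \<in> borel_measurable M" "Z' \<in> borel_measurable M"
    and lim: "tendsto_in_prob M Z Z'"
  shows "(\<lambda>n. CLINT \<omega>|M. iexp (Z n \<omega>)) \<longlonglongrightarrow> (CLINT \<omega>|M. iexp (Z' \<omega>))"
proof (rule LIMSEQ_I)
  fix r :: real assume r: "0 < r"
  define e where "e = r / 4"
  have e: "e > 0" using r by (simp add: e_def)
  let ?A = "\<lambda>n. {\<omega> \<in> space M. \<bar>Z n \<omega> - Z' \<omega>\<bar> > e}"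
  have "(\<lambda>n. prob (?A n)) \<longlonglongrightarrow> 0"
    using lim e by (simp add: tendsto_in_prob_def)
  then have "eventually (\<lambda>n. prob (?A n) < e) sequentially"
    using e by (rule order_tendstoD)
  then obtain K where K: "\<And>n. n \<ge> K \<Longrightarrow> prob (?A n) < e"
    by (auto simp: eventually_sequentially)
  have i: "integrable M (\<lambda>\<omega>. iexp (V \<omega>))" if [measurable]: "V \<in> borel_measurable M" for V :: "'a \<Rightarrow> real"
    by (auto intro!: integrable_const_bound[where B=1])
  have "norm ((CLINT \<omega>|M. iexp (Z n \<omega>)) - (CLINT \<omega>|M. iexp (Z' \<omega>))) < r" if "n \<ge> K" for n
  proof -
    have Int: "integrable M (\<lambda>\<omega>. 2 * indicator (?A n) \<omega> :: real)"
      by (intro integrable_mult_right integrable_real_indicator) (auto simp: emeasure_eq_measure)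
    have "norm ((CLINT \<omega>|M. iexp (Z n \<omega>)) - (CLINT \<omega>|M. iexp (Z' \<omega>)))
        = norm (CLINT \<omega>|M. iexp (Z n \<omega>) - iexp (Z' \<omega>))"
      by (subst Bochner_Integration.integral_diff) (auto intro!: i)
    also have "\<dots> \<le> (LINT \<omega>|M. e + 2 * indicator (?A n) \<omega>)"
    proof (rule order_trans[OF integral_norm_bound], rule integral_mono)
      show "integrable M (\<lambda>\<omega>. cmod (iexp (Z n \<omega>) - iexp (Z' \<omega>)))"
        by (intro integrable_norm Bochner_Integration.integrable_diff i) auto
      show "integrable M (\<lambda>\<omega>. e + 2 * indicator (?A n) \<omega>)"
        by (intro Bochner_Integration.integrable_add integrable_mult_right integrable_real_indicator)
          (auto simp: emeasure_eq_measure)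
      fix \<omega> assume w: "\<omega> \<in> space M"
      show "cmod (iexp (Z n \<omega>) - iexp (Z' \<omega>)) \<le> e + 2 * indicator (?A n) \<omega>"
      proof (cases "\<omega> \<in> ?A n")
        case True
        have "cmod (iexp (Z n \<omega>) - iexp (Z' \<omega>)) \<le> 1 + 1"
          by (intro order_trans[OF norm_triangle_ineq4] add_mono) auto
        then show ?thesis using True e by simp
      next
        case False
        then show ?thesis using norm_iexp_diff_le[of "Z n \<omega>" "Z' \<omega>"] w by auto
      qed
    qed
    also have "\<dots> = e + 2 * prob (?A n)"
      using Int by (subst Bochner_Integration.integral_add) (auto simp: prob_space Int_absorb2)
    also have "\<dots> < r" using K[OF that] r by (simp add: e_def)
    finally show ?thesis .
  qed
  then show "\<exists>no. \<forall>n\<ge>no. norm ((CLINT \<omega>|M. iexp (Z n \<omega>)) - (CLINT \<omega>|M. iexp (Z' \<omega>))) < r" by blast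
qed

lemma (in prob_space) tendsto_in_prob_add:
  fixes Z :: "nat \<Rightarrow> 'a \<Rightarrow> real"
  assumes [measurable]: "\<And>n. Z n \<in> borel_measurable M" "Z' \<in> borel_measurable M"
     "\<And>n. W n \<in> borel_measurable M" "W' \<in> borel_measurable M"
    and Z: "tendsto_in_prob M Z Z'" and W: "tendsto_in_prob M W W'"
  shows "tendsto_in_prob M (\<lambda>n \<omega>. Z n \<omega> + W n \<omega>) (\<lambda>\<omega>. Z' \<omega> + W' \<omega>)"
  unfolding tendsto_in_prob_def
proof (intro allI impI)
  fix e :: real assume e: "e > 0"
  let ?P = "\<lambda>Z Z' e n. {\<omega> \<in> space M. \<bar>Z n \<omega> - Z' \<omega>\<bar> > e}"
  have lim: "(\<lambda>n. prob (?P Z Z' (e/2) n) + prob (?P W W' (e/2) n)) \<longlonglongrightarrow> 0 + 0"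
    using Z W half_gt_zero[OF e] unfolding tendsto_in_prob_def by (intro tendsto_add) blast+
  show "(\<lambda>n. prob {\<omega> \<in> space M. e < \<bar>Z n \<omega> + W n \<omega> - (Z' \<omega> + W' \<omega>)\<bar>}) \<longlonglongrightarrow> 0"
  proof (rule tendsto_sandwich[OF _ _ tendsto_const])
    show "eventually (\<lambda>n. prob {\<omega> \<in> space M. e < \<bar>Z n \<omega> + W n \<omega> - (Z' \<omega> + W' \<omega>)\<bar>}
        \<le> prob (?P Z Z' (e/2) n) + prob (?P W W' (e/2) n)) sequentially"
    proof (rule always_eventually, rule allI)
      fix n
      have "prob {\<omega> \<in> space M. e < \<bar>Z n \<omega> + W n \<omega> - (Z' \<omega> + W' \<omega>)\<bar>}
        \<le> prob (?P Z Z' (e/2) n \<union> ?P W W' (e/2) n)"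
        by (intro finite_measure_mono) (auto simp: abs_if split: if_splits)
      also have "\<dots> \<le> prob (?P Z Z' (e/2) n) + prob (?P W W' (e/2) n)"
        by (intro measure_Un_le) auto
      finally show "prob {\<omega> \<in> space M. e < \<bar>Z n \<omega> + W n \<omega> - (Z' \<omega> + W' \<omega>)\<bar>}
        \<le> prob (?P Z Z' (e/2) n) + prob (?P W W' (e/2) n)" .
    qed
  qed (use lim in auto)
qed

lemma tendsto_in_prob_cmult:
  assumes Z: "tendsto_in_prob M Z Z'"
  shows "tendsto_in_prob M (\<lambda>n \<omega>. c * Z n \<omega>) (\<lambda>\<omega>. c * Z' \<omega>)"
proof (cases "c = 0")
  case True then show ?thesis by (simp add: tendsto_in_prob_def not_less)
next
  case False
  have "{\<omega> \<in> space M. e < \<bar>c * Z n \<omega> - c * Z' \<omega>\<bar>} = {\<omega> \<in> space M. e / \<bar>c\<bar> < \<bar>Z n \<omega> - Z' \<omega>\<bar>}" for e n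
    using False by (simp add: divide_less_eq abs_mult mult.commute flip: right_diff_distrib)
  then show ?thesis using Z False by (simp add: tendsto_in_prob_def)
qed

lemma tendsto_in_prob_cong:
  assumes [measurable]: "\<And>n. Z n \<in> borel_measurable M" "Z' \<in> borel_measurable M"
     "\<And>n. W n \<in> borel_measurable M" "W' \<in> borel_measurable M"
    and Z: "\<And>n. AE \<omega> in M. Z n \<omega> = W n \<omega>" "AE \<omega> in M. Z' \<omega> = W' \<omega>"
    and lim: "tendsto_in_prob M Z Z'"
  shows "tendsto_in_prob M W W'"
proof -
  have "measure M {\<omega> \<in> space M. e < \<bar>Z n \<omega> - Z' \<omega>\<bar>} = measure M {\<omega> \<in> space M. e < \<bar>W n \<omega> - W' \<omega>\<bar>}" for e n
    by (rule measure_eq_AE) (use Z(1)[of n] Z(2) in auto)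
  then show ?thesis using lim by (simp add: tendsto_in_prob_def)
qed

lemma (in prob_space) tendsto_in_prob_L2:
  fixes Z :: "nat \<Rightarrow> 'a \<Rightarrow> real"
  assumes [measurable]: "\<And>n. Z n \<in> borel_measurable M" "Z' \<in> borel_measurable M"
    and int: "\<And>n. integrable M (\<lambda>\<omega>. (Z n \<omega> - Z' \<omega>)\<^sup>2)"
    and lim: "(\<lambda>n. LINT \<omega>|M. (Z n \<omega> - Z' \<omega>)\<^sup>2) \<longlonglongrightarrow> 0"
  shows "tendsto_in_prob M Z Z'"
  unfolding tendsto_in_prob_def
proof (intro allI impI)
  fix e :: real assume e: "e > 0"
  have lim': "(\<lambda>n. (LINT \<omega>|M. (Z n \<omega> - Z' \<omega>)\<^sup>2) / e\<^sup>2) \<longlonglongrightarrow> 0"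
    using tendsto_divide[OF lim tendsto_const, of "e\<^sup>2"] e by simp
  show "(\<lambda>n. prob {\<omega> \<in> space M. e < \<bar>Z n \<omega> - Z' \<omega>\<bar>}) \<longlonglongrightarrow> 0"
  proof (rule tendsto_sandwich[OF _ _ tendsto_const lim'])
    show "eventually (\<lambda>n. prob {\<omega> \<in> space M. e < \<bar>Z n \<omega> - Z' \<omega>\<bar>} \<le> (LINT \<omega>|M. (Z n \<omega> - Z' \<omega>)\<^sup>2) / e\<^sup>2) sequentially"
    proof (rule always_eventually, rule allI)
      fix n
      have "e < \<bar>x\<bar> \<Longrightarrow> e\<^sup>2 \<le> x\<^sup>2" for x :: real
        using e by (metis abs_le_square_iff abs_of_pos less_imp_le)
      then have "prob {\<omega> \<in> space M. e < \<bar>Z n \<omega> - Z' \<omega>\<bar>} \<le> prob {\<omega> \<in> space M. e\<^sup>2 \<le> (Z n \<omega> - Z' \<omega>)\<^sup>2}"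
        by (intro finite_measure_mono) auto
      also have "\<dots> \<le> (LINT \<omega>|M. (Z n \<omega> - Z' \<omega>)\<^sup>2) / e\<^sup>2"
        by (intro integral_Markov_inequality_measure[where A="space M"] int) (use e in auto)
      finally show "prob {\<omega> \<in> space M. e < \<bar>Z n \<omega> - Z' \<omega>\<bar>} \<le> (LINT \<omega>|M. (Z n \<omega> - Z' \<omega>)\<^sup>2) / e\<^sup>2" .
    qed
  qed auto
qed

text \<open>Fatou's lemma in the form used to deduce the existence of moments from a bound on approximating
integrals.\<close>

lemma fatou_integrable:
  fixes g :: "nat \<Rightarrow> 'a \<Rightarrow> real"
  assumes [measurable]: "\<And>n. integrable M (g n)" "h \<in> borel_measurable M"
    and nonneg: "\<And>n x. x \<in> space M \<Longrightarrow> 0 \<le> g n x" and lim: "AE x in M. (\<lambda>n. g n x) \<longlonglongrightarrow> h x"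
    and bound: "eventually (\<lambda>n. (LINT x|M. g n x) \<le> B) sequentially"
  shows "integrable M h" "(LINT x|M. h x) \<le> B"
proof -
  have h0: "AE x in M. 0 \<le> h x"
    using lim AE_space by eventually_elim (auto intro!: LIMSEQ_le_const nonneg)
  obtain n where "(LINT x|M. g n x) \<le> B"
    using eventually_happens'[OF sequentially_bot bound] by blast
  moreover have "0 \<le> (LINT x|M. g n x)"
    using nonneg by (intro Bochner_Integration.integral_nonneg) auto
  ultimately have B: "0 \<le> B" by linarith
  have "(\<integral>\<^sup>+x. ennreal (h x) \<partial>M) = (\<integral>\<^sup>+x. liminf (\<lambda>n. ennreal (g n x)) \<partial>M)"
  proof (rule nn_integral_cong_AE)
    show "AE x in M. ennreal (h x) = liminf (\<lambda>n. ennreal (g n x))"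
      using lim by eventually_elim (auto intro!: lim_imp_Liminf[symmetric] tendsto_ennrealI)
  qed
  also have "\<dots> \<le> liminf (\<lambda>n. \<integral>\<^sup>+x. ennreal (g n x) \<partial>M)"
    by (rule nn_integral_liminf) auto
  also have "\<dots> \<le> ennreal B"
  proof (rule Liminf_le)
    show "eventually (\<lambda>n. (\<integral>\<^sup>+x. ennreal (g n x) \<partial>M) \<le> ennreal B) sequentially"
      using bound by eventually_elim
        (subst nn_integral_eq_integral; auto simp: assms nonneg intro!: ennreal_leI AE_I2)
  qed auto
  finally have *: "(\<integral>\<^sup>+x. ennreal (h x) \<partial>M) \<le> ennreal B" .
  show int: "integrable M h"
    by (rule integrableI_nonneg[OF assms(2) h0]) (use * in \<open>auto intro: le_less_trans simp: top.not_eq_extremum\<close>)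
  show "(LINT x|M. h x) \<le> B"
    using * nn_integral_eq_integral[OF int h0] B by simp
qed

text \<open>A subsequence with summable distances converges almost everywhere; Fatou's lemma identifies its
limit as the limit in mean square. Functions instead of equivalence classes are what the definition
of the stochastic integral asks for.\<close>

lemma L2_complete:
  fixes Z :: "nat \<Rightarrow> 'a \<Rightarrow> real"
  assumes "finite_measure M" and [measurable]: "\<And>n. Z n \<in> borel_measurable M"
    and int: "\<And>n m. integrable M (\<lambda>\<omega>. (Z n \<omega> - Z m \<omega>)\<^sup>2)"
    and Cauchy: "\<And>e. e > 0 \<Longrightarrow> \<exists>K. \<forall>n\<ge>K. \<forall>m\<ge>K. (LINT \<omega>|M. (Z n \<omega> - Z m \<omega>)\<^sup>2) \<le> e"
  shows "\<exists>Z'\<in>borel_measurable M. (\<forall>n. integrable M (\<lambda>\<omega>. (Z n \<omega> - Z' \<omega>)\<^sup>2)) \<and>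
      (\<lambda>n. LINT \<omega>|M. (Z n \<omega> - Z' \<omega>)\<^sup>2) \<longlonglongrightarrow> 0"
proof -
  interpret finite_measure M by fact
  have "\<exists>r. \<forall>k. (\<forall>n\<ge>r k. \<forall>m\<ge>r k. (LINT \<omega>|M. (Z n \<omega> - Z m \<omega>)\<^sup>2) \<le> (1/4)^k) \<and> r k < r (Suc k)"
  proof (rule dependent_nat_choice)
    show "\<exists>x. \<forall>n\<ge>x. \<forall>m\<ge>x. (LINT \<omega>|M. (Z n \<omega> - Z m \<omega>)\<^sup>2) \<le> (1/4)^0"
      using Cauchy[of 1] by simp
    fix x n
    obtain K where "\<forall>i\<ge>K. \<forall>m\<ge>K. (LINT \<omega>|M. (Z i \<omega> - Z m \<omega>)\<^sup>2) \<le> (1/4)^(Suc n)"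
      using Cauchy[of "(1/4)^(Suc n)"] by auto
    then show "\<exists>y. (\<forall>i\<ge>y. \<forall>m\<ge>y. (LINT \<omega>|M. (Z i \<omega> - Z m \<omega>)\<^sup>2) \<le> (1/4)^(Suc n)) \<and> x < y"
      by (intro exI[of _ "max K (Suc x)"]) auto
  qed
  then obtain r where r: "\<And>k n m. n \<ge> r k \<Longrightarrow> m \<ge> r k \<Longrightarrow> (LINT \<omega>|M. (Z n \<omega> - Z m \<omega>)\<^sup>2) \<le> (1/4)^k"
    and r_lt: "\<And>k. r k < r (Suc k)" by blast
  have sm: "strict_mono r" using r_lt by (simp add: strict_mono_Suc_iff)
  let ?d = "\<lambda>k \<omega>. \<bar>Z (r (Suc k)) \<omega> - Z (r k) \<omega>\<bar>"
  have i2: "integrable M (\<lambda>\<omega>. 2^k * (Z (r (Suc k)) \<omega> - Z (r k) \<omega>)\<^sup>2 + (1/2)^k)" for k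
    by (intro Bochner_Integration.integrable_add integrable_mult_right int) auto
  have dle: "?d k \<omega> \<le> 2^k * (Z (r (Suc k)) \<omega> - Z (r k) \<omega>)\<^sup>2 + (1/2)^k" for k \<omega>
  proof -
    have *: "x \<le> a * x\<^sup>2 + 1/a" if "a > 0" "x \<ge> 0" for a x :: real
    proof -
      have "0 \<le> (a * x - 1)\<^sup>2 + a * x" using that by auto
      then have "a * x \<le> a * (a * x\<^sup>2 + 1/a)"
        using that by (simp add: power2_eq_square algebra_simps)
      then show ?thesis using that by simp
    qed
    show ?thesis using *[of "2^k" "?d k \<omega>"] by (simp add: power_one_over)
  qed
  have d_int: "(\<integral>\<^sup>+\<omega>. ennreal (?d k \<omega>) \<partial>M) \<le> ennreal ((1 + measure M (space M)) * (1/2)^k)" for k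
  proof -
    have "(\<integral>\<^sup>+\<omega>. ennreal (?d k \<omega>) \<partial>M) \<le> (\<integral>\<^sup>+\<omega>. ennreal (2^k * (Z (r (Suc k)) \<omega> - Z (r k) \<omega>)\<^sup>2 + (1/2)^k) \<partial>M)"
      by (intro nn_integral_mono ennreal_leI dle)
    also have "\<dots> = ennreal (LINT \<omega>|M. 2^k * (Z (r (Suc k)) \<omega> - Z (r k) \<omega>)\<^sup>2 + (1/2)^k)"
      by (rule nn_integral_eq_integral[OF i2]) auto
    also have "(LINT \<omega>|M. 2^k * (Z (r (Suc k)) \<omega> - Z (r k) \<omega>)\<^sup>2 + (1/2)^k)
        = 2^k * (LINT \<omega>|M. (Z (r (Suc k)) \<omega> - Z (r k) \<omega>)\<^sup>2) + measure M (space M) * (1/2)^k"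
      using int by simp
    also have "\<dots> \<le> 2^k * (1/4)^k + measure M (space M) * (1/2)^k"
      using r[of k "r (Suc k)" "r k"] r_lt[of k] by (intro add_right_mono mult_left_mono) auto
    also have "(2::real)^k * (1/4)^k = (1/2)^k"
      by (simp flip: power_mult_distrib)
    finally show ?thesis by (simp add: algebra_simps ennreal_leI)
  qed
  have "(\<integral>\<^sup>+\<omega>. (\<Sum>k. ennreal (?d k \<omega>)) \<partial>M) = (\<Sum>k. \<integral>\<^sup>+\<omega>. ennreal (?d k \<omega>) \<partial>M)"
    by (rule nn_integral_suminf) auto
  also have "\<dots> \<le> (\<Sum>k. ennreal ((1 + measure M (space M)) * (1/2)^k))"
    by (intro suminf_le d_int) auto
  also have "\<dots> = ennreal (\<Sum>k. (1 + measure M (space M)) * (1/2)^k)"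
    by (intro suminf_ennreal2 summable_mult summable_geometric) auto
  also have "\<dots> < \<infinity>" by simp
  finally have "AE \<omega> in M. (\<Sum>k. ennreal (?d k \<omega>)) \<noteq> \<infinity>"
    by (intro nn_integral_PInf_AE) auto
  then have conv: "AE \<omega> in M. convergent (\<lambda>k. Z (r k) \<omega>)"
  proof eventually_elim
    case (elim \<omega>)
    have "summable (\<lambda>k. ?d k \<omega>)"
      using elim by (intro summable_suminf_not_top) (auto simp: top_unique)
    then have "summable (\<lambda>k. Z (r (Suc k)) \<omega> - Z (r k) \<omega>)"
      by (intro summable_norm_cancel[where f="\<lambda>k. Z (r (Suc k)) \<omega> - Z (r k) \<omega>"]) simp
    then have "convergent (\<lambda>n. Z (r 0) \<omega> + (\<Sum>k<n. Z (r (Suc k)) \<omega> - Z (r k) \<omega>))"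
      by (intro convergent_add convergent_const) (simp add: summable_iff_convergent)
    then show ?case using sum_lessThan_telescope[of "\<lambda>k. Z (r k) \<omega>"] by simp
  qed
  define Z' where "Z' \<omega> = lim (\<lambda>k. Z (r k) \<omega>)" for \<omega>
  have [measurable]: "Z' \<in> borel_measurable M" unfolding Z'_def by measurable
  have le: "integrable M (\<lambda>\<omega>. (Z n \<omega> - Z' \<omega>)\<^sup>2) \<and> (LINT \<omega>|M. (Z n \<omega> - Z' \<omega>)\<^sup>2) \<le> e"
    if e: "eventually (\<lambda>k. (LINT \<omega>|M. (Z n \<omega> - Z (r k) \<omega>)\<^sup>2) \<le> e) sequentially" for n e
  proof -
    have "AE \<omega> in M. (\<lambda>k. (Z n \<omega> - Z (r k) \<omega>)\<^sup>2) \<longlonglongrightarrow> (Z n \<omega> - Z' \<omega>)\<^sup>2"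
      using conv by eventually_elim
        (auto intro!: tendsto_intros simp: convergent_LIMSEQ_iff Z'_def)
    from fatou_integrable[OF int _ _ this e] show ?thesis by simp
  qed
  have "integrable M (\<lambda>\<omega>. (Z n \<omega> - Z' \<omega>)\<^sup>2)" for n
  proof -
    have bd: "(LINT \<omega>|M. (Z n \<omega> - Z (r k) \<omega>)\<^sup>2) \<le> 2 * (LINT \<omega>|M. (Z n \<omega> - Z (r 0) \<omega>)\<^sup>2) + 2" for k
    proof -
      have "(LINT \<omega>|M. (Z n \<omega> - Z (r k) \<omega>)\<^sup>2) \<le> (LINT \<omega>|M. 2 * (Z n \<omega> - Z (r 0) \<omega>)\<^sup>2 + 2 * (Z (r 0) \<omega> - Z (r k) \<omega>)\<^sup>2)"
      proof (intro integral_mono int)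
        show "(Z n \<omega> - Z (r k) \<omega>)\<^sup>2 \<le> 2 * (Z n \<omega> - Z (r 0) \<omega>)\<^sup>2 + 2 * (Z (r 0) \<omega> - Z (r k) \<omega>)\<^sup>2" for \<omega>
          using sum_squares_bound[of "Z n \<omega> - Z (r 0) \<omega>" "Z (r 0) \<omega> - Z (r k) \<omega>"]
          by (simp add: power2_eq_square algebra_simps)
      qed (use int in auto)
      also have "\<dots> = 2 * (LINT \<omega>|M. (Z n \<omega> - Z (r 0) \<omega>)\<^sup>2) + 2 * (LINT \<omega>|M. (Z (r 0) \<omega> - Z (r k) \<omega>)\<^sup>2)"
        using int by simp
      also have "(LINT \<omega>|M. (Z (r 0) \<omega> - Z (r k) \<omega>)\<^sup>2) \<le> 1"
        using r[of 0 "r 0" "r k"] sm by (simp add: strict_mono_less_eq)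
      finally show ?thesis by simp
    qed
    show ?thesis using le[OF always_eventually[of "\<lambda>k. (LINT \<omega>|M. (Z n \<omega> - Z (r k) \<omega>)\<^sup>2) \<le> 2 * (LINT \<omega>|M. (Z n \<omega> - Z (r 0) \<omega>)\<^sup>2) + 2"]] bd by blast
  qed
  moreover have "(\<lambda>n. LINT \<omega>|M. (Z n \<omega> - Z' \<omega>)\<^sup>2) \<longlonglongrightarrow> 0"
  proof (rule LIMSEQ_I)
    fix e :: real assume e: "0 < e"
    obtain K where K: "\<forall>n\<ge>K. \<forall>m\<ge>K. (LINT \<omega>|M. (Z n \<omega> - Z m \<omega>)\<^sup>2) \<le> e/2"
      using Cauchy[of "e/2"] e by auto
    have "norm ((LINT \<omega>|M. (Z n \<omega> - Z' \<omega>)\<^sup>2) - 0) < e" if n: "n \<ge> K" for n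
    proof -
      have "eventually (\<lambda>k. (LINT \<omega>|M. (Z n \<omega> - Z (r k) \<omega>)\<^sup>2) \<le> e/2) sequentially"
        using K n seq_suble[OF sm] by (intro eventually_sequentiallyI[of K]) (meson order_trans)
      from le[OF this] e show ?thesis by (simp add: abs_of_nonneg)
    qed
    then show "\<exists>no. \<forall>n\<ge>no. norm ((LINT \<omega>|M. (Z n \<omega> - Z' \<omega>)\<^sup>2) - 0) < e" by blast
  qed
  ultimately show ?thesis by (intro bexI[of _ Z']) auto
qed

section \<open>Moments from characteristic functions\<close>

lemma (in prob_space) integrable_iexp:
  fixes V :: "'a \<Rightarrow> real"
  assumes [measurable]: "V \<in> borel_measurable M"
  shows "integrable M (\<lambda>\<omega>. iexp (V \<omega>))"
  by (auto intro!: integrable_const_bound[where B=1])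

lemma (in prob_space) Re_char:
  fixes V :: "'a \<Rightarrow> real"
  assumes [measurable]: "V \<in> borel_measurable M"
  shows "Re (CLINT \<omega>|M. iexp (V \<omega>)) = (LINT \<omega>|M. cos (V \<omega>))"
  by (subst integral_Re[symmetric]) (auto intro!: integrable_iexp simp: Re_exp)

lemma two_minus_two_cos_le: "2 - 2 * cos x \<le> x\<^sup>2" for x :: real
proof -
  have "\<bar>sin (x/2)\<bar> \<le> \<bar>x/2\<bar>" by (rule abs_sin_x_le_abs_x)
  then have "(sin (x/2))\<^sup>2 \<le> (x/2)\<^sup>2" by (simp only: abs_le_square_iff)
  then show ?thesis
    using cos_double_sin[of "x/2"] by (simp add: power2_eq_square)
qed

text \<open>The function \<open>2 - 2 cos(uz)\<close> serves as a bounded substitute for \<open>(uz)\<^sup>2\<close>: its expectation is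
determined by the characteristic function before any moment is known to exist.\<close>

lemma two_minus_two_cos_tendsto: "((\<lambda>u. (2 - 2 * cos (u * z)) / u\<^sup>2) \<longlongrightarrow> z\<^sup>2) (at (0::real))"
proof (cases "z = 0")
  case False
  have "((\<lambda>x::real. sin x / x) \<longlongrightarrow> 1) (at 0)"
    using DERIV_sin[of "0::real"] by (simp add: DERIV_def)
  moreover have "filterlim (\<lambda>u. u * z / 2) (at 0) (at 0)"
    using False tendsto_mult_left_zero[OF tendsto_ident_at[of "0::real" UNIV], of "z / 2"]
    by (intro filterlim_atI) (auto simp: eventually_at_filter)
  ultimately have "((\<lambda>u. sin (u * z / 2) / (u * z / 2)) \<longlongrightarrow> 1) (at 0)"
    by (rule filterlim_compose)
  then have "((\<lambda>u. z\<^sup>2 * (sin (u * z / 2) / (u * z / 2))\<^sup>2) \<longlongrightarrow> z\<^sup>2 * 1\<^sup>2) (at 0)"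
    by (intro tendsto_intros)
  moreover have "z\<^sup>2 * (sin (u * z / 2) / (u * z / 2))\<^sup>2 = (2 - 2 * cos (u * z)) / u\<^sup>2" for u
  proof (cases "u = 0")
    case u: False
    have c: "cos (u * z) = 1 - 2 * (sin (u * z / 2))\<^sup>2"
      using cos_double_sin[of "u * z / 2"] by simp
    have "z\<^sup>2 * (s / (u * z / 2))\<^sup>2 = 4 * s\<^sup>2 / u\<^sup>2" for s
      using u False by (simp add: power_divide power_mult_distrib)
    then show ?thesis by (simp add: c)
  qed simp
  ultimately show ?thesis by simp
qed simp

text \<open>With \<open>C = 0\<close> this also shows that a variable with characteristic function 1 vanishes almost surely.\<close>

lemma (in prob_space) second_moment_le_of_char:
  fixes Z :: "'a \<Rightarrow> real"
  assumes [measurable]: "Z \<in> borel_measurable M"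
    and bound: "\<And>u. cmod ((CLINT \<omega>|M. iexp (u * Z \<omega>)) - 1) \<le> C * u\<^sup>2"
  shows "integrable M (\<lambda>\<omega>. (Z \<omega>)\<^sup>2)" "(LINT \<omega>|M. (Z \<omega>)\<^sup>2) \<le> 2 * C"
proof -
  define u :: "nat \<Rightarrow> real" where "u n = 1 / Suc n" for n
  have u: "u \<longlonglongrightarrow> 0" "\<And>n. u n \<noteq> 0"
    using LIMSEQ_inverse_real_of_nat by (auto simp: u_def[abs_def] inverse_eq_divide)
  have uat: "filterlim u (at 0) sequentially"
    using u by (intro filterlim_atI) auto
  let ?g = "\<lambda>n \<omega>. (2 - 2 * cos (u n * Z \<omega>)) / (u n)\<^sup>2"
  have int: "integrable M (\<lambda>\<omega>. cos (v * Z \<omega>))" for v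
    by (auto intro!: integrable_const_bound[where B=1])
  have g: "integrable M (?g n)" for n
    by (intro integrable_divide_zero Bochner_Integration.integrable_diff integrable_mult_right int) auto
  have "(LINT \<omega>|M. ?g n \<omega>) \<le> 2 * C" for n
  proof -
    have "(LINT \<omega>|M. ?g n \<omega>) = 2 * (1 - Re (CLINT \<omega>|M. iexp (u n * Z \<omega>))) / (u n)\<^sup>2"
      using int by (subst Re_char) (auto simp: prob_space)
    also have "1 - Re (CLINT \<omega>|M. iexp (u n * Z \<omega>)) \<le> C * (u n)\<^sup>2"
      using bound[of "u n"] complex_Re_le_cmod[of "1 - (CLINT \<omega>|M. iexp (u n * Z \<omega>))"]
      by (simp add: norm_minus_commute)
    finally show ?thesis using u(2) by (simp add: divide_right_mono field_simps)
  qed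
  then have ev: "eventually (\<lambda>n. (LINT \<omega>|M. ?g n \<omega>) \<le> 2 * C) sequentially" by simp
  have lim: "AE \<omega> in M. (\<lambda>n. ?g n \<omega>) \<longlonglongrightarrow> (Z \<omega>)\<^sup>2"
    by (intro AE_I2 filterlim_compose[OF two_minus_two_cos_tendsto uat])
  show "integrable M (\<lambda>\<omega>. (Z \<omega>)\<^sup>2)" "(LINT \<omega>|M. (Z \<omega>)\<^sup>2) \<le> 2 * C"
    using fatou_integrable[OF g _ _ lim ev] by auto
qed

text \<open>The exponential is a contraction on the left half-plane.\<close>

lemma norm_exp_minus_one_le:
  assumes "Re w \<le> 0"
  shows "cmod (exp w - 1) \<le> cmod w"
proof -
  have "norm (exp w - exp 0) \<le> 1 * norm (w - 0)"
  proof (rule field_differentiable_bound[where f'=exp and S="{z. Re z \<le> 0}"])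
    show "convex {z. Re z \<le> 0}" by (simp add: convex_halfspace_Re_le)
      show "(exp has_field_derivative exp z) (at z within {z. Re z \<le> 0})" for z :: complex
      by (rule DERIV_subset[OF DERIV_exp]) simp
  qed (use assms in auto)
  then show ?thesis by simp
qed

lemma norm_exp_taylor2_le:
  assumes "cmod w \<le> 1"
  shows "cmod (exp w - 1 - w - w\<^sup>2/2) \<le> 3 * cmod w ^ 3"
proof -
  have "norm (exp w - (\<Sum>i\<le>2. w ^ i / fact i)) \<le> exp \<bar>Re w\<bar> * (norm w) ^ Suc 2 / fact 2"
    by (rule Taylor_exp)
  also have "(\<Sum>i\<le>2. w ^ i / fact i) = 1 + w + w\<^sup>2/2"
    by (simp add: eval_nat_numeral)
  also have "exp \<bar>Re w\<bar> * (norm w) ^ Suc 2 / fact 2 \<le> exp 1 * (norm w)^3 / 2"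
    using abs_Re_le_cmod[of w] assms by (intro divide_mono mult_mono) (auto simp: eval_nat_numeral)
  also have "\<dots> \<le> 3 * (norm w)^3"
    using exp_le by (auto simp: divide_le_eq intro!: mult_right_mono)
  finally show ?thesis by (simp add: algebra_simps)
qed

lemma quartic_expansion_div:
  fixes x :: "'a::field"
  assumes "x \<noteq> 0"
  shows "(p + c * x\<^sup>2 + d * x ^ 3) / x ^ 4 * x\<^sup>2 - c - d * x = p / x\<^sup>2"
proof -
  have "(p + c * x\<^sup>2 + d * x ^ 3) / x ^ 4 * x\<^sup>2 = (p + c * x\<^sup>2 + d * x ^ 3) / x\<^sup>2"
    using assms by (simp add: eval_nat_numeral)
  also have "\<dots> = p / x\<^sup>2 + c + d * x"
    using assms by (simp add: add_divide_distrib eval_nat_numeral)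
  finally show ?thesis by simp
qed

text \<open>Here \<open>\<psi>\<close> is the cumulant function of \<open>Z\<close>, known to order four at the origin, and the cubic
coefficient \<open>b\<close> drops out of the real part. Expanding \<open>exp \<psi>\<close>
yields \<open>Re E exp(iuZ) = 1 - \<kappa>2 u\<^sup>2/2 + (\<kappa>4/24 + \<kappa>2\<^sup>2/8) u\<^sup>4 + o(u\<^sup>4)\<close>. The square of
\<open>(2 - 2 cos(uZ))/u\<^sup>2\<close> tends to \<open>Z\<^sup>4\<close> from below and its expectation only involves the characteristic
function at \<open>u\<close> and \<open>2u\<close>, so Fatou's lemma gives the fourth moment, and dominated convergence its
value.\<close>

lemma (in prob_space) moments_of_char:
  fixes Z :: "'a \<Rightarrow> real" and \<psi> :: "real \<Rightarrow> complex" and \<kappa>2 b \<kappa>4 :: real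
  assumes [measurable]: "Z \<in> borel_measurable M"
    and char: "\<And>u. (CLINT \<omega>|M. iexp (u * Z \<omega>)) = exp (\<psi> u)"
    and psi: "((\<lambda>u. (\<psi> u + of_real (\<kappa>2 * u\<^sup>2 / 2) + \<i> * of_real (b * u ^ 3)) / of_real (u ^ 4)) \<longlongrightarrow> of_real (\<kappa>4 / 24)) (at 0)"
  shows "integrable M (\<lambda>\<omega>. (Z \<omega>) ^ 4)" "(LINT \<omega>|M. (Z \<omega>) ^ 4) = \<kappa>4 + 3 * \<kappa>2\<^sup>2"
    "(LINT \<omega>|M. (Z \<omega>)\<^sup>2) = \<kappa>2"
proof -
  let ?\<phi> = "\<lambda>u. (CLINT \<omega>|M. iexp (u * Z \<omega>))"
  have lin: "((\<lambda>u::real. complex_of_real u) \<longlongrightarrow> 0) (at 0)"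
    using tendsto_of_real[OF tendsto_ident_at[of "0::real" UNIV], where 'a=complex] by simp
  have nz: "eventually (\<lambda>u. u \<noteq> (0::real)) (at 0)" by (simp add: eventually_at_filter)
  have psi2: "((\<lambda>u. \<psi> u / of_real (u\<^sup>2)) \<longlongrightarrow> of_real (-\<kappa>2/2)) (at 0)"
  proof -
    have "((\<lambda>u. (\<psi> u + of_real (\<kappa>2 * u\<^sup>2 / 2) + \<i> * of_real (b * u ^ 3)) / of_real (u ^ 4) * (of_real u)\<^sup>2
        - of_real (\<kappa>2/2) - \<i> * of_real b * of_real u) \<longlongrightarrow> of_real (\<kappa>4 / 24) * 0\<^sup>2 - of_real (\<kappa>2/2) - \<i> * of_real b * 0) (at 0)"
      by (intro tendsto_intros psi lin)
    moreover have "eventually (\<lambda>u. (\<psi> u + of_real (\<kappa>2 * u\<^sup>2 / 2) + \<i> * of_real (b * u ^ 3)) / of_real (u ^ 4) * (of_real u)\<^sup>2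
        - of_real (\<kappa>2/2) - \<i> * of_real b * of_real u = \<psi> u / of_real (u\<^sup>2)) (at 0)"
      using nz
    proof eventually_elim
      case (elim u)
      then show ?case
        using quartic_expansion_div[of "of_real u :: complex" "\<psi> u" "of_real (\<kappa>2/2)" "\<i> * of_real b"]
        by (simp add: mult.assoc)
    qed
    ultimately show ?thesis by (rule Lim_transform_eventually[THEN tendsto_eq_rhs]) simp
  qed
  have psi0: "(\<psi> \<longlongrightarrow> 0) (at 0)"
  proof -
    have "((\<lambda>u. \<psi> u / of_real (u\<^sup>2) * (of_real u)\<^sup>2) \<longlongrightarrow> of_real (-\<kappa>2/2) * 0\<^sup>2) (at 0)"
      by (intro tendsto_intros psi2 lin)
    moreover have "eventually (\<lambda>u. \<psi> u / of_real (u\<^sup>2) * (of_real u)\<^sup>2 = \<psi> u) (at 0)"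
      using nz by eventually_elim simp
    ultimately show ?thesis by (rule Lim_transform_eventually[THEN tendsto_eq_rhs]) simp
  qed
  have rem: "((\<lambda>u. (exp (\<psi> u) - 1 - \<psi> u - (\<psi> u)\<^sup>2/2) / of_real (u^4)) \<longlongrightarrow> 0) (at 0)"
  proof (rule Lim_null_comparison)
    show "((\<lambda>u. 3 * (cmod (\<psi> u / of_real (u\<^sup>2)))^3 * u\<^sup>2) \<longlongrightarrow> 0) (at 0)"
      by (rule tendsto_eq_intros psi2 refl | simp)+
    have "eventually (\<lambda>u. cmod (\<psi> u) < 1) (at 0)"
      using tendsto_norm[OF psi0] by (intro order_tendstoD) auto
    then show "eventually (\<lambda>u. norm ((exp (\<psi> u) - 1 - \<psi> u - (\<psi> u)\<^sup>2/2) / of_real (u^4)) \<le> 3 * (cmod (\<psi> u / of_real (u\<^sup>2)))^3 * u\<^sup>2) (at 0)"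
      using nz
    proof eventually_elim
      case (elim u)
      have "norm ((exp (\<psi> u) - 1 - \<psi> u - (\<psi> u)\<^sup>2/2) / of_real (u^4)) \<le> (3 * cmod (\<psi> u) ^ 3) / u^4"
        unfolding norm_divide using norm_exp_taylor2_le[of "\<psi> u"] elim by (intro divide_mono) (auto simp: norm_power)
      also have "\<dots> = 3 * (cmod (\<psi> u / of_real (u\<^sup>2)))^3 * u\<^sup>2"
        using elim(2) by (simp add: norm_divide norm_power power_divide) (simp add: eval_nat_numeral)
      finally show ?case .
    qed
  qed
  have phi4: "((\<lambda>u. (?\<phi> u - 1 + of_real (\<kappa>2 * u\<^sup>2 / 2) + \<i> * of_real (b * u ^ 3)) / of_real (u ^ 4))
      \<longlongrightarrow> of_real (\<kappa>4 / 24 + \<kappa>2\<^sup>2/8)) (at 0)"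
  proof -
    have "((\<lambda>u. (exp (\<psi> u) - 1 - \<psi> u - (\<psi> u)\<^sup>2/2) / of_real (u^4) + (\<psi> u / of_real (u\<^sup>2))\<^sup>2 / 2
       + (\<psi> u + of_real (\<kappa>2 * u\<^sup>2 / 2) + \<i> * of_real (b * u ^ 3)) / of_real (u ^ 4)) \<longlongrightarrow>
       0 + (of_real (-\<kappa>2/2))\<^sup>2/2 + of_real (\<kappa>4 / 24)) (at 0)"
      by (intro tendsto_intros rem psi2 psi) auto
    moreover have "eventually (\<lambda>u. (exp (\<psi> u) - 1 - \<psi> u - (\<psi> u)\<^sup>2/2) / of_real (u^4) + (\<psi> u / of_real (u\<^sup>2))\<^sup>2 / 2
       + (\<psi> u + of_real (\<kappa>2 * u\<^sup>2 / 2) + \<i> * of_real (b * u ^ 3)) / of_real (u ^ 4) =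
       (?\<phi> u - 1 + of_real (\<kappa>2 * u\<^sup>2 / 2) + \<i> * of_real (b * u ^ 3)) / of_real (u ^ 4)) (at 0)"
      using nz
    proof eventually_elim
      case (elim u)
      have *: "(e - 1 - p - p\<^sup>2/2) / x^4 + (p / x\<^sup>2)\<^sup>2 / 2 + (p + c) / x^4 = (e - 1 + c) / x^4"
        if "x \<noteq> 0" for e p c x :: complex
      proof -
        have "(p / x\<^sup>2)\<^sup>2 / 2 = (p\<^sup>2/2) / x^4" by (simp add: power_divide flip: power_mult)
        then show ?thesis by (simp add: add_divide_distrib diff_divide_distrib)
      qed
      show ?case
        using *[of "of_real u" "exp (\<psi> u)" "\<psi> u" "of_real (\<kappa>2 * u\<^sup>2 / 2) + \<i> * of_real (b * u ^ 3)"] elim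
        by (simp only: char add.assoc of_real_power of_real_eq_0_iff not_False_eq_True)
    qed
    ultimately show ?thesis
      by (rule Lim_transform_eventually[THEN tendsto_eq_rhs]) (simp add: power2_eq_square)
  qed
  have re4: "((\<lambda>u. (Re (?\<phi> u) - 1 + \<kappa>2 * u\<^sup>2 / 2) / u ^ 4) \<longlongrightarrow> \<kappa>4 / 24 + \<kappa>2\<^sup>2/8) (at 0)"
  proof -
    have "Re ((?\<phi> u - 1 + of_real (\<kappa>2 * u\<^sup>2 / 2) + \<i> * of_real (b * u ^ 3)) / of_real (u ^ 4))
      = (Re (?\<phi> u) - 1 + \<kappa>2 * u\<^sup>2 / 2) / u ^ 4" for u
      by (subst Re_divide_of_real) simp
    with tendsto_Re[OF phi4] show ?thesis by (simp only: complex.sel Re_complex_of_real)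
  qed
  have re4': "((\<lambda>u. (Re (?\<phi> (2*u)) - 1 + \<kappa>2 * (2*u)\<^sup>2 / 2) / (2*u) ^ 4) \<longlongrightarrow> \<kappa>4 / 24 + \<kappa>2\<^sup>2/8) (at 0)"
  proof -
    have "filterlim (\<lambda>u::real. 2 * u) (at 0) (at 0)"
      by (intro filterlim_atI tendsto_eq_intros) (auto simp: eventually_at_filter)
    from filterlim_compose[OF re4 this] show ?thesis .
  qed
  \<comment> \<open>the combination \<open>(2 - 2 cos x)\<^sup>2 = 6 - 8 cos x + 2 cos 2x\<close>, in which the orders 0 and 2 cancel\<close>
  have D: "((\<lambda>u. (6 - 8 * Re (?\<phi> u) + 2 * Re (?\<phi> (2*u))) / u^4) \<longlongrightarrow> \<kappa>4 + 3 * \<kappa>2\<^sup>2) (at 0)"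
  proof -
    have "((\<lambda>u. -8 * ((Re (?\<phi> u) - 1 + \<kappa>2 * u\<^sup>2 / 2) / u ^ 4) + 32 * ((Re (?\<phi> (2*u)) - 1 + \<kappa>2 * (2*u)\<^sup>2 / 2) / (2*u) ^ 4))
       \<longlongrightarrow> -8 * (\<kappa>4 / 24 + \<kappa>2\<^sup>2/8) + 32 * (\<kappa>4 / 24 + \<kappa>2\<^sup>2/8)) (at 0)"
      by (intro tendsto_intros re4 re4')
    moreover have "eventually (\<lambda>u. -8 * ((Re (?\<phi> u) - 1 + \<kappa>2 * u\<^sup>2 / 2) / u ^ 4) + 32 * ((Re (?\<phi> (2*u)) - 1 + \<kappa>2 * (2*u)\<^sup>2 / 2) / (2*u) ^ 4)
       = (6 - 8 * Re (?\<phi> u) + 2 * Re (?\<phi> (2*u))) / u^4) (at 0)"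
      using nz by eventually_elim (simp add: field_simps eval_nat_numeral)
    ultimately show ?thesis by (rule Lim_transform_eventually[THEN tendsto_eq_rhs]) (simp add: field_simps)
  qed
  have D2: "((\<lambda>u. (2 - 2 * Re (?\<phi> u)) / u\<^sup>2) \<longlongrightarrow> \<kappa>2) (at 0)"
  proof -
    have "((\<lambda>u. -2 * ((Re (?\<phi> u) - 1 + \<kappa>2 * u\<^sup>2 / 2) / u ^ 4) * u\<^sup>2 + \<kappa>2) \<longlongrightarrow> -2 * (\<kappa>4 / 24 + \<kappa>2\<^sup>2/8) * 0\<^sup>2 + \<kappa>2) (at 0)"
      by (intro tendsto_intros re4)
    moreover have "eventually (\<lambda>u. -2 * ((Re (?\<phi> u) - 1 + \<kappa>2 * u\<^sup>2 / 2) / u ^ 4) * u\<^sup>2 + \<kappa>2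
       = (2 - 2 * Re (?\<phi> u)) / u\<^sup>2) (at 0)"
      using nz by eventually_elim (simp add: field_simps eval_nat_numeral)
    ultimately show ?thesis by (rule Lim_transform_eventually[THEN tendsto_eq_rhs]) simp
  qed
  define u :: "nat \<Rightarrow> real" where "u n = 1 / Suc n" for n
  have u: "u \<longlonglongrightarrow> 0" "\<And>n. u n \<noteq> 0"
    using LIMSEQ_inverse_real_of_nat by (auto simp: u_def[abs_def] inverse_eq_divide)
  have uat: "filterlim u (at 0) sequentially"
    using u by (intro filterlim_atI) auto
  have int: "integrable M (\<lambda>\<omega>. cos (v * Z \<omega>))" for v
    by (auto intro!: integrable_const_bound[where B=1])
  let ?g = "\<lambda>n \<omega>. ((2 - 2 * cos (u n * Z \<omega>)) / (u n)\<^sup>2)\<^sup>2"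
  have g_eq: "?g n \<omega> = (6 - 8 * cos (u n * Z \<omega>) + 2 * cos (2 * u n * Z \<omega>)) / (u n) ^ 4" for n \<omega>
    using cos_double_cos[of "u n * Z \<omega>"]
    by (simp add: power_divide algebra_simps power2_eq_square eval_nat_numeral)
  have g: "integrable M (?g n)" for n
    unfolding g_eq by (intro integrable_divide_zero Bochner_Integration.integrable_diff
        Bochner_Integration.integrable_add integrable_mult_right int) auto
  have g_lint: "(LINT \<omega>|M. ?g n \<omega>) = (6 - 8 * Re (?\<phi> (u n)) + 2 * Re (?\<phi> (2 * u n))) / (u n) ^ 4" for n
    unfolding g_eq using int[of "u n"] int[of "2 * u n"] by (subst (1 2) Re_char) (auto simp: prob_space)
  have glim: "(\<lambda>n. LINT \<omega>|M. ?g n \<omega>) \<longlonglongrightarrow> \<kappa>4 + 3 * \<kappa>2\<^sup>2"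
    unfolding g_lint by (rule filterlim_compose[OF D uat])
  then have "bounded (range (\<lambda>n. LINT \<omega>|M. ?g n \<omega>))"
    by (rule convergent_imp_bounded)
  then obtain B where B: "\<And>n. norm (LINT \<omega>|M. ?g n \<omega>) \<le> B"
    by (auto simp: bounded_iff)
  have "(LINT \<omega>|M. ?g n \<omega>) \<le> B" for n using B[of n] by simp
  then have ev: "eventually (\<lambda>n. (LINT \<omega>|M. ?g n \<omega>) \<le> B) sequentially" by simp
  have lim2: "(\<lambda>n. (2 - 2 * cos (u n * Z \<omega>)) / (u n)\<^sup>2) \<longlonglongrightarrow> (Z \<omega>)\<^sup>2" for \<omega>
    by (rule filterlim_compose[OF two_minus_two_cos_tendsto uat])
  have lim: "(\<lambda>n. ?g n \<omega>) \<longlonglongrightarrow> (Z \<omega>) ^ 4" for \<omega>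
    using tendsto_power[OF lim2, of _ 2] by simp
  show int4: "integrable M (\<lambda>\<omega>. (Z \<omega>) ^ 4)"
    by (rule fatou_integrable(1)[OF g _ _ AE_I2[OF lim] ev]) auto
  have le2: "(2 - 2 * cos (u n * Z \<omega>)) / (u n)\<^sup>2 \<le> (Z \<omega>)\<^sup>2" for n \<omega>
    using two_minus_two_cos_le[of "u n * Z \<omega>"] u(2)[of n] by (simp add: divide_le_eq power_mult_distrib mult.commute)
  have ge0: "0 \<le> (2 - 2 * cos (u n * Z \<omega>)) / (u n)\<^sup>2" for n \<omega>
    by simp
  have "(\<lambda>n. LINT \<omega>|M. ?g n \<omega>) \<longlonglongrightarrow> (LINT \<omega>|M. (Z \<omega>)^4)"
  proof (rule integral_dominated_convergence[where w="\<lambda>\<omega>. (Z \<omega>)^4"])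
    show "AE \<omega> in M. norm (?g n \<omega>) \<le> (Z \<omega>)^4" for n
      using power_mono[OF le2 ge0, of n _ 2] by simp
  qed (use lim int4 in auto)
  with glim show "(LINT \<omega>|M. (Z \<omega>) ^ 4) = \<kappa>4 + 3 * \<kappa>2\<^sup>2"
    using LIMSEQ_unique by blast
  have int2: "integrable M (\<lambda>\<omega>. (Z \<omega>)\<^sup>2)"
  proof (rule Bochner_Integration.integrable_bound[where f="\<lambda>\<omega>. 1 + (Z \<omega>)^4"])
    have "x\<^sup>2 \<le> 1 + x^4" for x :: real
      using sum_squares_bound[of 1 "x\<^sup>2"] by (simp add: flip: power_mult) (smt (verit) zero_le_power2)
    then show "AE \<omega> in M. norm ((Z \<omega>)\<^sup>2) \<le> norm (1 + (Z \<omega>)^4)" by (simp add: abs_of_nonneg add_nonneg_nonneg)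
  qed (use int4 in auto)
  have "(\<lambda>n. LINT \<omega>|M. (2 - 2 * cos (u n * Z \<omega>)) / (u n)\<^sup>2) \<longlonglongrightarrow> (LINT \<omega>|M. (Z \<omega>)\<^sup>2)"
  proof (rule integral_dominated_convergence[where w="\<lambda>\<omega>. (Z \<omega>)\<^sup>2"])
    show "AE \<omega> in M. norm ((2 - 2 * cos (u n * Z \<omega>)) / (u n)\<^sup>2) \<le> (Z \<omega>)\<^sup>2" for n
      using le2[of n] ge0[of n] by simp
  qed (use lim2 int2 in auto)
  moreover have "(LINT \<omega>|M. (2 - 2 * cos (u n * Z \<omega>)) / (u n)\<^sup>2) = (2 - 2 * Re (?\<phi> (u n))) / (u n)\<^sup>2" for n
    using int[of "u n"] by (subst Re_char) (auto simp: prob_space)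
  ultimately have "(\<lambda>n. (2 - 2 * Re (?\<phi> (u n))) / (u n)\<^sup>2) \<longlonglongrightarrow> (LINT \<omega>|M. (Z \<omega>)\<^sup>2)"
    by (simp only:)
  then show "(LINT \<omega>|M. (Z \<omega>)\<^sup>2) = \<kappa>2"
    by (rule LIMSEQ_unique) (rule filterlim_compose[OF D2 uat])
qed

section \<open>Characteristic functions determine joint laws\<close>

text \<open>A bounded weight \<open>w \<ge> 1\<close>, normalized, turns the law of \<open>V\<close> into another law on the line. This
makes the one-dimensional theory of characteristic functions applicable to expectations of
\<open>w g(V)\<close>. The lower bound 1 keeps the normalizing constant away from 0.\<close>

lemma (in prob_space) weighted_law:
  fixes V w :: "'a \<Rightarrow> real"
  assumes [measurable]: "V \<in> borel_measurable M" "w \<in> borel_measurable M"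
    and w: "\<And>\<omega>. 1 \<le> w \<omega>" "\<And>\<omega>. w \<omega> \<le> B"
  defines "c \<equiv> (LINT \<omega>|M. w \<omega>)"
  defines "\<mu> \<equiv> distr (density M (\<lambda>\<omega>. ennreal (w \<omega> / c))) borel V"
  shows "1 \<le> c" "real_distribution \<mu>"
    "\<And>g :: real \<Rightarrow> 'b::{banach, second_countable_topology}. g \<in> borel_measurable borel \<Longrightarrow>
      integral\<^sup>L \<mu> g = (1/c) *\<^sub>R (LINT \<omega>|M. w \<omega> *\<^sub>R g (V \<omega>))"
proof -
  have w0: "0 \<le> w \<omega>" for \<omega> using w(1)[of \<omega>] by linarith
  have int: "integrable M w"
    using w w0 by (intro integrable_const_bound[where B=B]) auto
  have "(LINT \<omega>|M. 1) \<le> c"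
    unfolding c_def by (intro integral_mono int w) auto
  then show c: "1 \<le> c" by (simp add: prob_space)
  have "emeasure (density M (\<lambda>\<omega>. ennreal (w \<omega> / c))) (space M) = (\<integral>\<^sup>+\<omega>. ennreal (w \<omega> / c) \<partial>M)"
    by (simp add: emeasure_density cong: nn_integral_cong)
  also have "\<dots> = ennreal (LINT \<omega>|M. w \<omega> / c)"
    using int w0 c by (intro nn_integral_eq_integral) auto
  also have "(LINT \<omega>|M. w \<omega> / c) = 1" using c by (simp add: c_def)
  finally have "prob_space (density M (\<lambda>\<omega>. ennreal (w \<omega> / c)))"
    by (intro prob_spaceI) simp
  then interpret D: prob_space "density M (\<lambda>\<omega>. ennreal (w \<omega> / c))" .
  show "real_distribution \<mu>"
    unfolding \<mu>_def by (intro D.real_distribution_distr) simp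
  fix g :: "real \<Rightarrow> 'b" assume [measurable]: "g \<in> borel_measurable borel"
  have "integral\<^sup>L \<mu> g = integral\<^sup>L (density M (\<lambda>\<omega>. ennreal (w \<omega> / c))) (\<lambda>\<omega>. g (V \<omega>))"
    unfolding \<mu>_def by (intro integral_distr) auto
  also have "\<dots> = (LINT \<omega>|M. (w \<omega> / c) *\<^sub>R g (V \<omega>))"
    using w0 c by (intro integral_density) auto
  also have "\<dots> = (LINT \<omega>|M. (1/c) *\<^sub>R (w \<omega> *\<^sub>R g (V \<omega>)))" by simp
  also have "\<dots> = (1/c) *\<^sub>R (LINT \<omega>|M. w \<omega> *\<^sub>R g (V \<omega>))" by (rule integral_scaleR_right)
  finally show "integral\<^sup>L \<mu> g = (1/c) *\<^sub>R (LINT \<omega>|M. w \<omega> *\<^sub>R g (V \<omega>))" .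
qed

lemma weighted_law_unique:
  fixes V w :: "'a \<Rightarrow> real" and V' w' :: "'b \<Rightarrow> real"
  assumes "prob_space M" "prob_space M'"
    and [measurable]: "V \<in> borel_measurable M" "w \<in> borel_measurable M" "V' \<in> borel_measurable M'" "w' \<in> borel_measurable M'"
    and w: "\<And>\<omega>. 1 \<le> w \<omega>" "\<And>\<omega>. w \<omega> \<le> B" "\<And>\<omega>. 1 \<le> w' \<omega>" "\<And>\<omega>. w' \<omega> \<le> B"
    and eq: "\<And>t. (CLINT \<omega>|M. w \<omega> *\<^sub>R iexp (t * V \<omega>)) = (CLINT \<omega>|M'. w' \<omega> *\<^sub>R iexp (t * V' \<omega>))"
    and A: "A \<in> sets borel"
  shows "(LINT \<omega>|M. w \<omega> * indicator A (V \<omega>)) = (LINT \<omega>|M'. w' \<omega> * indicator A (V' \<omega>))"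
proof -
  interpret M: prob_space M by fact
  interpret M': prob_space M' by fact
  note * = M.weighted_law[OF assms(3,4) w(1,2)]
  note ** = M'.weighted_law[OF assms(5,6) w(3,4)]
  have iw: "complex_of_real (LINT \<omega>|M. w \<omega>) = (CLINT \<omega>|M. w \<omega> *\<^sub>R iexp (0 * V \<omega>))"
    by (simp add: scaleR_conv_of_real flip: integral_complex_of_real)
  have iw': "complex_of_real (LINT \<omega>|M'. w' \<omega>) = (CLINT \<omega>|M'. w' \<omega> *\<^sub>R iexp (0 * V' \<omega>))"
    by (simp add: scaleR_conv_of_real flip: integral_complex_of_real)
  have c: "(LINT \<omega>|M. w \<omega>) = (LINT \<omega>|M'. w' \<omega>)"
    using iw iw' eq[of 0] by (metis of_real_eq_iff)
  let ?\<mu> = "distr (density M (\<lambda>\<omega>. ennreal (w \<omega> / (LINT \<omega>|M. w \<omega>)))) borel V"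
  let ?\<mu>' = "distr (density M' (\<lambda>\<omega>. ennreal (w' \<omega> / (LINT \<omega>|M'. w' \<omega>)))) borel V'"
  have "char ?\<mu> = char ?\<mu>'"
    unfolding char_def by (rule ext, subst *(3), simp, subst **(3), simp, simp only: eq c)
  then have "?\<mu> = ?\<mu>'"
    by (rule Levy_uniqueness[OF *(2) **(2)])
  then have "integral\<^sup>L ?\<mu> (indicator A :: real \<Rightarrow> real) = integral\<^sup>L ?\<mu>' (indicator A)" by simp
  then show ?thesis
    using A *(1) by (subst (asm) *(3), simp, subst (asm) **(3), simp, simp add: c)
qed

text \<open>A phase shifted cosine times a phase is a sum of two phases, so weights of this kind need nothing
beyond the given characteristic functions.\<close>

lemma cos_iexp: "(g * cos x) *\<^sub>R iexp y = (g/2) *\<^sub>R iexp (y + x) + (g/2) *\<^sub>R iexp (y - x)" for g :: real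
proof -
  have "complex_of_real (cos x) = (iexp x + iexp (-x)) / 2"
    by (metis cos_exp_eq cos_of_real mult_minus_right of_real_minus)
  moreover have "iexp (y + x) = iexp y * iexp x" "iexp (y - x) = iexp y * iexp (-x)"
    by (simp_all add: algebra_simps flip: exp_add)
  moreover have "G * ((e + e') / 2) * Y = G / 2 * (Y * e) + G / 2 * (Y * e')" for G Y e e' :: complex
    by (simp add: field_simps)
  ultimately show ?thesis
    by (simp only: scaleR_conv_of_real of_real_mult of_real_divide of_real_numeral)
qed

lemma iexp_as_cos: "iexp x = of_real (cos x) + \<i> * of_real (cos (x - pi/2))"
  by (simp add: cis_conv_exp[symmetric] complex_eq_iff cos_diff)

text \<open>The multivariate uniqueness theorem, by induction over the coordinates: each step trades a factor
\<open>exp(i c V\<^sub>j)\<close> for the indicator of \<open>V\<^sub>j \<in> A\<^sub>j\<close>, while the remaining coordinates stay in a phase.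
The bounded function \<open>w\<close> carries the indicators that have been obtained so far. For one step, the
weights \<open>B + 1 + w cos(S + \<theta>)\<close>, with \<open>S\<close> the phase of the remaining coordinates, lie between 1 and
\<open>2B + 1\<close>, and \<open>weighted_law_unique\<close> applies to them.\<close>

lemma joint_law_aux:
  fixes V :: "'i \<Rightarrow> 'a \<Rightarrow> real" and V' :: "'i \<Rightarrow> 'b \<Rightarrow> real"
  assumes PM: "prob_space M" "prob_space M'" and I: "finite I"
    and V[measurable]: "\<And>i. i \<in> I \<Longrightarrow> V i \<in> borel_measurable M" "\<And>i. i \<in> I \<Longrightarrow> V' i \<in> borel_measurable M'"
    and char1: "\<And>c. (CLINT \<omega>|M. iexp (\<Sum>i\<in>I. c i * V i \<omega>)) = (CLINT \<omega>|M'. iexp (\<Sum>i\<in>I. c i * V' i \<omega>))"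
    and w[measurable]: "w \<in> borel_measurable M" "w' \<in> borel_measurable M'"
    and wB: "\<And>\<omega>. \<bar>w \<omega>\<bar> \<le> B" "\<And>\<omega>. \<bar>w' \<omega>\<bar> \<le> B"
    and char: "\<And>c. (CLINT \<omega>|M. w \<omega> *\<^sub>R iexp (\<Sum>i\<in>I. c i * V i \<omega>)) = (CLINT \<omega>|M'. w' \<omega> *\<^sub>R iexp (\<Sum>i\<in>I. c i * V' i \<omega>))"
    and A: "\<And>i. i \<in> I \<Longrightarrow> A i \<in> sets borel"
  shows "(LINT \<omega>|M. w \<omega> * (\<Prod>i\<in>I. indicator (A i) (V i \<omega>))) = (LINT \<omega>|M'. w' \<omega> * (\<Prod>i\<in>I. indicator (A i) (V' i \<omega>)))"
  using I V char1 w wB char A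
proof (induction I arbitrary: w w' rule: finite_induct)
  case empty
  have "complex_of_real (LINT \<omega>|M. w \<omega>) = of_real (LINT \<omega>|M'. w' \<omega>)"
    using empty(8) by (simp add: scaleR_conv_of_real)
  then show ?case by simp
next
  case (insert j I)
  interpret M: prob_space M by fact
  interpret M': prob_space M' by fact
  have [measurable]: "V j \<in> borel_measurable M" "V' j \<in> borel_measurable M'"
    "w \<in> borel_measurable M" "w' \<in> borel_measurable M'"
    "\<And>i. i \<in> I \<Longrightarrow> V i \<in> borel_measurable M" "\<And>i. i \<in> I \<Longrightarrow> V' i \<in> borel_measurable M'"
    and Aj[measurable]: "A j \<in> sets borel"
    using insert.prems by auto
  note wB = insert.prems(6,7)
  have B0: "0 \<le> B" using wB(1) abs_ge_zero order_trans by blast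
  note [simp] = insert.hyps
  let ?S = "\<lambda>c \<omega>. \<Sum>i\<in>I. c i * V i \<omega>" and ?S' = "\<lambda>c \<omega>. \<Sum>i\<in>I. c i * V' i \<omega>"
  have upd: "(\<Sum>i\<in>I. (if i = j then t else c i) * V i \<omega>) = ?S c \<omega>"
     "(\<Sum>i\<in>I. (if i = j then t else c i) * V' i \<omega>') = ?S' c \<omega>'" for t c \<omega> \<omega>'
    using insert.hyps by (auto intro!: sum.cong)
  have c1: "(CLINT \<omega>|M. iexp (t * V j \<omega> + ?S c \<omega>)) = (CLINT \<omega>|M'. iexp (t * V' j \<omega> + ?S' c \<omega>))" for t c
    using insert.prems(3)[of "\<lambda>i. if i = j then t else c i"] by (simp add: upd)
  have cw: "(CLINT \<omega>|M. w \<omega> *\<^sub>R iexp (t * V j \<omega> + ?S c \<omega>)) = (CLINT \<omega>|M'. w' \<omega> *\<^sub>R iexp (t * V' j \<omega> + ?S' c \<omega>))" for t c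
    using insert.prems(8)[of "\<lambda>i. if i = j then t else c i"] by (simp add: upd)
  have bi: "integrable M (\<lambda>\<omega>. (w \<omega>/2) *\<^sub>R (a * iexp (f \<omega>)))" if [measurable]: "f \<in> borel_measurable M" for f :: "'a \<Rightarrow> real" and a
    using wB(1) by (auto intro!: M.integrable_const_bound[where B="B / 2 * cmod a"] AE_I2 mult_right_mono simp: norm_mult)
  have bi': "integrable M' (\<lambda>\<omega>. (w' \<omega>/2) *\<^sub>R (a * iexp (f \<omega>)))" if [measurable]: "f \<in> borel_measurable M'" for f :: "'b \<Rightarrow> real" and a
    using wB(2) by (auto intro!: M'.integrable_const_bound[where B="B / 2 * cmod a"] AE_I2 mult_right_mono simp: norm_mult)
  let ?p = "\<lambda>c \<theta> \<omega>. (B + 1) + w \<omega> * cos (?S c \<omega> + \<theta>)" and ?p' = "\<lambda>c \<theta> \<omega>. (B + 1) + w' \<omega> * cos (?S' c \<omega> + \<theta>)"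
  have wc: "\<bar>x * cos y\<bar> \<le> B" if "\<bar>x\<bar> \<le> B" for x y :: real
    using mult_mono[OF that abs_cos_le_one[of y]] B0 by (simp add: abs_mult)
  have pB: "1 \<le> ?p c \<theta> \<omega>" "?p c \<theta> \<omega> \<le> 2 * B + 1" "1 \<le> ?p' c \<theta> \<omega>'" "?p' c \<theta> \<omega>' \<le> 2 * B + 1" for c \<theta> \<omega> \<omega>'
    using wc[OF wB(1)[of \<omega>], of "?S c \<omega> + \<theta>"] wc[OF wB(2)[of \<omega>'], of "?S' c \<omega>' + \<theta>"] by linarith+
  have pexp: "((B + 1) + g * cos (s + \<theta>)) *\<^sub>R iexp (t * v)
      = (B + 1) *\<^sub>R iexp (t * v + 0) + ((g/2) *\<^sub>R (iexp \<theta> * iexp (t * v + s)) + (g/2) *\<^sub>R (iexp (-\<theta>) * iexp (t * v + (- s))))" for g s \<theta> t v :: real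
    by (subst scaleR_add_left, subst cos_iexp) (simp add: algebra_simps flip: exp_add)
  have neg: "?S (\<lambda>i. - c i) \<omega> = - ?S c \<omega>" "?S' (\<lambda>i. - c i) \<omega>' = - ?S' c \<omega>'" for c \<omega> \<omega>'
    by (simp_all add: sum_negf)
  have chp: "(CLINT \<omega>|M. ?p c \<theta> \<omega> *\<^sub>R iexp (t * V j \<omega>)) = (CLINT \<omega>|M'. ?p' c \<theta> \<omega> *\<^sub>R iexp (t * V' j \<omega>))" for c \<theta> t
  proof -
    have e: "(CLINT \<omega>|M. (w \<omega>/2) *\<^sub>R (a * iexp (t * V j \<omega> + ?S c \<omega>))) = (CLINT \<omega>|M'. (w' \<omega>/2) *\<^sub>R (a * iexp (t * V' j \<omega> + ?S' c \<omega>)))" for a c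
    proof -
      have "(CLINT \<omega>|M. (a/2) * (w \<omega> *\<^sub>R iexp (t * V j \<omega> + ?S c \<omega>))) = (CLINT \<omega>|M'. (a/2) * (w' \<omega> *\<^sub>R iexp (t * V' j \<omega> + ?S' c \<omega>)))"
        by (simp only: integral_mult_right_zero cw)
      then show ?thesis by (simp add: scaleR_conv_of_real mult_ac)
    qed
    have eV: "(CLINT \<omega>|M. ?p c \<theta> \<omega> *\<^sub>R iexp (t * V j \<omega>)) =
       (B + 1) *\<^sub>R (CLINT \<omega>|M. iexp (t * V j \<omega> + ?S (\<lambda>_. 0) \<omega>)) + ((CLINT \<omega>|M. (w \<omega>/2) *\<^sub>R (iexp \<theta> * iexp (t * V j \<omega> + ?S c \<omega>)))
        + (CLINT \<omega>|M. (w \<omega>/2) *\<^sub>R (iexp (-\<theta>) * iexp (t * V j \<omega> + ?S (\<lambda>i. - c i) \<omega>))))"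
    proof -
      have i0: "integrable M (\<lambda>\<omega>. (B + 1) *\<^sub>R iexp (t * V j \<omega> + ?S (\<lambda>_. 0) \<omega>))"
        by (intro integrable_scaleR_right M.integrable_iexp) measurable
      have i1: "integrable M (\<lambda>\<omega>. (w \<omega>/2) *\<^sub>R (a * iexp (t * V j \<omega> + ?S c \<omega>)))" for a c
        by (intro bi) measurable
      have "(CLINT \<omega>|M. ?p c \<theta> \<omega> *\<^sub>R iexp (t * V j \<omega>)) = (CLINT \<omega>|M. (B + 1) *\<^sub>R iexp (t * V j \<omega> + ?S (\<lambda>_. 0) \<omega>)
        + ((w \<omega>/2) *\<^sub>R (iexp \<theta> * iexp (t * V j \<omega> + ?S c \<omega>)) + (w \<omega>/2) *\<^sub>R (iexp (-\<theta>) * iexp (t * V j \<omega> + ?S (\<lambda>i. - c i) \<omega>))))"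
        unfolding pexp neg by simp
      then show ?thesis
        by (subst (asm) Bochner_Integration.integral_add[OF i0 Bochner_Integration.integrable_add[OF i1 i1]],
            subst (asm) Bochner_Integration.integral_add[OF i1 i1], simp only: integral_scaleR_right)
    qed
    have eV': "(CLINT \<omega>|M'. ?p' c \<theta> \<omega> *\<^sub>R iexp (t * V' j \<omega>)) =
       (B + 1) *\<^sub>R (CLINT \<omega>|M'. iexp (t * V' j \<omega> + ?S' (\<lambda>_. 0) \<omega>)) + ((CLINT \<omega>|M'. (w' \<omega>/2) *\<^sub>R (iexp \<theta> * iexp (t * V' j \<omega> + ?S' c \<omega>)))
        + (CLINT \<omega>|M'. (w' \<omega>/2) *\<^sub>R (iexp (-\<theta>) * iexp (t * V' j \<omega> + ?S' (\<lambda>i. - c i) \<omega>))))"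
    proof -
      have i0: "integrable M' (\<lambda>\<omega>. (B + 1) *\<^sub>R iexp (t * V' j \<omega> + ?S' (\<lambda>_. 0) \<omega>))"
        by (intro integrable_scaleR_right M'.integrable_iexp) measurable
      have i1: "integrable M' (\<lambda>\<omega>. (w' \<omega>/2) *\<^sub>R (a * iexp (t * V' j \<omega> + ?S' c \<omega>)))" for a c
        by (intro bi') measurable
      have "(CLINT \<omega>|M'. ?p' c \<theta> \<omega> *\<^sub>R iexp (t * V' j \<omega>)) = (CLINT \<omega>|M'. (B + 1) *\<^sub>R iexp (t * V' j \<omega> + ?S' (\<lambda>_. 0) \<omega>)
        + ((w' \<omega>/2) *\<^sub>R (iexp \<theta> * iexp (t * V' j \<omega> + ?S' c \<omega>)) + (w' \<omega>/2) *\<^sub>R (iexp (-\<theta>) * iexp (t * V' j \<omega> + ?S' (\<lambda>i. - c i) \<omega>))))"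
        unfolding pexp neg by simp
      then show ?thesis
        by (subst (asm) Bochner_Integration.integral_add[OF i0 Bochner_Integration.integrable_add[OF i1 i1]],
            subst (asm) Bochner_Integration.integral_add[OF i1 i1], simp only: integral_scaleR_right)
    qed
    show ?thesis unfolding eV eV' e c1 ..
  qed
  let ?w = "\<lambda>\<omega>. w \<omega> * indicator (A j) (V j \<omega>)" and ?w' = "\<lambda>\<omega>. w' \<omega> * indicator (A j) (V' j \<omega>)"
  have ci: "integrable M (\<lambda>\<omega>. ?w \<omega> * cos (f \<omega>))" if [measurable]: "f \<in> borel_measurable M" for f
    using wc[OF wB(1)] B0 by (intro M.integrable_const_bound[where B=B]) (auto simp: indicator_def)
  have ci': "integrable M' (\<lambda>\<omega>. ?w' \<omega> * cos (f \<omega>))" if [measurable]: "f \<in> borel_measurable M'" for f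
    using wc[OF wB(2)] B0 by (intro M'.integrable_const_bound[where B=B]) (auto simp: indicator_def)
  have ind: "(LINT \<omega>|M. indicator (A j) (V j \<omega>)) = (LINT \<omega>|M'. indicator (A j) (V' j \<omega>) :: real)"
  proof -
    have c0: "(CLINT \<omega>|M. iexp (t * V j \<omega>)) = (CLINT \<omega>|M'. iexp (t * V' j \<omega>))" for t
      using c1[of t "\<lambda>_. 0"] by (simp only: mult_zero_left sum.neutral_const add_0_right)
    have "(LINT \<omega>|M. 1 * indicator (A j) (V j \<omega>)) = (LINT \<omega>|M'. 1 * indicator (A j) (V' j \<omega>) :: real)"
      by (rule weighted_law_unique[OF PM, where B=1]; (simp only: scaleR_one c0 order_refl | measurable))
    then show ?thesis by (simp only: mult_1)
  qed
  \<comment> \<open>the constant part \<open>B + 1\<close> of the weight is subtracted again\<close>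
  have cosw: "(LINT \<omega>|M. ?w \<omega> * cos (?S c \<omega> + \<theta>)) = (LINT \<omega>|M'. ?w' \<omega> * cos (?S' c \<omega> + \<theta>))" for c \<theta>
  proof -
    have "(LINT \<omega>|M. ?p c \<theta> \<omega> * indicator (A j) (V j \<omega>)) = (LINT \<omega>|M'. ?p' c \<theta> \<omega> * indicator (A j) (V' j \<omega>))"
      by (rule weighted_law_unique[OF PM, where B="2 * B + 1"]) (use pB chp in auto)
    moreover have "(LINT \<omega>|M. ?p c \<theta> \<omega> * indicator (A j) (V j \<omega>)) = (B + 1) * (LINT \<omega>|M. indicator (A j) (V j \<omega>)) + (LINT \<omega>|M. ?w \<omega> * cos (?S c \<omega> + \<theta>))"
    proof -
      have "(LINT \<omega>|M. ?p c \<theta> \<omega> * indicator (A j) (V j \<omega>)) = (LINT \<omega>|M. (B + 1) * indicator (A j) (V j \<omega>) + ?w \<omega> * cos (?S c \<omega> + \<theta>))"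
        by (simp add: algebra_simps)
      also have "\<dots> = (LINT \<omega>|M. (B + 1) * indicator (A j) (V j \<omega>)) + (LINT \<omega>|M. ?w \<omega> * cos (?S c \<omega> + \<theta>))"
        by (intro Bochner_Integration.integral_add ci) (auto intro!: M.integrable_const_bound[where B="B+1"] simp: indicator_def B0)
      finally show ?thesis by simp
    qed
    moreover have "(LINT \<omega>|M'. ?p' c \<theta> \<omega> * indicator (A j) (V' j \<omega>)) = (B + 1) * (LINT \<omega>|M'. indicator (A j) (V' j \<omega>)) + (LINT \<omega>|M'. ?w' \<omega> * cos (?S' c \<omega> + \<theta>))"
    proof -
      have "(LINT \<omega>|M'. ?p' c \<theta> \<omega> * indicator (A j) (V' j \<omega>)) = (LINT \<omega>|M'. (B + 1) * indicator (A j) (V' j \<omega>) + ?w' \<omega> * cos (?S' c \<omega> + \<theta>))"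
        by (simp add: algebra_simps)
      also have "\<dots> = (LINT \<omega>|M'. (B + 1) * indicator (A j) (V' j \<omega>)) + (LINT \<omega>|M'. ?w' \<omega> * cos (?S' c \<omega> + \<theta>))"
        by (intro Bochner_Integration.integral_add ci') (auto intro!: M'.integrable_const_bound[where B="B+1"] simp: indicator_def B0)
      finally show ?thesis by simp
    qed
    ultimately show ?thesis using ind by simp
  qed
  have split: "x *\<^sub>R iexp s = of_real (x * cos (s + 0)) + \<i> * of_real (x * cos (s + - (pi/2)))" for x s
    unfolding iexp_as_cos[of s] by (simp add: scaleR_conv_of_real algebra_simps)
  have cw2: "(CLINT \<omega>|M. ?w \<omega> *\<^sub>R iexp (?S c \<omega>)) = (CLINT \<omega>|M'. ?w' \<omega> *\<^sub>R iexp (?S' c \<omega>))" for c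
  proof -
    have "(CLINT \<omega>|M. ?w \<omega> *\<^sub>R iexp (?S c \<omega>)) = of_real (LINT \<omega>|M. ?w \<omega> * cos (?S c \<omega> + 0)) + \<i> * of_real (LINT \<omega>|M. ?w \<omega> * cos (?S c \<omega> + - (pi/2)))"
      unfolding split
      by (subst Bochner_Integration.integral_add)
        (intro integrable_mult_right integrable_of_real ci; measurable | simp only: integral_mult_right_zero integral_complex_of_real)+
    also have "\<dots> = (CLINT \<omega>|M'. ?w' \<omega> *\<^sub>R iexp (?S' c \<omega>))"
      unfolding split cosw
      by (subst Bochner_Integration.integral_add)
        (intro integrable_mult_right integrable_of_real ci'; measurable | simp only: integral_mult_right_zero integral_complex_of_real)+
    finally show ?thesis .
  qed
  have "(LINT \<omega>|M. ?w \<omega> * (\<Prod>i\<in>I. indicator (A i) (V i \<omega>))) = (LINT \<omega>|M'. ?w' \<omega> * (\<Prod>i\<in>I. indicator (A i) (V' i \<omega>)))"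
  proof (rule insert.IH)
    show "(CLINT \<omega>|M. iexp (?S c \<omega>)) = (CLINT \<omega>|M'. iexp (?S' c \<omega>))" for c
      using c1[of 0 c] by simp
    show "\<bar>?w \<omega>\<bar> \<le> B" "\<bar>?w' \<omega>'\<bar> \<le> B" for \<omega> \<omega>'
      using wB(1)[of \<omega>] wB(2)[of \<omega>'] B0 by (auto simp: indicator_def)
  qed (use insert.prems cw2 in auto)
  then show ?case using insert.hyps by (simp add: mult.assoc)
qed

text \<open>The boxes \<open>{x. \<forall>i\<in>I. x i \<in> A i}\<close> generate the product \<open>\<sigma>\<close>-algebra and are closed under
intersection.\<close>

lemma joint_law_eq:
  fixes V :: "'i \<Rightarrow> 'a \<Rightarrow> real" and V' :: "'i \<Rightarrow> 'b \<Rightarrow> real"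
  assumes PM: "prob_space M" "prob_space M'" and I: "finite I"
    and V[measurable]: "\<And>i. i \<in> I \<Longrightarrow> V i \<in> borel_measurable M" "\<And>i. i \<in> I \<Longrightarrow> V' i \<in> borel_measurable M'"
    and char: "\<And>c. (CLINT \<omega>|M. iexp (\<Sum>i\<in>I. c i * V i \<omega>)) = (CLINT \<omega>|M'. iexp (\<Sum>i\<in>I. c i * V' i \<omega>))"
  shows "distr M (\<Pi>\<^sub>M i\<in>I. borel) (\<lambda>\<omega>. \<lambda>i\<in>I. V i \<omega>) = distr M' (\<Pi>\<^sub>M i\<in>I. borel) (\<lambda>\<omega>. \<lambda>i\<in>I. V' i \<omega>)" (is "?P = ?Q")
proof (rule measure_eqI_PiM_finite[where A="\<lambda>_. space (\<Pi>\<^sub>M i\<in>I. (borel :: real measure))", OF I])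
  interpret M: prob_space M by fact
  interpret M': prob_space M' by fact
  have [measurable]: "(\<lambda>\<omega>. \<lambda>i\<in>I. V i \<omega>) \<in> measurable M (\<Pi>\<^sub>M i\<in>I. borel)" "(\<lambda>\<omega>. \<lambda>i\<in>I. V' i \<omega>) \<in> measurable M' (\<Pi>\<^sub>M i\<in>I. borel)"
    by (intro measurable_restrict V; assumption)+
  show "sets ?P = sets (\<Pi>\<^sub>M i\<in>I. borel)" "sets ?Q = sets (\<Pi>\<^sub>M i\<in>I. borel)" by simp_all
  fix A :: "'i \<Rightarrow> real set" assume A: "\<And>i. i \<in> I \<Longrightarrow> A i \<in> sets borel"
  have [measurable]: "Pi\<^sub>E I A \<in> sets (\<Pi>\<^sub>M i\<in>I. borel)" using I A by (intro sets_PiM_I_finite) auto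
  have pr: "(\<Prod>i\<in>I. indicator (A i) (f i)) = (indicator (Pi\<^sub>E I A) (\<lambda>i\<in>I. f i) :: real)" for f
    using I by (auto simp: indicator_def prod_zero_iff PiE_iff)
  have E: "Pi\<^sub>E I A \<inter> space (\<Pi>\<^sub>M i\<in>I. borel) = Pi\<^sub>E I A"
    by (auto simp: space_PiM)
  have "measure ?P (Pi\<^sub>E I A) = integral\<^sup>L ?P (indicator (Pi\<^sub>E I A))"
    by (simp add: E)
  also have "\<dots> = (LINT \<omega>|M. 1 * (\<Prod>i\<in>I. indicator (A i) (V i \<omega>)))"
    by (subst integral_distr) (simp_all add: pr)
  also have "\<dots> = (LINT \<omega>|M'. 1 * (\<Prod>i\<in>I. indicator (A i) (V' i \<omega>)))"
    by (rule joint_law_aux[OF PM I, where B=1]) (use char A in auto)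
  also have "\<dots> = integral\<^sup>L ?Q (indicator (Pi\<^sub>E I A))"
    by (subst integral_distr) (simp_all add: pr)
  also have "\<dots> = measure ?Q (Pi\<^sub>E I A)"
    by (simp add: E)
  finally show "emeasure ?P (Pi\<^sub>E I A) = emeasure ?Q (Pi\<^sub>E I A)"
    by (simp add: M.prob_space_distr M'.prob_space_distr finite_measure.emeasure_eq_measure prob_space.finite_measure)
next
  have "(\<Pi>\<^sub>E i\<in>I. space (borel :: real measure)) \<in> prod_algebra I (\<lambda>_. borel)"
    using I by (intro prod_algebraI_finite) auto
  then show "range (\<lambda>_::nat. space (\<Pi>\<^sub>M i\<in>I. (borel::real measure))) \<subseteq> prod_algebra I (\<lambda>_. borel)"
    by (auto simp: space_PiM)
next
  have "prob_space ?P"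
    using PM(1) V(1) by (intro prob_space.prob_space_distr measurable_restrict)
  then show "emeasure ?P (space (\<Pi>\<^sub>M i\<in>I. borel)) \<noteq> \<infinity>"
    using prob_space.emeasure_space_1[of ?P] by simp
qed auto

lemma joint_law_integral_eq:
  fixes V :: "'i \<Rightarrow> 'a \<Rightarrow> real" and V' :: "'i \<Rightarrow> 'b \<Rightarrow> real" and G :: "('i \<Rightarrow> real) \<Rightarrow> 'c::{banach, second_countable_topology}"
  assumes PM: "prob_space M" "prob_space M'" and I: "finite I"
    and V[measurable]: "\<And>i. i \<in> I \<Longrightarrow> V i \<in> borel_measurable M" "\<And>i. i \<in> I \<Longrightarrow> V' i \<in> borel_measurable M'"
    and char: "\<And>c. (CLINT \<omega>|M. iexp (\<Sum>i\<in>I. c i * V i \<omega>)) = (CLINT \<omega>|M'. iexp (\<Sum>i\<in>I. c i * V' i \<omega>))"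
    and G[measurable]: "G \<in> borel_measurable (\<Pi>\<^sub>M i\<in>I. borel)"
  shows "(LINT \<omega>|M. G (\<lambda>i\<in>I. V i \<omega>)) = (LINT \<omega>|M'. G (\<lambda>i\<in>I. V' i \<omega>))"
proof -
  have Vm: "(\<lambda>\<omega>. \<lambda>i\<in>I. V i \<omega>) \<in> measurable M (\<Pi>\<^sub>M i\<in>I. borel)" "(\<lambda>\<omega>. \<lambda>i\<in>I. V' i \<omega>) \<in> measurable M' (\<Pi>\<^sub>M i\<in>I. borel)"
    by (intro measurable_restrict V; assumption)+
  have "(LINT \<omega>|M. G (\<lambda>i\<in>I. V i \<omega>)) = integral\<^sup>L (distr M (\<Pi>\<^sub>M i\<in>I. borel) (\<lambda>\<omega>. \<lambda>i\<in>I. V i \<omega>)) G"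
    by (rule integral_distr[OF Vm(1) G, symmetric])
  also have "\<dots> = integral\<^sup>L (distr M' (\<Pi>\<^sub>M i\<in>I. borel) (\<lambda>\<omega>. \<lambda>i\<in>I. V' i \<omega>)) G"
    using joint_law_eq[OF assms(1-6)] by simp
  also have "\<dots> = (LINT \<omega>|M'. G (\<lambda>i\<in>I. V' i \<omega>))"
    by (rule integral_distr[OF Vm(2) G])
  finally show ?thesis .
qed

section \<open>Convergence in distribution from characteristic functions\<close>

lemma borel_measurable_component[measurable (raw)]:
  fixes f :: "'a \<Rightarrow> real^'n"
  shows "f \<in> borel_measurable M \<Longrightarrow> (\<lambda>x. f x $ j) \<in> borel_measurable M"
  by (rule measurable_compose[where g="\<lambda>x. x $ j"]) (auto intro!: borel_measurable_continuous_onI continuous_intros)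

lemma tendsto_add_cancel:
  fixes f g :: "'a \<Rightarrow> real"
  assumes "((\<lambda>x. f x + g x) \<longlongrightarrow> a + b) F" "(f \<longlongrightarrow> a) F"
  shows "(g \<longlongrightarrow> b) F"
  using tendsto_diff[OF assms] by simp

text \<open>Levy's continuity theorem on the line, applied to the normalized weighted laws.\<close>

lemma weighted_weak_convergence:
  fixes V w :: "nat \<Rightarrow> 'a \<Rightarrow> real" and V' w' :: "'b \<Rightarrow> real"
  assumes "prob_space M" "prob_space M'"
    and [measurable]: "\<And>n. V n \<in> borel_measurable M" "\<And>n. w n \<in> borel_measurable M" "V' \<in> borel_measurable M'" "w' \<in> borel_measurable M'"
    and w: "\<And>n \<omega>. 1 \<le> w n \<omega>" "\<And>n \<omega>. w n \<omega> \<le> B" "\<And>\<omega>. 1 \<le> w' \<omega>" "\<And>\<omega>. w' \<omega> \<le> B"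
    and lim: "\<And>t. (\<lambda>n. CLINT \<omega>|M. w n \<omega> *\<^sub>R iexp (t * V n \<omega>)) \<longlonglongrightarrow> (CLINT \<omega>|M'. w' \<omega> *\<^sub>R iexp (t * V' \<omega>))"
    and g: "continuous_on UNIV g" "\<And>x. \<bar>g x\<bar> \<le> C"
  shows "(\<lambda>n. LINT \<omega>|M. w n \<omega> * g (V n \<omega>)) \<longlonglongrightarrow> (LINT \<omega>|M'. w' \<omega> * g (V' \<omega>) :: real)"
proof -
  interpret M: prob_space M by fact
  interpret M': prob_space M' by fact
  note Mw = M.weighted_law[OF assms(3,4) w(1,2)]
  note Mw' = M'.weighted_law[OF assms(5,6) w(3,4)]
  let ?c = "\<lambda>n. LINT \<omega>|M. w n \<omega>" and ?c' = "LINT \<omega>|M'. w' \<omega>"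
  let ?\<mu> = "\<lambda>n. distr (density M (\<lambda>\<omega>. ennreal (w n \<omega> / ?c n))) borel (V n)"
  let ?\<mu>' = "distr (density M' (\<lambda>\<omega>. ennreal (w' \<omega> / ?c'))) borel V'"
  have [measurable]: "g \<in> borel_measurable borel" using g(1) by (rule borel_measurable_continuous_onI)
  have clim: "?c \<longlonglongrightarrow> ?c'"
  proof -
    have "(\<lambda>n. Re (CLINT \<omega>|M. w n \<omega> *\<^sub>R iexp (0 * V n \<omega>))) \<longlonglongrightarrow> Re (CLINT \<omega>|M'. w' \<omega> *\<^sub>R iexp (0 * V' \<omega>))"
      by (intro tendsto_Re lim)
    then show ?thesis by (simp add: scaleR_conv_of_real)
  qed
  have c0: "?c n \<noteq> 0" "?c' \<noteq> 0" for n using Mw(1)[of n] Mw'(1) by auto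
  have "weak_conv_m ?\<mu> ?\<mu>'"
  proof (rule levy_continuity[OF Mw(2) Mw'(2)])
    fix t
    have "(\<lambda>n. (1 / ?c n) *\<^sub>R (CLINT \<omega>|M. w n \<omega> *\<^sub>R iexp (t * V n \<omega>))) \<longlonglongrightarrow> (1 / ?c') *\<^sub>R (CLINT \<omega>|M'. w' \<omega> *\<^sub>R iexp (t * V' \<omega>))"
      by (intro tendsto_intros clim lim c0)
    then show "(\<lambda>n. char (?\<mu> n) t) \<longlonglongrightarrow> char ?\<mu>' t"
      unfolding char_def by (subst Mw(3), simp, subst Mw'(3), simp)
  qed
  then have "(\<lambda>n. integral\<^sup>L (?\<mu> n) g) \<longlonglongrightarrow> integral\<^sup>L ?\<mu>' g"
    by (rule weak_conv_imp_integral_bdd_continuous_conv[OF Mw(2) Mw'(2), where B=C])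
      (use g in \<open>auto simp: continuous_on_eq_continuous_at\<close>)
  then have "(\<lambda>n. (1 / ?c n) *\<^sub>R (LINT \<omega>|M. w n \<omega> * g (V n \<omega>))) \<longlonglongrightarrow> (1 / ?c') *\<^sub>R (LINT \<omega>|M'. w' \<omega> * g (V' \<omega>))"
    by (subst (asm) Mw(3), simp, subst (asm) Mw'(3), simp, simp)
  from tendsto_scaleR[OF clim this] show ?thesis using c0 by simp
qed

text \<open>The bounded test functions \<open>G\<close> for which the expectations of \<open>G(V\<^sub>n) exp(i u\<bullet>V\<^sub>n)\<close> converge for
all \<open>u\<close>. Keeping the phase in the definition makes the class stable under multiplication by
functions of one coordinate.\<close>

definition trig_conv :: "'w measure \<Rightarrow> (nat \<Rightarrow> 'w \<Rightarrow> real^'r) \<Rightarrow> (real^'r) measure \<Rightarrow> (real^'r \<Rightarrow> real) \<Rightarrow> bool" where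
  "trig_conv M V P G \<longleftrightarrow> G \<in> borel_measurable borel \<and> (\<exists>B. \<forall>x. \<bar>G x\<bar> \<le> B) \<and>
    (\<forall>u. (\<lambda>n. CLINT \<omega>|M. G (V n \<omega>) *\<^sub>R iexp (u \<bullet> V n \<omega>)) \<longlonglongrightarrow> (CLINT x|P. G x *\<^sub>R iexp (u \<bullet> x)))"

locale char_convergence = M: prob_space M + P: prob_space P
  for M :: "'w measure" and P :: "(real^'r) measure" +
  fixes V :: "nat \<Rightarrow> 'w \<Rightarrow> real^'r"
  assumes V[measurable]: "\<And>n. V n \<in> borel_measurable M" and sets_P[measurable_cong]: "sets P = sets borel"
    and conv: "\<And>u. (\<lambda>n. CLINT \<omega>|M. iexp (u \<bullet> V n \<omega>)) \<longlonglongrightarrow> (CLINT x|P. iexp (u \<bullet> x))"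
begin

text \<open>For fixed \<open>u\<close> and \<open>\<theta>\<close> the weight \<open>B + 1 + G cos(u\<bullet>x + \<theta>)\<close> is positive and bounded, and its
weighted characteristic function in the \<open>j\<close>-th coordinate converges by assumption on \<open>G\<close>. So the
one-dimensional continuity theorem applies to that coordinate and any bounded continuous \<open>g\<close>.\<close>

lemma trig_conv_mult_coordinate:
  assumes G: "trig_conv M V P G" and g: "continuous_on UNIV g" "\<And>x. \<bar>g x\<bar> \<le> C"
  shows "trig_conv M V P (\<lambda>x. G x * g (x $ j))"
proof -
  have [measurable]: "G \<in> borel_measurable borel" using G by (simp add: trig_conv_def)
  have gm[measurable]: "g \<in> borel_measurable borel" using g(1) by (rule borel_measurable_continuous_onI)
  obtain B where B: "\<And>x. \<bar>G x\<bar> \<le> B" using G by (auto simp: trig_conv_def)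
  have B0: "0 \<le> B" using B abs_ge_zero order_trans by blast
  have C0: "0 \<le> C" using g(2) abs_ge_zero order_trans by blast
  have Glim: "(\<lambda>n. CLINT \<omega>|M. G (V n \<omega>) *\<^sub>R iexp (u \<bullet> V n \<omega>)) \<longlonglongrightarrow> (CLINT x|P. G x *\<^sub>R iexp (u \<bullet> x))" for u
    using G by (simp add: trig_conv_def)
  have wc: "\<bar>G x * cos y\<bar> \<le> B" for x y
    using mult_mono[OF B abs_cos_le_one] B0 by (simp add: abs_mult)
  let ?p = "\<lambda>u \<theta> x. (B + 1) + G x * cos (u \<bullet> x + \<theta>)"
  have pB: "1 \<le> ?p u \<theta> x" "?p u \<theta> x \<le> 2 * B + 1" for u \<theta> x
    using wc[of x "u \<bullet> x + \<theta>"] by linarith+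
  let ?e = "\<lambda>t. axis j t :: real^'r"
  have ax: "?e t \<bullet> x = t * x $ j" for t x by (simp add: inner_axis')
  have pexp: "?p u \<theta> x *\<^sub>R iexp (t * x $ j)
      = (B + 1) *\<^sub>R iexp (?e t \<bullet> x) + ((iexp \<theta> / 2) * (G x *\<^sub>R iexp ((?e t + u) \<bullet> x)) + (iexp (-\<theta>) / 2) * (G x *\<^sub>R iexp ((?e t - u) \<bullet> x)))" for u \<theta> t x
    by (subst scaleR_add_left, subst cos_iexp)
      (simp add: ax scaleR_conv_of_real algebra_simps inner_add_left inner_diff_left flip: exp_add)
  have Gint: "integrable M (\<lambda>\<omega>. G (V n \<omega>) *\<^sub>R iexp (u \<bullet> V n \<omega>))" for n u
    using B by (intro M.integrable_const_bound[where B=B]) auto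
  have GintP: "integrable P (\<lambda>x. G x *\<^sub>R iexp (u \<bullet> x))" for u
    using B by (intro P.integrable_const_bound[where B=B]) auto
  have plim: "(\<lambda>n. CLINT \<omega>|M. ?p u \<theta> (V n \<omega>) *\<^sub>R iexp (t * V n \<omega> $ j)) \<longlonglongrightarrow> (CLINT x|P. ?p u \<theta> x *\<^sub>R iexp (t * x $ j))" for u \<theta> t
  proof -
    have "(\<lambda>n. (B + 1) *\<^sub>R (CLINT \<omega>|M. iexp (?e t \<bullet> V n \<omega>)) +
       ((iexp \<theta> / 2) * (CLINT \<omega>|M. G (V n \<omega>) *\<^sub>R iexp ((?e t + u) \<bullet> V n \<omega>)) + (iexp (-\<theta>) / 2) * (CLINT \<omega>|M. G (V n \<omega>) *\<^sub>R iexp ((?e t - u) \<bullet> V n \<omega>))))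
      \<longlonglongrightarrow> (B + 1) *\<^sub>R (CLINT x|P. iexp (?e t \<bullet> x)) +
       ((iexp \<theta> / 2) * (CLINT x|P. G x *\<^sub>R iexp ((?e t + u) \<bullet> x)) + (iexp (-\<theta>) / 2) * (CLINT x|P. G x *\<^sub>R iexp ((?e t - u) \<bullet> x)))"
      by (intro tendsto_intros conv Glim)
    moreover have "(CLINT \<omega>|M. ?p u \<theta> (V n \<omega>) *\<^sub>R iexp (t * V n \<omega> $ j)) = (B + 1) *\<^sub>R (CLINT \<omega>|M. iexp (?e t \<bullet> V n \<omega>)) +
       ((iexp \<theta> / 2) * (CLINT \<omega>|M. G (V n \<omega>) *\<^sub>R iexp ((?e t + u) \<bullet> V n \<omega>)) + (iexp (-\<theta>) / 2) * (CLINT \<omega>|M. G (V n \<omega>) *\<^sub>R iexp ((?e t - u) \<bullet> V n \<omega>)))" for n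
    proof -
      have i0: "integrable M (\<lambda>\<omega>. (B + 1) *\<^sub>R iexp (?e t \<bullet> V n \<omega>))"
        by (intro integrable_scaleR_right M.integrable_iexp) measurable
      have i1: "integrable M (\<lambda>\<omega>. a * (G (V n \<omega>) *\<^sub>R iexp (v \<bullet> V n \<omega>)))" for a v
        by (intro integrable_mult_right Gint)
      show ?thesis unfolding pexp
        by (subst Bochner_Integration.integral_add[OF i0 Bochner_Integration.integrable_add[OF i1 i1]],
            subst Bochner_Integration.integral_add[OF i1 i1], simp only: integral_scaleR_right integral_mult_right_zero)
    qed
    moreover have "(CLINT x|P. ?p u \<theta> x *\<^sub>R iexp (t * x $ j)) = (B + 1) *\<^sub>R (CLINT x|P. iexp (?e t \<bullet> x)) +
       ((iexp \<theta> / 2) * (CLINT x|P. G x *\<^sub>R iexp ((?e t + u) \<bullet> x)) + (iexp (-\<theta>) / 2) * (CLINT x|P. G x *\<^sub>R iexp ((?e t - u) \<bullet> x)))"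
    proof -
      have i0: "integrable P (\<lambda>x. (B + 1) *\<^sub>R iexp (?e t \<bullet> x))"
        by (intro integrable_scaleR_right P.integrable_iexp) measurable
      have i1: "integrable P (\<lambda>x. a * (G x *\<^sub>R iexp (v \<bullet> x)))" for a v
        by (intro integrable_mult_right GintP)
      show ?thesis unfolding pexp
        by (subst Bochner_Integration.integral_add[OF i0 Bochner_Integration.integrable_add[OF i1 i1]],
            subst Bochner_Integration.integral_add[OF i1 i1], simp only: integral_scaleR_right integral_mult_right_zero)
    qed
    ultimately show ?thesis by (simp only:)
  qed
  have glim: "(\<lambda>n. LINT \<omega>|M. g (V n \<omega> $ j)) \<longlonglongrightarrow> (LINT x|P. g (x $ j))"
  proof -
    have "(\<lambda>n. LINT \<omega>|M. 1 * g (V n \<omega> $ j)) \<longlonglongrightarrow> (LINT x|P. 1 * g (x $ j))"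
    proof (rule weighted_weak_convergence[OF M.prob_space_axioms P.prob_space_axioms, where B=1 and C=C and w="\<lambda>_ _. 1" and w'="\<lambda>_. 1" and V="\<lambda>n \<omega>. V n \<omega> $ j" and V'="\<lambda>x. x $ j" and g=g])
      show "(\<lambda>n. CLINT \<omega>|M. 1 *\<^sub>R iexp (t * V n \<omega> $ j)) \<longlonglongrightarrow> (CLINT \<omega>|P. 1 *\<^sub>R iexp (t * \<omega> $ j))" for t
        using conv[of "?e t"] by (simp only: ax scaleR_one)
    qed (use g in auto)
    then show ?thesis by simp
  qed
  let ?G = "\<lambda>x. G x * g (x $ j)"
  have ig: "integrable M (\<lambda>\<omega>. (B + 1) * g (V n \<omega> $ j))" "integrable P (\<lambda>x. (B + 1) * g (x $ j))" for n
    using g(2) by (auto intro!: integrable_mult_right M.integrable_const_bound[where B=C] P.integrable_const_bound[where B=C])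
  have GgB: "\<bar>?G x * cos y\<bar> \<le> B * C" for x y
    using mult_mono[OF wc[of x y] g(2)[of "x $ j"]] B0 by (simp add: abs_mult mult_ac)
  have ic: "integrable M (\<lambda>\<omega>. ?G (V n \<omega>) * cos (u \<bullet> V n \<omega> + \<theta>))" "integrable P (\<lambda>x. ?G x * cos (u \<bullet> x + \<theta>))" for n u \<theta>
    using GgB by (auto intro!: M.integrable_const_bound[where B="B * C"] P.integrable_const_bound[where B="B * C"])
  have coslim: "(\<lambda>n. LINT \<omega>|M. ?G (V n \<omega>) * cos (u \<bullet> V n \<omega> + \<theta>)) \<longlonglongrightarrow> (LINT x|P. ?G x * cos (u \<bullet> x + \<theta>))" for u \<theta>
  proof -
    have "(\<lambda>n. LINT \<omega>|M. ?p u \<theta> (V n \<omega>) * g (V n \<omega> $ j)) \<longlonglongrightarrow> (LINT x|P. ?p u \<theta> x * g (x $ j))"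
      by (rule weighted_weak_convergence[OF M.prob_space_axioms P.prob_space_axioms, where B="2*B+1" and C=C])
        (use pB plim g in auto)
    moreover have e: "?p u \<theta> x * g (x $ j) = (B + 1) * g (x $ j) + ?G x * cos (u \<bullet> x + \<theta>)" for x
      by (simp add: algebra_simps)
    ultimately have "(\<lambda>n. (LINT \<omega>|M. (B + 1) * g (V n \<omega> $ j)) + (LINT \<omega>|M. ?G (V n \<omega>) * cos (u \<bullet> V n \<omega> + \<theta>))) \<longlonglongrightarrow>
       (LINT x|P. (B + 1) * g (x $ j)) + (LINT x|P. ?G x * cos (u \<bullet> x + \<theta>))"
      by (simp only: e Bochner_Integration.integral_add[OF ig(1) ic(1)] Bochner_Integration.integral_add[OF ig(2) ic(2)])
    moreover have "(\<lambda>n. (LINT \<omega>|M. (B + 1) * g (V n \<omega> $ j))) \<longlonglongrightarrow> (LINT x|P. (B + 1) * g (x $ j))"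
      unfolding integral_mult_right_zero by (intro tendsto_intros glim)
    ultimately show ?thesis by (rule tendsto_add_cancel)
  qed
  have split: "x *\<^sub>R iexp s = of_real (x * cos (s + 0)) + \<i> * of_real (x * cos (s + - (pi/2)))" for x s
    unfolding iexp_as_cos[of s] by (simp add: scaleR_conv_of_real algebra_simps)
  show ?thesis
    unfolding trig_conv_def
  proof (intro conjI allI)
    show "\<exists>B. \<forall>x. \<bar>?G x\<bar> \<le> B"
      using mult_mono[OF B g(2)] B0 by (auto simp: abs_mult)
    fix u
    have i: "(CLINT \<omega>|M. ?G (V n \<omega>) *\<^sub>R iexp (u \<bullet> V n \<omega>)) =
       of_real (LINT \<omega>|M. ?G (V n \<omega>) * cos (u \<bullet> V n \<omega> + 0)) + \<i> * of_real (LINT \<omega>|M. ?G (V n \<omega>) * cos (u \<bullet> V n \<omega> + - (pi/2)))" for n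
      unfolding split
      by (subst Bochner_Integration.integral_add)
        (intro integrable_mult_right integrable_of_real ic; measurable | simp only: integral_mult_right_zero integral_complex_of_real)+
    have iP: "(CLINT x|P. ?G x *\<^sub>R iexp (u \<bullet> x)) =
       of_real (LINT x|P. ?G x * cos (u \<bullet> x + 0)) + \<i> * of_real (LINT x|P. ?G x * cos (u \<bullet> x + - (pi/2)))"
      unfolding split
      by (subst Bochner_Integration.integral_add)
        (intro integrable_mult_right integrable_of_real ic; measurable | simp only: integral_mult_right_zero integral_complex_of_real)+
    show "(\<lambda>n. CLINT \<omega>|M. ?G (V n \<omega>) *\<^sub>R iexp (u \<bullet> V n \<omega>)) \<longlonglongrightarrow> (CLINT x|P. ?G x *\<^sub>R iexp (u \<bullet> x))"
      unfolding i iP by (intro tendsto_intros coslim)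
  qed measurable
qed

lemma trig_conv_one: "trig_conv M V P (\<lambda>_. 1)"
  using conv by (auto simp: trig_conv_def intro: exI[of _ 1])

lemma trig_conv_cmult: "trig_conv M V P G \<Longrightarrow> trig_conv M V P (\<lambda>x. c * G x)"
proof -
  assume G: "trig_conv M V P G"
  then obtain B where B: "\<And>x. \<bar>G x\<bar> \<le> B" by (auto simp: trig_conv_def)
  have "\<bar>c * G x\<bar> \<le> \<bar>c\<bar> * B" for x using B by (simp add: abs_mult mult_left_mono)
  moreover have "(c * g) *\<^sub>R z = c *\<^sub>R (g *\<^sub>R z)" for g and z :: complex by simp
  ultimately show ?thesis
    using G unfolding trig_conv_def by (auto simp only: integral_scaleR_right intro!: tendsto_scaleR exI[of _ "\<bar>c\<bar> * B"] borel_measurable_times borel_measurable_const)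
qed

lemma trig_conv_add: "trig_conv M V P G \<Longrightarrow> trig_conv M V P H \<Longrightarrow> trig_conv M V P (\<lambda>x. G x + H x)"
proof -
  assume G: "trig_conv M V P G" and H: "trig_conv M V P H"
  then obtain B C where B: "\<And>x. \<bar>G x\<bar> \<le> B" "\<And>x. \<bar>H x\<bar> \<le> C" by (auto simp: trig_conv_def)
  have BC: "\<bar>G x + H x\<bar> \<le> B + C" for x using B(1)[of x] B(2)[of x] by linarith
  have [measurable]: "G \<in> borel_measurable borel" "H \<in> borel_measurable borel" using G H by (auto simp: trig_conv_def)
  have i: "integrable M (\<lambda>\<omega>. G (V n \<omega>) *\<^sub>R iexp (u \<bullet> V n \<omega>))" "integrable M (\<lambda>\<omega>. H (V n \<omega>) *\<^sub>R iexp (u \<bullet> V n \<omega>))"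
     "integrable P (\<lambda>x. G x *\<^sub>R iexp (u \<bullet> x))" "integrable P (\<lambda>x. H x *\<^sub>R iexp (u \<bullet> x))" for n u
    using B by (intro M.integrable_const_bound[where B=B] P.integrable_const_bound[where B=B]
       M.integrable_const_bound[where B=C] P.integrable_const_bound[where B=C]; simp)+
  have "(\<lambda>n. CLINT \<omega>|M. (G (V n \<omega>) + H (V n \<omega>)) *\<^sub>R iexp (u \<bullet> V n \<omega>)) \<longlonglongrightarrow> (CLINT x|P. (G x + H x) *\<^sub>R iexp (u \<bullet> x))" for u
    unfolding scaleR_add_left Bochner_Integration.integral_add[OF i(1,2)] Bochner_Integration.integral_add[OF i(3,4)]
    using G H by (intro tendsto_add) (auto simp: trig_conv_def)
  with BC show ?thesis by (auto simp: trig_conv_def)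
qed

text \<open>The retraction onto the cube with half side \<open>R\<close>; it makes polynomials bounded.\<close>

definition clip :: "real \<Rightarrow> real^'r \<Rightarrow> real^'r" where
  "clip R x = (\<chi> j. max (-R) (min R (x $ j)))"

lemma trig_conv_polynomial_clip:
  assumes p: "real_polynomial_function p" and G: "trig_conv M V P G"
  shows "trig_conv M V P (\<lambda>x. G x * p (clip R x))"
  using p G
proof (induction p arbitrary: G)
  case (linear f)
  have coord: "trig_conv M V P (\<lambda>x. f (axis j 1) * (G x * clip R x $ j))" for j
  proof (rule trig_conv_cmult)
    have "trig_conv M V P (\<lambda>x. G x * max (-R) (min R (x $ j)))"
      by (rule trig_conv_mult_coordinate[OF linear.prems, where C="\<bar>R\<bar>"]) (auto intro!: continuous_intros)
    then show "trig_conv M V P (\<lambda>x. G x * clip R x $ j)" by (simp add: clip_def)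
  qed
  have f: "f y = (\<Sum>j\<in>UNIV. f (axis j 1) * y $ j)" for y :: "real^'r"
  proof -
    interpret f: bounded_linear f by fact
    have "y = (\<Sum>j\<in>UNIV. y $ j *\<^sub>R axis j 1)"
      by (simp add: vec_eq_iff axis_def if_distrib[where f="\<lambda>x. _ * x"] sum.If_cases)
    then have "f y = f (\<Sum>j\<in>UNIV. y $ j *\<^sub>R axis j 1)" by simp
    also have "\<dots> = (\<Sum>j\<in>UNIV. f (axis j 1) * y $ j)" by (simp add: f.sum f.scaleR mult.commute)
    finally show ?thesis .
  qed
  have s: "trig_conv M V P (\<lambda>x. \<Sum>j\<in>J. f (axis j 1) * (G x * clip R x $ j))" if "finite J" for J
    using that
  proof induction
    case empty
    show ?case using trig_conv_cmult[OF trig_conv_one, of 0] by simp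
  next
    case (insert j J)
    then show ?case using trig_conv_add[OF coord[of j] insert.IH] by simp
  qed
  show ?case
    using s[of UNIV] by (subst f) (simp add: sum_distrib_left mult_ac)
next
  case (const c)
  then show ?case using trig_conv_cmult[of G c] by (simp add: mult.commute)
next
  case (add f g)
  show ?case using trig_conv_add[OF add.IH(1)[OF add.prems] add.IH(2)[OF add.prems]] by (simp add: algebra_simps)
next
  case (mult f g)
  show ?case using mult.IH(2)[OF mult.IH(1)[OF mult.prems]] by (simp add: algebra_simps)
qed

text \<open>Bump functions and clipped polynomials are products of functions of single coordinates, hence lie
in the class \<open>trig_conv\<close>. A bump gives tightness, and on the cube where the bump lives a bounded
continuous function is uniformly close to a polynomial, by Stone and Weierstrass.\<close>

theorem conv_in_distr: "conv_in_distr M V P"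
  unfolding conv_in_distr_def
proof (intro allI impI)
  fix g :: "real^'r \<Rightarrow> real" assume g: "continuous_on UNIV g" "bounded (range g)"
  have [measurable]: "g \<in> borel_measurable borel" using g(1) by (rule borel_measurable_continuous_onI)
  obtain C where C: "\<And>x. \<bar>g x\<bar> \<le> C" using g(2) by (auto simp: bounded_iff)
  have C0: "0 \<le> C" using C abs_ge_zero order_trans by blast
  define pr where "pr n A = M.prob {\<omega> \<in> space M. V n \<omega> \<in> A}" for n A
  define bump :: "real \<Rightarrow> real^'r \<Rightarrow> real" where "bump R x = (\<Prod>j\<in>UNIV. max 0 (min 1 (R + 1 - \<bar>x $ j\<bar>)))" for R x
  let ?K = "\<lambda>R. {x :: real^'r. \<forall>j. \<bar>x $ j\<bar> \<le> R}"
  have bump01: "0 \<le> bump R x" "bump R x \<le> 1" for R and x :: "real^'r"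
    unfolding bump_def by (auto intro!: prod_nonneg prod_le_1)
  have bump_out: "bump R x \<le> indicator (?K (R + 1)) x" for R x
  proof (cases "x \<in> ?K (R + 1)")
    case False
    then obtain j where "\<bar>x $ j\<bar> > R + 1" by (auto simp: not_le)
    then have "max 0 (min 1 (R + 1 - \<bar>x $ j\<bar>)) = 0" by simp
    then have "bump R x = 0" unfolding bump_def by (intro prod_zero) auto
    then show ?thesis by (simp only: indicator_pos_le)
  next
    case True
    then have "indicator (?K (R + 1)) x = (1 :: real)" by simp
    then show ?thesis using bump01(2)[of R x] by (simp only:)
  qed
  have bump_in: "bump R x = 1" if "x \<in> ?K R" for R and x :: "real^'r"
    unfolding bump_def using that by (intro prod.neutral) (auto simp: min_def max_def)
  have tb: "trig_conv M V P (bump R)" for R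
  proof -
    have "trig_conv M V P (\<lambda>x. \<Prod>j\<in>J. max 0 (min 1 (R + 1 - \<bar>x $ j\<bar>)))" if "finite J" for J
      using that
    proof induction
      case empty then show ?case using trig_conv_one by simp
    next
      case (insert j J)
      have "trig_conv M V P (\<lambda>x. (\<Prod>j\<in>J. max 0 (min 1 (R + 1 - \<bar>x $ j\<bar>))) * max 0 (min 1 (R + 1 - \<bar>x $ j\<bar>)))"
        by (rule trig_conv_mult_coordinate[OF insert.IH, where C=1]) (auto intro!: continuous_intros)
      then show ?case using insert by (simp add: mult.commute)
    qed
    then show ?thesis unfolding bump_def[abs_def] by simp
  qed
  have lim_of: "(\<lambda>n. LINT \<omega>|M. G (V n \<omega>)) \<longlonglongrightarrow> (LINT x|P. G x)" if "trig_conv M V P G" for G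
  proof -
    have "(\<lambda>n. Re (CLINT \<omega>|M. G (V n \<omega>) *\<^sub>R iexp (0 \<bullet> V n \<omega>))) \<longlonglongrightarrow> Re (CLINT x|P. G x *\<^sub>R iexp (0 \<bullet> x))"
      using that unfolding trig_conv_def by (intro tendsto_Re) blast
    then show ?thesis by (simp add: scaleR_conv_of_real)
  qed
  show "(\<lambda>n. LINT \<omega>|M. g (V n \<omega>)) \<longlonglongrightarrow> (LINT x|P. g x)"
  proof (rule LIMSEQ_I)
    fix r :: real assume r: "0 < r"
    \<comment> \<open>both approximation errors are at most \<open>e + (2C + 1)e\<close>, and a third \<open>e\<close> comes from the limit\<close>
    define e where "e = min 1 (r / (8 * C + 8))"
    have "e * (8 * C + 8) \<le> (r / (8 * C + 8)) * (8 * C + 8)"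
      using C0 by (intro mult_right_mono) (auto simp: e_def)
    then have e: "0 < e" "e \<le> 1" "e * (8 * C + 8) \<le> r" using r C0 by (auto simp: e_def)
    \<comment> \<open>\<open>P\<close> puts mass at least \<open>1 - e\<close> on some cube, hence so do the laws of \<open>V\<^sub>n\<close> eventually\<close>
    have bm[measurable]: "bump R \<in> borel_measurable borel" for R
      using tb[of R] by (simp add: trig_conv_def)
    have "(\<lambda>n. LINT x|P. bump (real n) x) \<longlonglongrightarrow> (LINT x|P. 1)"
    proof (rule integral_dominated_convergence[where w="\<lambda>_. 1"])
      show "AE x in P. (\<lambda>n. bump (real n) x) \<longlonglongrightarrow> 1"
      proof (rule AE_I2)
        fix x :: "real^'r"
        obtain N :: nat where N: "norm x \<le> real N" using real_arch_simple by blast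
        have "bump (real n) x = 1" if "n \<ge> N" for n
          by (rule bump_in) (use N that in \<open>auto intro!: order_trans[OF component_le_norm_cart]\<close>)
        then show "(\<lambda>n. bump (real n) x) \<longlonglongrightarrow> 1"
          by (intro tendsto_eventually eventually_sequentiallyI[of N])
      qed
    qed (use bump01 in auto)
    then have "eventually (\<lambda>n. (LINT x|P. bump (real n) x) > 1 - e) sequentially"
      using e by (intro order_tendstoD) (auto simp: P.prob_space)
    then obtain R :: nat where R: "(LINT x|P. bump (real R) x) > 1 - e"
      by (auto simp: eventually_sequentially)
    define S where "S = real R + 1"
    have S: "0 \<le> S" by (simp add: S_def)
    obtain p where p: "real_polynomial_function p" and pg: "\<And>x. x \<in> ?K S \<Longrightarrow> \<bar>g x - p x\<bar> < e"
    proof (rule Stone_Weierstrass_real_polynomial_function[of "?K S" g e])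
      have "?K S = cbox (\<chi> j. -S) (\<chi> j. S)" by (auto simp: mem_box_cart abs_le_iff minus_le_iff)
      then show "compact (?K S)" by simp
    qed (use g e in \<open>auto intro: continuous_on_subset\<close>)
    let ?h = "\<lambda>x. p (clip S x)"
    have clipK: "clip S x \<in> ?K S" for x using S by (auto simp: clip_def)
    have clip_id: "clip S x = x" if "x \<in> ?K S" for x
    proof -
      have "max (-S) (min S (x $ i)) = x $ i" for i
      proof -
        have "\<bar>x $ i\<bar> \<le> S" using that by blast
        then show ?thesis by linarith
      qed
      then show ?thesis by (simp add: clip_def vec_eq_iff)
    qed
    have hB: "\<bar>?h x\<bar> \<le> C + e" for x using pg[OF clipK[of x]] C[of "clip S x"] by linarith
    have th: "trig_conv M V P ?h" using trig_conv_polynomial_clip[OF p trig_conv_one, of S] by simp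
    then have [measurable]: "?h \<in> borel_measurable borel" by (simp add: trig_conv_def)
    have err: "\<bar>g x - ?h x\<bar> \<le> e + (2 * C + e) * (1 - bump (real R) x)" for x
    proof (cases "x \<in> ?K S")
      case True
      then have "\<bar>g x - ?h x\<bar> < e" using pg[OF True] clip_id[OF True] by simp
      moreover have "0 \<le> (2 * C + e) * (1 - bump (real R) x)" using C0 e bump01 by (intro mult_nonneg_nonneg) auto
      ultimately show ?thesis by linarith
    next
      case False
      then have "indicator (?K (real R + 1)) x = (0 :: real)" by (simp add: S_def)
      then have "bump (real R) x = 0" using bump_out[of "real R" x] bump01[of "real R" x] by linarith
      then show ?thesis using C[of x] hB[of x] e by simp
    qed
    have errM: "\<bar>(LINT \<omega>|M. g (V n \<omega>)) - (LINT \<omega>|M. ?h (V n \<omega>))\<bar> \<le> e + (2 * C + e) * (1 - (LINT \<omega>|M. bump (real R) (V n \<omega>)))" for n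
    proof -
      have i: "integrable M (\<lambda>\<omega>. g (V n \<omega>))" "integrable M (\<lambda>\<omega>. ?h (V n \<omega>))" "integrable M (\<lambda>\<omega>. bump (real R) (V n \<omega>))"
        by (rule M.integrable_const_bound[where B="C"], use C in auto)
          (rule M.integrable_const_bound[where B="C + e"], use hB in auto,
           rule M.integrable_const_bound[where B=1], use bump01 in auto)
      have "\<bar>LINT \<omega>|M. g (V n \<omega>) - ?h (V n \<omega>)\<bar> \<le> (LINT \<omega>|M. \<bar>g (V n \<omega>) - ?h (V n \<omega>)\<bar>)"
        by (rule integral_abs_bound)
      also have "\<dots> \<le> (LINT \<omega>|M. e + (2 * C + e) * (1 - bump (real R) (V n \<omega>)))"
        using i err by (intro integral_mono) auto
      also have "\<dots> = e + (2 * C + e) * (1 - (LINT \<omega>|M. bump (real R) (V n \<omega>)))"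
        using i by (simp add: M.prob_space)
      finally show ?thesis using i by simp
    qed
    have errP: "\<bar>(LINT x|P. g x) - (LINT x|P. ?h x)\<bar> \<le> e + (2 * C + e) * (1 - (LINT x|P. bump (real R) x))"
    proof -
      have i: "integrable P g" "integrable P ?h" "integrable P (bump (real R))"
        by (rule P.integrable_const_bound[where B="C"], use C in auto)
          (rule P.integrable_const_bound[where B="C + e"], use hB in auto,
           rule P.integrable_const_bound[where B=1], use bump01 in auto)
      have "\<bar>LINT x|P. g x - ?h x\<bar> \<le> (LINT x|P. \<bar>g x - ?h x\<bar>)"
        by (rule integral_abs_bound)
      also have "\<dots> \<le> (LINT x|P. e + (2 * C + e) * (1 - bump (real R) x))"
        using i err by (intro integral_mono) auto
      also have "\<dots> = e + (2 * C + e) * (1 - (LINT x|P. bump (real R) x))"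
        using i by (simp add: P.prob_space)
      finally show ?thesis using i by simp
    qed
    have ev1: "eventually (\<lambda>n. (LINT \<omega>|M. bump (real R) (V n \<omega>)) > 1 - e) sequentially"
      using lim_of[OF tb[of "real R"]] R by (rule order_tendstoD)
    have ev2: "eventually (\<lambda>n. \<bar>(LINT \<omega>|M. ?h (V n \<omega>)) - (LINT x|P. ?h x)\<bar> < e) sequentially"
      using tendstoD[OF lim_of[OF th] e(1)] by (simp add: dist_real_def)
    show "\<exists>no. \<forall>n\<ge>no. norm ((LINT \<omega>|M. g (V n \<omega>)) - (LINT x|P. g x)) < r"
    proof -
      have "eventually (\<lambda>n. norm ((LINT \<omega>|M. g (V n \<omega>)) - (LINT x|P. g x)) < r) sequentially"
        using ev1 ev2
      proof eventually_elim
        case (elim n)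
        have m: "(2 * C + e) * y \<le> (2 * C + 1) * e" if "y < e" for y
          using mult_left_mono[of y e "2 * C + e"] mult_right_mono[of "2 * C + e" "2 * C + 1" e] that e(1,2) C0 by linarith
        have "(2 * C + e) * (1 - (LINT \<omega>|M. bump (real R) (V n \<omega>))) \<le> (2 * C + 1) * e"
          "(2 * C + e) * (1 - (LINT x|P. bump (real R) x)) \<le> (2 * C + 1) * e"
          using elim(1) R by (intro m; linarith)+
        moreover have "2 * (e + (2 * C + 1) * e) + e < r"
          using e(3) mult_nonneg_nonneg[OF C0 less_imp_le[OF e(1)]] e(1) by (simp add: algebra_simps)
        moreover have tri: "\<bar>a - b\<bar> < r"
          if "\<bar>a - c\<bar> \<le> e + y" "\<bar>b - d\<bar> \<le> e + z" "\<bar>c - d\<bar> < e" "y \<le> k" "z \<le> k" "2 * (e + k) + e < r" for a b c d y z k :: real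
          using that by argo
        ultimately show ?case using errM[of n] errP elim(2) unfolding real_norm_def by (intro tri)
      qed
      then show ?thesis by (simp add: eventually_sequentially)
    qed
  qed
qed

end

section \<open>Powers of characteristic functions and normal laws\<close>

text \<open>The central limit theorem for sums of \<open>K n\<close> independent copies of \<open>s n * W\<close>, in terms of
characteristic functions only. The scale \<open>s\<close> and the number \<open>K\<close> are tied only through the limit
\<open>\<rho>\<close> of the total variance, which covers block sums that fill a part of a box.\<close>

lemma (in prob_space) char_power_limit:
  fixes W :: "'a \<Rightarrow> real" and s :: "nat \<Rightarrow> real" and K :: "nat \<Rightarrow> nat"
  assumes [measurable]: "W \<in> borel_measurable M" and W2: "integrable M (\<lambda>\<omega>. (W \<omega>)\<^sup>2)"
    and mean: "(LINT \<omega>|M. W \<omega>) = 0" and s: "s \<longlonglongrightarrow> 0" and K: "(\<lambda>n. real (K n) * (s n)\<^sup>2) \<longlonglongrightarrow> \<rho>"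
  shows "(\<lambda>n. (CLINT \<omega>|M. iexp (s n * W \<omega>)) ^ K n) \<longlonglongrightarrow> of_real (exp (- \<rho> * (LINT \<omega>|M. (W \<omega>)\<^sup>2) / 2))"
proof -
  have W1: "integrable M W" by (rule square_integrable_imp_integrable[OF _ W2]) simp
  define \<sigma> where "\<sigma> = (LINT \<omega>|M. (W \<omega>)\<^sup>2)"
  have \<sigma>0: "0 \<le> \<sigma>" by (simp add: \<sigma>_def)
  define \<phi> where "\<phi> t = (CLINT \<omega>|M. iexp (t * W \<omega>))" for t
  define d where "d t = (LINT \<omega>|M. min (6 * (W \<omega>)\<^sup>2) (\<bar>t\<bar> * \<bar>W \<omega>\<bar> ^ 3))" for t
  have char: "char (distr M borel W) t = \<phi> t" for t
    unfolding char_def \<phi>_def by (subst integral_distr) auto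
  have approx: "cmod (\<phi> t - (1 - t\<^sup>2 * \<sigma> / 2)) \<le> (t\<^sup>2 / 6) * d t" for t
    using char_approx3'[OF _ W1 W2 mean _ refl, of \<sigma> t] by (simp add: char d_def mean \<sigma>_def)
  have norm\<phi>: "cmod (\<phi> t) \<le> 1" for t
  proof -
    have "cmod (\<phi> t) \<le> (LINT \<omega>|M. cmod (iexp (t * W \<omega>)))" unfolding \<phi>_def by (rule integral_norm_bound)
    then show ?thesis by (simp add: prob_space)
  qed
  have dlim: "(\<lambda>n. d (s n)) \<longlonglongrightarrow> 0"
  proof -
    have "(\<lambda>n. d (s n)) \<longlonglongrightarrow> (LINT \<omega>|M. 0)" unfolding d_def
    proof (rule integral_dominated_convergence[where w="\<lambda>\<omega>. 6 * (W \<omega>)\<^sup>2"])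
      show "AE \<omega> in M. (\<lambda>n. min (6 * (W \<omega>)\<^sup>2) (\<bar>s n\<bar> * \<bar>W \<omega>\<bar> ^ 3)) \<longlonglongrightarrow> 0"
      proof (rule AE_I2)
        fix \<omega>
        have "(\<lambda>n. min (6 * (W \<omega>)\<^sup>2) (\<bar>s n\<bar> * \<bar>W \<omega>\<bar> ^ 3)) \<longlonglongrightarrow> min (6 * (W \<omega>)\<^sup>2) (\<bar>0\<bar> * \<bar>W \<omega>\<bar> ^ 3)"
          by (intro tendsto_intros s)
        then show "(\<lambda>n. min (6 * (W \<omega>)\<^sup>2) (\<bar>s n\<bar> * \<bar>W \<omega>\<bar> ^ 3)) \<longlonglongrightarrow> 0" by simp
      qed
    qed (use W2 in auto)
    then show ?thesis by simp
  qed
  have expb: "\<bar>exp (- x) - (1 - x)\<bar> \<le> x\<^sup>2" if "0 \<le> x" for x :: real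
  proof (cases "x \<le> 1")
    case True
    have "exp (- x) \<ge> 1 - x" using exp_ge_add_one_self[of "- x"] by simp
    moreover have "exp (- x) \<le> 1 - x + x\<^sup>2"
    proof -
      have "(1 - x + x\<^sup>2) * (1 + x) = 1 + x ^ 3" by (simp add: algebra_simps power2_eq_square power3_eq_cube)
      moreover have "(1 - x + x\<^sup>2) * (1 + x) \<le> (1 - x + x\<^sup>2) * exp x"
        using exp_ge_add_one_self[of x] True by (intro mult_left_mono) auto
      ultimately have "1 \<le> (1 - x + x\<^sup>2) * exp x" using that by (smt (verit) zero_le_power)
      then show ?thesis by (simp add: exp_minus field_simps)
    qed
    ultimately show ?thesis by simp
  next
    case False
    have "exp (- x) \<ge> 1 - x" using exp_ge_add_one_self[of "- x"] by simp
    moreover have "exp (- x) \<le> 1" using that by simp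
    moreover have "x \<le> x\<^sup>2" using False by (simp add: power2_eq_square)
    ultimately show ?thesis by linarith
  qed
  have bound: "cmod (\<phi> (s n) ^ K n - of_real (exp (- ((s n)\<^sup>2 * \<sigma> / 2))) ^ K n)
     \<le> (real (K n) * (s n)\<^sup>2) * (d (s n) / 6 + (s n)\<^sup>2 * \<sigma>\<^sup>2 / 4)" for n
  proof -
    let ?x = "(s n)\<^sup>2 * \<sigma> / 2"
    have x0: "0 \<le> ?x" using \<sigma>0 by simp
    have "cmod (\<phi> (s n) ^ K n - of_real (exp (- ?x)) ^ K n) \<le> K n * cmod (\<phi> (s n) - of_real (exp (- ?x)))"
      using x0 by (intro norm_power_diff norm\<phi>) (simp only: norm_of_real abs_exp_cancel exp_le_one_iff neg_le_0_iff_le)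
    also have "cmod (\<phi> (s n) - of_real (exp (- ?x))) \<le> cmod (\<phi> (s n) - (1 - (s n)\<^sup>2 * \<sigma> / 2)) + cmod (of_real (exp (- ?x) - (1 - ?x)))"
    proof -
      have "\<phi> (s n) - of_real (exp (- ?x)) = (\<phi> (s n) - (1 - (s n)\<^sup>2 * \<sigma> / 2)) - of_real (exp (- ?x) - (1 - ?x))"
        by simp
      then show ?thesis by (simp only: norm_triangle_ineq4)
    qed
    also have "\<dots> \<le> (s n)\<^sup>2 / 6 * d (s n) + ?x\<^sup>2"
      unfolding norm_of_real by (intro add_mono approx expb x0)
    also have "\<dots> = (s n)\<^sup>2 * (d (s n) / 6 + (s n)\<^sup>2 * \<sigma>\<^sup>2 / 4)"
      by (simp add: algebra_simps power2_eq_square)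
    finally show ?thesis by (simp add: mult_left_mono mult.assoc)
  qed
  have "(\<lambda>n. \<phi> (s n) ^ K n - of_real (exp (- ((s n)\<^sup>2 * \<sigma> / 2))) ^ K n) \<longlonglongrightarrow> 0"
  proof (rule Lim_null_comparison[OF always_eventually])
    have "(\<lambda>n. (real (K n) * (s n)\<^sup>2) * (d (s n) / 6 + (s n)\<^sup>2 * \<sigma>\<^sup>2 / 4)) \<longlonglongrightarrow> \<rho> * (0 / 6 + 0\<^sup>2 * \<sigma>\<^sup>2 / 4)"
      by (intro tendsto_intros K dlim s) auto
    then show "(\<lambda>n. (real (K n) * (s n)\<^sup>2) * (d (s n) / 6 + (s n)\<^sup>2 * \<sigma>\<^sup>2 / 4)) \<longlonglongrightarrow> 0" by simp
  qed (use bound in blast)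
  moreover have "(\<lambda>n. complex_of_real (exp (- ((s n)\<^sup>2 * \<sigma> / 2))) ^ K n) \<longlonglongrightarrow> of_real (exp (- \<rho> * \<sigma> / 2))"
  proof -
    have "(\<lambda>n. exp (- (real (K n) * (s n)\<^sup>2) * \<sigma> / 2)) \<longlonglongrightarrow> exp (- \<rho> * \<sigma> / 2)"
      by (intro tendsto_intros K) auto
    moreover have "exp (- (real (K n) * (s n)\<^sup>2) * \<sigma> / 2) = exp (- ((s n)\<^sup>2 * \<sigma> / 2)) ^ K n" for n
      by (simp add: mult_ac flip: exp_of_nat_mult)
    ultimately show ?thesis by (simp only: flip: of_real_power) (rule tendsto_of_real, simp)
  qed
  ultimately have "(\<lambda>n. (\<phi> (s n) ^ K n - of_real (exp (- ((s n)\<^sup>2 * \<sigma> / 2))) ^ K n) + of_real (exp (- ((s n)\<^sup>2 * \<sigma> / 2))) ^ K n)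
     \<longlonglongrightarrow> 0 + of_real (exp (- \<rho> * \<sigma> / 2))"
    by (rule tendsto_add)
  then show ?thesis by (simp add: \<phi>_def \<sigma>_def)
qed

text \<open>Completing the square in one coordinate after the other. The set \<open>I\<close> contains the rows that have
not been eliminated yet.\<close>

lemma psd_decomposition:
  fixes C :: "real^'r^'r"
  assumes "psd C" "finite I" "\<And>p q. p \<notin> I \<Longrightarrow> C $ p $ q = 0"
  shows "\<exists>v :: 'r \<Rightarrow> real^'r. \<forall>x. x \<bullet> (C *v x) = (\<Sum>i\<in>I. (x \<bullet> v i)\<^sup>2)"
  using assms(2,1,3)
proof (induction I arbitrary: C rule: finite_induct)
  case empty
  then have "C = 0" by (simp add: vec_eq_iff)
  then show ?case by simp
next
  case (insert i I)
  have sym: "C $ p $ q = C $ q $ p" for p q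
  proof -
    have "transpose C $ p $ q = C $ p $ q" using insert.prems(1) by (simp add: psd_def)
    then show ?thesis by (simp add: transpose_def)
  qed
  have pos: "0 \<le> x \<bullet> (C *v x)" for x using insert.prems(1) by (simp add: psd_def)
  define w where "w = C *v axis i 1"
  have w: "w $ p = C $ p $ i" for p
    by (simp add: w_def matrix_vector_mult_def axis_def if_distrib[where f="\<lambda>x. _ * x"] sum.If_cases cong: if_cong)
  have dot_sym: "x \<bullet> (C *v y) = y \<bullet> (C *v x)" for x y
  proof -
    have "transpose C = C" using insert.prems(1) by (simp add: psd_def)
    then show ?thesis by (metis dot_lmul_matrix inner_commute transpose_matrix_vector)
  qed
  have shift: "(x - a *\<^sub>R axis i 1) \<bullet> (C *v (x - a *\<^sub>R axis i 1)) = x \<bullet> (C *v x) - 2 * a * (x \<bullet> w) + a\<^sup>2 * C $ i $ i" for x a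
    using dot_sym[of "axis i 1" x]
    by (simp add: matrix_vector_mult_diff_distrib scaleR_matrix_vector_assoc[symmetric] matrix_vector_mult_scaleR
       inner_diff_left inner_diff_right w_def[symmetric] inner_axis' w power2_eq_square algebra_simps)
  show ?case
  proof (cases "C $ i $ i = 0")
    case True
    have xw: "x \<bullet> w = 0" for x
    proof (rule ccontr)
      assume n: "x \<bullet> w \<noteq> 0"
      have "0 \<le> x \<bullet> (C *v x) - 2 * a * (x \<bullet> w)" for a
        using pos[of "x - a *\<^sub>R axis i 1"] by (simp add: shift True)
      from this[of "(x \<bullet> (C *v x) + 1) / (2 * (x \<bullet> w))"] n show False by simp
    qed
    then have "w = 0" by (metis inner_eq_zero_iff)
    then have "C $ p $ q = 0" if "p \<notin> I" for p q
      using that insert.prems(2)[of p q] w[of q] sym[of p q] by (cases "p = i") auto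
    from insert.IH[OF insert.prems(1) this] obtain v where v: "\<forall>x. x \<bullet> (C *v x) = (\<Sum>i\<in>I. (x \<bullet> v i)\<^sup>2)"
      by blast
    have "(\<Sum>k\<in>I. (x \<bullet> (v(i := 0)) k)\<^sup>2) = (\<Sum>k\<in>I. (x \<bullet> v k)\<^sup>2)" for x
      using insert.hyps by (intro sum.cong) auto
    with v show ?thesis using insert.hyps by (intro exI[of _ "v(i := 0)"]) simp
  next
    case False
    have ei: "axis i 1 \<bullet> (C *v axis i 1) = C $ i $ i"
      by (simp add: w_def[symmetric] inner_axis' w)
    have Ci: "0 < C $ i $ i" using False pos[of "axis i 1"] ei by simp
    \<comment> \<open>the Schur complement of the pivot\<close>
    define D where "D = (\<chi> p q. C $ p $ q - w $ p * w $ q / C $ i $ i)"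
    have Dx: "D *v x = C *v x - ((x \<bullet> w) / C $ i $ i) *\<^sub>R w" for x
    proof -
      have "(\<Sum>j\<in>UNIV. (C $ p $ j - w $ p * w $ j / C $ i $ i) * x $ j)
          = (\<Sum>j\<in>UNIV. C $ p $ j * x $ j - (w $ p / C $ i $ i) * (x $ j * w $ j))" for p
        by (intro sum.cong) (auto simp: algebra_simps)
      then show ?thesis
        by (simp add: D_def vec_eq_iff matrix_vector_mult_def sum_subtractf inner_vec_def sum_distrib_left sum_divide_distrib mult_ac)
    qed
    have D: "x \<bullet> (D *v x) = x \<bullet> (C *v x) - (x \<bullet> w)\<^sup>2 / C $ i $ i" for x
      by (simp add: Dx inner_diff_right power2_eq_square)
    have "0 \<le> x \<bullet> (D *v x)" for x
      using pos[of "x - ((x \<bullet> w) / C $ i $ i) *\<^sub>R axis i 1"] Ci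
      unfolding shift D by (simp add: power2_eq_square field_simps)
    then have "psd D" by (auto simp: psd_def D_def transpose_def vec_eq_iff sym mult.commute)
    moreover have "D $ p $ q = 0" if "p \<notin> I" for p q
    proof (cases "p = i")
      case True then show ?thesis using Ci by (simp add: D_def w sym[of q i])
    next
      case False then show ?thesis using that insert.prems(2) by (simp add: D_def w)
    qed
    ultimately obtain v where v: "\<forall>x. x \<bullet> (D *v x) = (\<Sum>i\<in>I. (x \<bullet> v i)\<^sup>2)"
      using insert.IH[of D] by blast
    let ?v = "v(i := (1 / sqrt (C $ i $ i)) *\<^sub>R w)"
    have "(\<Sum>k\<in>I. (x \<bullet> ?v k)\<^sup>2) = (\<Sum>k\<in>I. (x \<bullet> v k)\<^sup>2)" for x
      using insert.hyps by (intro sum.cong) auto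
    then have "x \<bullet> (C *v x) = (\<Sum>k\<in>insert i I. (x \<bullet> ?v k)\<^sup>2)" for x
      using insert.hyps v D[of x] Ci by (simp add: power_divide)
    then show ?thesis by blast
  qed
qed

text \<open>The law of \<open>\<Sum>\<^sub>i \<xi>\<^sub>i v\<^sub>i\<close> with independent standard normal \<open>\<xi>\<^sub>i\<close>.\<close>

lemma normal_law_exists:
  fixes C :: "real^'r^'r"
  assumes "psd C"
  shows "\<exists>P. normal_law 0 C P"
proof -
  obtain v :: "'r \<Rightarrow> real^'r" where v: "\<And>x. x \<bullet> (C *v x) = (\<Sum>i\<in>UNIV. (x \<bullet> v i)\<^sup>2)"
    using psd_decomposition[OF assms, of UNIV] by auto
  interpret N: real_distribution std_normal_distribution by (rule real_dist_normal_dist)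
  interpret Pi: product_prob_space "\<lambda>_::'r. std_normal_distribution" UNIV
    by standard
  define Pm where "Pm = (\<Pi>\<^sub>M i\<in>(UNIV::'r set). std_normal_distribution)"
  interpret Pm: prob_space Pm unfolding Pm_def by (intro Pi.prob_space_axioms)
  define L where "L x = (\<Sum>i\<in>UNIV. x i *\<^sub>R v i)" for x :: "'r \<Rightarrow> real"
  have L[measurable]: "L \<in> borel_measurable Pm"
    unfolding L_def[abs_def] Pm_def by measurable
  have "(CLINT x|distr Pm borel L. iexp (u \<bullet> x)) = exp (\<i> * of_real (0 \<bullet> u) - of_real (u \<bullet> (C *v u)) / 2)" for u
  proof -
    have "(CLINT x|distr Pm borel L. iexp (u \<bullet> x)) = (CLINT x|Pm. iexp (u \<bullet> L x))"
      by (intro integral_distr) auto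
    also have "\<dots> = (CLINT x|Pm. (\<Prod>i\<in>UNIV. iexp ((u \<bullet> v i) * x i)))"
      by (simp add: L_def inner_sum_right mult_ac sum_distrib_left flip: exp_sum)
    also have "\<dots> = (\<Prod>i\<in>UNIV. CLINT y|std_normal_distribution. iexp ((u \<bullet> v i) * y))"
      unfolding Pm_def by (intro Pi.product_integral_prod N.integrable_iexp) auto
    also have "\<dots> = (\<Prod>i\<in>UNIV. char std_normal_distribution (u \<bullet> v i))"
      by (simp add: char_def)
    also have "\<dots> = of_real (exp (- (\<Sum>i\<in>UNIV. (u \<bullet> v i)\<^sup>2) / 2))"
      by (simp add: char_std_normal_distribution exp_sum[symmetric] sum_negf sum_divide_distrib flip: of_real_prod)
    finally show ?thesis by (simp add: v[symmetric] exp_of_real[symmetric])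
  qed
  then have "normal_law 0 C (distr Pm borel L)"
    unfolding normal_law_def by (auto intro: Pm.prob_space_distr)
  then show ?thesis ..
qed

section \<open>A gliding hump\<close>

text \<open>If the integrals \<open>\<integral> h n\<close> kept away from \<open>2\<pi>i\<int>\<close>, their mass would have to move through
disjoint pieces of the space. Let \<open>B k\<close> be the set of points of \<open>K k\<close> at which \<open>h n\<close> is bounded by
1 from the index \<open>k\<close> on. On a fixed \<open>B k\<close> dominated convergence applies, and the complement of a
large \<open>B k\<close> carries little of a fixed \<open>h n\<close>. One can therefore choose indices \<open>n j\<close> and \<open>k j\<close> such
that \<open>h (n (j+1))\<close> is essentially concentrated on the ring \<open>D j = B (k (j+1)) - B (k j)\<close>. If \<open>A\<close> is
the union of every second ring, then \<open>exp (\<integral>\<^sub>A h n)\<close> tends to 1 along the other half of the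
subsequence; as the limit exists, it is 1 along the whole sequence. Along the first half the
complement of \<open>A\<close> contributes nothing, so that \<open>exp (\<integral> h n)\<close> tends to 1 there, and again its limit
exists. Exponentials are used because only characteristic functions are known to converge.\<close>

lemma gliding_hump:
  fixes h :: "nat \<Rightarrow> 'a \<Rightarrow> complex" and K :: "nat \<Rightarrow> 'a set"
  assumes int: "\<And>n. integrable N (h n)" and ae: "AE p in N. (\<lambda>n. h n p) \<longlonglongrightarrow> 0"
    and K: "incseq K" "\<And>k. K k \<in> sets N" "\<And>k. emeasure N (K k) < \<infinity>" "(\<Union>k. K k) = space N"
    and conv: "\<And>A. A \<in> sets N \<Longrightarrow> convergent (\<lambda>n. exp (CLINT p|N. indicator A p *\<^sub>R h n p))"
  shows "(\<lambda>n. exp (CLINT p|N. h n p)) \<longlonglongrightarrow> 1"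
proof -
  have hm[measurable]: "h n \<in> borel_measurable N" for n using borel_measurable_integrable[OF int] .
  have Km[measurable]: "K k \<in> sets N" for k by (rule K)
  define B where "B k = {p \<in> space N. p \<in> K k \<and> (\<forall>n\<in>{k..}. cmod (h n p) \<le> 1)}" for k
  have Bm[measurable]: "B k \<in> sets N" for k unfolding B_def by measurable
  have Bmono: "B k \<subseteq> B l" if "k \<le> l" for k l
    using that K(1) by (auto simp: B_def incseq_def subset_eq)
  have Bev: "AE p in N. eventually (\<lambda>k. p \<in> B k) sequentially"
    using ae AE_space
  proof eventually_elim
    case (elim p)
    obtain k1 where k1: "p \<in> K k1" using elim K(4) by blast
    have "eventually (\<lambda>n. cmod (h n p) < 1) sequentially"
      using tendsto_norm[OF elim(1)] by (intro order_tendstoD) auto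
    then obtain k2 where k2: "\<And>n. n \<ge> k2 \<Longrightarrow> cmod (h n p) < 1" by (auto simp: eventually_sequentially)
    show ?case
    proof (rule eventually_sequentiallyI[of "max k1 k2"])
      fix k assume k: "max k1 k2 \<le> k"
      then have "p \<in> K k" using k1 K(1) by (auto simp: incseq_def subset_eq)
      then show "p \<in> B k" using k k2 elim(2) by (auto simp: B_def intro: less_imp_le)
    qed
  qed
  have hn: "integrable N (\<lambda>p. cmod (h n p))" for n using int by simp
  have ih: "integrable N (\<lambda>p. indicator A p * cmod (h n p))" if "A \<in> sets N" for A n
    using integrable_mult_indicator[OF that hn] by simp
  define a where "a n k = (LINT p|N. indicator (space N - B k) p * cmod (h n p))" for n k
  define b where "b k n = (LINT p|N. indicator (B k) p * cmod (h n p))" for n k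
  have alim: "a n \<longlonglongrightarrow> 0" for n
  proof -
    have "a n \<longlonglongrightarrow> (LINT p|N. 0)" unfolding a_def[abs_def]
    proof (rule integral_dominated_convergence[where w="\<lambda>p. cmod (h n p)"])
      show "AE p in N. (\<lambda>k. indicator (space N - B k) p * cmod (h n p)) \<longlonglongrightarrow> 0"
        using Bev
      proof eventually_elim
        case (elim p)
        then show ?case by (intro tendsto_eventually) (auto elim: eventually_mono)
      qed
    qed (use hn in \<open>auto simp: indicator_def\<close>)
    then show ?thesis by simp
  qed
  have blim: "b k \<longlonglongrightarrow> 0" for k
  proof -
    have "(\<lambda>n. b k (n + k)) \<longlonglongrightarrow> (LINT p|N. 0)" unfolding b_def[abs_def]
    proof (rule integral_dominated_convergence[where w="indicator (B k)"])
      have "emeasure N (B k) \<le> emeasure N (K k)" by (intro emeasure_mono) (auto simp: B_def)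
      then show "integrable N (indicator (B k) :: 'a \<Rightarrow> real)"
        using K(3)[of k] by (intro integrable_real_indicator) auto
      show "AE p in N. (\<lambda>n. indicator (B k) p * cmod (h (n + k) p)) \<longlonglongrightarrow> 0"
        using ae
      proof eventually_elim
        case (elim p)
        have "(\<lambda>n. indicator (B k) p * cmod (h (n + k) p)) \<longlonglongrightarrow> indicator (B k) p * cmod 0"
          by (intro tendsto_intros LIMSEQ_ignore_initial_segment elim)
        then show ?case by simp
      qed
      show "AE p in N. norm (indicator (B k) p * cmod (h (n + k) p)) \<le> indicator (B k) p" for n
        by (intro AE_I2) (auto simp: indicator_def B_def)
    qed auto
    then show ?thesis by (simp add: LIMSEQ_offset)
  qed
  let ?P = "\<lambda>j (x :: nat \<times> nat). a (fst x) (snd x) < 1 / Suc j"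
  let ?Q = "\<lambda>j (x :: nat \<times> nat) y. fst x < fst y \<and> snd x < snd y \<and> b (snd x) (fst y) < 1 / Suc j"
  have "\<exists>x. \<forall>j. ?P j (x j) \<and> ?Q j (x j) (x (Suc j))"
  proof (rule dependent_nat_choice)
    have ex: "\<exists>k>l. a n k < e" if "e > 0" for n l e
    proof -
      have "eventually (\<lambda>k. a n k < e) sequentially" by (rule order_tendstoD(2)[OF alim that])
      then obtain k0 where "\<And>k. k \<ge> k0 \<Longrightarrow> a n k < e" by (auto simp: eventually_sequentially)
      then show ?thesis by (intro exI[of _ "max k0 (Suc l)"]) auto
    qed
    show "\<exists>x. ?P 0 x" using ex[of 1 0 0] by auto
    fix x :: "nat \<times> nat" and j
    have "eventually (\<lambda>n. b (snd x) n < 1 / Suc j) sequentially" by (rule order_tendstoD(2)[OF blim]) simp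
    then obtain n0 where n0: "\<And>n. n \<ge> n0 \<Longrightarrow> b (snd x) n < 1 / Suc j" by (auto simp: eventually_sequentially)
    define n where "n = max n0 (Suc (fst x))"
    obtain k where "k > snd x" "a n k < 1 / Suc (Suc j)" using ex[of "1 / Suc (Suc j)" "snd x" n] by auto
    then show "\<exists>y. ?P (Suc j) y \<and> ?Q j x y"
      using n0[of n] by (intro exI[of _ "(n, k)"]) (auto simp: n_def)
  qed
  then obtain x where xP: "\<And>j. ?P j (x j)" and xQ: "\<And>j. ?Q j (x j) (x (Suc j))" by blast
  define n where "n j = fst (x j)" for j
  define k where "k j = snd (x j)" for j
  have an: "a (n j) (k j) < 1 / Suc j" for j using xP by (simp add: n_def k_def)
  have bn: "b (k j) (n (Suc j)) < 1 / Suc j" for j using xQ by (simp add: n_def k_def)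
  have smn: "strict_mono n" and smk: "strict_mono k"
    using xQ by (auto simp: strict_mono_Suc_iff n_def k_def)
  define D where "D j = B (k (Suc j)) - B (k j)" for j
  have Dm[measurable]: "D j \<in> sets N" for j by (simp add: D_def)
  have Ddisj: "D i \<inter> D j = {}" if "i < j" for i j
    using Bmono[of "k (Suc i)" "k j"] that smk by (auto simp: D_def strict_mono_less_eq)
  define A where "A = (\<Union>i. D (2 * i))"
  have Am[measurable]: "A \<in> sets N" by (auto simp: A_def)
  have outside: "cmod (CLINT p|N. indicator E p *\<^sub>R h (n (Suc j)) p) \<le> 2 / Suc j"
    if E[measurable]: "E \<in> sets N" and ED: "E \<inter> D j = {}" for E j
  proof -
    have "cmod (CLINT p|N. indicator E p *\<^sub>R h (n (Suc j)) p) \<le> (LINT p|N. norm (indicator E p *\<^sub>R h (n (Suc j)) p))"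
      by (rule integral_norm_bound)
    also have "\<dots> \<le> (LINT p|N. indicator (space N - B (k (Suc j))) p * cmod (h (n (Suc j)) p) + indicator (B (k j)) p * cmod (h (n (Suc j)) p))"
    proof (rule integral_mono)
      show "integrable N (\<lambda>p. norm (indicator E p *\<^sub>R h (n (Suc j)) p))"
        using ih[OF E, of "n (Suc j)"] by simp
      show "integrable N (\<lambda>p. indicator (space N - B (k (Suc j))) p * cmod (h (n (Suc j)) p) + indicator (B (k j)) p * cmod (h (n (Suc j)) p))"
        by (intro Bochner_Integration.integrable_add ih) auto
      show "norm (indicator E p *\<^sub>R h (n (Suc j)) p) \<le> indicator (space N - B (k (Suc j))) p * cmod (h (n (Suc j)) p) + indicator (B (k j)) p * cmod (h (n (Suc j)) p)" if "p \<in> space N" for p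
        using that ED by (auto simp: D_def indicator_def)
    qed
    also have "\<dots> = a (n (Suc j)) (k (Suc j)) + b (k j) (n (Suc j))"
      unfolding a_def b_def by (intro Bochner_Integration.integral_add ih) auto
    also have "\<dots> \<le> 1 / Suc (Suc j) + 1 / Suc j"
      using an[of "Suc j"] bn[of j] by linarith
    also have "\<dots> \<le> 1 / Suc j + 1 / Suc j" by (intro add_right_mono frac_le) auto
    finally show ?thesis by simp
  qed
  have to0: "(\<lambda>i. 2 / real (Suc (r i))) \<longlonglongrightarrow> 0" if "strict_mono r" for r :: "nat \<Rightarrow> nat"
  proof -
    have "(\<lambda>i. 2 * (1 / real (Suc (r i)))) \<longlonglongrightarrow> 2 * 0"
      using LIMSEQ_subseq_LIMSEQ[OF LIMSEQ_inverse_real_of_nat that]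
      by (intro tendsto_mult) (auto simp: o_def inverse_eq_divide)
    then show ?thesis by simp
  qed
  have smodd: "strict_mono (\<lambda>i::nat. 2 * i + 1)" "strict_mono (\<lambda>i::nat. 2 * i)" by (auto simp: strict_mono_def)
  have in0: "(\<lambda>i. CLINT p|N. indicator A p *\<^sub>R h (n (Suc (2 * i + 1))) p) \<longlonglongrightarrow> 0"
  proof (rule Lim_null_comparison[OF always_eventually])
    show "\<forall>i. cmod (CLINT p|N. indicator A p *\<^sub>R h (n (Suc (2 * i + 1))) p) \<le> 2 / Suc (2 * i + 1)"
    proof (intro allI outside Am)
      fix i
      have "D (2 * i') \<inter> D (2 * i + 1) = {}" for i'
      proof (cases "2 * i' < 2 * i + 1")
        case False
        then have "2 * i + 1 < 2 * i'" by presburger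
        from Ddisj[OF this] show ?thesis by blast
      qed (rule Ddisj)
      then show "A \<inter> D (2 * i + 1) = {}" by (auto simp: A_def)
    qed
  qed (rule to0[OF smodd(1)])
  have out0: "(\<lambda>i. CLINT p|N. indicator (space N - A) p *\<^sub>R h (n (Suc (2 * i))) p) \<longlonglongrightarrow> 0"
  proof (rule Lim_null_comparison[OF always_eventually, OF _ to0[OF smodd(2)]])
    show "\<forall>i. cmod (CLINT p|N. indicator (space N - A) p *\<^sub>R h (n (Suc (2 * i))) p) \<le> 2 / Suc (2 * i)"
      by (intro allI outside) (auto simp: A_def)
  qed
  obtain L where L: "(\<lambda>m. exp (CLINT p|N. indicator A p *\<^sub>R h m p)) \<longlonglongrightarrow> L"
    using conv[OF Am] by (auto simp: convergent_def)
  have Lsub: "(\<lambda>i. exp (CLINT p|N. indicator A p *\<^sub>R h (n (Suc (r i))) p)) \<longlonglongrightarrow> L" if "strict_mono r" for r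
  proof -
    have "strict_mono (\<lambda>i. n (Suc (r i)))" using smn that by (auto simp: strict_mono_def)
    from LIMSEQ_subseq_LIMSEQ[OF L this] show ?thesis by (simp add: o_def)
  qed
  have "L = 1"
    using LIMSEQ_unique[OF Lsub[OF smodd(1)] tendsto_exp[OF in0]] by simp
  obtain L' where L': "(\<lambda>m. exp (CLINT p|N. h m p)) \<longlonglongrightarrow> L'"
  proof -
    have "(CLINT p|N. indicator (space N) p *\<^sub>R h m p) = (CLINT p|N. h m p)" for m
      by (intro Bochner_Integration.integral_cong) auto
    then show ?thesis using conv[of "space N"] that by (auto simp: convergent_def)
  qed
  have "(\<lambda>i. exp (CLINT p|N. indicator A p *\<^sub>R h (n (Suc (2 * i))) p) * exp (CLINT p|N. indicator (space N - A) p *\<^sub>R h (n (Suc (2 * i))) p)) \<longlonglongrightarrow> 1 * exp 0"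
    using Lsub[OF smodd(2)] \<open>L = 1\<close> by (intro tendsto_intros out0) auto
  moreover have "exp (CLINT p|N. indicator A p *\<^sub>R h m p) * exp (CLINT p|N. indicator (space N - A) p *\<^sub>R h m p) = exp (CLINT p|N. h m p)" for m
  proof -
    have "(CLINT p|N. h m p) = (CLINT p|N. indicator A p *\<^sub>R h m p + indicator (space N - A) p *\<^sub>R h m p)"
      by (intro Bochner_Integration.integral_cong) (auto simp: indicator_def)
    also have "\<dots> = (CLINT p|N. indicator A p *\<^sub>R h m p) + (CLINT p|N. indicator (space N - A) p *\<^sub>R h m p)"
      by (intro Bochner_Integration.integral_add integrable_mult_indicator int) auto
    finally show ?thesis by (simp add: exp_add)
  qed
  ultimately have "(\<lambda>i. exp (CLINT p|N. h (n (Suc (2 * i))) p)) \<longlonglongrightarrow> 1" by simp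
  moreover have "strict_mono (\<lambda>i. n (Suc (2 * i)))" using smn by (auto simp: strict_mono_def)
  then have "(\<lambda>i. exp (CLINT p|N. h (n (Suc (2 * i))) p)) \<longlonglongrightarrow> L'"
    using LIMSEQ_subseq_LIMSEQ[OF L'] by (simp add: o_def)
  ultimately have "L' = 1" using LIMSEQ_unique by blast
  with L' show ?thesis by simp
qed

section \<open>The exponent of a centred Levy basis\<close>

text \<open>The centring condition makes the mean of all integrals zero, and the fourth moment of \<open>\<nu>\<close> is what
the moment formulas rest on.\<close>

locale centred_levy_basis =
  fixes M :: "'w measure"
    and \<Lambda> :: "('s::polish_space \<times> (real^'m)) set \<Rightarrow> 'w \<Rightarrow> real^'d"
    and \<gamma> :: "real^'d" and Sig :: "real^'d^'d" and \<nu> :: "(real^'d) measure"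
    and \<pi> :: "'s measure"
  assumes basis: "levy_basis M \<Lambda> \<gamma> Sig \<nu> \<pi>"
    and nu4: "integrable \<nu> (\<lambda>x. norm x ^ 4)"
    and centred: "\<gamma> + (LINT x : {x. norm x > 1} | \<nu>. x) = 0"
begin

sublocale M: prob_space M using basis by (simp add: levy_basis_def)
sublocale PI: prob_space \<pi> using basis by (simp add: levy_basis_def)

lemma sets_nu[measurable_cong, simp]: "sets \<nu> = sets borel" and psd_Sig: "psd Sig"
  and sets_pi[measurable_cong, simp]: "sets \<pi> = sets borel" and nu0: "emeasure \<nu> {0} = 0"
  and nu_min: "integrable \<nu> (\<lambda>x. min 1 ((norm x)\<^sup>2))"
  using basis by (auto simp: levy_basis_def levy_measure_def)

lemma space_nu[simp]: "space \<nu> = UNIV"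
  using sets_eq_imp_space_eq[OF sets_nu] by simp

lemma nu2: "integrable \<nu> (\<lambda>x. (norm x)\<^sup>2)"
proof (rule Bochner_Integration.integrable_bound[OF Bochner_Integration.integrable_add[OF nu_min nu4]])
  have "y\<^sup>2 \<le> min 1 (y\<^sup>2) + y ^ 4" for y :: real
  proof (cases "y\<^sup>2 \<le> 1")
    case False
    then have "y\<^sup>2 * 1 \<le> y\<^sup>2 * y\<^sup>2" by (intro mult_left_mono) auto
    moreover have "y ^ 4 = y\<^sup>2 * y\<^sup>2" by (simp add: eval_nat_numeral)
    moreover have "min 1 (y\<^sup>2) = 1" using False by simp
    ultimately show ?thesis by linarith
  qed simp
  then show "AE x in \<nu>. norm ((norm x)\<^sup>2) \<le> norm (min 1 ((norm x)\<^sup>2) + norm x ^ 4)"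
    by (intro AE_I2) (simp add: abs_of_nonneg)
qed measurable

lemma nu3: "integrable \<nu> (\<lambda>x. norm x ^ 3)"
proof (rule Bochner_Integration.integrable_bound[OF Bochner_Integration.integrable_add[OF nu2 nu4]])
  have "y ^ 3 \<le> y\<^sup>2 + y ^ 4" for y :: real
  proof -
    have "0 \<le> (y\<^sup>2 - y)\<^sup>2 + y\<^sup>2 + y ^ 4" by auto
    then show ?thesis by (simp add: power2_eq_square eval_nat_numeral algebra_simps)
  qed
  then show "AE x in \<nu>. norm (norm x ^ 3) \<le> norm ((norm x)\<^sup>2 + norm x ^ 4)"
    by (intro AE_I2) (simp add: abs_of_nonneg)
qed measurable

sublocale nu: sigma_finite_measure \<nu>
proof
  let ?A = "\<lambda>n::nat. {x :: real^'d. 1 / Suc n \<le> min 1 ((norm x)\<^sup>2)}"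
  have fin: "emeasure \<nu> (?A n) < \<infinity>" for n
  proof -
    have "emeasure \<nu> {x \<in> space \<nu>. 1 / Suc n \<le> min 1 ((norm x)\<^sup>2)} < \<infinity>"
    proof -
      have "emeasure \<nu> {x \<in> space \<nu>. 1 \<le> ennreal (Suc n) * ennreal (min 1 ((norm x)\<^sup>2))} \<le> ennreal (Suc n) * (\<integral>\<^sup>+x. ennreal (min 1 ((norm x)\<^sup>2)) * indicator (space \<nu>) x \<partial>\<nu>)"
        by (rule nn_integral_Markov_inequality) auto
      also have "(\<integral>\<^sup>+x. ennreal (min 1 ((norm x)\<^sup>2)) * indicator (space \<nu>) x \<partial>\<nu>) = (\<integral>\<^sup>+x. ennreal (min 1 ((norm x)\<^sup>2)) \<partial>\<nu>)"
        by (intro nn_integral_cong) auto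
      also have "ennreal (Suc n) * \<dots> < \<infinity>"
        using nu_min by (subst nn_integral_eq_integral) (auto simp: ennreal_mult_less_top simp del: of_nat_Suc)
      also have "{x \<in> space \<nu>. 1 \<le> ennreal (Suc n) * ennreal (min 1 ((norm x)\<^sup>2))} = {x \<in> space \<nu>. 1 / Suc n \<le> min 1 ((norm x)\<^sup>2)}"
      proof -
        have e: "1 \<le> ennreal a * ennreal m \<longleftrightarrow> 1 / a \<le> m" if "0 < a" "0 \<le> m" for a m :: real
          using that by (simp add: ennreal_mult[symmetric] divide_le_eq mult.commute)
        have "1 \<le> ennreal (real (Suc n)) * ennreal (min 1 ((norm x)\<^sup>2)) \<longleftrightarrow> 1 / real (Suc n) \<le> min 1 ((norm x)\<^sup>2)" for x :: "real^'d"
          by (rule e) auto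
        then show ?thesis by (simp only:)
      qed
      finally show ?thesis .
    qed
    then show ?thesis by (simp add: sets_eq_imp_space_eq[OF sets_nu])
  qed
  have cover: "(\<Union>n. ?A n) \<union> {0} = UNIV"
  proof -
    have "\<exists>n::nat. 1 / Suc n \<le> min 1 ((norm x)\<^sup>2)" if "x \<noteq> 0" for x :: "real^'d"
      using reals_Archimedean[of "min 1 ((norm x)\<^sup>2)"] that by (auto simp: inverse_eq_divide intro: less_imp_le)
    then show ?thesis by auto
  qed
  have fin': "emeasure \<nu> a \<noteq> \<infinity>" if "a \<in> insert {0} (range ?A)" for a
  proof -
    from that consider "a = {0}" | n where "a = ?A n" by blast
    then show ?thesis
    proof cases
      case 1 then show ?thesis using nu0 by simp
    next
      case 2 show ?thesis unfolding 2 by (rule less_imp_neq[OF fin])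
    qed
  qed
  show "\<exists>A. countable A \<and> A \<subseteq> sets \<nu> \<and> \<Union> A = space \<nu> \<and> (\<forall>a\<in>A. emeasure \<nu> a \<noteq> \<infinity>)"
  proof (intro exI[of _ "insert {0} (range ?A)"] conjI ballI fin')
    show "\<Union> (insert {0} (range ?A)) = space \<nu>" using cover by auto
  qed auto
qed

lemma inner_le_norms: "\<bar>a \<bullet> x\<bar> \<le> norm a * norm x" for a x :: "real^'d"
  by (rule Cauchy_Schwarz_ineq2)

lemma integrable_inner_power:
  assumes "n \<in> {2,3,4}"
  shows "integrable \<nu> (\<lambda>x. (a \<bullet> x) ^ n)"
proof (rule Bochner_Integration.integrable_bound[where f="\<lambda>x. norm a ^ n * norm x ^ n"])
  show "integrable \<nu> (\<lambda>x. norm a ^ n * norm x ^ n)" using assms nu2 nu3 nu4 by auto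
  have "\<bar>a \<bullet> x\<bar> ^ n \<le> (norm a * norm x) ^ n" for x by (intro power_mono inner_le_norms) auto
  then show "AE x in \<nu>. norm ((a \<bullet> x) ^ n) \<le> norm (norm a ^ n * norm x ^ n)"
    by (intro AE_I2) (simp add: power_abs power_mult_distrib abs_mult)
qed measurable

lemma integrable_inner_mult: "integrable \<nu> (\<lambda>x. (a \<bullet> x) * (b \<bullet> x))"
proof (rule Bochner_Integration.integrable_bound[where f="\<lambda>x. (norm a * norm b) * (norm x)\<^sup>2"])
  show "integrable \<nu> (\<lambda>x. (norm a * norm b) * (norm x)\<^sup>2)" using nu2 by auto
  have "\<bar>a \<bullet> x\<bar> * \<bar>b \<bullet> x\<bar> \<le> (norm a * norm x) * (norm b * norm x)" for x by (intro mult_mono inner_le_norms) auto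
  then show "AE x in \<nu>. norm ((a \<bullet> x) * (b \<bullet> x)) \<le> norm ((norm a * norm b) * (norm x)\<^sup>2)"
    by (intro AE_I2) (simp add: abs_mult power2_eq_square mult_ac)
qed measurable

abbreviation "SL \<equiv> sigma_levy Sig \<nu>"

definition cov where "cov a b = a \<bullet> (SL *v b)"

text \<open>By the choice of \<open>\<Sigma>\<^sub>\<Lambda>\<close>, the form \<open>cov u u\<close> is the variance of the infinitely divisible law with
exponent \<open>\<Phi>\<close> in the direction \<open>u\<close>.\<close>

lemma cov_eq: "cov a b = a \<bullet> (Sig *v b) + (LINT x|\<nu>. (a \<bullet> x) * (b \<bullet> x))"
proof -
  let ?O = "\<lambda>x :: real^'d. (\<chi> i j. x $ i * x $ j) :: real^'d^'d"
  have Oc: "continuous_on UNIV ?O"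
    by (intro continuous_on_vec_lambda continuous_intros)
  then have [measurable]: "?O \<in> borel_measurable \<nu>"
    by (simp add: measurable_cong_sets[OF sets_nu refl] borel_measurable_continuous_onI)
  have On: "norm (?O x) \<le> (real CARD('d))\<^sup>2 * (norm x)\<^sup>2" for x
  proof -
    have l1: "norm y \<le> (\<Sum>i\<in>UNIV. norm (y $ i))" for y :: "'e::real_normed_vector^'d"
      unfolding norm_vec_def by (rule L2_set_le_sum) auto
    have "norm (?O x) \<le> (\<Sum>i\<in>UNIV. norm (?O x $ i))" by (rule l1)
    also have "\<dots> \<le> (\<Sum>i\<in>(UNIV::'d set). \<Sum>j\<in>(UNIV::'d set). (norm x)\<^sup>2)"
    proof (rule sum_mono)
      fix i :: 'd
      have "norm (?O x $ i) \<le> (\<Sum>j\<in>UNIV. norm (?O x $ i $ j))" by (rule l1)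
      also have "\<dots> \<le> (\<Sum>j\<in>(UNIV::'d set). (norm x)\<^sup>2)"
        by (intro sum_mono) (auto simp: abs_mult power2_eq_square intro!: mult_mono component_le_norm_cart)
      finally show "norm (?O x $ i) \<le> (\<Sum>j\<in>(UNIV::'d set). (norm x)\<^sup>2)" .
    qed
    also have "\<dots> = (real CARD('d))\<^sup>2 * (norm x)\<^sup>2" by (simp add: power2_eq_square)
    finally show ?thesis .
  qed
  have Oi: "integrable \<nu> ?O"
    by (rule Bochner_Integration.integrable_bound[where f="\<lambda>x. (real CARD('d))\<^sup>2 * (norm x)\<^sup>2"])
      (use nu2 On in auto)
  have lin: "bounded_linear (\<lambda>A :: real^'d^'d. a \<bullet> (A *v b))"
    unfolding linear_conv_bounded_linear[symmetric]
    by (intro linearI)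
      (auto simp: matrix_vector_mult_add_rdistrib inner_add_right scaleR_matrix_vector_assoc[symmetric])
  have pt: "a \<bullet> (?O x *v b) = (a \<bullet> x) * (b \<bullet> x)" for x
  proof -
    have "a \<bullet> (?O x *v b) = (\<Sum>i\<in>UNIV. \<Sum>j\<in>UNIV. a $ i * (x $ i * x $ j * b $ j))"
      by (simp add: matrix_vector_mult_def inner_vec_def sum_distrib_left)
    also have "\<dots> = (\<Sum>i\<in>UNIV. \<Sum>j\<in>UNIV. (a $ i * x $ i) * (b $ j * x $ j))"
      by (intro sum.cong refl) (simp add: mult_ac)
    also have "\<dots> = (a \<bullet> x) * (b \<bullet> x)"
      by (simp add: inner_vec_def flip: sum_product)
    finally show ?thesis .
  qed
  have "a \<bullet> ((LINT x|\<nu>. ?O x) *v b) = (LINT x|\<nu>. a \<bullet> (?O x *v b))"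
    using integral_bounded_linear[OF lin Oi] by simp
  also have "\<dots> = (LINT x|\<nu>. (a \<bullet> x) * (b \<bullet> x))" by (simp only: pt)
  finally show ?thesis
    by (simp add: cov_def sigma_levy_def matrix_vector_mult_add_rdistrib inner_add_right)
qed

lemma Sig_sym: "a \<bullet> (Sig *v b) = b \<bullet> (Sig *v a)"
proof -
  have "transpose Sig = Sig" using psd_Sig by (simp add: psd_def)
  then show ?thesis by (metis dot_lmul_matrix inner_commute transpose_matrix_vector)
qed

lemma cov_sym: "cov a b = cov b a"
  unfolding cov_eq using Sig_sym[of a b] by (simp add: mult.commute)

lemma cov_add_right: "cov a (b + c) = cov a b + cov a c"
  and cov_scale_right: "cov a (r *\<^sub>R b) = r * cov a b"
  and cov_add_left: "cov (b + c) a = cov b a + cov c a"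
  and cov_scale_left: "cov (r *\<^sub>R b) a = r * cov b a"
  by (simp_all add: cov_def matrix_vector_right_distrib inner_add_right inner_add_left matrix_vector_mult_scaleR)

lemma cov_nonneg: "0 \<le> cov a a"
  unfolding cov_eq using psd_Sig by (auto simp: psd_def intro!: add_nonneg_nonneg)

lemma cov_zero[simp]: "cov a 0 = 0" "cov 0 a = 0"
  by (simp_all add: cov_def)

lemma cov_Cauchy_Schwarz: "\<bar>cov a b\<bar> \<le> sqrt (cov a a) * sqrt (cov b b)"
proof -
  have q: "0 \<le> cov a a + 2 * t * cov a b + t\<^sup>2 * cov b b" for t
    using cov_nonneg[of "a + t *\<^sub>R b"]
    by (simp add: cov_add_right cov_add_left cov_scale_right cov_scale_left cov_sym[of b a] power2_eq_square algebra_simps)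
  have "(cov a b)\<^sup>2 \<le> cov a a * cov b b"
  proof (cases "cov b b = 0")
    case True
    have "cov a b = 0"
    proof (rule ccontr)
      assume n: "cov a b \<noteq> 0"
      show False using q[of "- (cov a a + 1) / (2 * cov a b)"] n True by (simp add: field_simps)
    qed
    then show ?thesis using True by simp
  next
    case False
    then have "0 < cov b b" using cov_nonneg[of b] by simp
    then show ?thesis using q[of "- cov a b / cov b b"] by (simp add: power2_eq_square field_simps)
  qed
  then have "sqrt ((cov a b)\<^sup>2) \<le> sqrt (cov a a * cov b b)" by (rule real_sqrt_le_mono)
  then show ?thesis by (simp add: real_sqrt_mult)
qed

abbreviation "\<Phi> \<equiv> levy_exponent \<gamma> Sig \<nu>"

lemma iexp_remainder1: "cmod (iexp y - 1 - \<i> * of_real y) \<le> y\<^sup>2 / 2"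
  using iexp_approx1[of y 1] by (simp add: algebra_simps eval_nat_numeral)

lemma integrable_iexp_remainder1: "integrable \<nu> (\<lambda>x. iexp (u \<bullet> x) - 1 - \<i> * of_real (u \<bullet> x))"
  by (rule Bochner_Integration.integrable_bound[where f="\<lambda>x. (u \<bullet> x)\<^sup>2 / 2"])
    (use integrable_inner_power[of 2 u] iexp_remainder1 in auto)

text \<open>The centring condition removes the truncation function together with the drift.\<close>

lemma levy_exponent_centred:
  "\<Phi> u = - of_real (u \<bullet> (Sig *v u)) / 2 + (CLINT x|\<nu>. iexp (u \<bullet> x) - 1 - \<i> * of_real (u \<bullet> x))"
proof -
  let ?big = "{x :: real^'d. norm x > 1}"
  have bigi: "integrable \<nu> (\<lambda>x. indicator ?big x *\<^sub>R x)"
  proof (rule Bochner_Integration.integrable_bound[OF nu2])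
    have "norm x \<le> norm x * norm x" if "1 < norm x" for x :: "real^'d"
      using mult_left_mono[of 1 "norm x" "norm x"] that by simp
    then show "AE x in \<nu>. norm (indicator ?big x *\<^sub>R x) \<le> norm ((norm x)\<^sup>2)"
      by (auto simp: indicator_def power2_eq_square)
  qed measurable
  have "(LINT x|\<nu>. indicator ?big x * (u \<bullet> x)) = (LINT x|\<nu>. u \<bullet> (indicator ?big x *\<^sub>R x))"
    by simp
  also have "\<dots> = u \<bullet> (LINT x|\<nu>. indicator ?big x *\<^sub>R x)"
    by (rule integral_inner_right) (use bigi in simp)
  also have "(LINT x|\<nu>. indicator ?big x *\<^sub>R x) = - \<gamma>"
    using centred by (simp add: set_lebesgue_integral_def eq_neg_iff_add_eq_0 add.commute)
  finally have big: "(LINT x|\<nu>. indicator ?big x * (u \<bullet> x)) = - (\<gamma> \<bullet> u)" by (simp add: inner_commute)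
  have bigi': "integrable \<nu> (\<lambda>x. indicator ?big x * (u \<bullet> x))"
    using integrable_inner_right[OF bigi, of u] by simp
  have "(CLINT x|\<nu>. iexp (u \<bullet> x) - 1 - \<i> * of_real ((u \<bullet> x) * indicator {0..1} (norm x)))
     = (CLINT x|\<nu>. (iexp (u \<bullet> x) - 1 - \<i> * of_real (u \<bullet> x)) + \<i> * of_real (indicator ?big x * (u \<bullet> x)))"
    by (intro Bochner_Integration.integral_cong) (auto simp: indicator_def)
  also have "\<dots> = (CLINT x|\<nu>. iexp (u \<bullet> x) - 1 - \<i> * of_real (u \<bullet> x)) + (CLINT x|\<nu>. \<i> * of_real (indicator ?big x * (u \<bullet> x)))"
    by (intro Bochner_Integration.integral_add integrable_iexp_remainder1 integrable_mult_right integrable_of_real bigi')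
  also have "(CLINT x|\<nu>. \<i> * of_real (indicator ?big x * (u \<bullet> x))) = - \<i> * of_real (\<gamma> \<bullet> u)"
    by (simp only: integral_mult_right_zero integral_complex_of_real big) simp
  finally show ?thesis by (simp add: levy_exponent_def)
qed

lemma measurable_matrix_vector_mult[measurable]: "(*v) (A :: real^'a^'b) \<in> borel_measurable borel"
  by (intro borel_measurable_continuous_onI linear_continuous_on matrix_vector_mul_bounded_linear)

lemma measurable_levy_exponent[measurable]: "\<Phi> \<in> borel_measurable borel"
  unfolding levy_exponent_centred[abs_def] by measurable

text \<open>This bound makes \<open>\<Phi> \<circ> g\<close> integrable for square integrable \<open>g\<close>.\<close>

lemma norm_levy_exponent_le: "cmod (\<Phi> u) \<le> cov u u / 2"
proof -
  have "cmod (\<Phi> u) \<le> cmod (- of_real (u \<bullet> (Sig *v u)) / 2) + (LINT x|\<nu>. cmod (iexp (u \<bullet> x) - 1 - \<i> * of_real (u \<bullet> x)))"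
    unfolding levy_exponent_centred by (intro order_trans[OF norm_triangle_ineq] add_left_mono integral_norm_bound)
  also have "\<dots> \<le> u \<bullet> (Sig *v u) / 2 + (LINT x|\<nu>. (u \<bullet> x)\<^sup>2 / 2)"
  proof (rule add_mono)
    have "0 \<le> u \<bullet> (Sig *v u)" using psd_Sig by (simp add: psd_def)
    then show "cmod (- of_real (u \<bullet> (Sig *v u)) / 2) \<le> u \<bullet> (Sig *v u) / 2" by (simp add: norm_divide)
    show "(LINT x|\<nu>. cmod (iexp (u \<bullet> x) - 1 - \<i> * of_real (u \<bullet> x))) \<le> (LINT x|\<nu>. (u \<bullet> x)\<^sup>2 / 2)"
      by (intro integral_mono integrable_norm integrable_iexp_remainder1 iexp_remainder1)
        (use integrable_inner_power[of 2 u] in auto)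
  qed
  also have "\<dots> = cov u u / 2"
    by (simp add: cov_eq power2_eq_square add_divide_distrib)
  finally show ?thesis .
qed

lemma levy_exponent_zero[simp]: "\<Phi> 0 = 0"
  using norm_levy_exponent_le[of 0] by simp

lemma Re_levy_exponent_le: "Re (\<Phi> u) \<le> 0"
proof -
  have "0 \<le> u \<bullet> (Sig *v u)" using psd_Sig by (simp add: psd_def)
  moreover have "Re (CLINT x|\<nu>. iexp (u \<bullet> x) - 1 - \<i> * of_real (u \<bullet> x)) \<le> 0"
  proof -
    have "(LINT x|\<nu>. Re (iexp (u \<bullet> x) - 1 - \<i> * of_real (u \<bullet> x))) \<le> (LINT x|\<nu>. 0)"
      by (intro integral_mono integrable_Re integrable_iexp_remainder1) (auto simp: Re_exp)
    then show ?thesis by (simp only: integral_Re[OF integrable_iexp_remainder1]) simp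
  qed
  ultimately show ?thesis unfolding levy_exponent_centred by simp
qed

definition c3 where "c3 u = (LINT x|\<nu>. (u \<bullet> x) ^ 3)"
definition c4 where "c4 u = (LINT x|\<nu>. (u \<bullet> x) ^ 4)"
text \<open>The remainder of \<open>\<Phi>\<close> after the second and third order terms; the fourth order term is still in it.\<close>

definition R4 where "R4 u = \<Phi> u + of_real (cov u u / 2) + \<i> * of_real (c3 u / 6)"

lemma measurable_c3[measurable]: "c3 \<in> borel_measurable borel"
  and measurable_c4[measurable]: "c4 \<in> borel_measurable borel"
  unfolding c3_def[abs_def] c4_def[abs_def] by measurable

lemma measurable_cov[measurable]:
  "f \<in> borel_measurable N \<Longrightarrow> g \<in> borel_measurable N \<Longrightarrow> (\<lambda>x. cov (f x) (g x)) \<in> borel_measurable N"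
proof -
  assume [measurable]: "f \<in> borel_measurable N" "g \<in> borel_measurable N"

  show ?thesis unfolding cov_def by measurable
qed

text \<open>The integrand of \<open>R4\<close> with respect to \<open>\<nu>\<close>.\<close>

definition r4 :: "real \<Rightarrow> complex" where
  "r4 y = iexp y - 1 - \<i> * of_real y + of_real (y\<^sup>2 / 2) + \<i> * of_real (y ^ 3 / 6)"

lemma norm_r4_le: "cmod (r4 y) \<le> y ^ 4 / 24"
  and norm_r4_diff_le: "cmod (r4 y - of_real (y ^ 4 / 24)) \<le> \<bar>y\<bar> ^ 5 / 120"
proof -
  have e3: "iexp y - (\<Sum>k\<le>3. (\<i> * y)^k / fact k) = r4 y"
    by (simp add: r4_def eval_nat_numeral fact_reduce algebra_simps)
  have e4: "iexp y - (\<Sum>k\<le>4. (\<i> * y)^k / fact k) = r4 y - of_real (y ^ 4 / 24)"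
    by (simp add: r4_def eval_nat_numeral fact_reduce algebra_simps)
  show "cmod (r4 y) \<le> y ^ 4 / 24"
    using iexp_approx1[of y 3] unfolding e3 by (simp add: eval_nat_numeral fact_reduce)
  show "cmod (r4 y - of_real (y ^ 4 / 24)) \<le> \<bar>y\<bar> ^ 5 / 120"
    using iexp_approx1[of y 4] unfolding e4 by (simp add: eval_nat_numeral fact_reduce)
qed

lemma measurable_r4[measurable]: "r4 \<in> borel_measurable borel"
  unfolding r4_def[abs_def] by measurable

lemma integrable_r4: "integrable \<nu> (\<lambda>x. r4 (u \<bullet> x))"
  by (rule Bochner_Integration.integrable_bound[where f="\<lambda>x. (u \<bullet> x) ^ 4 / 24"])
    (use integrable_inner_power[of 4 u] norm_r4_le in auto)

lemma R4_eq: "R4 u = (CLINT x|\<nu>. r4 (u \<bullet> x))"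
proof -
  have i2: "integrable \<nu> (\<lambda>x. complex_of_real ((u \<bullet> x)\<^sup>2 / 2))" 
    by (intro integrable_of_real) (use integrable_inner_power[of 2 u] in auto)
  have i3: "integrable \<nu> (\<lambda>x. \<i> * complex_of_real ((u \<bullet> x) ^ 3 / 6))" 
    by (intro integrable_mult_right integrable_of_real) (use integrable_inner_power[of 3 u] in auto)
  have "(CLINT x|\<nu>. r4 (u \<bullet> x)) = (CLINT x|\<nu>. iexp (u \<bullet> x) - 1 - \<i> * of_real (u \<bullet> x))
     + (CLINT x|\<nu>. complex_of_real ((u \<bullet> x)\<^sup>2 / 2)) + (CLINT x|\<nu>. \<i> * complex_of_real ((u \<bullet> x) ^ 3 / 6))"
    unfolding r4_def
    by (subst Bochner_Integration.integral_add[OF Bochner_Integration.integrable_add[OF integrable_iexp_remainder1 i2] i3],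
        subst Bochner_Integration.integral_add[OF integrable_iexp_remainder1 i2], simp)
  also have "(CLINT x|\<nu>. complex_of_real ((u \<bullet> x)\<^sup>2 / 2)) = of_real ((LINT x|\<nu>. (u \<bullet> x)\<^sup>2) / 2)"
    by (simp only: integral_complex_of_real integral_divide_zero)
  also have "(CLINT x|\<nu>. \<i> * complex_of_real ((u \<bullet> x) ^ 3 / 6)) = \<i> * of_real (c3 u / 6)"
    by (simp only: integral_mult_right_zero integral_complex_of_real integral_divide_zero c3_def)
  finally show ?thesis
    unfolding R4_def levy_exponent_centred cov_eq by (simp add: power2_eq_square add_divide_distrib)
qed

lemma norm_R4_le: "cmod (R4 u) \<le> c4 u / 24"
proof -
  have "cmod (R4 u) \<le> (LINT x|\<nu>. cmod (r4 (u \<bullet> x)))"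
    unfolding R4_eq by (rule integral_norm_bound)
  also have "\<dots> \<le> (LINT x|\<nu>. (u \<bullet> x) ^ 4 / 24)"
    by (intro integral_mono integrable_norm integrable_r4 norm_r4_le) (use integrable_inner_power[of 4 u] in auto)
  finally show ?thesis by (simp add: c4_def)
qed

lemma c4_scale: "c4 (t *\<^sub>R v) = t ^ 4 * c4 v" and c3_scale: "c3 (t *\<^sub>R v) = t ^ 3 * c3 v"
  by (simp_all add: c4_def c3_def power_mult_distrib)

text \<open>The bound \<open>norm_r4_le\<close> is homogeneous of degree four, so it dominates uniformly in the scale.\<close>

lemma R4_lim:
  assumes t: "t \<longlonglongrightarrow> 0" "\<And>n. t n \<noteq> 0"
  shows "(\<lambda>n. R4 (t n *\<^sub>R v) / of_real (t n ^ 4)) \<longlonglongrightarrow> of_real (c4 v / 24)"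
proof -
  have "(\<lambda>n. CLINT x|\<nu>. r4 (t n * (v \<bullet> x)) / of_real (t n ^ 4)) \<longlonglongrightarrow> (CLINT x|\<nu>. of_real ((v \<bullet> x) ^ 4 / 24))"
  proof (rule integral_dominated_convergence[where w="\<lambda>x. (v \<bullet> x) ^ 4 / 24"])
    show "integrable \<nu> (\<lambda>x. (v \<bullet> x) ^ 4 / 24)" using integrable_inner_power[of 4 v] by auto
    show "AE x in \<nu>. (\<lambda>n. r4 (t n * (v \<bullet> x)) / of_real (t n ^ 4)) \<longlonglongrightarrow> of_real ((v \<bullet> x) ^ 4 / 24)"
    proof (intro AE_I2)
      fix x
      let ?y = "v \<bullet> x"
      have "(\<lambda>n. r4 (t n * ?y) / of_real (t n ^ 4) - of_real (?y ^ 4 / 24)) \<longlonglongrightarrow> 0"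
      proof (rule Lim_null_comparison[OF always_eventually])
        have "(\<lambda>n. \<bar>t n\<bar> * \<bar>?y\<bar> ^ 5 / 120) \<longlonglongrightarrow> \<bar>0\<bar> * \<bar>?y\<bar> ^ 5 / 120" by (intro tendsto_intros t) auto
        then show "(\<lambda>n. \<bar>t n\<bar> * \<bar>?y\<bar> ^ 5 / 120) \<longlonglongrightarrow> 0" by simp
        show "\<forall>n. norm (r4 (t n * ?y) / of_real (t n ^ 4) - of_real (?y ^ 4 / 24)) \<le> \<bar>t n\<bar> * \<bar>?y\<bar> ^ 5 / 120"
        proof
          fix n
          have "r4 (t n * ?y) / of_real (t n ^ 4) - of_real (?y ^ 4 / 24) = (r4 (t n * ?y) - of_real ((t n * ?y) ^ 4 / 24)) / of_real (t n ^ 4)"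
            using t(2)[of n] by (simp add: diff_divide_distrib power_mult_distrib)
          then have "norm (r4 (t n * ?y) / of_real (t n ^ 4) - of_real (?y ^ 4 / 24)) = cmod (r4 (t n * ?y) - of_real ((t n * ?y) ^ 4 / 24)) / t n ^ 4"
            by (simp add: norm_divide norm_power)
          also have "\<dots> \<le> (\<bar>t n * ?y\<bar> ^ 5 / 120) / t n ^ 4"
            by (intro divide_right_mono norm_r4_diff_le) auto
          also have "\<bar>t n * ?y\<bar> ^ 5 = t n ^ 4 * (\<bar>t n\<bar> * \<bar>?y\<bar> ^ 5)"
            using power_Suc2[of "\<bar>t n\<bar>" 4] by (simp add: abs_mult power_mult_distrib)
          also have "(t n ^ 4 * (\<bar>t n\<bar> * \<bar>?y\<bar> ^ 5) / 120) / t n ^ 4 = \<bar>t n\<bar> * \<bar>?y\<bar> ^ 5 / 120"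
            using t(2)[of n] by simp
          finally show "norm (r4 (t n * ?y) / of_real (t n ^ 4) - of_real (?y ^ 4 / 24)) \<le> \<bar>t n\<bar> * \<bar>?y\<bar> ^ 5 / 120" .
        qed
      qed
      then show "(\<lambda>n. r4 (t n * ?y) / of_real (t n ^ 4)) \<longlonglongrightarrow> of_real (?y ^ 4 / 24)"
        by (simp only: LIM_zero_iff)
    qed
    show "AE x in \<nu>. norm (r4 (t n * (v \<bullet> x)) / of_real (t n ^ 4)) \<le> (v \<bullet> x) ^ 4 / 24" for n
    proof (intro AE_I2)
      fix x
      have "norm (r4 (t n * (v \<bullet> x)) / of_real (t n ^ 4)) = cmod (r4 (t n * (v \<bullet> x))) / t n ^ 4"
        by (simp add: norm_divide norm_power)
      also have "\<dots> \<le> ((t n * (v \<bullet> x)) ^ 4 / 24) / t n ^ 4"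
        by (intro divide_right_mono norm_r4_le) auto
      finally show "norm (r4 (t n * (v \<bullet> x)) / of_real (t n ^ 4)) \<le> (v \<bullet> x) ^ 4 / 24"
        using t(2)[of n] by (simp add: power_mult_distrib)
    qed
  qed measurable
  then show ?thesis
    by (simp only: R4_eq inner_scaleR_left integral_divide_zero c4_def integral_complex_of_real)
qed

section \<open>The random measure and integrals of simple functions\<close>

abbreviation N :: "('s \<times> (real^'m)) measure" where "N \<equiv> \<pi> \<Otimes>\<^sub>M lborel"

lemma sets_N[measurable_cong, simp]: "sets N = sets borel"
  by (subst borel_prod[symmetric], rule sets_pair_measure_cong) auto

lemma sets_borel_pair[simp]: "sets (borel \<Otimes>\<^sub>M borel) = sets (borel :: ('s \<times> (real^'m)) measure)"
  by (simp only: borel_prod)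

lemma space_N[simp]: "space N = UNIV"
  using sets_eq_imp_space_eq[OF sets_N] by simp

sublocale PN: pair_sigma_finite \<pi> "lborel :: (real^'m) measure" ..
sublocale N: sigma_finite_measure N ..

lemma bounded_borelI: "B \<in> sets borel \<Longrightarrow> bounded B \<Longrightarrow> B \<in> bounded_borel"
  by (simp add: bounded_borel_def)

lemma emeasure_N_bounded:
  assumes "B \<in> bounded_borel"
  shows "emeasure N B < \<infinity>"
proof -
  have "bounded (snd ` B)" using assms by (auto simp: bounded_borel_def intro: bounded_snd)
  then obtain r where r: "\<And>x. x \<in> B \<Longrightarrow> norm (snd x) \<le> r" by (auto simp: bounded_iff)
  have "emeasure N B \<le> emeasure N (UNIV \<times> cball 0 r)"
    using r by (intro emeasure_mono) (force, simp add: borel_Times del: sets_N)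
  also have "\<dots> = emeasure \<pi> UNIV * emeasure lborel (cball (0::real^'m) r)"
    by (rule lborel.emeasure_pair_measure_Times) auto
  also have "emeasure \<pi> UNIV = 1"
    using PI.emeasure_space_1 sets_eq_imp_space_eq[OF sets_pi] by simp
  also have "1 * emeasure lborel (cball (0::real^'m) r) < \<infinity>"
    using emeasure_bounded_finite[of "cball (0::real^'m) r"] by simp
  finally show ?thesis .
qed

lemma \<Lambda>_measurable: "B' \<in> bounded_borel \<Longrightarrow> \<Lambda> B' \<in> borel_measurable M"
  and \<Lambda>_indep: "range B \<subseteq> bounded_borel \<Longrightarrow> disjoint_family B \<Longrightarrow> M.indep_vars (\<lambda>_. borel) (\<lambda>n. \<Lambda> (B n)) (UNIV :: nat set)"
  and \<Lambda>_sums: "range B \<subseteq> bounded_borel \<Longrightarrow> disjoint_family B \<Longrightarrow> (\<Union>n::nat. B n) \<in> bounded_borel \<Longrightarrow>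
        AE \<omega> in M. (\<lambda>n. \<Lambda> (B n) \<omega>) sums \<Lambda> (\<Union>n. B n) \<omega>"
  and \<Lambda>_char: "B' \<in> bounded_borel \<Longrightarrow> (CLINT \<omega>|M. iexp (u \<bullet> \<Lambda> B' \<omega>)) = exp (\<Phi> u * of_real (measure N B'))"
  using basis unfolding levy_basis_def by blast+

lemma empty_bounded_borel[simp]: "{} \<in> bounded_borel" by (simp add: bounded_borel_def)

text \<open>The constant series \<open>\<Lambda> {} + \<Lambda> {} + \<dots>\<close> can only converge to zero.\<close>

lemma \<Lambda>_empty: "AE \<omega> in M. \<Lambda> {} \<omega> = 0"
proof -
  have "AE \<omega> in M. (\<lambda>n::nat. \<Lambda> {} \<omega>) sums \<Lambda> (\<Union>n::nat. {}) \<omega>"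
    by (rule \<Lambda>_sums[of "\<lambda>_. {}"]) (auto simp: disjoint_family_on_def)
  then show ?thesis
  proof eventually_elim
  case (elim \<omega>)
  then have "(\<lambda>n::nat. \<Lambda> {} \<omega>) sums \<Lambda> {} \<omega>" by simp
  then have "(\<lambda>n::nat. \<Lambda> {} \<omega>) \<longlonglongrightarrow> 0" by (intro summable_LIMSEQ_zero) (auto simp: summable_def)
  then show ?case by (simp add: LIMSEQ_const_iff)
  qed
qed

lemma \<Lambda>_Un:
  assumes "A \<in> bounded_borel" "B \<in> bounded_borel" "A \<inter> B = {}"
  shows "AE \<omega> in M. \<Lambda> (A \<union> B) \<omega> = \<Lambda> A \<omega> + \<Lambda> B \<omega>"
proof -
  let ?B = "\<lambda>n::nat. if n = 0 then A else if n = 1 then B else {}"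
  have U: "(\<Union>n. ?B n) = A \<union> B" by (auto split: if_splits intro: exI[of _ 0] exI[of _ 1])
  have "AE \<omega> in M. (\<lambda>n. \<Lambda> (?B n) \<omega>) sums \<Lambda> (\<Union>n. ?B n) \<omega>"
    unfolding U using assms
    by (intro \<Lambda>_sums[of ?B, unfolded U]) (auto simp: disjoint_family_on_def bounded_borel_def)
  then show ?thesis using \<Lambda>_empty
  proof eventually_elim
    case (elim \<omega>)
    have "(\<lambda>n. \<Lambda> (?B n) \<omega>) sums (\<Sum>n\<in>{0,1}. \<Lambda> (?B n) \<omega>)"
      by (rule sums_finite) (use elim in auto)
    then show ?case using elim(1) sums_unique2 unfolding U by fastforce
  qed
qed

lemma \<Lambda>_UN:
  assumes "finite I" "\<And>i. i \<in> I \<Longrightarrow> B i \<in> bounded_borel" "disjoint_family_on B I"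
  shows "AE \<omega> in M. \<Lambda> (\<Union>i\<in>I. B i) \<omega> = (\<Sum>i\<in>I. \<Lambda> (B i) \<omega>)"
  using assms
proof (induction I rule: finite_induct)
  case empty then show ?case using \<Lambda>_empty by simp
next
  case (insert j I)
  have "(\<Union>i\<in>I. B i) \<in> bounded_borel"
    using insert by (auto simp: bounded_borel_def)
  moreover have "B j \<inter> (\<Union>i\<in>I. B i) = {}"
    using insert.prems(2) insert.hyps by (auto simp: disjoint_family_on_def)
  ultimately have "AE \<omega> in M. \<Lambda> (B j \<union> (\<Union>i\<in>I. B i)) \<omega> = \<Lambda> (B j) \<omega> + \<Lambda> (\<Union>i\<in>I. B i) \<omega>"
    using insert.prems by (intro \<Lambda>_Un) auto
  moreover have "AE \<omega> in M. \<Lambda> (\<Union>i\<in>I. B i) \<omega> = (\<Sum>i\<in>I. \<Lambda> (B i) \<omega>)"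
    using insert.prems by (intro insert.IH) (auto simp: disjoint_family_on_def)
  ultimately show ?case
  proof eventually_elim
    case (elim \<omega>)
    then show ?case using insert.hyps by simp
  qed
qed

abbreviation "lsi A g \<equiv> levy_simple_integral \<Lambda> A g"

lemma levy_simple_level:
  fixes g :: "'s \<times> (real^'m) \<Rightarrow> real^'d"
  assumes "levy_simple g" "y \<noteq> 0" "A \<in> sets borel"
  shows "A \<inter> g -` {y} \<in> bounded_borel"
proof (rule bounded_borelI)
  have g: "g \<in> borel_measurable borel" using assms(1) by (simp add: levy_simple_def)
  have "{y} \<in> sets borel" by simp
  then have "g -` {y} \<inter> space borel \<in> sets borel"
    by (rule measurable_sets[OF g])
  then show "A \<inter> g -` {y} \<in> sets borel" by (intro sets.Int assms(3)) (simp only: space_borel Int_UNIV_right)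
  show "bounded (A \<inter> g -` {y})"
    by (rule bounded_subset[of "{p. g p \<noteq> 0}"]) (use assms in \<open>auto simp: levy_simple_def\<close>)
qed

lemma lsi_measurable[measurable]:
  assumes "levy_simple g" "A \<in> sets borel"
  shows "lsi A g \<in> borel_measurable M"
proof -
  have [measurable]: "\<Lambda> (A \<inter> g -` {y}) \<in> borel_measurable M" if "y \<in> range g - {0}" for y
    using that assms by (intro \<Lambda>_measurable levy_simple_level) auto
  show ?thesis unfolding levy_simple_integral_def[abs_def] by measurable
qed

text \<open>The canonical representation of a simple integral may be replaced by any finite partition into
bounded sets on which the integrand is constant. Linearity follows by passing to a common refinement.\<close>

lemma lsi_partition:
  assumes g: "levy_simple g" and A: "A \<in> sets borel" and I: "finite I"
    and E: "\<And>i. i \<in> I \<Longrightarrow> E i \<in> bounded_borel" and disj: "disjoint_family_on E I"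
    and val: "\<And>i p. i \<in> I \<Longrightarrow> p \<in> E i \<Longrightarrow> g p = c i" and cover: "\<And>p. g p \<noteq> 0 \<Longrightarrow> p \<in> (\<Union>i\<in>I. E i)"
  shows "AE \<omega> in M. lsi A g \<omega> = (\<Sum>i\<in>I. c i \<bullet> \<Lambda> (A \<inter> E i) \<omega>)"
proof -
  let ?Y = "range g - {0}"
  have finY: "finite ?Y" using g by (simp add: levy_simple_def)
  have bb: "A \<inter> E i \<in> bounded_borel" if "i \<in> I" for i
    using E[OF that] A by (auto simp: bounded_borel_def intro: bounded_subset)
  have "AE \<omega> in M. \<forall>y\<in>?Y. \<Lambda> (A \<inter> g -` {y}) \<omega> = (\<Sum>i\<in>{i\<in>I. c i = y}. \<Lambda> (A \<inter> E i) \<omega>)"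
  proof (rule AE_finite_allI[OF finY])
    fix y assume y: "y \<in> ?Y"
    have "A \<inter> g -` {y} = (\<Union>i\<in>{i\<in>I. c i = y}. A \<inter> E i)"
    proof (intro set_eqI iffI)
      fix p assume p: "p \<in> A \<inter> g -` {y}"
      then obtain i where "i \<in> I" "p \<in> E i" using cover[of p] y by auto
      then show "p \<in> (\<Union>i\<in>{i\<in>I. c i = y}. A \<inter> E i)" using p val[of i p] by auto
    next
      fix p assume "p \<in> (\<Union>i\<in>{i\<in>I. c i = y}. A \<inter> E i)"
      then obtain i where "i \<in> I" "c i = y" "p \<in> A" "p \<in> E i" by auto
      then show "p \<in> A \<inter> g -` {y}" using val[of i p] by auto
    qed
    moreover have "AE \<omega> in M. \<Lambda> (\<Union>i\<in>{i\<in>I. c i = y}. A \<inter> E i) \<omega> = (\<Sum>i\<in>{i\<in>I. c i = y}. \<Lambda> (A \<inter> E i) \<omega>)"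
      using I bb disj by (intro \<Lambda>_UN) (auto simp: disjoint_family_on_def)
    ultimately show "AE \<omega> in M. \<Lambda> (A \<inter> g -` {y}) \<omega> = (\<Sum>i\<in>{i\<in>I. c i = y}. \<Lambda> (A \<inter> E i) \<omega>)" by simp
  qed
  then show ?thesis using \<Lambda>_empty
  proof eventually_elim
    case (elim \<omega>)
    let ?t = "\<lambda>i. c i \<bullet> \<Lambda> (A \<inter> E i) \<omega>"
    have "lsi A g \<omega> = (\<Sum>y\<in>?Y. \<Sum>i\<in>{i\<in>I. c i = y}. ?t i)"
      unfolding levy_simple_integral_def using elim(1) by (intro sum.cong) (auto simp: inner_sum_right)
    also have "\<dots> = (\<Sum>y\<in>?Y. \<Sum>i\<in>{i\<in>{i\<in>I. c i \<in> ?Y}. c i = y}. ?t i)"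
      by (intro sum.cong) auto
    also have "\<dots> = (\<Sum>i\<in>{i\<in>I. c i \<in> ?Y}. ?t i)"
      using I finY by (intro sum.group) auto
    also have "\<dots> = (\<Sum>i\<in>I. ?t i)"
    proof (intro sum.mono_neutral_left I ballI)
      fix i assume i: "i \<in> I - {i\<in>I. c i \<in> ?Y}"
      then have "c i = 0 \<or> E i = {}" using val[of i] by (auto, metis rangeI ex_in_conv)
      then show "?t i = 0" using elim(2) by auto
    qed auto
    finally show ?case .
  qed
qed

lemma levy_simple_lincomb:
  assumes "levy_simple g" "levy_simple h"
  shows "levy_simple (\<lambda>p. a *\<^sub>R g p + b *\<^sub>R h p)"
  unfolding levy_simple_def
proof (intro conjI)
  show "(\<lambda>p. a *\<^sub>R g p + b *\<^sub>R h p) \<in> borel_measurable borel" using assms by (auto simp: levy_simple_def)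
  have "finite ((\<lambda>(y, z). a *\<^sub>R y + b *\<^sub>R z) ` (range g \<times> range h))"
    by (rule finite_imageI, rule finite_cartesian_product) (use assms in \<open>auto simp: levy_simple_def\<close>)
  then show "finite (range (\<lambda>p. a *\<^sub>R g p + b *\<^sub>R h p))" by (rule rev_finite_subset) auto
  have "bounded ({p. g p \<noteq> 0} \<union> {p. h p \<noteq> 0})" using assms by (simp add: levy_simple_def)
  then show "bounded {p. a *\<^sub>R g p + b *\<^sub>R h p \<noteq> 0}" by (rule bounded_subset) auto
qed

lemma lsi_lincomb:
  assumes g: "levy_simple g" and h: "levy_simple h" and A: "A \<in> sets borel"
  shows "AE \<omega> in M. lsi A (\<lambda>p. a *\<^sub>R g p + b *\<^sub>R h p) \<omega> = a * lsi A g \<omega> + b * lsi A h \<omega>"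
proof -
  let ?I = "range g \<times> range h - {(0, 0)}"
  let ?E = "\<lambda>i. g -` {fst i} \<inter> h -` {snd i}"
  have I: "finite ?I" using g h by (auto simp: levy_simple_def)
  have E: "?E i \<in> bounded_borel" if "i \<in> ?I" for i
  proof (rule bounded_borelI)
    have m: "g \<in> borel_measurable borel" "h \<in> borel_measurable borel" using g h by (simp_all add: levy_simple_def)
    have "g -` {fst i} \<inter> space borel \<in> sets borel" "h -` {snd i} \<inter> space borel \<in> sets borel"
      by (rule measurable_sets[OF m(1)], simp) (rule measurable_sets[OF m(2)], simp)
    then show "?E i \<in> sets borel" by (intro sets.Int) (simp_all only: space_borel Int_UNIV_right)
    have "bounded ({p. g p \<noteq> 0} \<union> {p. h p \<noteq> 0})" using g h by (simp add: levy_simple_def)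
    then show "bounded (?E i)" by (rule bounded_subset) (use that in auto)
  qed
  have d: "disjoint_family_on ?E ?I" by (auto simp: disjoint_family_on_def)
  have cover: "p \<in> (\<Union>i\<in>?I. ?E i)" if "g p \<noteq> 0 \<or> h p \<noteq> 0" for p
    by (rule UN_I[of "(g p, h p)"]) (use that in auto)
  have "AE \<omega> in M. lsi A g \<omega> = (\<Sum>i\<in>?I. fst i \<bullet> \<Lambda> (A \<inter> ?E i) \<omega>)"
    by (rule lsi_partition[OF g A I E d _ cover]) auto
  moreover have "AE \<omega> in M. lsi A h \<omega> = (\<Sum>i\<in>?I. snd i \<bullet> \<Lambda> (A \<inter> ?E i) \<omega>)"
    by (rule lsi_partition[OF h A I E d _ cover]) auto
  moreover have "AE \<omega> in M. lsi A (\<lambda>p. a *\<^sub>R g p + b *\<^sub>R h p) \<omega> = (\<Sum>i\<in>?I. (a *\<^sub>R fst i + b *\<^sub>R snd i) \<bullet> \<Lambda> (A \<inter> ?E i) \<omega>)"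
    by (rule lsi_partition[OF levy_simple_lincomb[OF g h] A I E d _ cover]) auto
  ultimately show ?thesis
    by eventually_elim (simp add: inner_add_left sum.distrib sum_distrib_left)
qed

lemma integrable_simple_levy_exponent:
  assumes g: "levy_simple g"
  shows "integrable N (\<lambda>p. \<Phi> (g p))"
    and "A \<in> sets borel \<Longrightarrow> (CLINT p|N. indicator A p *\<^sub>R \<Phi> (g p)) = (\<Sum>y\<in>range g - {0}. \<Phi> y * of_real (measure N (A \<inter> g -` {y})))"
proof -
  let ?Y = "range g - {0}"
  have finY: "finite ?Y" using g by (simp add: levy_simple_def)
  have sm: "A \<inter> g -` {y} \<in> sets N" "emeasure N (A \<inter> g -` {y}) < \<infinity>" if "y \<in> ?Y" "A \<in> sets borel" for y A
  proof -
    have "A \<inter> g -` {y} \<in> bounded_borel" using that by (intro levy_simple_level[OF g]) auto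
    then show "A \<inter> g -` {y} \<in> sets N" "emeasure N (A \<inter> g -` {y}) < \<infinity>"
      unfolding sets_N by (simp add: bounded_borel_def, rule emeasure_N_bounded)
  qed
  have e: "indicator A p *\<^sub>R \<Phi> (g p) = (\<Sum>y\<in>?Y. indicator (A \<inter> g -` {y}) p *\<^sub>R \<Phi> y)" for A p
  proof (cases "p \<in> A \<and> g p \<noteq> 0")
    case True
    have "(\<Sum>y\<in>?Y. indicator (A \<inter> g -` {y}) p *\<^sub>R \<Phi> y) = (\<Sum>y\<in>?Y. if y = g p then \<Phi> y else 0)"
      using True by (intro sum.cong) (auto simp: indicator_def)
    also have "\<dots> = \<Phi> (g p)" using True finY by (simp add: sum.delta)
    finally show ?thesis using True by simp
  next
    case False
    then have "(\<Sum>y\<in>?Y. indicator (A \<inter> g -` {y}) p *\<^sub>R \<Phi> y) = 0" by (intro sum.neutral) (auto simp: indicator_def)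
    then show ?thesis using False by (auto simp: indicator_def)
  qed
  have i: "integrable N (\<lambda>p. indicator (A \<inter> g -` {y}) p *\<^sub>R \<Phi> y)" if "y \<in> ?Y" "A \<in> sets borel" for A y
    using sm[OF that] by (intro integrable_scaleR_left integrable_real_indicator) auto
  show "integrable N (\<lambda>p. \<Phi> (g p))"
  proof -
    have "integrable N (\<lambda>p. \<Sum>y\<in>?Y. indicator (UNIV \<inter> g -` {y}) p *\<^sub>R \<Phi> y)"
      by (intro Bochner_Integration.integrable_sum i) auto
    then show ?thesis by (simp only: e[symmetric]) simp
  qed
  assume A: "A \<in> sets borel"
  have "(CLINT p|N. indicator A p *\<^sub>R \<Phi> (g p)) = (\<Sum>y\<in>?Y. CLINT p|N. indicator (A \<inter> g -` {y}) p *\<^sub>R \<Phi> y)"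
    unfolding e by (intro Bochner_Integration.integral_sum i A)
  also have "\<dots> = (\<Sum>y\<in>?Y. \<Phi> y * of_real (measure N (A \<inter> g -` {y})))"
  proof (rule sum.cong)
    fix y assume y: "y \<in> ?Y"
    have "(CLINT p|N. indicator (A \<inter> g -` {y}) p *\<^sub>R \<Phi> y) = (LINT p|N. indicator (A \<inter> g -` {y}) p) *\<^sub>R \<Phi> y"
      using sm[OF y A] by (intro integral_scaleR_left integrable_real_indicator) auto
    then show "(CLINT p|N. indicator (A \<inter> g -` {y}) p *\<^sub>R \<Phi> y) = \<Phi> y * of_real (measure N (A \<inter> g -` {y}))"
      by (simp add: scaleR_conv_of_real)
  qed simp
  finally show "(CLINT p|N. indicator A p *\<^sub>R \<Phi> (g p)) = (\<Sum>y\<in>?Y. \<Phi> y * of_real (measure N (A \<inter> g -` {y})))" .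
qed

text \<open>Distinct values are taken on disjoint sets, so the summands are independent.\<close>

lemma lsi_char:
  assumes g: "levy_simple g" and A: "A \<in> sets borel"
  shows "(CLINT \<omega>|M. iexp (lsi A g \<omega>)) = exp (CLINT p|N. indicator A p *\<^sub>R \<Phi> (g p))"
proof -
  let ?Y = "range g - {0}"
  have finY: "finite ?Y" using g by (simp add: levy_simple_def)
  obtain f :: "nat \<Rightarrow> real^'d" and n where f: "bij_betw f {..<n} ?Y"
    using ex_bij_betw_nat_finite[OF finY] by (auto simp: lessThan_atLeast0)
  define B where "B k = (if k < n then A \<inter> g -` {f k} else {})" for k
  have fk: "f k \<in> ?Y" if "k < n" for k using f that by (auto simp: bij_betw_def)
  have Bb: "B k \<in> bounded_borel" for k
    using fk[of k] by (auto simp: B_def intro!: levy_simple_level[OF g _ A])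
  have prod_bound: "disjoint_family B"
    using f by (auto simp: B_def disjoint_family_on_def bij_betw_def inj_on_def)
  have "M.indep_vars (\<lambda>_. borel) (\<lambda>k \<omega>. f k \<bullet> \<Lambda> (B k) \<omega>) (UNIV :: nat set)"
    by (rule M.indep_vars_compose2[OF \<Lambda>_indep]) (use Bb prod_bound in auto)
  then have ind: "M.indep_vars (\<lambda>_. borel) (\<lambda>k \<omega>. f k \<bullet> \<Lambda> (B k) \<omega>) {..<n}"
    by (rule M.indep_vars_subset) auto
  have [measurable]: "\<Lambda> (B k) \<in> borel_measurable M" for k by (rule \<Lambda>_measurable[OF Bb])
  have "lsi A g \<omega> = (\<Sum>k<n. f k \<bullet> \<Lambda> (B k) \<omega>)" for \<omega>
    unfolding levy_simple_integral_def
    by (subst sum.reindex_bij_betw[OF f, symmetric]) (auto simp: B_def intro!: sum.cong)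
  then have "(CLINT \<omega>|M. iexp (lsi A g \<omega>)) = char (distr M borel (\<lambda>\<omega>. \<Sum>k<n. f k \<bullet> \<Lambda> (B k) \<omega>)) 1"
    unfolding char_def by (subst integral_distr) auto
  also have "\<dots> = (\<Prod>k<n. char (distr M borel (\<lambda>\<omega>. f k \<bullet> \<Lambda> (B k) \<omega>)) 1)"
    by (rule M.char_distr_sum[OF ind])
  also have "\<dots> = (\<Prod>k<n. exp (\<Phi> (f k) * of_real (measure N (B k))))"
    unfolding char_def by (intro prod.cong refl, subst integral_distr) (auto simp: \<Lambda>_char[OF Bb])
  also have "\<dots> = exp (\<Sum>k<n. \<Phi> (f k) * of_real (measure N (A \<inter> g -` {f k})))"
    by (simp add: exp_sum[symmetric] B_def)
  also have "(\<Sum>k<n. \<Phi> (f k) * of_real (measure N (A \<inter> g -` {f k}))) = (CLINT p|N. indicator A p *\<^sub>R \<Phi> (g p))"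
    unfolding integrable_simple_levy_exponent(2)[OF g A] by (rule sum.reindex_bij_betw[OF f])
  finally show ?thesis .
qed

section \<open>Square integrable integrands\<close>

lemma cov_bound: "\<exists>C\<ge>0. \<forall>v. cov v v \<le> C * (norm v)\<^sup>2"
proof (intro exI conjI allI)
  fix v
  have "cov v v \<le> norm v * norm (SL *v v)" unfolding cov_def by (rule norm_cauchy_schwarz)
  also have "\<dots> \<le> norm v * (onorm ((*v) SL) * norm v)"
    by (intro mult_left_mono onorm matrix_vector_mul_bounded_linear) auto
  finally show "cov v v \<le> onorm ((*v) SL) * (norm v)\<^sup>2" by (simp add: power2_eq_square mult_ac)
qed (rule onorm_pos_le[OF matrix_vector_mul_bounded_linear])

definition covC where "covC = (SOME C. C \<ge> 0 \<and> (\<forall>v. cov v v \<le> C * (norm v)\<^sup>2))"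

lemma covC: "covC \<ge> 0" "cov v v \<le> covC * (norm v)\<^sup>2"
  using someI_ex[OF cov_bound[unfolded Bex_def]] by (auto simp: covC_def)

lemma levy_exponent_tendsto:
  assumes v: "v \<longlonglongrightarrow> u"
  shows "(\<lambda>n. \<Phi> (v n)) \<longlonglongrightarrow> \<Phi> u"
proof -
  obtain B where B: "\<And>n. norm (v n) \<le> B" using convergent_imp_bounded[OF v] by (auto simp: bounded_iff)
  have "(\<lambda>n. CLINT x|\<nu>. iexp (v n \<bullet> x) - 1 - \<i> * of_real (v n \<bullet> x)) \<longlonglongrightarrow> (CLINT x|\<nu>. iexp (u \<bullet> x) - 1 - \<i> * of_real (u \<bullet> x))"
  proof (rule integral_dominated_convergence[where w="\<lambda>x. B\<^sup>2 * (norm x)\<^sup>2 / 2"])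
    show "integrable \<nu> (\<lambda>x. B\<^sup>2 * (norm x)\<^sup>2 / 2)" using nu2 by auto
    show "AE x in \<nu>. (\<lambda>n. iexp (v n \<bullet> x) - 1 - \<i> * of_real (v n \<bullet> x)) \<longlonglongrightarrow> iexp (u \<bullet> x) - 1 - \<i> * of_real (u \<bullet> x)"
      by (intro AE_I2 tendsto_intros v)
    show "AE x in \<nu>. norm (iexp (v n \<bullet> x) - 1 - \<i> * of_real (v n \<bullet> x)) \<le> B\<^sup>2 * (norm x)\<^sup>2 / 2" for n
    proof (rule AE_I2)
      fix x
      have "\<bar>v n \<bullet> x\<bar> \<le> B * norm x"
        by (rule order_trans[OF inner_le_norms mult_right_mono[OF B]]) auto
      then have "\<bar>v n \<bullet> x\<bar>\<^sup>2 \<le> (B * norm x)\<^sup>2" by (intro power_mono) auto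
      then show "norm (iexp (v n \<bullet> x) - 1 - \<i> * of_real (v n \<bullet> x)) \<le> B\<^sup>2 * (norm x)\<^sup>2 / 2"
        using iexp_remainder1[of "v n \<bullet> x"] by (simp add: power_mult_distrib)
    qed
  qed measurable
  moreover have "(\<lambda>n. v n \<bullet> (Sig *v v n)) \<longlonglongrightarrow> u \<bullet> (Sig *v u)"
    by (intro tendsto_inner v bounded_linear.tendsto[OF matrix_vector_mul_bounded_linear v])
  ultimately show ?thesis unfolding levy_exponent_centred
    by (intro tendsto_add tendsto_divide tendsto_minus tendsto_of_real tendsto_const) auto
qed

abbreviation "L2 g \<equiv> g \<in> borel_measurable borel \<and> integrable N (\<lambda>p. (norm (g p :: real^'d))\<^sup>2)"

lemma L2_lincomb:
  assumes "L2 g" "L2 h"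
  shows "L2 (\<lambda>p. a *\<^sub>R g p + b *\<^sub>R h p)"
proof
  show m: "(\<lambda>p. a *\<^sub>R g p + b *\<^sub>R h p) \<in> borel_measurable borel" using assms by auto
  show "integrable N (\<lambda>p. (norm (a *\<^sub>R g p + b *\<^sub>R h p))\<^sup>2)"
  proof (rule Bochner_Integration.integrable_bound[where f="\<lambda>p. 2 * a\<^sup>2 * (norm (g p))\<^sup>2 + 2 * b\<^sup>2 * (norm (h p))\<^sup>2"])
    show "integrable N (\<lambda>p. 2 * a\<^sup>2 * (norm (g p))\<^sup>2 + 2 * b\<^sup>2 * (norm (h p))\<^sup>2)" using assms by auto
    show "AE p in N. norm ((norm (a *\<^sub>R g p + b *\<^sub>R h p))\<^sup>2) \<le> norm (2 * a\<^sup>2 * (norm (g p))\<^sup>2 + 2 * b\<^sup>2 * (norm (h p))\<^sup>2)"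
    proof (rule AE_I2)
      fix p
      have "(norm (a *\<^sub>R g p + b *\<^sub>R h p))\<^sup>2 \<le> (\<bar>a\<bar> * norm (g p) + \<bar>b\<bar> * norm (h p))\<^sup>2"
        by (intro power_mono order_trans[OF norm_triangle_ineq]) auto
      also have "\<dots> \<le> 2 * (\<bar>a\<bar> * norm (g p))\<^sup>2 + 2 * (\<bar>b\<bar> * norm (h p))\<^sup>2"
        using sum_squares_bound[of "\<bar>a\<bar> * norm (g p)" "\<bar>b\<bar> * norm (h p)"] by (simp add: power2_sum)
      finally show "norm ((norm (a *\<^sub>R g p + b *\<^sub>R h p))\<^sup>2) \<le> norm (2 * a\<^sup>2 * (norm (g p))\<^sup>2 + 2 * b\<^sup>2 * (norm (h p))\<^sup>2)"
        by (simp add: power_mult_distrib mult.assoc)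
    qed
  qed (use m in auto)
qed

lemma integrable_cov:
  assumes "L2 g" "L2 h"
  shows "integrable N (\<lambda>p. cov (g p) (h p))"
proof -
  have [measurable]: "g \<in> borel_measurable borel" "h \<in> borel_measurable borel" using assms by auto
  show ?thesis
proof (rule Bochner_Integration.integrable_bound[where f="\<lambda>p. covC * (norm (g p))\<^sup>2 + covC * (norm (h p))\<^sup>2"])
  show "integrable N (\<lambda>p. covC * (norm (g p))\<^sup>2 + covC * (norm (h p))\<^sup>2)" using assms by auto
  show "AE p in N. norm (cov (g p) (h p)) \<le> norm (covC * (norm (g p))\<^sup>2 + covC * (norm (h p))\<^sup>2)"
  proof (rule AE_I2)
    fix p
    have "\<bar>cov (g p) (h p)\<bar> \<le> sqrt (cov (g p) (g p)) * sqrt (cov (h p) (h p))" by (rule cov_Cauchy_Schwarz)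
    also have "\<dots> \<le> cov (g p) (g p) + cov (h p) (h p)"
    proof -
      have "2 * sqrt x * sqrt y \<le> x + y" if "0 \<le> x" "0 \<le> y" for x y :: real
        using sum_squares_bound[of "sqrt x" "sqrt y"] that by simp
      from this[OF cov_nonneg[of "g p"] cov_nonneg[of "h p"]]
        mult_nonneg_nonneg[OF real_sqrt_ge_zero[OF cov_nonneg[of "g p"]] real_sqrt_ge_zero[OF cov_nonneg[of "h p"]]]
      show ?thesis by linarith
    qed
    also have "\<dots> \<le> covC * (norm (g p))\<^sup>2 + covC * (norm (h p))\<^sup>2" by (intro add_mono covC)
    finally show "norm (cov (g p) (h p)) \<le> norm (covC * (norm (g p))\<^sup>2 + covC * (norm (h p))\<^sup>2)" by simp
  qed
qed measurable
qed

lemma integrable_levy_exponent: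
  assumes "L2 g"
  shows "integrable N (\<lambda>p. \<Phi> (g p))"
proof -
  have [measurable]: "g \<in> borel_measurable borel" using assms by auto
  show ?thesis
proof (rule Bochner_Integration.integrable_bound[OF integrable_cov[OF assms assms]])
  show "AE p in N. norm (\<Phi> (g p)) \<le> norm (cov (g p) (g p))"
  proof (rule AE_I2)
    fix p show "norm (\<Phi> (g p)) \<le> norm (cov (g p) (g p))"
      using norm_levy_exponent_le[of "g p"] cov_nonneg[of "g p"] by simp
  qed
qed measurable
qed

lemma levy_simple_L2:
  assumes g: "levy_simple g"
  shows "L2 g"
proof
  show m[measurable]: "g \<in> borel_measurable borel" using g by (simp add: levy_simple_def)
  let ?S = "{p. g p \<noteq> 0}"
  have S: "?S \<in> bounded_borel" using g m unfolding levy_simple_def by (intro bounded_borelI) measurable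
  obtain B where B: "\<And>p. norm (g p) \<le> B"
    using finite_imp_bounded[of "range g"] g by (auto simp: bounded_iff levy_simple_def)
  show "integrable N (\<lambda>p. (norm (g p))\<^sup>2)"
  proof (rule Bochner_Integration.integrable_bound[where f="\<lambda>p. B\<^sup>2 * indicator ?S p"])
    show "integrable N (\<lambda>p. B\<^sup>2 * indicator ?S p)"
      using S emeasure_N_bounded[OF S] by (intro integrable_mult_right integrable_real_indicator) (auto simp: bounded_borel_def)
    show "AE p in N. norm ((norm (g p))\<^sup>2) \<le> norm (B\<^sup>2 * indicator ?S p)"
      using B by (intro AE_I2) (auto simp: indicator_def power_mono)
  qed measurable
qed

text \<open>An isometry would be exact, but the inequality is enough for completeness, and it is available
before any moment of \<open>Z\<close> is known.\<close>

lemma second_moment_le_of_exponent: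
  assumes [measurable]: "Z \<in> borel_measurable M" and g: "L2 g" and A[measurable]: "A \<in> sets borel"
    and char: "\<And>u. (CLINT \<omega>|M. iexp (u * Z \<omega>)) = exp (CLINT p|N. indicator A p *\<^sub>R \<Phi> (u *\<^sub>R g p))"
  shows "integrable M (\<lambda>\<omega>. (Z \<omega>)\<^sup>2)" "(LINT \<omega>|M. (Z \<omega>)\<^sup>2) \<le> (LINT p|N. cov (g p) (g p))"
proof -
  let ?C = "(LINT p|N. cov (g p) (g p)) / 2"
  have b: "cmod ((CLINT \<omega>|M. iexp (u * Z \<omega>)) - 1) \<le> ?C * u\<^sup>2" for u
  proof -
    have gu: "L2 (\<lambda>p. u *\<^sub>R g p)" using L2_lincomb[OF g g, of u 0] by simp
    have i: "integrable N (\<lambda>p. indicator A p *\<^sub>R \<Phi> (u *\<^sub>R g p))"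
      using integrable_levy_exponent[OF gu] by (intro integrable_mult_indicator) auto
    have "Re (CLINT p|N. indicator A p *\<^sub>R \<Phi> (u *\<^sub>R g p)) \<le> (LINT p|N. 0)"
      unfolding integral_Re[OF i, symmetric]
      using Re_levy_exponent_le by (intro integral_mono integrable_Re i) (auto simp: indicator_def)
    then have "cmod ((CLINT \<omega>|M. iexp (u * Z \<omega>)) - 1) \<le> cmod (CLINT p|N. indicator A p *\<^sub>R \<Phi> (u *\<^sub>R g p))"
      unfolding char by (intro norm_exp_minus_one_le) simp
    also have "\<dots> \<le> (LINT p|N. cmod (indicator A p *\<^sub>R \<Phi> (u *\<^sub>R g p)))" by (rule integral_norm_bound)
    also have "\<dots> \<le> (LINT p|N. u\<^sup>2 * cov (g p) (g p) / 2)"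
    proof (rule integral_mono)
      show "integrable N (\<lambda>p. cmod (indicator A p *\<^sub>R \<Phi> (u *\<^sub>R g p)))" using i by (rule integrable_norm)
      show "integrable N (\<lambda>p. u\<^sup>2 * cov (g p) (g p) / 2)" using integrable_cov[OF g g] by auto
      show "cmod (indicator A p *\<^sub>R \<Phi> (u *\<^sub>R g p)) \<le> u\<^sup>2 * cov (g p) (g p) / 2" for p
        using norm_levy_exponent_le[of "u *\<^sub>R g p"] mult_nonneg_nonneg[OF zero_le_power2[of u] cov_nonneg[of "g p"]]
        by (auto simp: indicator_def cov_scale_left cov_scale_right power2_eq_square mult.assoc)
    qed
    finally show ?thesis by (simp add: mult.commute)
  qed
  show "integrable M (\<lambda>\<omega>. (Z \<omega>)\<^sup>2)" "(LINT \<omega>|M. (Z \<omega>)\<^sup>2) \<le> (LINT p|N. cov (g p) (g p))"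
    using M.second_moment_le_of_char[OF _ b] by auto
qed

lemma lsi_char_scaled:
  assumes g: "levy_simple g" and A: "A \<in> sets borel"
  shows "(CLINT \<omega>|M. iexp (u * lsi A g \<omega>)) = exp (CLINT p|N. indicator A p *\<^sub>R \<Phi> (u *\<^sub>R g p))"
proof -
  have s: "levy_simple (\<lambda>p. u *\<^sub>R g p)" using levy_simple_lincomb[OF g g, of u 0] by simp
  have [measurable]: "lsi A g \<in> borel_measurable M" "lsi A (\<lambda>p. u *\<^sub>R g p) \<in> borel_measurable M"
    using lsi_measurable[OF g A] lsi_measurable[OF s A] .
  have "AE \<omega> in M. lsi A (\<lambda>p. u *\<^sub>R g p) \<omega> = u * lsi A g \<omega>"
    using lsi_lincomb[OF g g A, of u 0] by simp
  then have "(CLINT \<omega>|M. iexp (u * lsi A g \<omega>)) = (CLINT \<omega>|M. iexp (lsi A (\<lambda>p. u *\<^sub>R g p) \<omega>))"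
    by (intro integral_cong_AE) auto
  then show ?thesis using lsi_char[OF s A] by simp
qed

text \<open>Pointwise approximation by simple functions with the domination \<open>2 |g|\<close>, restricted to balls to
make the supports bounded.\<close>

lemma L2_simple_approximation:
  assumes g: "L2 g"
  obtains gn where "\<And>n. levy_simple (gn n)" "\<And>p. (\<lambda>n. gn n p) \<longlonglongrightarrow> g p" "\<And>n p. norm (gn n p) \<le> 2 * norm (g p)"
proof -
  have [measurable]: "g \<in> borel_measurable borel" using g by simp
  obtain F where F: "\<And>i. simple_function borel (F i)" "\<And>x. (\<lambda>i. F i x) \<longlonglongrightarrow> g x" "\<And>i x. dist (F i x) 0 \<le> 2 * dist (g x) 0"
    using borel_measurable_implies_sequence_metric[of g borel 0] by auto
  fix p0 :: "'s \<times> (real^'m)"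
  define gn where "gn n p = indicator (ball p0 (real n)) p *\<^sub>R F n p" for n p
  show ?thesis
  proof (rule that[of gn])
    fix n
    have Fm: "F n \<in> borel_measurable borel" using F(1) by (rule borel_measurable_simple_function)
    show "levy_simple (gn n)" unfolding levy_simple_def
    proof (intro conjI)
      show "gn n \<in> borel_measurable borel" unfolding gn_def[abs_def]
        by (intro borel_measurable_scaleR borel_measurable_indicator Fm) auto
      have "finite (insert 0 (range (F n)))" using F(1)[of n] by (simp add: simple_function_def)
      then show "finite (range (gn n))" by (rule rev_finite_subset) (auto simp: gn_def indicator_def)
      show "bounded {p. gn n p \<noteq> 0}"
        by (rule bounded_subset[of "ball p0 (real n)"]) (auto simp: gn_def indicator_def)
    qed
    show "norm (gn n p) \<le> 2 * norm (g p)" for p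
      using F(3)[of n p] by (auto simp: gn_def indicator_def)
  next
    fix p
    obtain k :: nat where k: "dist p0 p < real k" using reals_Archimedean2 by blast
    have "eventually (\<lambda>n. F n p = gn n p) sequentially"
      by (rule eventually_sequentiallyI[of k]) (use k in \<open>auto simp: gn_def indicator_def\<close>)
    then show "(\<lambda>n. gn n p) \<longlonglongrightarrow> g p" by (rule Lim_transform_eventually[OF F(2)])
  qed
qed

lemma lsi_diff_second_moment:
  assumes g: "levy_simple g" "levy_simple h" and A: "A \<in> sets borel"
  shows "integrable M (\<lambda>\<omega>. (lsi A g \<omega> - lsi A h \<omega>)\<^sup>2)"
    "(LINT \<omega>|M. (lsi A g \<omega> - lsi A h \<omega>)\<^sup>2) \<le> covC * (LINT p|N. (norm (g p - h p))\<^sup>2)"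
proof -
  have d: "levy_simple (\<lambda>p. g p - h p)" using levy_simple_lincomb[OF g, of 1 "-1"] by simp
  note Ld = levy_simple_L2[OF d]
  have [measurable]: "lsi A g \<in> borel_measurable M" "lsi A h \<in> borel_measurable M" "lsi A (\<lambda>p. g p - h p) \<in> borel_measurable M"
    using g d A by (auto intro: lsi_measurable)
  have AE: "AE \<omega> in M. (lsi A (\<lambda>p. g p - h p) \<omega>)\<^sup>2 = (lsi A g \<omega> - lsi A h \<omega>)\<^sup>2"
  proof -
    have "AE \<omega> in M. lsi A (\<lambda>p. g p - h p) \<omega> = lsi A g \<omega> - lsi A h \<omega>"
      using lsi_lincomb[OF g A, of 1 "-1"] by simp
    then show ?thesis by eventually_elim simp
  qed
  note m = second_moment_le_of_exponent[OF _ Ld A lsi_char_scaled[OF d A]]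
  show "integrable M (\<lambda>\<omega>. (lsi A g \<omega> - lsi A h \<omega>)\<^sup>2)"
    using m(1) by (subst integrable_cong_AE[OF _ _ AE, symmetric]) auto
  have "(LINT \<omega>|M. (lsi A g \<omega> - lsi A h \<omega>)\<^sup>2) = (LINT \<omega>|M. (lsi A (\<lambda>p. g p - h p) \<omega>)\<^sup>2)"
    using AE by (intro integral_cong_AE) auto
  also have "\<dots> \<le> (LINT p|N. cov (g p - h p) (g p - h p))" using m(2) by simp
  also have "\<dots> \<le> (LINT p|N. covC * (norm (g p - h p))\<^sup>2)"
    using Ld covC by (intro integral_mono integrable_cov) auto
  finally show "(LINT \<omega>|M. (lsi A g \<omega> - lsi A h \<omega>)\<^sup>2) \<le> covC * (LINT p|N. (norm (g p - h p))\<^sup>2)"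
    by simp
qed

lemma L2_simple_integral_converges:
  assumes g: "L2 g" and gn: "\<And>n. levy_simple (gn n)" "\<And>p. (\<lambda>n. gn n p) \<longlonglongrightarrow> g p" "\<And>n p. norm (gn n p) \<le> 2 * norm (g p)"
    and A: "A \<in> sets borel"
  shows "\<exists>Z\<in>borel_measurable M. tendsto_in_prob M (\<lambda>n. lsi A (gn n)) Z"
proof -
  have [measurable]: "g \<in> borel_measurable borel" using g by simp
  have gm[measurable]: "gn n \<in> borel_measurable borel" for n using gn(1)[of n] by (simp add: levy_simple_def)
  have lm[measurable]: "lsi A (gn n) \<in> borel_measurable M" for n by (rule lsi_measurable[OF gn(1) A])
  define a where "a n = (LINT p|N. (norm (gn n p - g p))\<^sup>2)" for n
  have Lgn: "L2 (gn n)" for n using levy_simple_L2[OF gn(1)] .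
  have Ld: "L2 (\<lambda>p. gn n p - g p)" for n using L2_lincomb[OF Lgn g, of 1 n "-1"] by simp
  have "a \<longlonglongrightarrow> (LINT p|N. 0)" unfolding a_def[abs_def]
  proof (rule integral_dominated_convergence[where w="\<lambda>p. 9 * (norm (g p))\<^sup>2"])
    show "integrable N (\<lambda>p. 9 * (norm (g p))\<^sup>2)" using g by auto
    show "AE p in N. (\<lambda>n. (norm (gn n p - g p))\<^sup>2) \<longlonglongrightarrow> 0"
    proof (rule AE_I2)
      fix p
      have "(\<lambda>n. (norm (gn n p - g p))\<^sup>2) \<longlonglongrightarrow> (norm (g p - g p))\<^sup>2" by (intro tendsto_intros gn)
      then show "(\<lambda>n. (norm (gn n p - g p))\<^sup>2) \<longlonglongrightarrow> 0" by simp
    qed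
    show "AE p in N. norm ((norm (gn n p - g p))\<^sup>2) \<le> 9 * (norm (g p))\<^sup>2" for n
    proof (rule AE_I2)
      fix p
      have "norm (gn n p - g p) \<le> 3 * norm (g p)"
        using norm_triangle_ineq4[of "gn n p" "g p"] gn(3)[of n p] by linarith
      then have "(norm (gn n p - g p))\<^sup>2 \<le> (3 * norm (g p))\<^sup>2" by (intro power_mono) auto
      then show "norm ((norm (gn n p - g p))\<^sup>2) \<le> 9 * (norm (g p))\<^sup>2" by (simp add: power_mult_distrib)
    qed
  qed measurable
  then have alim: "a \<longlonglongrightarrow> 0" by simp
  have bound: "(LINT \<omega>|M. (lsi A (gn n) \<omega> - lsi A (gn m) \<omega>)\<^sup>2) \<le> 2 * covC * (a n + a m)" for n m
  proof -
    have "(LINT p|N. (norm (gn n p - gn m p))\<^sup>2) \<le> (LINT p|N. 2 * (norm (gn n p - g p))\<^sup>2 + 2 * (norm (gn m p - g p))\<^sup>2)"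
    proof (rule integral_mono)
      show "integrable N (\<lambda>p. (norm (gn n p - gn m p))\<^sup>2)"
        using L2_lincomb[OF Lgn[of n] Lgn[of m], of 1 "-1"] by simp
      show "integrable N (\<lambda>p. 2 * (norm (gn n p - g p))\<^sup>2 + 2 * (norm (gn m p - g p))\<^sup>2)" using Ld by auto
      fix p
      have "norm (gn n p - gn m p) \<le> norm (gn n p - g p) + norm (gn m p - g p)"
        using norm_triangle_ineq4[of "gn n p - g p" "gn m p - g p"] by simp
      then have "(norm (gn n p - gn m p))\<^sup>2 \<le> (norm (gn n p - g p) + norm (gn m p - g p))\<^sup>2" by (intro power_mono) auto
      then show "(norm (gn n p - gn m p))\<^sup>2 \<le> 2 * (norm (gn n p - g p))\<^sup>2 + 2 * (norm (gn m p - g p))\<^sup>2"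
        using sum_squares_bound[of "norm (gn n p - g p)" "norm (gn m p - g p)"] by (simp add: power2_sum)
    qed
    also have "\<dots> = 2 * (a n + a m)" unfolding a_def using Ld by simp
    finally have "covC * (LINT p|N. (norm (gn n p - gn m p))\<^sup>2) \<le> covC * (2 * (a n + a m))"
      using covC(1) by (rule mult_left_mono)
    from order_trans[OF lsi_diff_second_moment(2)[OF gn(1)[of n] gn(1)[of m] A] this]
    show ?thesis by (simp add: algebra_simps)
  qed
  have "\<exists>Z'\<in>borel_measurable M. (\<forall>n. integrable M (\<lambda>\<omega>. (lsi A (gn n) \<omega> - Z' \<omega>)\<^sup>2)) \<and>
      (\<lambda>n. LINT \<omega>|M. (lsi A (gn n) \<omega> - Z' \<omega>)\<^sup>2) \<longlonglongrightarrow> 0"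
  proof (rule L2_complete)
    show "finite_measure M" by (rule M.finite_measure_axioms)
    show "integrable M (\<lambda>\<omega>. (lsi A (gn n) \<omega> - lsi A (gn m) \<omega>)\<^sup>2)" for n m by (rule lsi_diff_second_moment[OF gn(1) gn(1) A])
    fix e :: real assume e: "e > 0"
    have "(\<lambda>n. 4 * covC * a n) \<longlonglongrightarrow> 4 * covC * 0" by (intro tendsto_intros alim)
    then have "eventually (\<lambda>n. 4 * covC * a n < e) sequentially" using e by (intro order_tendstoD) auto
    then obtain K where K: "\<And>n. n \<ge> K \<Longrightarrow> 4 * covC * a n < e" by (auto simp: eventually_sequentially)
    show "\<exists>K. \<forall>n\<ge>K. \<forall>m\<ge>K. (LINT \<omega>|M. (lsi A (gn n) \<omega> - lsi A (gn m) \<omega>)\<^sup>2) \<le> e"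
    proof (intro exI[of _ K] allI impI)
      fix n m assume "K \<le> n" "K \<le> m"
      then have "4 * covC * a n < e" "4 * covC * a m < e" by (auto intro: K)
      then show "(LINT \<omega>|M. (lsi A (gn n) \<omega> - lsi A (gn m) \<omega>)\<^sup>2) \<le> e"
        using bound[of n m] by (simp add: algebra_simps)
    qed
  qed (rule lm)
  then obtain Z' where Z': "Z' \<in> borel_measurable M" "\<And>n. integrable M (\<lambda>\<omega>. (lsi A (gn n) \<omega> - Z' \<omega>)\<^sup>2)"
      "(\<lambda>n. LINT \<omega>|M. (lsi A (gn n) \<omega> - Z' \<omega>)\<^sup>2) \<longlonglongrightarrow> 0" by blast
  then show ?thesis by (intro bexI[of _ Z'] M.tendsto_in_prob_L2 lm) auto
qed

abbreviation "has_int \<equiv> has_levy_integral M \<Lambda> N"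

theorem has_int_exists:
  assumes g: "L2 g"
  shows "\<exists>Z. has_int g Z"
proof -
  obtain gn where gn: "\<And>n. levy_simple (gn n)" "\<And>p. (\<lambda>n. gn n p) \<longlonglongrightarrow> g p" "\<And>n p. norm (gn n p) \<le> 2 * norm (g p)"
    using L2_simple_approximation[OF g] by metis
  note conv = L2_simple_integral_converges[OF g gn]
  obtain Z where "Z \<in> borel_measurable M" "tendsto_in_prob M (\<lambda>n. lsi UNIV (gn n)) Z"
    using conv[of UNIV] by auto
  then have "has_int g Z"
    unfolding has_levy_integral_def using gn(1,2) conv by (intro conjI exI[of _ gn]) auto
  then show ?thesis by blast
qed

lemma has_int_measurable: "has_int g Z \<Longrightarrow> Z \<in> borel_measurable M"
  by (simp add: has_levy_integral_def)

lemma has_int_lincomb: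
  assumes g: "has_int g Z" and h: "has_int h W"
  shows "has_int (\<lambda>p. a *\<^sub>R g p + b *\<^sub>R h p) (\<lambda>\<omega>. a * Z \<omega> + b * W \<omega>)"
proof -
  have [measurable]: "Z \<in> borel_measurable M" "W \<in> borel_measurable M"
    using g h by (auto simp: has_int_measurable)
  obtain gn where gn: "\<And>n. levy_simple (gn n)" "AE p in N. (\<lambda>n. gn n p) \<longlonglongrightarrow> g p"
    "\<And>A. A \<in> sets borel \<Longrightarrow> \<exists>Z\<in>borel_measurable M. tendsto_in_prob M (\<lambda>n. lsi A (gn n)) Z"
    "tendsto_in_prob M (\<lambda>n. lsi UNIV (gn n)) Z"
    using g unfolding has_levy_integral_def by blast
  obtain hn where hn: "\<And>n. levy_simple (hn n)" "AE p in N. (\<lambda>n. hn n p) \<longlonglongrightarrow> h p"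
    "\<And>A. A \<in> sets borel \<Longrightarrow> \<exists>Z\<in>borel_measurable M. tendsto_in_prob M (\<lambda>n. lsi A (hn n)) Z"
    "tendsto_in_prob M (\<lambda>n. lsi UNIV (hn n)) W"
    using h unfolding has_levy_integral_def by blast
  let ?k = "\<lambda>n p. a *\<^sub>R gn n p + b *\<^sub>R hn n p"
  have k: "levy_simple (?k n)" for n by (intro levy_simple_lincomb gn hn)
  have lim: "tendsto_in_prob M (\<lambda>n. lsi A (?k n)) (\<lambda>\<omega>. a * Z\<^sub>A \<omega> + b * W\<^sub>A \<omega>)"
    if A: "A \<in> sets borel" and m[measurable]: "Z\<^sub>A \<in> borel_measurable M" "W\<^sub>A \<in> borel_measurable M"
     and t: "tendsto_in_prob M (\<lambda>n. lsi A (gn n)) Z\<^sub>A" "tendsto_in_prob M (\<lambda>n. lsi A (hn n)) W\<^sub>A" for A Z\<^sub>A W\<^sub>A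
  proof -
    have [measurable]: "lsi A (gn n) \<in> borel_measurable M" "lsi A (hn n) \<in> borel_measurable M" "lsi A (?k n) \<in> borel_measurable M" for n
      using gn(1) hn(1) k A by (auto intro: lsi_measurable)
    have "tendsto_in_prob M (\<lambda>n \<omega>. a * lsi A (gn n) \<omega> + b * lsi A (hn n) \<omega>) (\<lambda>\<omega>. a * Z\<^sub>A \<omega> + b * W\<^sub>A \<omega>)"
      by (intro M.tendsto_in_prob_add tendsto_in_prob_cmult t) auto
    then show ?thesis
    proof (rule tendsto_in_prob_cong[rotated -1])
      fix n
      show "AE \<omega> in M. a * lsi A (gn n) \<omega> + b * lsi A (hn n) \<omega> = lsi A (?k n) \<omega>"
        using lsi_lincomb[OF gn(1)[of n] hn(1)[of n] A, of a b] by eventually_elim simp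
    qed auto
  qed
  show ?thesis unfolding has_levy_integral_def
  proof (intro conjI exI[of _ ?k] allI ballI k)
    show "AE p in N. (\<lambda>n. ?k n p) \<longlonglongrightarrow> a *\<^sub>R g p + b *\<^sub>R h p"
      using gn(2) hn(2) by eventually_elim (intro tendsto_intros)
    show "tendsto_in_prob M (\<lambda>n. lsi UNIV (?k n)) (\<lambda>\<omega>. a * Z \<omega> + b * W \<omega>)"
      by (rule lim) (use gn(4) hn(4) in auto)
    fix A :: "('s \<times> (real^'m)) set" assume A: "A \<in> sets borel"
    obtain Z\<^sub>A where Z\<^sub>A: "Z\<^sub>A \<in> borel_measurable M" "tendsto_in_prob M (\<lambda>n. lsi A (gn n)) Z\<^sub>A" using gn(3)[OF A] by blast
    obtain W\<^sub>A where W\<^sub>A: "W\<^sub>A \<in> borel_measurable M" "tendsto_in_prob M (\<lambda>n. lsi A (hn n)) W\<^sub>A" using hn(3)[OF A] by blast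
    show "\<exists>Z\<^sub>A\<in>borel_measurable M. tendsto_in_prob M (\<lambda>n. lsi A (?k n)) Z\<^sub>A"
      by (intro bexI[of _ "\<lambda>\<omega>. a * Z\<^sub>A \<omega> + b * W\<^sub>A \<omega>"] lim[OF A Z\<^sub>A(1) W\<^sub>A(1) Z\<^sub>A(2) W\<^sub>A(2)]
          borel_measurable_add borel_measurable_times borel_measurable_const Z\<^sub>A(1) W\<^sub>A(1))
  qed measurable
qed

text \<open>The field is only given as a version of the integral.\<close>

lemma has_int_cong_AE:
  assumes g: "has_int g Z" and Z: "AE \<omega> in M. Z \<omega> = Z' \<omega>" and [measurable]: "Z' \<in> borel_measurable M"
  shows "has_int g Z'"
proof -
  have [measurable]: "Z \<in> borel_measurable M" using g by (simp add: has_int_measurable)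
  obtain gn where gn: "\<And>n. levy_simple (gn n)" "AE p in N. (\<lambda>n. gn n p) \<longlonglongrightarrow> g p"
    "\<And>A. A \<in> sets borel \<Longrightarrow> \<exists>Z\<in>borel_measurable M. tendsto_in_prob M (\<lambda>n. lsi A (gn n)) Z"
    "tendsto_in_prob M (\<lambda>n. lsi UNIV (gn n)) Z"
    using g unfolding has_levy_integral_def by blast
  have [measurable]: "lsi UNIV (gn n) \<in> borel_measurable M" for n by (rule lsi_measurable[OF gn(1)]) simp
  have "tendsto_in_prob M (\<lambda>n. lsi UNIV (gn n)) Z'"
    by (rule tendsto_in_prob_cong[OF _ _ _ _ _ Z gn(4)]) auto
  then show ?thesis unfolding has_levy_integral_def using gn by (intro conjI exI[of _ gn]) auto
qed

text \<open>The uniqueness of the stochastic integral: simple functions that tend to zero almost everywhere and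
whose integrals converge over every Borel set have integrals that tend to zero. For each \<open>t\<close> the
functions \<open>\<Phi>(t d\<^sub>n)\<close> satisfy the hypotheses of \<open>gliding_hump\<close>, hence the limit has characteristic
function 1.\<close>

lemma levy_simple_diff_tendsto_zero:
  assumes d: "\<And>n. levy_simple (d n)" and d0: "AE p in N. (\<lambda>n. d n p) \<longlonglongrightarrow> 0"
    and conv: "\<And>A. A \<in> sets borel \<Longrightarrow> \<exists>Z\<in>borel_measurable M. tendsto_in_prob M (\<lambda>n. lsi A (d n)) Z"
    and D: "D \<in> borel_measurable M" "tendsto_in_prob M (\<lambda>n. lsi UNIV (d n)) D"
  shows "AE \<omega> in M. D \<omega> = 0"
proof -
  have [measurable]: "D \<in> borel_measurable M" by (rule D)
  have lm[measurable]: "lsi A (d n) \<in> borel_measurable M" if "A \<in> sets borel" for n A by (rule lsi_measurable[OF d that])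
  have dt: "levy_simple (\<lambda>p. t *\<^sub>R d n p)" for t n using levy_simple_lincomb[OF d d, of t n 0 n] by simp
  fix p0 :: "'s \<times> (real^'m)"
  have "(CLINT \<omega>|M. iexp (t * D \<omega>)) = 1" for t
  proof -
    have lim: "(\<lambda>n. exp (CLINT p|N. indicator A p *\<^sub>R \<Phi> (t *\<^sub>R d n p))) \<longlonglongrightarrow> (CLINT \<omega>|M. iexp (t * Z \<omega>))"
      if A: "A \<in> sets borel" and [measurable]: "Z \<in> borel_measurable M" and Z: "tendsto_in_prob M (\<lambda>n. lsi A (d n)) Z" for A Z
      unfolding lsi_char_scaled[OF d A, symmetric]
      by (intro M.tendsto_in_prob_char tendsto_in_prob_cmult Z) (use A in measurable)
    have "(\<lambda>n. exp (CLINT p|N. \<Phi> (t *\<^sub>R d n p))) \<longlonglongrightarrow> 1"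
    proof (rule gliding_hump[where K="\<lambda>k. cball p0 (real k)"])
      show "integrable N (\<lambda>p. \<Phi> (t *\<^sub>R d n p))" for n by (rule integrable_simple_levy_exponent[OF dt])
      show "AE p in N. (\<lambda>n. \<Phi> (t *\<^sub>R d n p)) \<longlonglongrightarrow> 0"
        using d0
      proof eventually_elim
        case (elim p)
        have "(\<lambda>n. \<Phi> (t *\<^sub>R d n p)) \<longlonglongrightarrow> \<Phi> (t *\<^sub>R 0)" by (intro levy_exponent_tendsto tendsto_intros elim)
        then show ?case by simp
      qed
      show "incseq (\<lambda>k. cball p0 (real k))" by (auto simp: incseq_def)
      show "cball p0 (real k) \<in> sets N" for k by (simp only: sets_N) simp
      show "emeasure N (cball p0 (real k)) < \<infinity>" for k by (intro emeasure_N_bounded bounded_borelI) auto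
      show "(\<Union>k. cball p0 (real k)) = space N" using real_arch_simple by auto
      fix A assume "A \<in> sets N"
      then have A: "A \<in> sets borel" by (simp only: sets_N)
      obtain Z where "Z \<in> borel_measurable M" "tendsto_in_prob M (\<lambda>n. lsi A (d n)) Z" using conv[OF A] by blast
      from lim[OF A this] show "convergent (\<lambda>n. exp (CLINT p|N. indicator A p *\<^sub>R \<Phi> (t *\<^sub>R d n p)))"
        by (rule convergentI)
    qed
    moreover have "(\<lambda>n. exp (CLINT p|N. \<Phi> (t *\<^sub>R d n p))) \<longlonglongrightarrow> (CLINT \<omega>|M. iexp (t * D \<omega>))"
      using lim[OF _ D] by simp
    ultimately show ?thesis using LIMSEQ_unique by blast
  qed
  \<comment> \<open>the second moment bound with constant 0 shows that \<open>D\<close> vanishes\<close>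
  then have b: "cmod ((CLINT \<omega>|M. iexp (u * D \<omega>)) - 1) \<le> 0 * u\<^sup>2" for u by simp
  have "integrable M (\<lambda>\<omega>. (D \<omega>)\<^sup>2)" "(LINT \<omega>|M. (D \<omega>)\<^sup>2) \<le> 0"
    using M.second_moment_le_of_char[OF _ b] by auto
  moreover have "0 \<le> (LINT \<omega>|M. (D \<omega>)\<^sup>2)" by (intro integral_nonneg_AE) auto
  ultimately have "AE \<omega> in M. (D \<omega>)\<^sup>2 = 0"
    by (subst integral_nonneg_eq_0_iff_AE[symmetric]) auto
  then show ?thesis by simp
qed

text \<open>For the dominated approximating sequence \<open>gn\<close> the formula passes to the limit. The sequence \<open>hn\<close>
in the definition of the integral is arbitrary, but \<open>levy_simple_diff_tendsto_zero\<close> applies to the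
differences.\<close>

theorem has_int_char:
  assumes g: "L2 g" and Z: "has_int g Z"
  shows "(CLINT \<omega>|M. iexp (Z \<omega>)) = exp (CLINT p|N. \<Phi> (g p))"
proof -
  have [measurable]: "Z \<in> borel_measurable M" using Z by (simp add: has_int_measurable)
  have gmeas[measurable]: "g \<in> borel_measurable borel" using g by simp
  obtain hn where hn: "\<And>n. levy_simple (hn n)" "AE p in N. (\<lambda>n. hn n p) \<longlonglongrightarrow> g p"
    "\<And>A. A \<in> sets borel \<Longrightarrow> \<exists>Z\<in>borel_measurable M. tendsto_in_prob M (\<lambda>n. lsi A (hn n)) Z"
    "tendsto_in_prob M (\<lambda>n. lsi UNIV (hn n)) Z"
    using Z unfolding has_levy_integral_def by blast
  obtain gn where gn: "\<And>n. levy_simple (gn n)" "\<And>p. (\<lambda>n. gn n p) \<longlonglongrightarrow> g p" "\<And>n p. norm (gn n p) \<le> 2 * norm (g p)"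
    using L2_simple_approximation[OF g] by metis
  note conv = L2_simple_integral_converges[OF g gn]
  have [measurable]: "gn n \<in> borel_measurable borel" for n using gn(1)[of n] by (simp add: levy_simple_def)
  obtain Z' where [measurable]: "Z' \<in> borel_measurable M" and Z': "tendsto_in_prob M (\<lambda>n. lsi UNIV (gn n)) Z'"
    using conv[of UNIV] by auto
  let ?d = "\<lambda>n p. 1 *\<^sub>R hn n p + (-1) *\<^sub>R gn n p"
  have d: "levy_simple (?d n)" for n by (intro levy_simple_lincomb gn hn)
  have lim: "tendsto_in_prob M (\<lambda>n. lsi A (?d n)) (\<lambda>\<omega>. 1 * Z\<^sub>A \<omega> + (-1) * W\<^sub>A \<omega>)"
    if A: "A \<in> sets borel" and m[measurable]: "Z\<^sub>A \<in> borel_measurable M" "W\<^sub>A \<in> borel_measurable M"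
     and t: "tendsto_in_prob M (\<lambda>n. lsi A (hn n)) Z\<^sub>A" "tendsto_in_prob M (\<lambda>n. lsi A (gn n)) W\<^sub>A" for A Z\<^sub>A W\<^sub>A
  proof -
    have mm[measurable]: "lsi A (hn n) \<in> borel_measurable M" "lsi A (gn n) \<in> borel_measurable M" "lsi A (?d n) \<in> borel_measurable M" for n
      using gn(1) hn(1) d A by (auto intro: lsi_measurable)
    have "tendsto_in_prob M (\<lambda>n \<omega>. 1 * lsi A (hn n) \<omega> + (-1) * lsi A (gn n) \<omega>) (\<lambda>\<omega>. 1 * Z\<^sub>A \<omega> + (-1) * W\<^sub>A \<omega>)"
      by (intro M.tendsto_in_prob_add tendsto_in_prob_cmult t) measurable
    then show ?thesis
    proof (rule tendsto_in_prob_cong[rotated -1])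
      fix n
      show "AE \<omega> in M. 1 * lsi A (hn n) \<omega> + (-1) * lsi A (gn n) \<omega> = lsi A (?d n) \<omega>"
        using lsi_lincomb[OF hn(1)[of n] gn(1)[of n] A, of 1 "-1"] by eventually_elim simp
    qed (intro mm borel_measurable_add borel_measurable_times borel_measurable_const m AE_I2 refl)+
  qed
  have "AE \<omega> in M. 1 * Z \<omega> + (-1) * Z' \<omega> = 0"
  proof (rule levy_simple_diff_tendsto_zero[OF d])
    show "AE p in N. (\<lambda>n. ?d n p) \<longlonglongrightarrow> 0"
      using hn(2)
    proof eventually_elim
      case (elim p)
      have "(\<lambda>n. ?d n p) \<longlonglongrightarrow> 1 *\<^sub>R g p + (-1) *\<^sub>R g p" by (intro tendsto_intros elim gn)
      then show ?case by simp
    qed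
    fix A :: "('s \<times> (real^'m)) set" assume A: "A \<in> sets borel"
    obtain Z\<^sub>A where Z\<^sub>A: "Z\<^sub>A \<in> borel_measurable M" "tendsto_in_prob M (\<lambda>n. lsi A (hn n)) Z\<^sub>A" using hn(3)[OF A] by blast
    obtain W\<^sub>A where W\<^sub>A: "W\<^sub>A \<in> borel_measurable M" "tendsto_in_prob M (\<lambda>n. lsi A (gn n)) W\<^sub>A" using conv[OF A] by blast
    show "\<exists>Z\<in>borel_measurable M. tendsto_in_prob M (\<lambda>n. lsi A (?d n)) Z"
      by (intro bexI[of _ "\<lambda>\<omega>. 1 * Z\<^sub>A \<omega> + (-1) * W\<^sub>A \<omega>"] lim[OF A Z\<^sub>A(1) W\<^sub>A(1) Z\<^sub>A(2) W\<^sub>A(2)]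
          borel_measurable_add borel_measurable_times borel_measurable_const Z\<^sub>A(1) W\<^sub>A(1))
  next
    show "tendsto_in_prob M (\<lambda>n. lsi UNIV (?d n)) (\<lambda>\<omega>. 1 * Z \<omega> + (-1) * Z' \<omega>)"
      by (rule lim) (use hn(4) Z' in auto)
  qed measurable
  then have ZZ': "AE \<omega> in M. Z \<omega> = Z' \<omega>" by simp
  have Philim: "(\<lambda>n. CLINT p|N. \<Phi> (gn n p)) \<longlonglongrightarrow> (CLINT p|N. \<Phi> (g p))"
  proof (rule integral_dominated_convergence[where w="\<lambda>p. 2 * covC * (norm (g p))\<^sup>2"])
    show "integrable N (\<lambda>p. 2 * covC * (norm (g p))\<^sup>2)" using g by auto
    show "AE p in N. (\<lambda>n. \<Phi> (gn n p)) \<longlonglongrightarrow> \<Phi> (g p)" by (intro AE_I2 levy_exponent_tendsto gn)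
    show "AE p in N. cmod (\<Phi> (gn n p)) \<le> 2 * covC * (norm (g p))\<^sup>2" for n
    proof (rule AE_I2)
      fix p
      have "cmod (\<Phi> (gn n p)) \<le> covC * (norm (gn n p))\<^sup>2 / 2"
        using norm_levy_exponent_le[of "gn n p"] covC(2)[of "gn n p"] by simp
      also have "\<dots> \<le> covC * (2 * norm (g p))\<^sup>2 / 2"
        using covC(1) gn(3) by (intro divide_right_mono mult_left_mono power_mono) auto
      finally show "cmod (\<Phi> (gn n p)) \<le> 2 * covC * (norm (g p))\<^sup>2" by (simp add: power_mult_distrib)
    qed
  qed measurable
  have [measurable]: "lsi UNIV (gn n) \<in> borel_measurable M" for n by (rule lsi_measurable[OF gn(1)]) simp
  have "(\<lambda>n. CLINT \<omega>|M. iexp (lsi UNIV (gn n) \<omega>)) \<longlonglongrightarrow> (CLINT \<omega>|M. iexp (Z' \<omega>))"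
    by (intro M.tendsto_in_prob_char Z') measurable
  moreover have "(CLINT \<omega>|M. iexp (lsi UNIV (gn n) \<omega>)) = exp (CLINT p|N. \<Phi> (gn n p))" for n
    using lsi_char[OF gn(1), of UNIV n] by simp
  ultimately have "(\<lambda>n. exp (CLINT p|N. \<Phi> (gn n p))) \<longlonglongrightarrow> (CLINT \<omega>|M. iexp (Z' \<omega>))" by (simp only:)
  then have "(CLINT \<omega>|M. iexp (Z' \<omega>)) = exp (CLINT p|N. \<Phi> (g p))"
    by (rule LIMSEQ_unique) (rule tendsto_exp[OF Philim])
  moreover have "(CLINT \<omega>|M. iexp (Z \<omega>)) = (CLINT \<omega>|M. iexp (Z' \<omega>))"
    using ZZ' by (intro integral_cong_AE) auto
  ultimately show ?thesis by simp
qed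

end

section \<open>Second and fourth moments of stochastic integrals\<close>

text \<open>A product of four numbers as a combination of fourth powers. The sum over the signs annihilates all
monomials in which one of \<open>z2\<close>, \<open>z3\<close>, \<open>z4\<close> has an even exponent.\<close>

lemma polarization4:
  fixes z1 z2 z3 z4 :: real
  shows "192 * (z1 * z2 * z3 * z4) =
    (\<Sum>a\<in>{1,-1}. \<Sum>b\<in>{1,-1}. \<Sum>c\<in>{1,-1}. a * b * c * (z1 + a * z2 + b * z3 + c * z4) ^ 4)"
  by (simp add: eval_nat_numeral) algebra

text \<open>The same combination applied to the square of a quadratic form, with \<open>c\<^sub>i\<^sub>j\<close> the entries of its
matrix, leaves the three pairings.\<close>

lemma polarization22:
  fixes c11 c22 c33 c44 c12 c13 c14 c23 c24 c34 :: real
  shows "64 * (c12 * c34 + c13 * c24 + c14 * c23) =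
    (\<Sum>a\<in>{1,-1}. \<Sum>b\<in>{1,-1}. \<Sum>c\<in>{1,-1}. a * b * c *
      (c11 + c22 + c33 + c44 + 2 * a * c12 + 2 * b * c13 + 2 * c * c14 + 2 * a * b * c23 + 2 * a * c * c24 + 2 * b * c * c34)\<^sup>2)"
  by (simp add: eval_nat_numeral) algebra

lemma integral_triple_sum:
  fixes F :: "real \<Rightarrow> real \<Rightarrow> real \<Rightarrow> 'a \<Rightarrow> real"
  assumes "\<And>a b c. integrable L (F a b c)"
  shows "(LINT x|L. (\<Sum>a\<in>A. \<Sum>b\<in>A. \<Sum>c\<in>A. a * b * c * F a b c x)) = (\<Sum>a\<in>A. \<Sum>b\<in>A. \<Sum>c\<in>A. a * b * c * (LINT x|L. F a b c x))"
  using assms by simp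

lemma abs_mult4_le: "\<bar>a * b * c * d\<bar> \<le> a ^ 4 + b ^ 4 + c ^ 4 + d ^ 4" for a b c d :: real
proof -
  have 2: "\<bar>x * y\<bar> \<le> x\<^sup>2 / 2 + y\<^sup>2 / 2" for x y :: real
    using sum_squares_bound[of "\<bar>x\<bar>" "\<bar>y\<bar>"] by (simp add: abs_mult)
  have p4: "0 \<le> x ^ 4" for x :: real by simp
  have "\<bar>a * b * c * d\<bar> = \<bar>(a * b) * (c * d)\<bar>" by (simp add: mult_ac)
  also have "\<dots> \<le> (a * b)\<^sup>2 / 2 + (c * d)\<^sup>2 / 2" by (rule 2)
  also have "\<dots> = (a\<^sup>2 * b\<^sup>2) / 2 + (c\<^sup>2 * d\<^sup>2) / 2" by (simp add: power_mult_distrib)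
  also have "a\<^sup>2 * b\<^sup>2 \<le> (a\<^sup>2)\<^sup>2 / 2 + (b\<^sup>2)\<^sup>2 / 2" using 2[of "a\<^sup>2" "b\<^sup>2"] by simp
  also have "c\<^sup>2 * d\<^sup>2 \<le> (c\<^sup>2)\<^sup>2 / 2 + (d\<^sup>2)\<^sup>2 / 2" using 2[of "c\<^sup>2" "d\<^sup>2"] by simp
  also have "((a\<^sup>2)\<^sup>2 / 2 + (b\<^sup>2)\<^sup>2 / 2) / 2 + ((c\<^sup>2)\<^sup>2 / 2 + (d\<^sup>2)\<^sup>2 / 2) / 2 \<le> a ^ 4 + b ^ 4 + c ^ 4 + d ^ 4"
  proof -
    have e: "(x\<^sup>2)\<^sup>2 = x ^ 4" for x :: real by simp
    show ?thesis unfolding e using p4[of a] p4[of b] p4[of c] p4[of d] by argo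
  qed
  finally show ?thesis by (simp add: divide_right_mono)
qed

context centred_levy_basis
begin

definition k4 where "k4 a b c d = (LINT x|\<nu>. (a \<bullet> x) * (b \<bullet> x) * (c \<bullet> x) * (d \<bullet> x))"

lemma integrable_inner_mult4: "integrable \<nu> (\<lambda>x. (a \<bullet> x) * (b \<bullet> x) * (c \<bullet> x) * (d \<bullet> x))"
proof (rule Bochner_Integration.integrable_bound[where f="\<lambda>x. (a \<bullet> x) ^ 4 + (b \<bullet> x) ^ 4 + (c \<bullet> x) ^ 4 + (d \<bullet> x) ^ 4"])
  show "integrable \<nu> (\<lambda>x. (a \<bullet> x) ^ 4 + (b \<bullet> x) ^ 4 + (c \<bullet> x) ^ 4 + (d \<bullet> x) ^ 4)"
    by (intro Bochner_Integration.integrable_add integrable_inner_power) auto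
  show "AE x in \<nu>. norm ((a \<bullet> x) * (b \<bullet> x) * (c \<bullet> x) * (d \<bullet> x)) \<le> norm ((a \<bullet> x) ^ 4 + (b \<bullet> x) ^ 4 + (c \<bullet> x) ^ 4 + (d \<bullet> x) ^ 4)"
    unfolding real_norm_def by (intro AE_I2 order_trans[OF abs_mult4_le] abs_ge_self)
qed measurable

lemma measurable_k4[measurable]:
  assumes [measurable]: "f1 \<in> borel_measurable L" "f2 \<in> borel_measurable L" "f3 \<in> borel_measurable L" "f4 \<in> borel_measurable L"
  shows "(\<lambda>p. k4 (f1 p) (f2 p) (f3 p) (f4 p)) \<in> borel_measurable L"
  unfolding k4_def by measurable

lemma c4_nonneg: "0 \<le> c4 v" unfolding c4_def by (intro integral_nonneg_AE) auto

definition "m4 = (LINT x|\<nu>. norm x ^ 4)"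
definition "m3 = (LINT x|\<nu>. norm x ^ 3)"

lemma c4_le: "c4 v \<le> m4 * norm v ^ 4" and abs_c3_le: "\<bar>c3 v\<bar> \<le> m3 * norm v ^ 3"
proof -
  have "c4 v \<le> (LINT x|\<nu>. norm v ^ 4 * norm x ^ 4)"
    unfolding c4_def
  proof (intro integral_mono integrable_inner_power)
    show "(v \<bullet> x) ^ 4 \<le> norm v ^ 4 * norm x ^ 4" for x
      using power_mono[OF inner_le_norms, of v x 4] by (simp add: power_mult_distrib power_even_abs_numeral)
  qed (use nu4 in auto)
  then show "c4 v \<le> m4 * norm v ^ 4" by (simp add: m4_def mult.commute)
  have "\<bar>c3 v\<bar> \<le> (LINT x|\<nu>. \<bar>(v \<bullet> x) ^ 3\<bar>)" unfolding c3_def by (rule integral_abs_bound)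
  also have "\<dots> \<le> (LINT x|\<nu>. norm v ^ 3 * norm x ^ 3)"
  proof (intro integral_mono integrable_abs integrable_inner_power)
    show "\<bar>(v \<bullet> x) ^ 3\<bar> \<le> norm v ^ 3 * norm x ^ 3" for x
      using power_mono[OF inner_le_norms, of v x 3] by (simp add: power_mult_distrib power_abs)
  qed (use nu3 in auto)
  finally show "\<bar>c3 v\<bar> \<le> m3 * norm v ^ 3" by (simp add: m3_def mult.commute)
qed

text \<open>Integrands for which the integral has a fourth moment.\<close>

definition L24 where "L24 g \<longleftrightarrow> L2 g \<and> integrable N (\<lambda>p. norm (g p :: real^'d) ^ 4)"

lemma L24_L2: "L24 g \<Longrightarrow> L2 g" by (simp add: L24_def)
lemma L24_measurable: "L24 g \<Longrightarrow> g \<in> borel_measurable borel" by (simp add: L24_def)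

lemma L24_lincomb:
  assumes g: "L24 g" and h: "L24 h"
  shows "L24 (\<lambda>p. a *\<^sub>R g p + b *\<^sub>R h p)"
proof -
  have [measurable]: "g \<in> borel_measurable borel" "h \<in> borel_measurable borel" using g h by (auto simp: L24_def)
  have "integrable N (\<lambda>p. norm (a *\<^sub>R g p + b *\<^sub>R h p) ^ 4)"
  proof (rule Bochner_Integration.integrable_bound[where f="\<lambda>p. 8 * a ^ 4 * norm (g p) ^ 4 + 8 * b ^ 4 * norm (h p) ^ 4"])
    show "integrable N (\<lambda>p. 8 * a ^ 4 * norm (g p) ^ 4 + 8 * b ^ 4 * norm (h p) ^ 4)" using g h by (auto simp: L24_def)
    show "AE p in N. norm (norm (a *\<^sub>R g p + b *\<^sub>R h p) ^ 4) \<le> norm (8 * a ^ 4 * norm (g p) ^ 4 + 8 * b ^ 4 * norm (h p) ^ 4)"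
    proof (rule AE_I2)
      fix p
      have two: "(x + y)\<^sup>2 \<le> 2 * x\<^sup>2 + 2 * y\<^sup>2" for x y :: real
        using sum_squares_bound[of x y] by (simp add: power2_sum)
      have "(x + y) ^ 4 \<le> 8 * x ^ 4 + 8 * y ^ 4" for x y :: real
      proof -
        have "(x + y) ^ 4 = ((x + y)\<^sup>2)\<^sup>2" by (simp flip: power_mult)
        also have "\<dots> \<le> (2 * x\<^sup>2 + 2 * y\<^sup>2)\<^sup>2" by (intro power_mono two) auto
        also have "\<dots> \<le> 2 * (2 * x\<^sup>2)\<^sup>2 + 2 * (2 * y\<^sup>2)\<^sup>2" by (rule two)
        finally show ?thesis by (simp add: power_mult_distrib flip: power_mult)
      qed
      moreover have "norm (a *\<^sub>R g p + b *\<^sub>R h p) ^ 4 \<le> (\<bar>a\<bar> * norm (g p) + \<bar>b\<bar> * norm (h p)) ^ 4"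
        by (intro power_mono order_trans[OF norm_triangle_ineq]) auto
      ultimately have "norm (a *\<^sub>R g p + b *\<^sub>R h p) ^ 4 \<le> 8 * (\<bar>a\<bar> * norm (g p)) ^ 4 + 8 * (\<bar>b\<bar> * norm (h p)) ^ 4"
        by (meson order_trans)
      then show "norm (norm (a *\<^sub>R g p + b *\<^sub>R h p) ^ 4) \<le> norm (8 * a ^ 4 * norm (g p) ^ 4 + 8 * b ^ 4 * norm (h p) ^ 4)"
        by (simp add: power_mult_distrib power_even_abs_numeral mult.assoc abs_of_nonneg)
    qed
  qed measurable
  then show ?thesis using L2_lincomb[of g h a b] g h by (simp add: L24_def)
qed

lemma integrable_c4: "L24 g \<Longrightarrow> integrable N (\<lambda>p. c4 (g p))"
  and integrable_c3: "L24 g \<Longrightarrow> integrable N (\<lambda>p. c3 (g p))"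
proof -
  assume g: "L24 g"
  then have [measurable]: "g \<in> borel_measurable borel" by (rule L24_measurable)
  show "integrable N (\<lambda>p. c4 (g p))"
    by (rule Bochner_Integration.integrable_bound[where f="\<lambda>p. m4 * norm (g p) ^ 4"])
      (use g c4_le c4_nonneg in \<open>auto simp: L24_def intro: order_trans[OF _ abs_ge_self]\<close>)
  show "integrable N (\<lambda>p. c3 (g p))"
  proof (rule Bochner_Integration.integrable_bound[where f="\<lambda>p. m3 * ((norm (g p))\<^sup>2 + norm (g p) ^ 4)"])
    show "integrable N (\<lambda>p. m3 * ((norm (g p))\<^sup>2 + norm (g p) ^ 4))" using g by (auto simp: L24_def)
    have m3: "0 \<le> m3" unfolding m3_def by (intro integral_nonneg_AE) auto
    have "y ^ 3 \<le> y\<^sup>2 + y ^ 4" for y :: real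
    proof -
      have "0 \<le> (y\<^sup>2 - y)\<^sup>2 + y\<^sup>2 + y ^ 4" by auto
      then show ?thesis by (simp add: power2_eq_square eval_nat_numeral algebra_simps)
    qed
    then have "\<bar>c3 (g p)\<bar> \<le> m3 * ((norm (g p))\<^sup>2 + norm (g p) ^ 4)" for p
      by (intro order_trans[OF abs_c3_le] mult_left_mono m3)
    then show "AE p in N. norm (c3 (g p)) \<le> norm (m3 * ((norm (g p))\<^sup>2 + norm (g p) ^ 4))"
      by (intro AE_I2) (auto intro: order_trans[OF _ abs_ge_self])
  qed measurable
qed

lemma has_int_scale: "has_int g Z \<Longrightarrow> has_int (\<lambda>p. a *\<^sub>R g p) (\<lambda>\<omega>. a * Z \<omega>)"
  using has_int_lincomb[of g Z g Z a 0] by simp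

lemma L24_scale: "L24 g \<Longrightarrow> L24 (\<lambda>p. a *\<^sub>R g p)"
  using L24_lincomb[of g g a 0] by simp

text \<open>The cumulant function of \<open>Z\<close> is \<open>\<psi>(u) = \<integral> \<Phi>(u g)\<close>, whose expansion to order four is obtained by
integrating that of \<open>\<Phi>\<close>.\<close>

theorem has_int_moments:
  assumes g: "L24 g" and Z: "has_int g Z"
  shows "integrable M (\<lambda>\<omega>. Z \<omega> ^ 4)"
    "(LINT \<omega>|M. Z \<omega> ^ 4) = (LINT p|N. c4 (g p)) + 3 * (LINT p|N. cov (g p) (g p))\<^sup>2"
    "(LINT \<omega>|M. (Z \<omega>)\<^sup>2) = (LINT p|N. cov (g p) (g p))"
proof -
  have [measurable]: "Z \<in> borel_measurable M" using Z by (rule has_int_measurable)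
  have [measurable]: "g \<in> borel_measurable borel" using g by (rule L24_measurable)
  define \<psi> where "\<psi> u = (CLINT p|N. \<Phi> (u *\<^sub>R g p))" for u
  have char: "(CLINT \<omega>|M. iexp (u * Z \<omega>)) = exp (\<psi> u)" for u
    unfolding \<psi>_def by (rule has_int_char[OF L24_L2[OF L24_scale[OF g]] has_int_scale[OF Z]])
  let ?\<kappa>2 = "LINT p|N. cov (g p) (g p)" and ?b = "(LINT p|N. c3 (g p)) / 6" and ?\<kappa>4 = "LINT p|N. c4 (g p)"
  have R: "\<psi> u + of_real (?\<kappa>2 * u\<^sup>2 / 2) + \<i> * of_real (?b * u ^ 3) = (CLINT p|N. R4 (u *\<^sub>R g p))" for u
  proof -
    have i1: "integrable N (\<lambda>p. \<Phi> (u *\<^sub>R g p))" by (rule integrable_levy_exponent[OF L24_L2[OF L24_scale[OF g]]])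
    have i2: "integrable N (\<lambda>p. complex_of_real (u\<^sup>2 * cov (g p) (g p) / 2))"
      using integrable_cov[OF L24_L2[OF g] L24_L2[OF g]] by (intro integrable_of_real) auto
    have i3: "integrable N (\<lambda>p. \<i> * complex_of_real (u ^ 3 * c3 (g p) / 6))"
      using integrable_c3[OF g] by (intro integrable_mult_right integrable_of_real) auto
    have "(CLINT p|N. R4 (u *\<^sub>R g p)) = (CLINT p|N. \<Phi> (u *\<^sub>R g p) + complex_of_real (u\<^sup>2 * cov (g p) (g p) / 2) + \<i> * complex_of_real (u ^ 3 * c3 (g p) / 6))"
      by (simp add: R4_def cov_scale_left cov_scale_right c3_scale power2_eq_square mult_ac)
    also have "\<dots> = \<psi> u + (CLINT p|N. complex_of_real (u\<^sup>2 * cov (g p) (g p) / 2)) + (CLINT p|N. \<i> * complex_of_real (u ^ 3 * c3 (g p) / 6))"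
      unfolding \<psi>_def
      by (subst Bochner_Integration.integral_add[OF Bochner_Integration.integrable_add[OF i1 i2] i3],
        subst Bochner_Integration.integral_add[OF i1 i2], simp)
    also have "(CLINT p|N. complex_of_real (u\<^sup>2 * cov (g p) (g p) / 2)) = of_real (?\<kappa>2 * u\<^sup>2 / 2)"
      by (simp only: integral_complex_of_real integral_divide_zero integral_mult_right_zero) (simp add: mult.commute)
    also have "(CLINT p|N. \<i> * complex_of_real (u ^ 3 * c3 (g p) / 6)) = \<i> * of_real (?b * u ^ 3)"
      by (simp only: integral_complex_of_real integral_divide_zero integral_mult_right_zero) (simp add: mult.commute)
    finally show ?thesis by simp
  qed
  have psi: "((\<lambda>u. (\<psi> u + of_real (?\<kappa>2 * u\<^sup>2 / 2) + \<i> * of_real (?b * u ^ 3)) / of_real (u ^ 4)) \<longlongrightarrow> of_real (?\<kappa>4 / 24)) (at 0)"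
    unfolding R tendsto_at_iff_sequentially
  proof (intro allI impI)
    fix t :: "nat \<Rightarrow> real" assume t0: "\<forall>i. t i \<in> UNIV - {0}" and t: "t \<longlonglongrightarrow> 0"
    have "(\<lambda>n. CLINT p|N. R4 (t n *\<^sub>R g p) / of_real (t n ^ 4)) \<longlonglongrightarrow> (CLINT p|N. of_real (c4 (g p) / 24))"
    proof (rule integral_dominated_convergence[where w="\<lambda>p. c4 (g p) / 24"])
      show "integrable N (\<lambda>p. c4 (g p) / 24)" using integrable_c4[OF g] by auto
      show "AE p in N. (\<lambda>n. R4 (t n *\<^sub>R g p) / of_real (t n ^ 4)) \<longlonglongrightarrow> of_real (c4 (g p) / 24)"
        using t0 by (intro AE_I2 R4_lim t) auto
      show "AE p in N. cmod (R4 (t n *\<^sub>R g p) / of_real (t n ^ 4)) \<le> c4 (g p) / 24" for n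
      proof (rule AE_I2)
        fix p
        have "cmod (R4 (t n *\<^sub>R g p) / of_real (t n ^ 4)) = cmod (R4 (t n *\<^sub>R g p)) / t n ^ 4"
          by (simp add: norm_divide norm_power)
        also have "\<dots> \<le> (c4 (t n *\<^sub>R g p) / 24) / t n ^ 4" by (intro divide_right_mono norm_R4_le) auto
        finally show "cmod (R4 (t n *\<^sub>R g p) / of_real (t n ^ 4)) \<le> c4 (g p) / 24"
          using t0 by (simp add: c4_scale)
      qed
      show "(\<lambda>p. R4 (t n *\<^sub>R g p) / of_real (t n ^ 4)) \<in> borel_measurable N" for n
        unfolding R4_def by measurable
    qed measurable
    then show "((\<lambda>u. (CLINT p|N. R4 (u *\<^sub>R g p)) / of_real (u ^ 4)) \<circ> t) \<longlonglongrightarrow> of_real (?\<kappa>4 / 24)"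
      by (simp only: o_def integral_divide_zero integral_complex_of_real)
  qed
  show "integrable M (\<lambda>\<omega>. Z \<omega> ^ 4)" "(LINT \<omega>|M. Z \<omega> ^ 4) = ?\<kappa>4 + 3 * ?\<kappa>2\<^sup>2" "(LINT \<omega>|M. (Z \<omega>)\<^sup>2) = ?\<kappa>2"
    using M.moments_of_char[OF _ char psi] by auto
qed

lemma integrable_k4:
  assumes "L24 g1" "L24 g2" "L24 g3" "L24 g4"
  shows "integrable N (\<lambda>p. k4 (g1 p) (g2 p) (g3 p) (g4 p))"
proof (rule Bochner_Integration.integrable_bound[where f="\<lambda>p. c4 (g1 p) + c4 (g2 p) + c4 (g3 p) + c4 (g4 p)"])
  show "integrable N (\<lambda>p. c4 (g1 p) + c4 (g2 p) + c4 (g3 p) + c4 (g4 p))"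
    by (intro Bochner_Integration.integrable_add integrable_c4 assms)
  have [measurable]: "g1 \<in> borel_measurable borel" "g2 \<in> borel_measurable borel" "g3 \<in> borel_measurable borel" "g4 \<in> borel_measurable borel"
    using assms by (auto intro: L24_measurable)
  show "(\<lambda>p. k4 (g1 p) (g2 p) (g3 p) (g4 p)) \<in> borel_measurable N" by measurable
  have "\<bar>k4 a b c d\<bar> \<le> c4 a + c4 b + c4 c + c4 d" for a b c d
  proof -
    have "\<bar>k4 a b c d\<bar> \<le> (LINT x|\<nu>. \<bar>(a \<bullet> x) * (b \<bullet> x) * (c \<bullet> x) * (d \<bullet> x)\<bar>)"
      unfolding k4_def by (rule integral_abs_bound)
    also have "\<dots> \<le> (LINT x|\<nu>. (a \<bullet> x) ^ 4 + (b \<bullet> x) ^ 4 + (c \<bullet> x) ^ 4 + (d \<bullet> x) ^ 4)"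
      by (intro integral_mono integrable_abs integrable_inner_mult4 abs_mult4_le Bochner_Integration.integrable_add integrable_inner_power) auto
    also have "\<dots> = c4 a + c4 b + c4 c + c4 d"
      using integrable_inner_power[of 4] by (simp add: c4_def)
    finally show ?thesis .
  qed
  then show "AE p in N. norm (k4 (g1 p) (g2 p) (g3 p) (g4 p)) \<le> norm (c4 (g1 p) + c4 (g2 p) + c4 (g3 p) + c4 (g4 p))"
    unfolding real_norm_def by (intro AE_I2 order_trans[OF _ abs_ge_self])
qed

definition "Cov g h = (LINT p|N. cov (g p) (h p))"
text \<open>The joint fourth cumulant of four integrals; the Gaussian part does not contribute to it.\<close>

definition "Cum g1 g2 g3 g4 = (LINT p|N. k4 (g1 p) (g2 p) (g3 p) (g4 p))"

lemma Cov_sym: "Cov g h = Cov h g"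
  unfolding Cov_def by (simp add: cov_sym)

theorem has_int_second_product:
  assumes g: "L24 g1" "L24 g2" and Z: "has_int g1 Z1" "has_int g2 Z2"
  shows "(LINT \<omega>|M. Z1 \<omega> * Z2 \<omega>) = Cov g1 g2"
proof -
  have e: "(LINT \<omega>|M. (1 * Z1 \<omega> + s * Z2 \<omega>)\<^sup>2) = Cov g1 g1 + 2 * s * Cov g1 g2 + s\<^sup>2 * Cov g2 g2" for s
  proof -
    have "(LINT \<omega>|M. (1 * Z1 \<omega> + s * Z2 \<omega>)\<^sup>2) = (LINT p|N. cov (1 *\<^sub>R g1 p + s *\<^sub>R g2 p) (1 *\<^sub>R g1 p + s *\<^sub>R g2 p))"
      by (rule has_int_moments(3)[OF L24_lincomb[OF g] has_int_lincomb[OF Z]])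
    also have "\<dots> = (LINT p|N. cov (g1 p) (g1 p) + 2 * s * cov (g1 p) (g2 p) + s\<^sup>2 * cov (g2 p) (g2 p))"
      by (intro Bochner_Integration.integral_cong refl)
        (simp add: cov_add_left cov_add_right cov_scale_left cov_scale_right cov_sym[of "g2 _" "g1 _"] power2_eq_square algebra_simps)
    also have "\<dots> = Cov g1 g1 + 2 * s * Cov g1 g2 + s\<^sup>2 * Cov g2 g2"
      unfolding Cov_def using integrable_cov[OF L24_L2 L24_L2] g by simp
    finally show ?thesis .
  qed
  have [measurable]: "Z1 \<in> borel_measurable M" "Z2 \<in> borel_measurable M" using Z by (auto intro: has_int_measurable)
  have sq: "integrable M (\<lambda>\<omega>. (Z \<omega>)\<^sup>2)" if "L24 g" "has_int g Z" for g Z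
  proof (rule Bochner_Integration.integrable_bound[where f="\<lambda>\<omega>. 1 + (Z \<omega>)^4"])
    show "integrable M (\<lambda>\<omega>. 1 + (Z \<omega>)^4)" using has_int_moments(1)[OF that] by auto
    have "x\<^sup>2 \<le> 1 + x^4" for x :: real
    proof -
      have "2 * 1 * x\<^sup>2 \<le> 1\<^sup>2 + (x\<^sup>2)\<^sup>2" by (rule sum_squares_bound)
      then have "2 * x\<^sup>2 \<le> 1 + x ^ 4" by simp
      then show ?thesis using zero_le_power2[of x] by argo
    qed
    then show "AE \<omega> in M. norm ((Z \<omega>)\<^sup>2) \<le> norm (1 + (Z \<omega>)^4)"
      by (intro AE_I2) (simp add: abs_of_nonneg add_nonneg_nonneg)
  qed (use has_int_measurable[OF that(2)] in measurable)
  have "(LINT \<omega>|M. Z1 \<omega> * Z2 \<omega>) = (LINT \<omega>|M. ((1 * Z1 \<omega> + 1 * Z2 \<omega>)\<^sup>2 - (1 * Z1 \<omega> + (-1) * Z2 \<omega>)\<^sup>2) / 4)"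
    by (intro Bochner_Integration.integral_cong) (auto simp: power2_eq_square algebra_simps)
  also have "\<dots> = ((LINT \<omega>|M. (1 * Z1 \<omega> + 1 * Z2 \<omega>)\<^sup>2) - (LINT \<omega>|M. (1 * Z1 \<omega> + (-1) * Z2 \<omega>)\<^sup>2)) / 4"
    by (simp only: integral_divide_zero
        Bochner_Integration.integral_diff[OF sq[OF L24_lincomb[OF g] has_int_lincomb[OF Z]] sq[OF L24_lincomb[OF g] has_int_lincomb[OF Z]]])
  also have "\<dots> = Cov g1 g2" unfolding e by simp
  finally show ?thesis .
qed

text \<open>Both sides are symmetric and multilinear, so that it suffices to know the fourth moments of the
linear combinations in \<open>polarization4\<close>.\<close>

theorem has_int_fourth_product:
  assumes g: "L24 g1" "L24 g2" "L24 g3" "L24 g4" and Z: "has_int g1 Z1" "has_int g2 Z2" "has_int g3 Z3" "has_int g4 Z4"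
  shows "integrable M (\<lambda>\<omega>. Z1 \<omega> * Z2 \<omega> * Z3 \<omega> * Z4 \<omega>)"
    "(LINT \<omega>|M. Z1 \<omega> * Z2 \<omega> * Z3 \<omega> * Z4 \<omega>)
      = Cum g1 g2 g3 g4 + (Cov g1 g2 * Cov g3 g4 + Cov g1 g3 * Cov g2 g4 + Cov g1 g4 * Cov g2 g3)"
proof -
  have [measurable]: "Z1 \<in> borel_measurable M" "Z2 \<in> borel_measurable M" "Z3 \<in> borel_measurable M" "Z4 \<in> borel_measurable M"
    using Z by (auto intro: has_int_measurable)
  show "integrable M (\<lambda>\<omega>. Z1 \<omega> * Z2 \<omega> * Z3 \<omega> * Z4 \<omega>)"
  proof (rule Bochner_Integration.integrable_bound[where f="\<lambda>\<omega>. Z1 \<omega> ^ 4 + Z2 \<omega> ^ 4 + Z3 \<omega> ^ 4 + Z4 \<omega> ^ 4"])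
    show "integrable M (\<lambda>\<omega>. Z1 \<omega> ^ 4 + Z2 \<omega> ^ 4 + Z3 \<omega> ^ 4 + Z4 \<omega> ^ 4)"
      by (intro Bochner_Integration.integrable_add has_int_moments(1)[OF g(1) Z(1)] has_int_moments(1)[OF g(2) Z(2)]
         has_int_moments(1)[OF g(3) Z(3)] has_int_moments(1)[OF g(4) Z(4)])
    show "AE \<omega> in M. norm (Z1 \<omega> * Z2 \<omega> * Z3 \<omega> * Z4 \<omega>) \<le> norm (Z1 \<omega> ^ 4 + Z2 \<omega> ^ 4 + Z3 \<omega> ^ 4 + Z4 \<omega> ^ 4)"
      unfolding real_norm_def by (intro AE_I2 order_trans[OF abs_mult4_le] abs_ge_self)
  qed measurable
  let ?z = "\<lambda>a b c \<omega>. Z1 \<omega> + a * Z2 \<omega> + b * Z3 \<omega> + c * Z4 \<omega>"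
  let ?g = "\<lambda>a b c p. g1 p + a *\<^sub>R g2 p + b *\<^sub>R g3 p + c *\<^sub>R g4 p"
  have zg: "has_int (?g a b c) (?z a b c)" for a b c
    using has_int_lincomb[OF has_int_lincomb[OF has_int_lincomb[OF Z(1,2), of 1 a] Z(3), of 1 b] Z(4), of 1 c] by simp
  have Lg: "L24 (?g a b c)" for a b c
    using L24_lincomb[OF L24_lincomb[OF L24_lincomb[OF g(1,2), of 1 a] g(3), of 1 b] g(4), of 1 c] by simp
  let ?S = "\<lambda>F :: real \<Rightarrow> real \<Rightarrow> real \<Rightarrow> real. \<Sum>a\<in>{1,-1}. \<Sum>b\<in>{1,-1}. \<Sum>c\<in>{1,-1}. a * b * c * F a b c"
  have quad: "(LINT p|N. cov (?g a b c p) (?g a b c p)) = Cov g1 g1 + Cov g2 g2 + Cov g3 g3 + Cov g4 g4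
     + 2 * a * Cov g1 g2 + 2 * b * Cov g1 g3 + 2 * c * Cov g1 g4 + 2 * a * b * Cov g2 g3 + 2 * a * c * Cov g2 g4 + 2 * b * c * Cov g3 g4"
    if "a \<in> {1,-1}" "b \<in> {1,-1}" "c \<in> {1,-1}" for a b c
  proof -
    have sq: "a * a = 1" "b * b = 1" "c * c = 1" "a * (a * y) = y" "b * (b * y) = y" "c * (c * y) = y" for y using that by auto
    have "(LINT p|N. cov (?g a b c p) (?g a b c p)) = (LINT p|N. cov (g1 p) (g1 p) + cov (g2 p) (g2 p) + cov (g3 p) (g3 p) + cov (g4 p) (g4 p)
     + 2 * a * cov (g1 p) (g2 p) + 2 * b * cov (g1 p) (g3 p) + 2 * c * cov (g1 p) (g4 p) + 2 * a * b * cov (g2 p) (g3 p)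
     + 2 * a * c * cov (g2 p) (g4 p) + 2 * b * c * cov (g3 p) (g4 p))"
      by (intro Bochner_Integration.integral_cong refl)
        (simp add: cov_add_left cov_add_right cov_scale_left cov_scale_right cov_sym[of "g2 _" "g1 _"] cov_sym[of "g3 _" "g1 _"] cov_sym[of "g4 _" "g1 _"]
          cov_sym[of "g3 _" "g2 _"] cov_sym[of "g4 _" "g2 _"] cov_sym[of "g4 _" "g3 _"] sq algebra_simps)
    also have "\<dots> = Cov g1 g1 + Cov g2 g2 + Cov g3 g3 + Cov g4 g4
     + 2 * a * Cov g1 g2 + 2 * b * Cov g1 g3 + 2 * c * Cov g1 g4 + 2 * a * b * Cov g2 g3 + 2 * a * c * Cov g2 g4 + 2 * b * c * Cov g3 g4"
      unfolding Cov_def using integrable_cov[OF L24_L2 L24_L2] g by simp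
    finally show ?thesis .
  qed
  have c4S: "192 * k4 (g1 p) (g2 p) (g3 p) (g4 p) = ?S (\<lambda>a b c. c4 (?g a b c p))" for p
  proof -
    have "192 * k4 (g1 p) (g2 p) (g3 p) (g4 p) = (LINT x|\<nu>. ?S (\<lambda>a b c. (?g a b c p \<bullet> x) ^ 4))"
      unfolding k4_def integral_mult_right_zero[symmetric]
      by (intro Bochner_Integration.integral_cong refl, subst polarization4) (simp add: inner_add_left)
    also have "\<dots> = ?S (\<lambda>a b c. c4 (?g a b c p))"
      unfolding c4_def using integrable_inner_power[of 4] by simp
    finally show ?thesis .
  qed
  have "192 * (LINT \<omega>|M. Z1 \<omega> * Z2 \<omega> * Z3 \<omega> * Z4 \<omega>) = (LINT \<omega>|M. ?S (\<lambda>a b c. ?z a b c \<omega> ^ 4))"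
    unfolding integral_mult_right_zero[symmetric]
    by (intro Bochner_Integration.integral_cong refl) (rule polarization4)
  also have "\<dots> = ?S (\<lambda>a b c. LINT \<omega>|M. ?z a b c \<omega> ^ 4)"
    by (rule integral_triple_sum) (rule has_int_moments(1)[OF Lg zg])
  also have "\<dots> = ?S (\<lambda>a b c. (LINT p|N. c4 (?g a b c p)) + 3 * (LINT p|N. cov (?g a b c p) (?g a b c p))\<^sup>2)"
    by (simp only: has_int_moments(2)[OF Lg zg])
  also have "\<dots> = ?S (\<lambda>a b c. (LINT p|N. c4 (?g a b c p))) + 3 * ?S (\<lambda>a b c. (LINT p|N. cov (?g a b c p) (?g a b c p))\<^sup>2)"
    by (simp add: algebra_simps)
  also have "?S (\<lambda>a b c. (LINT p|N. c4 (?g a b c p))) = 192 * Cum g1 g2 g3 g4"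
  proof -
    have "?S (\<lambda>a b c. (LINT p|N. c4 (?g a b c p))) = (LINT p|N. ?S (\<lambda>a b c. c4 (?g a b c p)))"
      by (rule integral_triple_sum[symmetric]) (rule integrable_c4[OF Lg])
    then show ?thesis unfolding c4S[symmetric] Cum_def by simp
  qed
  also have "?S (\<lambda>a b c. (LINT p|N. cov (?g a b c p) (?g a b c p))\<^sup>2)
     = 64 * (Cov g1 g2 * Cov g3 g4 + Cov g1 g3 * Cov g2 g4 + Cov g1 g4 * Cov g2 g3)"
    unfolding polarization22[of _ _ _ _ _ _ "Cov g1 g1" "Cov g2 g2" "Cov g3 g3" "Cov g4 g4"]
    by (intro sum.cong refl) (simp only: quad)
  finally show "(LINT \<omega>|M. Z1 \<omega> * Z2 \<omega> * Z3 \<omega> * Z4 \<omega>)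
      = Cum g1 g2 g3 g4 + (Cov g1 g2 * Cov g3 g4 + Cov g1 g3 * Cov g2 g4 + Cov g1 g4 * Cov g2 g3)" by simp
qed

section \<open>Bounds by the covariance seminorm\<close>

text \<open>The decay assumption is about this seminorm of \<open>f\<close> rather than its Euclidean norm, so cumulants
have to be bounded in terms of it as well.\<close>

definition "qn v = sqrt (cov v v)"

lemma qn_nonneg[simp]: "0 \<le> qn v" by (simp add: qn_def cov_nonneg)
lemma qn_square: "(qn v)\<^sup>2 = cov v v" by (simp add: qn_def cov_nonneg)
lemma qn_zero[simp]: "qn 0 = 0" by (simp add: qn_def)
lemma measurable_qn[measurable]: "qn \<in> borel_measurable borel" unfolding qn_def[abs_def] by measurable
lemma abs_cov_le: "\<bar>cov a b\<bar> \<le> qn a * qn b" unfolding qn_def by (rule cov_Cauchy_Schwarz)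

lemma qn_le_norm: "qn v \<le> sqrt covC * norm v"
  using real_sqrt_le_mono[OF covC(2)[of v]] by (simp add: qn_def real_sqrt_mult)

lemma null_directions_AE:
  assumes "cov v v = 0" shows "AE x in \<nu>. v \<bullet> x = 0"
proof -
  have "0 \<le> v \<bullet> (Sig *v v)" using psd_Sig by (simp add: psd_def)
  moreover have "0 \<le> (LINT x|\<nu>. (v \<bullet> x) * (v \<bullet> x))" by (intro integral_nonneg_AE) auto
  ultimately have "(LINT x|\<nu>. (v \<bullet> x) * (v \<bullet> x)) = 0" using assms unfolding cov_eq by linarith
  then show ?thesis
    by (subst (asm) integral_nonneg_eq_0_iff_AE) (auto intro: integrable_inner_mult)
qed

text \<open>On the orthogonal complement of the null space of \<open>cov\<close> the seminorm is equivalent to the Euclidean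
norm by compactness of the unit sphere, and directions in the null space are orthogonal to \<open>\<nu>\<close>-almost
every \<open>x\<close>.\<close>

lemma inner_le_seminorm: "\<exists>c\<ge>0. \<forall>v. AE x in \<nu>. \<bar>v \<bullet> x\<bar> \<le> c * qn v * norm x"
proof -
  let ?V = "{v. cov v v = 0}"
  have V0: "cov v w = 0" if "v \<in> ?V" for v w
    using abs_cov_le[of v w] that by (simp add: qn_def)
  have sub: "subspace ?V"
    unfolding subspace_def using V0
    by (auto simp: cov_add_left cov_add_right cov_scale_left cov_scale_right)
  let ?W = "{w. \<forall>v\<in>?V. orthogonal w v}"
  have Wc: "closed ?W"
  proof -
    have "?W = (\<Inter>v\<in>?V. {w. w \<bullet> v = 0})" by (auto simp: orthogonal_def)
    moreover have "closed (\<Inter>v\<in>?V. {w. w \<bullet> v = 0})"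
      by (intro closed_INT ballI closed_Collect_eq continuous_intros)
    ultimately show ?thesis by simp
  qed
  have comp: "compact (sphere 0 1 \<inter> ?W)" by (intro compact_Int_closed Wc) auto
  have cont: "continuous_on S (\<lambda>w. cov w w)" for S
    unfolding cov_def by (intro continuous_intros linear_continuous_on matrix_vector_mul_bounded_linear)
  obtain m where m: "m > 0" "\<And>w. w \<in> sphere 0 1 \<inter> ?W \<Longrightarrow> m \<le> cov w w"
  proof (cases "sphere 0 1 \<inter> ?W = {}")
    case True then show ?thesis using that[of 1] by simp
  next
    case False
    obtain w0 where w0: "w0 \<in> sphere 0 1 \<inter> ?W" "\<And>w. w \<in> sphere 0 1 \<inter> ?W \<Longrightarrow> cov w0 w0 \<le> cov w w"
      using continuous_attains_inf[OF comp False cont] by blast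
    have "cov w0 w0 \<noteq> 0"
    proof
      assume "cov w0 w0 = 0"
      then have "orthogonal w0 w0" using w0(1) by auto
      then show False using w0(1) by (simp add: orthogonal_def)
    qed
    then have "0 < cov w0 w0" using cov_nonneg[of w0] by simp
    then show ?thesis using that[of "cov w0 w0"] w0(2) by blast
  qed
  have Wn: "norm w \<le> (1 / sqrt m) * qn w" if w: "w \<in> ?W" for w
  proof (cases "w = 0")
    case False
    have "(1 / norm w) *\<^sub>R w \<in> sphere 0 1 \<inter> ?W" using w False by (auto simp: orthogonal_def)
    from m(2)[OF this] have "m \<le> cov w w / (norm w)\<^sup>2"
      by (simp add: cov_scale_left cov_scale_right power2_eq_square)
    then have "m * (norm w)\<^sup>2 \<le> cov w w" using False by (simp add: field_simps)
    then have "sqrt (m * (norm w)\<^sup>2) \<le> qn w" unfolding qn_def by (rule real_sqrt_le_mono)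
    then show ?thesis using m(1) by (simp add: real_sqrt_mult field_simps)
  qed simp
  show ?thesis
  proof (intro exI[of _ "1 / sqrt m"] conjI allI)
    show "0 \<le> 1 / sqrt m" using m by simp
    fix v
    obtain y z where yz: "y \<in> span ?V" "\<And>w. w \<in> span ?V \<Longrightarrow> orthogonal z w" "v = y + z"
      by (rule orthogonal_subspace_decomp_exists[of ?V v]) (rule that)
    have y: "y \<in> ?V" using yz(1) sub by (simp add: span_eq_iff[THEN iffD2])
    have z: "z \<in> ?W" using yz(2) by (auto intro: span_base)
    have q: "qn v = qn z"
      unfolding qn_def yz(3) using V0[OF y] V0[OF y, THEN trans[OF cov_sym]] by (simp add: cov_add_left cov_add_right)
    have "AE x in \<nu>. y \<bullet> x = 0" using y by (intro null_directions_AE) simp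
    then show "AE x in \<nu>. \<bar>v \<bullet> x\<bar> \<le> 1 / sqrt m * qn v * norm x"
    proof eventually_elim
      case (elim x)
      have "\<bar>v \<bullet> x\<bar> = \<bar>z \<bullet> x\<bar>" using elim by (simp add: yz(3) inner_add_left)
      also have "\<dots> \<le> norm z * norm x" by (rule inner_le_norms)
      also have "\<dots> \<le> (1 / sqrt m * qn z) * norm x" by (intro mult_right_mono Wn z) auto
      finally show ?case by (simp add: q)
    qed
  qed
qed

lemma abs_k4_le: "\<exists>K\<ge>0. \<forall>a b c d. \<bar>k4 a b c d\<bar> \<le> K * (qn a * qn b * qn c * qn d)"
proof -
  obtain c where c: "c \<ge> 0" "\<And>v. AE x in \<nu>. \<bar>v \<bullet> x\<bar> \<le> c * qn v * norm x" using inner_le_seminorm by blast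
  have "\<bar>k4 a b d e\<bar> \<le> (c ^ 4 * m4) * (qn a * qn b * qn d * qn e)" for a b d e
  proof -
    have "\<bar>k4 a b d e\<bar> \<le> (LINT x|\<nu>. \<bar>(a \<bullet> x) * (b \<bullet> x) * (d \<bullet> x) * (e \<bullet> x)\<bar>)"
      unfolding k4_def by (rule integral_abs_bound)
    also have "\<dots> \<le> (LINT x|\<nu>. (c ^ 4 * (qn a * qn b * qn d * qn e)) * norm x ^ 4)"
    proof (rule integral_mono_AE)
      show "integrable \<nu> (\<lambda>x. \<bar>(a \<bullet> x) * (b \<bullet> x) * (d \<bullet> x) * (e \<bullet> x)\<bar>)" by (intro integrable_abs integrable_inner_mult4)
      show "integrable \<nu> (\<lambda>x. (c ^ 4 * (qn a * qn b * qn d * qn e)) * norm x ^ 4)" using nu4 by auto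
      show "AE x in \<nu>. \<bar>(a \<bullet> x) * (b \<bullet> x) * (d \<bullet> x) * (e \<bullet> x)\<bar> \<le> (c ^ 4 * (qn a * qn b * qn d * qn e)) * norm x ^ 4"
        using c(2)[of a] c(2)[of b] c(2)[of d] c(2)[of e]
      proof eventually_elim
        case (elim x)
        have "\<bar>(a \<bullet> x) * (b \<bullet> x) * (d \<bullet> x) * (e \<bullet> x)\<bar> \<le> (c * qn a * norm x) * (c * qn b * norm x) * (c * qn d * norm x) * (c * qn e * norm x)"
          unfolding abs_mult using elim c(1) by (intro mult_mono mult_nonneg_nonneg) auto
        then show ?case by (simp add: eval_nat_numeral mult_ac)
      qed
    qed
    finally show ?thesis by (simp add: m4_def mult_ac)
  qed
  moreover have "0 \<le> c ^ 4 * m4" using c(1) by (simp add: m4_def)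
  ultimately show ?thesis by blast
qed

end

section \<open>Sums over the lattice\<close>

lemma summable_on_integrable_count_space:
  fixes f :: "'a \<Rightarrow> real"
  assumes "f summable_on UNIV"
  shows "integrable (count_space UNIV) f" "infsum f UNIV = (LINT x|count_space UNIV. f x)"
proof -
  note * = abs_summable_equivalent[THEN iffD1, OF summable_on_iff_abs_summable_on_real[THEN iffD1, OF assms]]
  then show "integrable (count_space UNIV) f" by (simp add: abs_summable_on_def)
  show "infsum f UNIV = (LINT x|count_space UNIV. f x)"
    using infsetsum_infsum[OF *] by (simp add: infsetsum_def)
qed

lemma summable_on_dominated:
  fixes f w :: "'a \<Rightarrow> real"
  assumes "w summable_on A" "\<And>x. x \<in> A \<Longrightarrow> \<bar>f x\<bar> \<le> w x"
  shows "f summable_on A"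
proof -
  have "(\<lambda>x. norm (f x)) summable_on A"
    by (rule summable_on_comparison_test[OF assms(1)]) (use assms(2) in auto)
  then show ?thesis by (rule summable_on_iff_abs_summable_on_real[THEN iffD2])
qed

lemma infsum_finite_sum:
  fixes f :: "'i \<Rightarrow> 'a \<Rightarrow> real"
  assumes "finite I" "\<And>i. i \<in> I \<Longrightarrow> f i summable_on A"
  shows "infsum (\<lambda>x. \<Sum>i\<in>I. f i x) A = (\<Sum>i\<in>I. infsum (f i) A)" "(\<lambda>x. \<Sum>i\<in>I. f i x) summable_on A"
proof -
  have "((\<lambda>x. \<Sum>i\<in>I. f i x) has_sum (\<Sum>i\<in>I. infsum (f i) A)) A"
    using assms
  proof (induction I rule: finite_induct)
    case (insert i I)
    then have "((\<lambda>x. f i x + (\<Sum>i\<in>I. f i x)) has_sum (infsum (f i) A + (\<Sum>i\<in>I. infsum (f i) A))) A"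
      by (intro has_sum_add has_sum_infsum) auto
    then show ?case using insert.hyps by simp
  qed simp
  then show "infsum (\<lambda>x. \<Sum>i\<in>I. f i x) A = (\<Sum>i\<in>I. infsum (f i) A)" "(\<lambda>x. \<Sum>i\<in>I. f i x) summable_on A"
    by (auto simp: infsumI has_sum_imp_summable)
qed

text \<open>Dominated convergence for the counting measure.\<close>

lemma infsum_dominated_convergence:
  fixes f :: "nat \<Rightarrow> 'a \<Rightarrow> real" and w :: "'a \<Rightarrow> real"
  assumes w: "w summable_on UNIV" and bound: "\<And>n x. \<bar>f n x\<bar> \<le> w x" and lim: "\<And>x. (\<lambda>n. f n x) \<longlonglongrightarrow> g x"
  shows "(\<lambda>n. infsum (f n) UNIV) \<longlonglongrightarrow> infsum g UNIV" "g summable_on UNIV" "\<And>n. f n summable_on UNIV"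
proof -
  have wn: "\<bar>w x\<bar> = w x" for x using order_trans[OF abs_ge_zero bound] by simp
  show f: "f n summable_on UNIV" for n
    by (rule summable_on_dominated[OF w]) (use bound in auto)
  have gb: "\<bar>g x\<bar> \<le> w x" for x
    by (rule LIMSEQ_le_const2[OF tendsto_rabs[OF lim]]) (use bound in auto)
  show g: "g summable_on UNIV"
    by (rule summable_on_dominated[OF w]) (use gb in auto)
  have "(\<lambda>n. LINT x|count_space UNIV. f n x) \<longlonglongrightarrow> (LINT x|count_space UNIV. g x)"
    by (rule integral_dominated_convergence[where w=w])
      (use bound lim summable_on_integrable_count_space(1)[OF w] in auto)
  then show "(\<lambda>n. infsum (f n) UNIV) \<longlonglongrightarrow> infsum g UNIV"
    using f g by (simp add: summable_on_integrable_count_space(2))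
qed

definition linf :: "int^'m \<Rightarrow> int" where
  "linf l = Max (range (\<lambda>i. \<bar>l $ i\<bar>))"

lemma component_le_linf: "\<bar>l $ i\<bar> \<le> linf l"
  unfolding linf_def by (rule Max_ge) auto

lemma linf_attained: "\<exists>i. \<bar>l $ i\<bar> = linf l"
proof -
  have "linf l \<in> range (\<lambda>i. \<bar>l $ i\<bar>)" unfolding linf_def by (rule Max_in) auto
  then show ?thesis by auto
qed

lemma linf_nonneg: "0 \<le> linf l"
  using component_le_linf[of l undefined] abs_ge_zero order_trans by blast

lemma vec_set_eq_image:
  "{j :: 'a^'m. \<forall>i. j $ i \<in> A} = vec_lambda ` (\<Pi>\<^sub>E i\<in>UNIV. A)"
proof (intro set_eqI iffI)
  fix j :: "'a^'m" assume "j \<in> {j. \<forall>i. j $ i \<in> A}"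
  then have "vec_nth j \<in> (\<Pi>\<^sub>E i\<in>UNIV. A)" "j = vec_lambda (vec_nth j)" by auto
  then show "j \<in> vec_lambda ` (\<Pi>\<^sub>E i\<in>UNIV. A)" by blast
qed auto

lemma inj_vec_lambda: "inj_on (vec_lambda :: ('m \<Rightarrow> 'a) \<Rightarrow> 'a^'m) S"
  by (rule inj_onI) (metis vec_lambda_inverse UNIV_I)

lemma card_vec_set:
  assumes "finite A"
  shows "card {j :: 'a^'m. \<forall>i. j $ i \<in> A} = card A ^ CARD('m)" "finite {j :: 'a^'m. \<forall>i. j $ i \<in> A}"
  unfolding vec_set_eq_image using assms
  by (auto simp: card_image[OF inj_vec_lambda] card_PiE intro!: finite_imageI finite_PiE)

lemma sum_vec_set_prod:
  fixes h :: "'a \<Rightarrow> real"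
  assumes "finite A"
  shows "(\<Sum>j\<in>{j :: 'a^'m. \<forall>i. j $ i \<in> A}. \<Prod>i\<in>UNIV. h (j $ i)) = (\<Sum>a\<in>A. h a) ^ CARD('m)"
proof -
  have "(\<Sum>j\<in>{j :: 'a^'m. \<forall>i. j $ i \<in> A}. \<Prod>i\<in>UNIV. h (j $ i)) = (\<Sum>f\<in>(\<Pi>\<^sub>E i\<in>(UNIV::'m set). A). \<Prod>i\<in>UNIV. h (f i))"
    unfolding vec_set_eq_image by (subst sum.reindex[OF inj_vec_lambda]) simp
  also have "\<dots> = (\<Prod>i\<in>(UNIV::'m set). \<Sum>a\<in>A. h a)"
    using assms by (intro prod_sum_PiE[symmetric]) auto
  finally show ?thesis by simp
qed

text \<open>Since every component is at most \<open>linf l\<close>, the summand is dominated by a product over the \<open>m\<close>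
components of the function \<open>(1 + |a|) powr (- t/m)\<close>, which is summable over the integers.\<close>

lemma lattice_powr_summable:
  assumes t: "t > real CARD('m)"
  shows "(\<lambda>l :: int^'m. (1 + real_of_int (linf l)) powr (- t)) summable_on UNIV"
proof (rule nonneg_bdd_above_summable_on)
  define s where "s = t / real CARD('m)"
  have s: "s > 1" using t by (simp add: s_def)
  define h where "h a = (1 + real_of_int \<bar>a\<bar>) powr (- s)" for a :: int
  have h0: "0 \<le> h a" for a by (simp add: h_def)
  have "summable (\<lambda>n. real (Suc n) powr (- s))"
    using summable_real_powr_iff[of "-s"] s by (subst summable_Suc_iff) auto
  then have sm: "summable (\<lambda>n. h (int n))" by (simp add: h_def add.commute)
  define H where "H = 2 * (\<Sum>n. h (int n))"
  have hsum: "(\<Sum>a\<in>A. h a) \<le> H" if "finite A" for A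
  proof -
    have half: "(\<Sum>a\<in>B. h a) \<le> (\<Sum>n. h (int n))" if B: "finite B" "inj_on (\<lambda>a. nat \<bar>a\<bar>) B" for B
    proof -
      have "(\<Sum>a\<in>B. h a) = (\<Sum>n\<in>(\<lambda>a. nat \<bar>a\<bar>) ` B. h (int n))"
        by (subst sum.reindex[OF B(2)]) (simp add: h_def)
      also have "\<dots> \<le> (\<Sum>n. h (int n))" by (rule sum_le_suminf[OF sm]) (use B h0 in auto)
      finally show ?thesis .
    qed
    have "(\<Sum>a\<in>A. h a) = (\<Sum>a\<in>{a\<in>A. 0 \<le> a}. h a) + (\<Sum>a\<in>{a\<in>A. a < 0}. h a)"
      using that by (subst sum.union_disjoint[symmetric]) (auto intro!: sum.cong)
    also have "\<dots> \<le> (\<Sum>n. h (int n)) + (\<Sum>n. h (int n))"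
      using that by (intro add_mono half) (auto simp: inj_on_def)
    finally show ?thesis by (simp add: H_def)
  qed
  have dom: "(1 + real_of_int (linf l)) powr (- t) \<le> (\<Prod>i\<in>UNIV. h (l $ i))" for l :: "int^'m"
  proof -
    let ?L = "1 + real_of_int (linf l)"
    have L: "1 \<le> ?L" using linf_nonneg[of l] by simp
    have "(?L powr (- s)) ^ CARD('m) \<le> (\<Prod>i\<in>(UNIV::'m set). h (l $ i))"
    proof -
      have "(\<Prod>i\<in>(UNIV::'m set). ?L powr (- s)) \<le> (\<Prod>i\<in>(UNIV::'m set). h (l $ i))"
      proof (intro prod_mono conjI)
        fix i
        have "1 + real_of_int \<bar>l $ i\<bar> \<le> ?L" using component_le_linf[of l i] by linarith
        then show "?L powr (- s) \<le> h (l $ i)" unfolding h_def using s by (intro powr_mono2') auto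
      qed auto
      then show ?thesis by simp
    qed
    also have "(?L powr (- s)) ^ CARD('m) = ?L powr (- t)"
      using L by (simp add: powr_power s_def)
    finally show ?thesis .
  qed
  show "bdd_above (sum (\<lambda>l :: int^'m. (1 + real_of_int (linf l)) powr (- t)) ` {F. F \<subseteq> UNIV \<and> finite F})"
  proof (rule bdd_aboveI2)
    fix F :: "(int^'m) set" assume "F \<in> {F. F \<subseteq> UNIV \<and> finite F}"
    then have F: "finite F" by simp
    define A where "A = (\<Union>l\<in>F. range (vec_nth l))"
    have A: "finite A" using F by (auto simp: A_def)
    have "(\<Sum>l\<in>F. (1 + real_of_int (linf l)) powr (- t)) \<le> (\<Sum>l\<in>F. \<Prod>i\<in>UNIV. h (l $ i))"
      by (intro sum_mono dom)
    also have "\<dots> \<le> (\<Sum>l\<in>{j :: int^'m. \<forall>i. j $ i \<in> A}. \<Prod>i\<in>UNIV. h (l $ i))"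
      using h0 by (intro sum_mono2 card_vec_set(2)[OF A]) (auto simp: A_def intro!: prod_nonneg)
    also have "\<dots> = (\<Sum>a\<in>A. h a) ^ CARD('m)" by (rule sum_vec_set_prod[OF A])
    also have "\<dots> \<le> H ^ CARD('m)" by (intro power_mono hsum A sum_nonneg h0)
    finally show "(\<Sum>l\<in>F. (1 + real_of_int (linf l)) powr (- t)) \<le> H ^ CARD('m)" .
  qed
qed auto

lemma finite_linf_less: "finite {l :: int^'m. linf l < L}"
proof (rule finite_subset)
  show "{l :: int^'m. linf l < L} \<subseteq> {l. \<forall>i. l $ i \<in> {-L..L}}"
  proof clarify
    fix l :: "int^'m" and i assume "linf l < L"
    then have "\<bar>l $ i\<bar> < L" using component_le_linf[of l i] by linarith
    then show "l $ i \<in> {-L..L}" by auto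
  qed
qed (rule card_vec_set(2), simp)

text \<open>The decay is only required for large \<open>l\<close>; the factor 1/2 is the one with which decay estimates arise
when the distance between two sites is shared evenly by both.\<close>

lemma lattice_decay_summable:
  fixes e :: "int^'m \<Rightarrow> real"
  assumes t: "t > real CARD('m)" and e: "\<And>l. 0 \<le> e l"
    and decay: "\<And>l. L \<le> linf l \<Longrightarrow> 1 \<le> linf l \<Longrightarrow> e l \<le> C * (real_of_int (linf l) / 2) powr (- t)"
  shows "e summable_on UNIV"
proof -
  let ?S = "{l :: int^'m. linf l < max L 1}"
  let ?w = "\<lambda>l. \<bar>C\<bar> * 4 powr t * (1 + real_of_int (linf l)) powr (- t)"
  have "e summable_on (UNIV - ?S)"
  proof (rule summable_on_dominated[where w="?w"])
    show "?w summable_on (UNIV - ?S)"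
      by (intro summable_on_cmult_right summable_on_subset_banach[OF lattice_powr_summable[OF t]]) auto
    fix l assume "l \<in> UNIV - ?S"
    then have l: "L \<le> linf l" "1 \<le> linf l" by auto
    let ?x = "real_of_int (linf l)"
    have "e l \<le> \<bar>C\<bar> * (?x / 2) powr (- t)"
      using decay[OF l] by (rule order_trans) (intro mult_right_mono, auto)
    also have "(?x / 2) powr (- t) \<le> ((1 + ?x) / 4) powr (- t)"
      using l t by (intro powr_mono2') auto
    also have "\<dots> = 4 powr t * (1 + ?x) powr (- t)"
      using l by (simp add: powr_divide powr_minus_divide)
    finally show "\<bar>e l\<bar> \<le> ?w l" using e[of l] by (simp add: mult_left_mono mult.assoc)
  qed
  moreover have "e summable_on ?S" by (intro summable_on_finite finite_linf_less)
  ultimately have "e summable_on ((UNIV - ?S) \<union> ?S)" by (intro summable_on_Un_disjoint) auto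
  then show ?thesis by simp
qed

lemma summable_on_shift:
  fixes e :: "int^'m \<Rightarrow> real"
  assumes "e summable_on UNIV"
  shows "(\<lambda>l. e (l + a)) summable_on UNIV" "(\<Sum>\<^sub>\<infinity>l. e (l + a)) = (\<Sum>\<^sub>\<infinity>l. e l)"
proof -
  have b: "bij_betw (\<lambda>l. l + a) UNIV (UNIV :: (int^'m) set)"
    by (rule bij_betwI[where g="\<lambda>l. l - a"]) auto
  show "(\<lambda>l. e (l + a)) summable_on UNIV" using summable_on_reindex_bij_betw[OF b] assms by blast
  show "(\<Sum>\<^sub>\<infinity>l. e (l + a)) = (\<Sum>\<^sub>\<infinity>l. e l)" by (rule infsum_reindex_bij_betw[OF b])
qed

text \<open>Each row of the covariance matrix of the sum is bounded by the full lattice sum of \<open>e\<close>.\<close>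

lemma second_moment_lattice_sum_le:
  fixes D :: "int^'m \<Rightarrow> 'w \<Rightarrow> real" and e :: "int^'m \<Rightarrow> real"
  assumes J: "finite J" and int: "\<And>j l. integrable M (\<lambda>\<omega>. D j \<omega> * D l \<omega>)"
    and bound: "\<And>j l. \<bar>LINT \<omega>|M. D j \<omega> * D l \<omega>\<bar> \<le> e (l - j)"
    and e: "e summable_on UNIV"
  shows "(LINT \<omega>|M. (\<Sum>j\<in>J. D j \<omega>)\<^sup>2) \<le> real (card J) * (\<Sum>\<^sub>\<infinity>l. e l)"
proof -
  have e0: "0 \<le> e l" for l using order_trans[OF abs_ge_zero bound[of 0 l]] by simp
  have "(LINT \<omega>|M. (\<Sum>j\<in>J. D j \<omega>)\<^sup>2) = (LINT \<omega>|M. (\<Sum>j\<in>J. \<Sum>l\<in>J. D j \<omega> * D l \<omega>))"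
    by (simp add: power2_eq_square sum_product)
  also have "\<dots> = (\<Sum>j\<in>J. \<Sum>l\<in>J. LINT \<omega>|M. D j \<omega> * D l \<omega>)"
    using int by simp
  also have "\<dots> \<le> (\<Sum>j\<in>J. \<Sum>\<^sub>\<infinity>l. e l)"
  proof (rule sum_mono)
    fix j
    have "(\<Sum>l\<in>J. LINT \<omega>|M. D j \<omega> * D l \<omega>) \<le> (\<Sum>l\<in>J. e (l - j))"
      using bound by (intro sum_mono) (auto intro: order_trans[OF abs_ge_self])
    also have "\<dots> \<le> (\<Sum>\<^sub>\<infinity>l. e (l - j))"
      using summable_on_shift(1)[OF e, of "- j"] e0 by (intro finite_sum_le_infsum J) auto
    also have "\<dots> = (\<Sum>\<^sub>\<infinity>l. e l)" using summable_on_shift(2)[OF e, of "- j"] by simp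
    finally show "(\<Sum>l\<in>J. LINT \<omega>|M. D j \<omega> * D l \<omega>) \<le> (\<Sum>\<^sub>\<infinity>l. e l)" .
  qed
  finally show ?thesis by simp
qed

lemma lattice_box_eq: "lattice_box n = {j. \<forall>i. j $ i \<in> {0<..n}}"
  by (auto simp: lattice_box_def)

lemma finite_lattice_box[simp]: "finite (lattice_box n)"
  unfolding lattice_box_eq by (rule card_vec_set) simp

lemma card_lattice_box: "card (lattice_box n :: (int^'m) set) = nat n ^ CARD('m)"
  unfolding lattice_box_eq by (subst card_vec_set) auto

lemma box_overlap_ratio:
  fixes l :: "int^'m"
  shows "(\<lambda>n. real (card {j \<in> lattice_box (int n). j + l \<in> lattice_box (int n)}) / real (card (lattice_box (int n) :: (int^'m) set))) \<longlonglongrightarrow> 1"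
proof (rule tendsto_sandwich)
  define L where "L = nat (linf l)"
  have L: "int L = linf l" using linf_nonneg[of l] by (simp add: L_def)
  show "(\<lambda>n. (1 - 2 * real L / real n) ^ CARD('m)) \<longlonglongrightarrow> 1"
  proof -
    have "(\<lambda>n. 2 * real L / real n) \<longlonglongrightarrow> 0" by (rule lim_const_over_n)
    then have "(\<lambda>n. (1 - 2 * real L / real n) ^ CARD('m)) \<longlonglongrightarrow> (1 - 0) ^ CARD('m)" by (intro tendsto_intros)
    then show ?thesis by simp
  qed
  show "eventually (\<lambda>n. (1 - 2 * real L / real n) ^ CARD('m) \<le> real (card {j \<in> lattice_box (int n). j + l \<in> lattice_box (int n)}) / real (card (lattice_box (int n) :: (int^'m) set))) sequentially"
  proof (rule eventually_sequentiallyI[of "Suc (2 * L)"])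
    fix n assume n: "Suc (2 * L) \<le> n"
    have "{j :: int^'m. \<forall>i. j $ i \<in> {int L<..int n - int L}} \<subseteq> {j \<in> lattice_box (int n). j + l \<in> lattice_box (int n)}"
    proof
      fix j :: "int^'m" assume j: "j \<in> {j. \<forall>i. j $ i \<in> {int L<..int n - int L}}"
      have "0 < j $ i \<and> j $ i \<le> int n \<and> 0 < (j + l) $ i \<and> (j + l) $ i \<le> int n" for i
      proof -
        have "int L < j $ i" "j $ i \<le> int n - int L" using j by auto
        moreover have "\<bar>l $ i\<bar> \<le> int L" using component_le_linf[of l i] L by simp
        ultimately show ?thesis unfolding vector_add_component by linarith
      qed
      then show "j \<in> {j \<in> lattice_box (int n). j + l \<in> lattice_box (int n)}" unfolding lattice_box_def by blast
    qed
    then have "card {j :: int^'m. \<forall>i. j $ i \<in> {int L<..int n - int L}} \<le> card {j \<in> lattice_box (int n). j + l \<in> lattice_box (int n)}"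
      by (intro card_mono) auto
    moreover have "card {j :: int^'m. \<forall>i. j $ i \<in> {int L<..int n - int L}} = (n - 2 * L) ^ CARD('m)"
    proof -
      have "card {int L<..int n - int L} = n - 2 * L" using n by (simp add: nat_diff_distrib)
      then show ?thesis by (subst card_vec_set) auto
    qed
    ultimately have "real ((n - 2 * L) ^ CARD('m)) / real (n ^ CARD('m)) \<le> real (card {j \<in> lattice_box (int n). j + l \<in> lattice_box (int n)}) / real (n ^ CARD('m))"
      by (intro divide_right_mono) auto
    moreover have "real ((n - 2 * L) ^ CARD('m)) / real (n ^ CARD('m)) = (1 - 2 * real L / real n) ^ CARD('m)"
    proof -
      have "real (n - 2 * L) / real n = 1 - 2 * real L / real n" using n by (simp add: of_nat_diff diff_divide_distrib)
      then show ?thesis by (simp flip: power_divide)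
    qed
    ultimately show "(1 - 2 * real L / real n) ^ CARD('m) \<le> real (card {j \<in> lattice_box (int n). j + l \<in> lattice_box (int n)}) / real (card (lattice_box (int n) :: (int^'m) set))"
      by (simp add: card_lattice_box)
  qed
  show "eventually (\<lambda>n. real (card {j \<in> lattice_box (int n). j + l \<in> lattice_box (int n)}) / real (card (lattice_box (int n) :: (int^'m) set)) \<le> 1) sequentially"
  proof (rule always_eventually, rule allI)
    fix n
    have "card {j \<in> lattice_box (int n). j + l \<in> lattice_box (int n)} \<le> card (lattice_box (int n) :: (int^'m) set)"
      by (intro card_mono) auto
    then show "real (card {j \<in> lattice_box (int n). j + l \<in> lattice_box (int n)}) / real (card (lattice_box (int n) :: (int^'m) set)) \<le> 1"
      by (auto simp: divide_le_eq_1 card_gt_0_iff)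
  qed
qed auto

text \<open>Grouping the pairs by their difference \<open>d\<close> gives \<open>c d\<close> the weight of the relative overlap of the box
with its translate by \<open>d\<close>, which tends to 1 and is at most 1.\<close>

lemma box_average_double_sum:
  fixes c :: "int^'m \<Rightarrow> real"
  assumes c: "c summable_on UNIV"
  shows "(\<lambda>n. (\<Sum>j\<in>lattice_box (int n). \<Sum>l\<in>lattice_box (int n). c (l - j)) / real (card (lattice_box (int n) :: (int^'m) set))) \<longlonglongrightarrow> infsum c UNIV"
proof -
  let ?E = "\<lambda>n. lattice_box (int n) :: (int^'m) set"
  let ?w = "\<lambda>n l. real (card {j \<in> ?E n. j + l \<in> ?E n}) / real (card (?E n))"
  have w01: "0 \<le> ?w n l" "?w n l \<le> 1" for n l
  proof -
    have "card {j \<in> ?E n. j + l \<in> ?E n} \<le> card (?E n)" by (intro card_mono) auto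
    then show "?w n l \<le> 1" by (auto simp: divide_le_eq_1 card_gt_0_iff)
  qed auto
  have abs: "(\<lambda>l. \<bar>c l\<bar>) summable_on UNIV" using summable_on_iff_abs_summable_on_real[THEN iffD1, OF c] by simp
  have "(\<lambda>n. \<Sum>\<^sub>\<infinity>l. ?w n l * c l) \<longlonglongrightarrow> infsum c UNIV"
  proof (rule infsum_dominated_convergence(1)[OF abs])
    show "\<bar>?w n l * c l\<bar> \<le> \<bar>c l\<bar>" for n l
      using mult_right_mono[OF w01(2)[of n l] abs_ge_zero[of "c l"]] w01(1)[of n l] by (simp add: abs_mult)
    show "(\<lambda>n. ?w n l * c l) \<longlonglongrightarrow> c l" for l
      using tendsto_mult[OF box_overlap_ratio[of l] tendsto_const[of "c l"]] by simp
  qed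
  moreover have "(\<Sum>j\<in>?E n. \<Sum>l\<in>?E n. c (l - j)) / real (card (?E n)) = (\<Sum>\<^sub>\<infinity>l. ?w n l * c l)" for n
  proof -
    have "(\<Sum>l\<in>?E n. c (l - j)) = (\<Sum>\<^sub>\<infinity>d. (if j + d \<in> ?E n then c d else 0))" for j
    proof -
      have "(\<Sum>l\<in>?E n. c (l - j)) = (\<Sum>d\<in>(\<lambda>l. l - j) ` ?E n. c d)"
        by (subst sum.reindex) (auto simp: inj_on_def)
      also have "\<dots> = (\<Sum>\<^sub>\<infinity>d\<in>(\<lambda>l. l - j) ` ?E n. c d)" by (subst infsum_finite) auto
      also have "\<dots> = (\<Sum>\<^sub>\<infinity>d. (if j + d \<in> ?E n then c d else 0))"
      proof (rule infsum_cong_neutral)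
        fix d assume "d \<in> UNIV - (\<lambda>l. l - j) ` ?E n"
        moreover have "j + d \<in> ?E n \<Longrightarrow> d \<in> (\<lambda>l. l - j) ` ?E n" by (rule image_eqI[of _ _ "j + d"]) auto
        ultimately show "(if j + d \<in> ?E n then c d else 0) = 0" by auto
      qed auto
      finally show ?thesis .
    qed
    then have "(\<Sum>j\<in>?E n. \<Sum>l\<in>?E n. c (l - j)) = (\<Sum>j\<in>?E n. \<Sum>\<^sub>\<infinity>d. (if j + d \<in> ?E n then c d else 0))" by simp
    also have "\<dots> = (\<Sum>\<^sub>\<infinity>d. \<Sum>j\<in>?E n. (if j + d \<in> ?E n then c d else 0))"
      by (rule infsum_finite_sum(1)[symmetric]) (simp, rule summable_on_dominated[OF abs], auto)
    also have "\<dots> = (\<Sum>\<^sub>\<infinity>d. real (card {j \<in> ?E n. j + d \<in> ?E n}) * c d)"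
      by (simp add: sum.inter_filter[symmetric])
    finally have e: "(\<Sum>j\<in>?E n. \<Sum>l\<in>?E n. c (l - j)) = (\<Sum>\<^sub>\<infinity>d. real (card {j \<in> ?E n. j + d \<in> ?E n}) * c d)" .
    have "(\<Sum>\<^sub>\<infinity>d. real (card {j \<in> ?E n. j + d \<in> ?E n}) * c d) / real (card (?E n))
       = (\<Sum>\<^sub>\<infinity>d. real (card {j \<in> ?E n. j + d \<in> ?E n}) * c d * (1 / real (card (?E n))))"
      by (subst infsum_cmult_left') simp
    then show ?thesis unfolding e by (simp add: mult_ac)
  qed
  ultimately show ?thesis by (simp only:)
qed

section \<open>Stationarity and the covariance of products\<close>

lemma real_pt_add: "real_pt (u + v) = real_pt u + real_pt v"
  by (simp add: real_pt_def vec_eq_iff)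

text \<open>Pointwise form of an interpolation between \<open>L\<^sup>2\<close> and \<open>L\<^bsup>4+\<delta>\<^esup>\<close>, for a product in which the two
factors \<open>a\<close> and \<open>b\<close> have small \<open>L\<^sup>2\<close> norm of order \<open>h powr (- \<beta>)\<close>. Write
\<open>a = a\<^sup>\<theta> a\<^bsup>1-\<theta>\<^esup>\<close> with \<open>\<theta> = \<delta>/(2+\<delta>)\<close> and bound the first part by the \<open>L\<^sup>2\<close> information and the
second by the \<open>L\<^bsup>4+\<delta>\<^esup>\<close> information, and likewise for \<open>b\<close>; then the powers of \<open>M\<close> add up to 1.\<close>

lemma four_factor_interpolation:
  fixes a b c d h \<beta> \<delta> :: real
  assumes "0 \<le> a" "0 \<le> b" "0 \<le> c" "0 \<le> d" "0 < h" "0 < \<delta>"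
  defines "M \<equiv> h powr (2 * \<beta>) * (a\<^sup>2 + b\<^sup>2) + a powr (4 + \<delta>) + b powr (4 + \<delta>) + c powr (4 + \<delta>) + d powr (4 + \<delta>)"
  shows "h powr (2 * \<beta> * \<delta> / (2 + \<delta>)) * (a * b * c * d) \<le> M"
proof (cases "M = 0")
  case True
  have "c powr (4 + \<delta>) \<le> M" unfolding M_def by simp
  then have "c = 0" using True by simp
  then show ?thesis using True by simp
next
  case False
  define q where "q = 4 + \<delta>"
  define \<theta> where "\<theta> = \<delta> / (2 + \<delta>)"
  have q: "q > 0" using assms by (simp add: q_def)
  have th: "0 < \<theta>" "\<theta> < 1" using assms by (auto simp: \<theta>_def)
  have M0: "0 \<le> M" unfolding M_def by simp
  then have M: "0 < M" using False by simp
  have root: "x \<le> M powr (1 / q)" if "0 \<le> x" "x powr q \<le> M" for x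
  proof -
    have "(x powr q) powr (1 / q) \<le> M powr (1 / q)" using that q by (intro powr_mono2) auto
    then show ?thesis using that q by (simp add: powr_powr)
  qed
  have le: "a powr q \<le> M" "b powr q \<le> M" "c powr q \<le> M" "d powr q \<le> M" unfolding M_def q_def by simp_all
  have half: "h powr \<beta> * x \<le> M powr (1/2)" if "0 \<le> x" "h powr (2 * \<beta>) * x\<^sup>2 \<le> M" for x
  proof -
    have "(h powr \<beta>)\<^sup>2 = h powr (2 * \<beta>)" by (simp add: power2_eq_square flip: powr_add)
    then have "(h powr \<beta> * x)\<^sup>2 \<le> M" using that by (simp add: power_mult_distrib)
    then have "h powr \<beta> * x \<le> sqrt M" by (rule real_le_rsqrt)
    then show ?thesis using M0 by (simp add: powr_half_sqrt)
  qed
  have sq: "h powr (2 * \<beta>) * a\<^sup>2 \<le> M" "h powr (2 * \<beta>) * b\<^sup>2 \<le> M" unfolding M_def by (simp_all add: distrib_left)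
  have factor: "h powr (\<beta> * \<theta>) * x \<le> M powr (\<theta> / 2 + (1 - \<theta>) / q)"
    if x: "0 \<le> x" "x powr q \<le> M" "h powr (2 * \<beta>) * x\<^sup>2 \<le> M" for x
  proof (cases "x = 0")
    case False
    then have "0 < x" using x by simp
    then have "h powr (\<beta> * \<theta>) * x = (h powr \<beta> * x) powr \<theta> * x powr (1 - \<theta>)"
      using assms(5) by (simp add: powr_mult powr_powr flip: powr_add)
    also have "\<dots> \<le> (M powr (1/2)) powr \<theta> * (M powr (1 / q)) powr (1 - \<theta>)"
      using th x \<open>0 < x\<close> assms(5) by (intro mult_mono powr_mono2 half root) auto
    also have "\<dots> = M powr (\<theta> / 2 + (1 - \<theta>) / q)" using M by (simp add: powr_powr powr_add)
    finally show ?thesis .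
  qed (use M0 in simp)
  have "h powr (2 * \<beta> * \<delta> / (2 + \<delta>)) * (a * b * c * d) = (h powr (\<beta> * \<theta>) * a) * (h powr (\<beta> * \<theta>) * b) * c * d"
    using assms(5) by (simp add: \<theta>_def mult_ac flip: powr_add)
  also have "\<dots> \<le> M powr (\<theta> / 2 + (1 - \<theta>) / q) * M powr (\<theta> / 2 + (1 - \<theta>) / q) * M powr (1 / q) * M powr (1 / q)"
    using assms(1-4) by (intro mult_mono factor root le sq) auto
  also have "\<dots> = M powr (\<theta> + 2 * (1 - \<theta>) / q + 2 / q)"
    by (simp flip: powr_add) (simp add: field_simps)
  also have "\<theta> + 2 * (1 - \<theta>) / q + 2 / q = 1"
    using assms(6) by (simp add: \<theta>_def q_def field_simps add_pos_pos less_imp_neq[THEN not_sym])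
  finally show ?thesis using M by simp
qed

context centred_levy_basis
begin

text \<open>The integrand of \<open>X\<^sub>u\<close> is \<open>f\<close> composed with the reflection \<open>s \<mapsto> u - s\<close>, which preserves the control
measure.\<close>

definition reflect :: "real^'m \<Rightarrow> 's \<times> (real^'m) \<Rightarrow> 's \<times> (real^'m)" where "reflect x p = (fst p, x - snd p)"

lemma measurable_reflect[measurable]: "reflect x \<in> borel_measurable borel"
  unfolding reflect_def[abs_def] borel_prod[symmetric] by measurable

lemma distr_reflect: "distr N N (reflect x) = N"
proof -
  have "distr lborel lborel (\<lambda>s. x - s) = (lborel :: (real^'m) measure)"
  proof -
    have "lborel = density (distr lborel borel (\<lambda>s :: real^'m. x + (-1) *\<^sub>R s)) (\<lambda>_. ennreal (\<bar>-1\<bar> ^ DIM(real^'m)))"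
      using lborel_affine[of "-1" x] by simp
    then have "distr lborel borel (\<lambda>s :: real^'m. x - s) = lborel" by (simp add: density_1)
    then show ?thesis by (simp cong: distr_cong)
  qed
  moreover have "distr \<pi> \<pi> (\<lambda>z. z) = \<pi>" by (rule distr_id)
  moreover have "distr \<pi> \<pi> (\<lambda>z. z) \<Otimes>\<^sub>M distr lborel lborel (\<lambda>s :: real^'m. x - s) = distr N N (\<lambda>(z, s). (z, x - s))"
    by (rule pair_measure_distr) (use calculation sigma_finite_lborel in auto)
  ultimately show ?thesis by (simp add: reflect_def[abs_def] case_prod_unfold)
qed

lemma integral_reflect:
  fixes g :: "'s \<times> (real^'m) \<Rightarrow> 'e::{banach, second_countable_topology}"
  assumes [measurable]: "g \<in> borel_measurable borel"
  shows "(LINT p|N. g (reflect x p)) = (LINT p|N. g p)" "integrable N (\<lambda>p. g (reflect x p)) \<longleftrightarrow> integrable N g"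
proof -
  have m: "reflect x \<in> measurable N N" "g \<in> borel_measurable N" by measurable
  show "(LINT p|N. g (reflect x p)) = (LINT p|N. g p)" using integral_distr[OF m] by (simp add: distr_reflect)
  show "integrable N (\<lambda>p. g (reflect x p)) \<longleftrightarrow> integrable N g" using integrable_distr_eq[OF m] by (simp add: distr_reflect)
qed

definition sh :: "('s \<times> (real^'m) \<Rightarrow> 'e) \<Rightarrow> int^'m \<Rightarrow> 's \<times> (real^'m) \<Rightarrow> 'e" where
  "sh g u p = g (reflect (real_pt u) p)"

lemma measurable_sh[measurable]: "g \<in> borel_measurable borel \<Longrightarrow> sh g u \<in> borel_measurable borel"
  unfolding sh_def[abs_def] by (rule measurable_compose[OF measurable_reflect])

text \<open>Two reflections make a translation. This form is the one in which stationarity is used: the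
composition of \<open>H\<close> with the translation is supplied by \<open>sh_shift\<close>.\<close>

lemma integral_shift:
  fixes H :: "'s \<times> (real^'m) \<Rightarrow> 'e::{banach, second_countable_topology}"
  assumes [measurable]: "H \<in> borel_measurable borel" and H': "\<And>p. H (reflect (real_pt a) (reflect 0 p)) = H' p"
  shows "(LINT p|N. H p) = (LINT p|N. H' p)"
proof -
  have "(LINT p|N. H' p) = (LINT p|N. H (reflect (real_pt a) (reflect 0 p)))" by (simp add: H')
  also have "\<dots> = (LINT p|N. H (reflect (real_pt a) p))" by (rule integral_reflect(1)) measurable
  also have "\<dots> = (LINT p|N. H p)" by (rule integral_reflect(1)) measurable
  finally show ?thesis by simp
qed

lemma sh_shift: "sh g (u + a) (reflect (real_pt a) (reflect 0 p)) = sh g u p"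
  by (simp add: sh_def reflect_def real_pt_add)

lemma Cov_shift:
  assumes [measurable]: "g \<in> borel_measurable borel" "h \<in> borel_measurable borel"
  shows "Cov (sh g (u + a)) (sh h (v + a)) = Cov (sh g u) (sh h v)"
  unfolding Cov_def by (rule integral_shift[of _ a]) (measurable, simp add: sh_shift)

lemma Cum_shift:
  assumes [measurable]: "g1 \<in> borel_measurable borel" "g2 \<in> borel_measurable borel" "g3 \<in> borel_measurable borel" "g4 \<in> borel_measurable borel"
  shows "Cum (sh g1 (u1 + a)) (sh g2 (u2 + a)) (sh g3 (u3 + a)) (sh g4 (u4 + a)) = Cum (sh g1 u1) (sh g2 u2) (sh g3 u3) (sh g4 u4)"
  unfolding Cum_def by (rule integral_shift[of _ a]) (measurable, simp add: sh_shift)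

lemma L24_sh: "L24 g \<Longrightarrow> L24 (sh g u)"
  unfolding L24_def sh_def[abs_def]
  using integral_reflect(2)[of "\<lambda>p. (norm (g p))\<^sup>2"] integral_reflect(2)[of "\<lambda>p. norm (g p) ^ 4"] by auto

text \<open>The covariance of the products \<open>Z1 Z2\<close> and \<open>Z3 Z4\<close> of the integrals of the four functions.\<close>

definition prod_cov where
  "prod_cov g1 g2 g3 g4 = Cum g1 g2 g3 g4 + (Cov g1 g3 * Cov g2 g4 + Cov g1 g4 * Cov g2 g3)"

text \<open>Of the three pairings in the fourth moment, subtracting the product of the means removes
\<open>Cov g1 g2 * Cov g3 g4\<close>.\<close>

lemma product_covariance:
  assumes g: "L24 g1" "L24 g2" "L24 g3" "L24 g4" and Z: "has_int g1 Z1" "has_int g2 Z2" "has_int g3 Z3" "has_int g4 Z4"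
  shows "integrable M (\<lambda>\<omega>. Z1 \<omega> * Z2 \<omega>)"
    "integrable M (\<lambda>\<omega>. (Z1 \<omega> * Z2 \<omega> - Cov g1 g2) * (Z3 \<omega> * Z4 \<omega> - Cov g3 g4))"
    "(LINT \<omega>|M. (Z1 \<omega> * Z2 \<omega> - Cov g1 g2) * (Z3 \<omega> * Z4 \<omega> - Cov g3 g4)) = prod_cov g1 g2 g3 g4"
proof -
  have i2: "integrable M (\<lambda>\<omega>. Z \<omega> * W \<omega>)" if g: "L24 g" "L24 h" and Z: "has_int g Z" "has_int h W" for g h Z W
  proof -
    have [measurable]: "Z \<in> borel_measurable M" "W \<in> borel_measurable M" using Z by (auto intro: has_int_measurable)
    show ?thesis
      by (rule M.square_integrable_imp_integrable)
        (use has_int_fourth_product(1)[OF g(1) g(2) g(1) g(2) Z(1) Z(2) Z(1) Z(2)] in \<open>auto simp: power2_eq_square mult_ac\<close>)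
  qed
  note i12 = i2[OF g(1,2) Z(1,2)] and i34 = i2[OF g(3,4) Z(3,4)]
  show "integrable M (\<lambda>\<omega>. Z1 \<omega> * Z2 \<omega>)" by (rule i12)
  note i4 = has_int_fourth_product[OF g Z]
  have e: "(Z1 \<omega> * Z2 \<omega> - Cov g1 g2) * (Z3 \<omega> * Z4 \<omega> - Cov g3 g4) =
    ((Z1 \<omega> * Z2 \<omega> * Z3 \<omega> * Z4 \<omega> - Cov g3 g4 * (Z1 \<omega> * Z2 \<omega>)) - Cov g1 g2 * (Z3 \<omega> * Z4 \<omega>)) + Cov g1 g2 * Cov g3 g4" for \<omega>
    by (simp add: algebra_simps)
  show "integrable M (\<lambda>\<omega>. (Z1 \<omega> * Z2 \<omega> - Cov g1 g2) * (Z3 \<omega> * Z4 \<omega> - Cov g3 g4))"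
    unfolding e using i4(1) i12 i34 by simp
  show "(LINT \<omega>|M. (Z1 \<omega> * Z2 \<omega> - Cov g1 g2) * (Z3 \<omega> * Z4 \<omega> - Cov g3 g4)) = prod_cov g1 g2 g3 g4"
    unfolding e using i4 i12 i34 has_int_second_product[OF g(1,2) Z(1,2)] has_int_second_product[OF g(3,4) Z(3,4)]
    by (simp add: M.prob_space prod_cov_def)
qed

definition K4 where "K4 = (SOME K. K \<ge> 0 \<and> (\<forall>a b c d. \<bar>k4 a b c d\<bar> \<le> K * (qn a * qn b * qn c * qn d)))"

lemma K4: "K4 \<ge> 0" "\<bar>k4 a b c d\<bar> \<le> K4 * (qn a * qn b * qn c * qn d)"
  using someI_ex[OF abs_k4_le] by (auto simp: K4_def)

end

section \<open>Decay of covariances and cumulants\<close>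

text \<open>The two lower bounds on \<open>\<beta>\<close> are the summability conditions for covariances and for fourth
cumulants.\<close>

locale mma_setup = centred_levy_basis M \<Lambda> \<gamma> Sig \<nu> \<pi>
  for M :: "'w measure"
    and \<Lambda> :: "('s::polish_space \<times> (real^'m)) set \<Rightarrow> 'w \<Rightarrow> real^'d"
    and \<gamma> :: "real^'d" and Sig :: "real^'d^'d" and \<nu> :: "(real^'d) measure"
    and \<pi> :: "'s measure" +
  fixes f :: "'s \<times> (real^'m) \<Rightarrow> real^'d" and X :: "int^'m \<Rightarrow> 'w \<Rightarrow> real" and \<delta> \<beta> :: real
  assumes f_meas[measurable]: "f \<in> borel_measurable borel" and delta: "\<delta> > 0"
    and f_L2: "integrable (\<pi> \<Otimes>\<^sub>M lborel) (\<lambda>p. (norm (f p))\<^sup>2)"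
    and f_L4: "integrable (\<pi> \<Otimes>\<^sub>M lborel) (\<lambda>p. norm (f p) powr (4 + \<delta>))"
    and X: "mma_field M \<Lambda> \<pi> f X"
    and eta: "eta_hat f Sig \<nu> \<pi> \<in> O[at_top](\<lambda>h. h powr (- \<beta>))"
    and beta1: "\<beta> > real CARD('m)" and beta2: "2 * \<beta> * \<delta> / (2 + \<delta>) > real CARD('m)"
begin

lemma L24_f: "L24 f"
proof -
  have "integrable N (\<lambda>p. norm (f p) ^ 4)"
  proof (rule Bochner_Integration.integrable_bound[OF Bochner_Integration.integrable_add[OF f_L2 f_L4]])
    have "y ^ 4 \<le> y\<^sup>2 + y powr (4 + \<delta>)" if "0 \<le> y" for y :: real
    proof (cases "y \<le> 1")
      case True
      then have "y ^ 4 \<le> y\<^sup>2" using that by (intro power_decreasing) auto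
      then show ?thesis by (simp add: add_increasing2)
    next
      case False
      then have "y ^ 4 = y powr 4" by (simp add: powr_numeral)
      also have "\<dots> \<le> y powr (4 + \<delta>)" using False delta by (intro powr_mono) auto
      finally show ?thesis by (simp add: add_increasing)
    qed
    then show "AE p in N. norm (norm (f p) ^ 4) \<le> norm ((norm (f p))\<^sup>2 + norm (f p) powr (4 + \<delta>))"
      by (intro AE_I2) (simp add: abs_of_nonneg)
  qed measurable
  then show ?thesis using f_L2 by (simp add: L24_def)
qed

text \<open>Cutting \<open>f\<close> off, inside or outside a cube, produces functions of this kind. All bounds are uniform
over them.\<close>

definition restricts where "restricts g \<longleftrightarrow> g \<in> borel_measurable borel \<and> (\<forall>p. g p = f p \<or> g p = 0)"

lemma restricts_measurable[measurable_dest]: "restricts g \<Longrightarrow> g \<in> borel_measurable borel" by (simp add: restricts_def)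

lemma restricts_L24: "restricts g \<Longrightarrow> L24 g"
proof -
  assume g: "restricts g"
  then have [measurable]: "g \<in> borel_measurable borel" by (simp add: restricts_def)
  have "norm (g p) \<le> norm (f p)" for p using g by (auto simp: restricts_def simp del: split_paired_All dest: spec[of _ p])
  then have "integrable N (\<lambda>p. norm (g p) ^ n)" if "integrable N (\<lambda>p. norm (f p) ^ n)" for n
    by (intro Bochner_Integration.integrable_bound[OF that]) (auto intro!: power_mono)
  then show ?thesis using L24_f by (simp add: L24_def)
qed

lemma restricts_f[simp]: "restricts f" by (simp add: restricts_def)

definition fF where "fF p = qn (f p)"
lemma fF_nonneg[simp]: "0 \<le> fF p" by (simp add: fF_def)
lemma fF_measurable[measurable]: "fF \<in> borel_measurable borel" unfolding fF_def[abs_def] by measurable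

lemma fF2: "integrable N (\<lambda>p. (fF p)\<^sup>2)"
  unfolding fF_def qn_square using L24_f by (intro integrable_cov L24_L2)

lemma fF_norm: "fF p \<le> sqrt covC * norm (f p)" unfolding fF_def by (rule qn_le_norm)

lemma fF4: "integrable N (\<lambda>p. fF p ^ 4)"
proof (rule Bochner_Integration.integrable_bound[where f="\<lambda>p. sqrt covC ^ 4 * norm (f p) ^ 4"])
  show "integrable N (\<lambda>p. sqrt covC ^ 4 * norm (f p) ^ 4)" using L24_f by (auto simp: L24_def)
  show "AE p in N. norm (fF p ^ 4) \<le> norm (sqrt covC ^ 4 * norm (f p) ^ 4)"
    unfolding power_mult_distrib[symmetric] using fF_norm covC(1)
    by (intro AE_I2) (auto simp del: power_mult_distrib intro!: power_mono)
qed measurable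

lemma fFq: "integrable N (\<lambda>p. fF p powr (4 + \<delta>))"
proof (rule Bochner_Integration.integrable_bound[where f="\<lambda>p. sqrt covC powr (4 + \<delta>) * norm (f p) powr (4 + \<delta>)"])
  show "integrable N (\<lambda>p. sqrt covC powr (4 + \<delta>) * norm (f p) powr (4 + \<delta>))" using f_L4 by auto
  show "AE p in N. norm (fF p powr (4 + \<delta>)) \<le> norm (sqrt covC powr (4 + \<delta>) * norm (f p) powr (4 + \<delta>))"
  proof (rule AE_I2)
    fix p
    have "fF p powr (4 + \<delta>) \<le> (sqrt covC * norm (f p)) powr (4 + \<delta>)"
      using fF_norm delta by (intro powr_mono2) auto
    then show "norm (fF p powr (4 + \<delta>)) \<le> norm (sqrt covC powr (4 + \<delta>) * norm (f p) powr (4 + \<delta>))"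
      using covC(1) by (simp add: powr_mult)
  qed
qed measurable

definition far_region :: "real \<Rightarrow> ('s \<times> (real^'m)) set" where "far_region h = {p. \<exists>i. h / 2 \<le> \<bar>snd p $ i\<bar>}"

lemma far_region_measurable[measurable]: "far_region h \<in> sets borel"
proof -
  have "{p :: 's \<times> (real^'m). h / 2 \<le> \<bar>snd p $ i\<bar>} \<in> sets borel" for i
    by (intro borel_closed closed_Collect_le continuous_intros)
  then have "(\<Union>i. {p :: 's \<times> (real^'m). h / 2 \<le> \<bar>snd p $ i\<bar>}) \<in> sets borel" by (intro sets.finite_UN) auto
  moreover have "far_region h = (\<Union>i. {p :: 's \<times> (real^'m). h / 2 \<le> \<bar>snd p $ i\<bar>})" by (auto simp: far_region_def)
  ultimately show ?thesis by simp
qed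

definition tail where "tail h = (LINT p|N. indicator (far_region h) p * (fF p)\<^sup>2)"

lemma tail_integrable: "integrable N (\<lambda>p. indicator (far_region h) p * (fF p)\<^sup>2)"
  using integrable_mult_indicator[OF _ fF2, of "far_region h"] by simp

lemma tail_nonneg: "0 \<le> tail h" unfolding tail_def by (intro integral_nonneg_AE) auto

lemma eta_hat_eq: "eta_hat f Sig \<nu> \<pi> h = sqrt (tail h)"
proof -
  let ?H = "\<lambda>p. indicator (far_region h) p * (fF p)\<^sup>2 :: real"
  have i: "integrable N (\<lambda>p. ?H (reflect 0 p))" using tail_integrable by (subst integral_reflect(2)) auto
  have "(LINT z|\<pi>. LINT s|lborel. ?H (reflect 0 (z, s))) = (LINT p|N. ?H (reflect 0 p))"
    by (rule PN.integral_fst'[OF i])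
  also have "\<dots> = tail h" unfolding tail_def by (rule integral_reflect(1)) measurable
  finally have e: "(LINT z|\<pi>. LINT s|lborel. ?H (reflect 0 (z, s))) = tail h" .
  have "indicator (- {s :: real^'m. \<forall>i. - h / 2 < s $ i \<and> s $ i < h / 2}) s *\<^sub>R ((f (z, - s) v* SL) \<bullet> f (z, - s)) = ?H (reflect 0 (z, s))" for z s
  proof -
    have "(f (z, - s) v* SL) \<bullet> f (z, - s) = (fF (z, - s))\<^sup>2"
      unfolding fF_def qn_square cov_def by (rule dot_lmul_matrix)
    moreover have "(s \<in> - {s :: real^'m. \<forall>i. - h / 2 < s $ i \<and> s $ i < h / 2}) = ((z, - s) \<in> far_region h)"
    proof -
      have "\<not> (- h / 2 < y \<and> y < h / 2) \<longleftrightarrow> h / 2 \<le> \<bar>y\<bar>" for y :: real by (auto simp: abs_if)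
      then show ?thesis by (auto simp: far_region_def)
    qed
    ultimately show ?thesis by (simp add: reflect_def indicator_def)
  qed
  then show ?thesis unfolding eta_hat_def set_lebesgue_integral_def by (simp only: e)
qed

lemma tail_decay: "\<exists>C h0. \<forall>h\<ge>h0. 0 < h \<longrightarrow> h powr (2 * \<beta>) * tail h \<le> C"
proof -
  obtain c where c: "c > 0" "eventually (\<lambda>h. norm (eta_hat f Sig \<nu> \<pi> h) \<le> c * norm (h powr (- \<beta>))) at_top"
    using landau_o.bigE[OF eta] by blast
  then obtain h0 where h0: "\<And>h. h \<ge> h0 \<Longrightarrow> norm (eta_hat f Sig \<nu> \<pi> h) \<le> c * norm (h powr (- \<beta>))"
    by (auto simp: eventually_at_top_linorder)
  have "h powr (2 * \<beta>) * tail h \<le> c\<^sup>2" if h: "h \<ge> h0" "0 < h" for h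
  proof -
    have "sqrt (tail h) \<le> c * h powr (- \<beta>)" using h0[OF h(1)] by (simp add: eta_hat_eq tail_nonneg)
    then have "(sqrt (tail h))\<^sup>2 \<le> (c * h powr (- \<beta>))\<^sup>2" using tail_nonneg[of h] by (intro power_mono) auto
    then have "tail h \<le> c\<^sup>2 * h powr (- 2 * \<beta>)"
      using h by (simp add: tail_nonneg power_mult_distrib powr_power mult.commute)
    then have "h powr (2 * \<beta>) * tail h \<le> h powr (2 * \<beta>) * (c\<^sup>2 * h powr (- 2 * \<beta>))" by (intro mult_left_mono) auto
    also have "\<dots> = c\<^sup>2" using h by (simp add: mult_ac flip: powr_add)
    finally show ?thesis .
  qed
  then show ?thesis by blast
qed

text \<open>Scalar majorants for the seminorm of an integrand. Products of several shifted integrands are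
estimated through them.\<close>

definition profile where "profile \<phi> \<longleftrightarrow> \<phi> \<in> borel_measurable borel \<and> (\<forall>p. 0 \<le> \<phi> p \<and> \<phi> p \<le> fF p)"

lemma profile_fF[simp]: "profile fF" by (simp add: profile_def)
lemma profile_measurable[measurable_dest]: "profile \<phi> \<Longrightarrow> \<phi> \<in> borel_measurable borel" by (simp add: profile_def)
lemma profileD: "profile \<phi> \<Longrightarrow> 0 \<le> sh \<phi> u p" "profile \<phi> \<Longrightarrow> sh \<phi> u p \<le> sh fF u p"
  by (auto simp: profile_def sh_def simp del: split_paired_All)

lemma sh_mono: "(\<And>p. \<phi> p \<le> \<psi> p) \<Longrightarrow> sh \<phi> u p \<le> sh \<psi> u p"
  for \<phi> \<psi> :: "'s \<times> (real^'m) \<Rightarrow> real"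
  by (simp add: sh_def)

text \<open>The part of the profile outside the cube of side \<open>h\<close>.\<close>

definition fO where "fO h p = indicator (far_region h) p * fF p"

lemma profile_fO[simp]: "profile (fO h)"
  unfolding profile_def fO_def[abs_def] by (auto simp: indicator_def)

lemma sh_fF_integrable:
  "integrable N (\<lambda>p. (sh fF u p)\<^sup>2)" "integrable N (\<lambda>p. sh fF u p ^ 4)" "integrable N (\<lambda>p. sh fF u p powr (4 + \<delta>))"
  "integrable N (\<lambda>p. indicator (far_region h) (reflect (real_pt u) p) * (sh fF u p)\<^sup>2)"
  unfolding sh_def
  using integral_reflect(2)[of "\<lambda>p. (fF p)\<^sup>2"] integral_reflect(2)[of "\<lambda>p. fF p ^ 4"] integral_reflect(2)[of "\<lambda>p. fF p powr (4 + \<delta>)"]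
    integral_reflect(2)[of "\<lambda>p. indicator (far_region h) p * (fF p)\<^sup>2"] fF2 fF4 fFq tail_integrable by auto

lemma sh_fF_integral:
  "(LINT p|N. (sh fF u p)\<^sup>2) = (LINT p|N. (fF p)\<^sup>2)" "(LINT p|N. sh fF u p powr (4 + \<delta>)) = (LINT p|N. fF p powr (4 + \<delta>))"
  "(LINT p|N. indicator (far_region h) (reflect (real_pt u) p) * (sh fF u p)\<^sup>2) = tail h"
  unfolding sh_def tail_def
  using integral_reflect(1)[of "\<lambda>p. (fF p)\<^sup>2"] integral_reflect(1)[of "\<lambda>p. fF p powr (4 + \<delta>)"]
    integral_reflect(1)[of "\<lambda>p. indicator (far_region h) p * (fF p)\<^sup>2"] by auto

definition J2 where "J2 \<phi> u \<psi> v = (LINT p|N. sh \<phi> u p * sh \<psi> v p)"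
definition J4 where "J4 \<phi>1 u1 \<phi>2 u2 \<phi>3 u3 \<phi>4 u4 = (LINT p|N. sh \<phi>1 u1 p * sh \<phi>2 u2 p * sh \<phi>3 u3 p * sh \<phi>4 u4 p)"

lemma J2_integrable:
  assumes \<phi>: "profile \<phi>" "profile \<psi>"
  shows "integrable N (\<lambda>p. sh \<phi> u p * sh \<psi> v p)"
proof (rule Bochner_Integration.integrable_bound[where f="\<lambda>p. (sh fF u p)\<^sup>2 + (sh fF v p)\<^sup>2"])
  show "integrable N (\<lambda>p. (sh fF u p)\<^sup>2 + (sh fF v p)\<^sup>2)" by (intro Bochner_Integration.integrable_add sh_fF_integrable)
  show "AE p in N. norm (sh \<phi> u p * sh \<psi> v p) \<le> norm ((sh fF u p)\<^sup>2 + (sh fF v p)\<^sup>2)"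
  proof (rule AE_I2)
    fix p
    have "sh \<phi> u p * sh \<psi> v p \<le> sh fF u p * sh fF v p"
      using \<phi> profile_fF by (intro mult_mono profileD) auto
    also have "\<dots> \<le> (sh fF u p)\<^sup>2 + (sh fF v p)\<^sup>2"
      using sum_squares_bound[of "sh fF u p" "sh fF v p"] mult_nonneg_nonneg[OF profileD(1)[OF profile_fF, of u p] profileD(1)[OF profile_fF, of v p]] by linarith
    finally show "norm (sh \<phi> u p * sh \<psi> v p) \<le> norm ((sh fF u p)\<^sup>2 + (sh fF v p)\<^sup>2)"
      using profileD(1)[OF \<phi>(1), of u p] profileD(1)[OF \<phi>(2), of v p] by (simp add: abs_mult)
  qed
qed (use \<phi> in measurable)

lemma J4_integrable:
  assumes \<phi>: "profile \<phi>1" "profile \<phi>2" "profile \<phi>3" "profile \<phi>4"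
  shows "integrable N (\<lambda>p. sh \<phi>1 u1 p * sh \<phi>2 u2 p * sh \<phi>3 u3 p * sh \<phi>4 u4 p)"
proof (rule Bochner_Integration.integrable_bound[where f="\<lambda>p. sh fF u1 p ^ 4 + sh fF u2 p ^ 4 + sh fF u3 p ^ 4 + sh fF u4 p ^ 4"])
  show "integrable N (\<lambda>p. sh fF u1 p ^ 4 + sh fF u2 p ^ 4 + sh fF u3 p ^ 4 + sh fF u4 p ^ 4)"
    by (intro Bochner_Integration.integrable_add sh_fF_integrable)
  show "AE p in N. norm (sh \<phi>1 u1 p * sh \<phi>2 u2 p * sh \<phi>3 u3 p * sh \<phi>4 u4 p) \<le> norm (sh fF u1 p ^ 4 + sh fF u2 p ^ 4 + sh fF u3 p ^ 4 + sh fF u4 p ^ 4)"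
  proof (rule AE_I2)
    fix p
    note n = profileD(1)[OF \<phi>(1), of u1 p] profileD(1)[OF \<phi>(2), of u2 p] profileD(1)[OF \<phi>(3), of u3 p] profileD(1)[OF \<phi>(4), of u4 p]
    have "\<bar>sh \<phi>1 u1 p * sh \<phi>2 u2 p * sh \<phi>3 u3 p * sh \<phi>4 u4 p\<bar> \<le> sh \<phi>1 u1 p ^ 4 + sh \<phi>2 u2 p ^ 4 + sh \<phi>3 u3 p ^ 4 + sh \<phi>4 u4 p ^ 4"
      by (rule abs_mult4_le)
    also have "\<dots> \<le> sh fF u1 p ^ 4 + sh fF u2 p ^ 4 + sh fF u3 p ^ 4 + sh fF u4 p ^ 4"
      using \<phi> n by (intro add_mono power_mono profileD) auto
    finally show "norm (sh \<phi>1 u1 p * sh \<phi>2 u2 p * sh \<phi>3 u3 p * sh \<phi>4 u4 p) \<le> norm (sh fF u1 p ^ 4 + sh fF u2 p ^ 4 + sh fF u3 p ^ 4 + sh fF u4 p ^ 4)"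
      unfolding real_norm_def by (rule order_trans[OF _ abs_ge_self])
  qed
qed (use \<phi> in measurable)

lemma J2_nonneg: "profile \<phi> \<Longrightarrow> profile \<psi> \<Longrightarrow> 0 \<le> J2 \<phi> u \<psi> v"
  unfolding J2_def by (intro integral_nonneg_AE AE_I2 mult_nonneg_nonneg profileD)

lemma J4_nonneg: "profile \<phi>1 \<Longrightarrow> profile \<phi>2 \<Longrightarrow> profile \<phi>3 \<Longrightarrow> profile \<phi>4 \<Longrightarrow> 0 \<le> J4 \<phi>1 u1 \<phi>2 u2 \<phi>3 u3 \<phi>4 u4"
  unfolding J4_def by (intro integral_nonneg_AE AE_I2 mult_nonneg_nonneg profileD)

lemma J2_mono:
  assumes "profile \<phi>" "profile \<psi>" "profile \<phi>'" "profile \<psi>'" "\<And>p. \<phi> p \<le> \<phi>' p" "\<And>p. \<psi> p \<le> \<psi>' p"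
  shows "J2 \<phi> u \<psi> v \<le> J2 \<phi>' u \<psi>' v"
  unfolding J2_def
  by (intro integral_mono J2_integrable mult_mono profileD(1) sh_mono assms)

lemma J4_mono:
  assumes "profile \<phi>1" "profile \<phi>2" "profile \<phi>3" "profile \<phi>4" "profile \<psi>1" "profile \<psi>2" "profile \<psi>3" "profile \<psi>4"
    "\<And>p. \<phi>1 p \<le> \<psi>1 p" "\<And>p. \<phi>2 p \<le> \<psi>2 p" "\<And>p. \<phi>3 p \<le> \<psi>3 p" "\<And>p. \<phi>4 p \<le> \<psi>4 p"
  shows "J4 \<phi>1 u1 \<phi>2 u2 \<phi>3 u3 \<phi>4 u4 \<le> J4 \<psi>1 u1 \<psi>2 u2 \<psi>3 u3 \<psi>4 u4"
  unfolding J4_def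
  by (intro integral_mono J4_integrable mult_mono mult_nonneg_nonneg profileD(1) sh_mono assms)

lemma J2_shift:
  assumes "profile \<phi>" "profile \<psi>"
  shows "J2 \<phi> (u + a) \<psi> (v + a) = J2 \<phi> u \<psi> v"
proof -
  have [measurable]: "\<phi> \<in> borel_measurable borel" "\<psi> \<in> borel_measurable borel" using assms by (auto intro: profile_measurable)
  show ?thesis unfolding J2_def by (rule integral_shift[of _ a]) (measurable, simp add: sh_shift)
qed

lemma J4_shift:
  assumes "profile \<phi>1" "profile \<phi>2" "profile \<phi>3" "profile \<phi>4"
  shows "J4 \<phi>1 (u1 + a) \<phi>2 (u2 + a) \<phi>3 (u3 + a) \<phi>4 (u4 + a) = J4 \<phi>1 u1 \<phi>2 u2 \<phi>3 u3 \<phi>4 u4"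
proof -
  have [measurable]: "\<phi>1 \<in> borel_measurable borel" "\<phi>2 \<in> borel_measurable borel" "\<phi>3 \<in> borel_measurable borel" "\<phi>4 \<in> borel_measurable borel"
    using assms by (auto intro: profile_measurable)
  show ?thesis unfolding J4_def by (rule integral_shift[of _ a]) (measurable, simp add: sh_shift)
qed

definition E2 where "E2 = (LINT p|N. (fF p)\<^sup>2)"

lemma J2_le_E2: "profile \<phi> \<Longrightarrow> profile \<psi> \<Longrightarrow> J2 \<phi> u \<psi> v \<le> E2"
proof -
  assume \<phi>: "profile \<phi>" "profile \<psi>"
  have "J2 \<phi> u \<psi> v \<le> (LINT p|N. (sh fF u p)\<^sup>2 / 2 + (sh fF v p)\<^sup>2 / 2)"
    unfolding J2_def
  proof (rule integral_mono)
    show "integrable N (\<lambda>p. sh \<phi> u p * sh \<psi> v p)" by (rule J2_integrable[OF \<phi>])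
    show "integrable N (\<lambda>p. (sh fF u p)\<^sup>2 / 2 + (sh fF v p)\<^sup>2 / 2)"
      by (intro Bochner_Integration.integrable_add integrable_divide_zero sh_fF_integrable)
    fix p
    have "sh \<phi> u p * sh \<psi> v p \<le> sh fF u p * sh fF v p"
      using \<phi> profile_fF by (intro mult_mono profileD) auto
    then show "sh \<phi> u p * sh \<psi> v p \<le> (sh fF u p)\<^sup>2 / 2 + (sh fF v p)\<^sup>2 / 2"
      using sum_squares_bound[of "sh fF u p" "sh fF v p"] by simp
  qed
  also have "\<dots> = E2" using sh_fF_integrable(1) by (simp add: sh_fF_integral E2_def)
  finally show ?thesis .
qed

text \<open>In a coordinate \<open>i\<close> where \<open>|l\<^sub>i| = L\<close>, the numbers \<open>|s\<^sub>i|\<close> and \<open>|l\<^sub>i - s\<^sub>i|\<close> cannot both be below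
\<open>L/2\<close>. The shifts by \<open>a\<close> and \<open>b\<close> cost at most \<open>L/4\<close>, which leaves \<open>L/4 = h/2\<close>.\<close>

lemma far_out:
  assumes l: "linf l = L" and h: "h = real_of_int L / 2" and a: "4 * linf a \<le> L" and b: "4 * linf b \<le> L"
  shows "(reflect (real_pt 0) p \<in> far_region h \<and> reflect (real_pt a) p \<in> far_region h) \<or> (reflect (real_pt l) p \<in> far_region h \<and> reflect (real_pt (l + b)) p \<in> far_region h)"
proof -
  obtain i where i: "\<bar>l $ i\<bar> = linf l" using linf_attained by blast
  let ?s = "snd p $ i"
  have ab: "\<bar>real_of_int (a $ i)\<bar> \<le> real_of_int L / 4" "\<bar>real_of_int (b $ i)\<bar> \<le> real_of_int L / 4"
    using component_le_linf[of a i] component_le_linf[of b i] a b by linarith+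
  have L0: "0 \<le> real_of_int L" using linf_nonneg[of l] l by simp
  have li: "\<bar>real_of_int (l $ i)\<bar> = real_of_int L" using i l by linarith
  have "real_of_int L / 2 \<le> \<bar>?s\<bar> \<or> real_of_int L / 2 \<le> \<bar>real_of_int (l $ i) - ?s\<bar>"
    using li by argo
  then show ?thesis
  proof
    assume "real_of_int L / 2 \<le> \<bar>?s\<bar>"
    then have "h / 2 \<le> \<bar>0 - ?s\<bar>" "h / 2 \<le> \<bar>real_of_int (a $ i) - ?s\<bar>" using ab L0 h by argo+
    then show ?thesis by (auto simp: far_region_def reflect_def real_pt_def)
  next
    assume "real_of_int L / 2 \<le> \<bar>real_of_int (l $ i) - ?s\<bar>"
    then have "h / 2 \<le> \<bar>real_of_int (l $ i) - ?s\<bar>" "h / 2 \<le> \<bar>real_of_int (l $ i) + real_of_int (b $ i) - ?s\<bar>" using ab L0 h by argo+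
    then show ?thesis by (auto simp: far_region_def reflect_def real_pt_def)
  qed
qed

text \<open>One of the two factors is evaluated in its tail, of size \<open>h powr (- \<beta>)\<close>, while the other one is
bounded in \<open>L\<^sup>2\<close>. Young's inequality with the weight \<open>h powr \<beta>\<close> replaces Cauchy and Schwarz, as it
works pointwise and the factor in question depends on the point.\<close>

lemma J2_summable: "(\<lambda>l. J2 fF 0 fF l) summable_on UNIV"
proof -
  obtain C h0 where C: "\<And>h. h \<ge> h0 \<Longrightarrow> 0 < h \<Longrightarrow> h powr (2 * \<beta>) * tail h \<le> C" using tail_decay by blast
  show ?thesis
  proof (rule lattice_decay_summable[OF beta1, where L="\<lceil>2 * h0\<rceil>" and C="C + E2"])
    show "0 \<le> J2 fF 0 fF l" for l by (simp add: J2_nonneg)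
    fix l :: "int^'m" assume l: "\<lceil>2 * h0\<rceil> \<le> linf l" "1 \<le> linf l"
    define h where "h = real_of_int (linf l) / 2"
    have h: "h0 \<le> h" "0 < h" using l unfolding h_def by linarith+
    let ?i = "\<lambda>u p. indicator (far_region h) (reflect (real_pt u) p) :: real"
    let ?g = "\<lambda>p. h powr (2 * \<beta>) * (?i 0 p * (sh fF 0 p)\<^sup>2) / 2 + h powr (2 * \<beta>) * (?i l p * (sh fF l p)\<^sup>2) / 2 + (sh fF 0 p)\<^sup>2 / 2 + (sh fF l p)\<^sup>2 / 2"
    have "h powr \<beta> * J2 fF 0 fF l = (LINT p|N. h powr \<beta> * (sh fF 0 p * sh fF l p))" by (simp add: J2_def)
    also have "\<dots> \<le> (LINT p|N. ?g p)"
    proof (rule integral_mono)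
      show "integrable N (\<lambda>p. h powr \<beta> * (sh fF 0 p * sh fF l p))" by (intro integrable_mult_right J2_integrable profile_fF)
      show "integrable N ?g"
        by (intro Bochner_Integration.integrable_add integrable_divide_zero integrable_mult_right sh_fF_integrable)
      fix p
      have lz: "linf (0 :: int^'m) = 0" by (simp add: linf_def)
      have disj: "?i 0 p = 1 \<or> ?i l p = 1"
        using far_out[of l "linf l" h 0 0 p] l lz by (auto simp: h_def)
      have young: "h powr \<beta> * (x * y) \<le> h powr (2 * \<beta>) * x\<^sup>2 / 2 + y\<^sup>2 / 2" for x y
        using sum_squares_bound[of "h powr \<beta> * x" y] h by (simp add: power_mult_distrib powr_power mult_ac)
      show "h powr \<beta> * (sh fF 0 p * sh fF l p) \<le> ?g p"
        using disj
      proof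
        assume i: "?i 0 p = 1"
        have "0 \<le> h powr (2 * \<beta>) * (?i l p * (sh fF l p)\<^sup>2) / 2" by simp
        then show ?thesis unfolding i using young[of "sh fF 0 p" "sh fF l p"] zero_le_power2[of "sh fF 0 p"] by argo
      next
        assume i: "?i l p = 1"
        have "0 \<le> h powr (2 * \<beta>) * (?i 0 p * (sh fF 0 p)\<^sup>2) / 2" by simp
        then show ?thesis unfolding i using young[of "sh fF l p" "sh fF 0 p"] zero_le_power2[of "sh fF l p"]
          unfolding mult.commute[of "sh fF l p" "sh fF 0 p"] by argo
      qed
    qed
    also have "\<dots> = h powr (2 * \<beta>) * tail h + E2"
      using sh_fF_integrable by (simp add: sh_fF_integral E2_def)
    also have "\<dots> \<le> C + E2" using C[OF h] by simp
    finally have "h powr (- \<beta>) * (h powr \<beta> * J2 fF 0 fF l) \<le> h powr (- \<beta>) * (C + E2)" by (intro mult_left_mono) auto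
    then show "J2 fF 0 fF l \<le> (C + E2) * (real_of_int (linf l) / 2) powr (- \<beta>)"
      using h by (simp add: h_def[symmetric] mult.assoc[symmetric] flip: powr_add) (simp add: mult.commute)
  qed
qed

text \<open>By \<open>far_out\<close>, for large \<open>l\<close> and at every point two of the four factors are evaluated in their tails, and
\<open>four_factor_interpolation\<close> applies to them; which two they are depends on the point, so the bounds
for both cases are added.\<close>

lemma J4_summable: "(\<lambda>l. J4 fF 0 fF a fF l fF (l + b)) summable_on UNIV"
proof -
  obtain C h0 where C: "\<And>h. h \<ge> h0 \<Longrightarrow> 0 < h \<Longrightarrow> h powr (2 * \<beta>) * tail h \<le> C" using tail_decay by blast
  define Eq where "Eq = (LINT p|N. fF p powr (4 + \<delta>))"
  let ?\<tau> = "2 * \<beta> * \<delta> / (2 + \<delta>)"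
  show ?thesis
  proof (rule lattice_decay_summable[OF beta2, where L="max \<lceil>2 * h0\<rceil> (max (4 * linf a) (4 * linf b))" and C="4 * C + 4 * Eq"])
    show "0 \<le> J4 fF 0 fF a fF l fF (l + b)" for l by (simp add: J4_nonneg)
    fix l :: "int^'m" assume "max \<lceil>2 * h0\<rceil> (max (4 * linf a) (4 * linf b)) \<le> linf l" "1 \<le> linf l"
    then have l: "\<lceil>2 * h0\<rceil> \<le> linf l" "1 \<le> linf l" "4 * linf a \<le> linf l" "4 * linf b \<le> linf l" by auto
    define h where "h = real_of_int (linf l) / 2"
    have h: "h0 \<le> h" "0 < h" using l(1,2) unfolding h_def by linarith+
    let ?i = "\<lambda>u p. indicator (far_region h) (reflect (real_pt u) p) :: real"
    let ?o = "\<lambda>u p. h powr (2 * \<beta>) * (?i u p * (sh fF u p)\<^sup>2)" and ?q = "\<lambda>u p. sh fF u p powr (4 + \<delta>)"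
    let ?g = "\<lambda>p. (?o 0 p + ?o a p + ?o l p + ?o (l + b) p) + (?q 0 p + ?q a p + ?q l p + ?q (l + b) p)"
    have "h powr ?\<tau> * J4 fF 0 fF a fF l fF (l + b) = (LINT p|N. h powr ?\<tau> * (sh fF 0 p * sh fF a p * sh fF l p * sh fF (l + b) p))"
      by (simp add: J4_def)
    also have "\<dots> \<le> (LINT p|N. ?g p)"
    proof (rule integral_mono)
      show "integrable N (\<lambda>p. h powr ?\<tau> * (sh fF 0 p * sh fF a p * sh fF l p * sh fF (l + b) p))"
        by (intro integrable_mult_right J4_integrable profile_fF)
      show "integrable N ?g" by (intro Bochner_Integration.integrable_add integrable_mult_right sh_fF_integrable)
      fix p
      have o0: "0 \<le> ?o u p" for u by simp
      note n = profileD(1)[OF profile_fF, of 0 p] profileD(1)[OF profile_fF, of a p] profileD(1)[OF profile_fF, of l p] profileD(1)[OF profile_fF, of "l + b" p]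
      have "(?i 0 p = 1 \<and> ?i a p = 1) \<or> (?i l p = 1 \<and> ?i (l + b) p = 1)"
        using far_out[OF refl h_def l(3,4), of p] by (auto simp: indicator_def)
      then show "h powr ?\<tau> * (sh fF 0 p * sh fF a p * sh fF l p * sh fF (l + b) p) \<le> ?g p"
      proof
        assume i: "?i 0 p = 1 \<and> ?i a p = 1"
        have "h powr ?\<tau> * (sh fF 0 p * sh fF a p * sh fF l p * sh fF (l + b) p) \<le>
          h powr (2 * \<beta>) * ((sh fF 0 p)\<^sup>2 + (sh fF a p)\<^sup>2) + ?q 0 p + ?q a p + ?q l p + ?q (l + b) p"
          by (rule four_factor_interpolation[OF n h(2) delta])
        also have "\<dots> = (?o 0 p + ?o a p) + ?q 0 p + ?q a p + ?q l p + ?q (l + b) p"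
          using i by (simp add: distrib_left)
        finally show ?thesis using o0[of l] o0[of "l + b"] by linarith
      next
        assume i: "?i l p = 1 \<and> ?i (l + b) p = 1"
        have "h powr ?\<tau> * (sh fF l p * sh fF (l + b) p * sh fF 0 p * sh fF a p) \<le>
          h powr (2 * \<beta>) * ((sh fF l p)\<^sup>2 + (sh fF (l + b) p)\<^sup>2) + ?q l p + ?q (l + b) p + ?q 0 p + ?q a p"
          by (rule four_factor_interpolation[OF n(3,4,1,2) h(2) delta])
        also have "\<dots> = (?o l p + ?o (l + b) p) + ?q l p + ?q (l + b) p + ?q 0 p + ?q a p"
          using i by (simp add: distrib_left)
        finally have "h powr ?\<tau> * (sh fF l p * sh fF (l + b) p * sh fF 0 p * sh fF a p) \<le> ?g p"
          using o0[of 0] o0[of a] by linarith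
        then show ?thesis by (simp add: mult_ac)
      qed
    qed
    also have "\<dots> = 4 * (h powr (2 * \<beta>) * tail h) + 4 * Eq"
      using sh_fF_integrable by (simp add: sh_fF_integral Eq_def)
    also have "\<dots> \<le> 4 * C + 4 * Eq" using C[OF h] by simp
    finally have "h powr (- ?\<tau>) * (h powr ?\<tau> * J4 fF 0 fF a fF l fF (l + b)) \<le> h powr (- ?\<tau>) * (4 * C + 4 * Eq)" by (intro mult_left_mono) auto
    moreover have "h powr (- ?\<tau>) * h powr ?\<tau> = 1" using h by (simp flip: powr_add)
    ultimately show "J4 fF 0 fF a fF l fF (l + b) \<le> (4 * C + 4 * Eq) * (real_of_int (linf l) / 2) powr (- ?\<tau>)"
      unfolding h_def[symmetric] mult.assoc[symmetric] by (simp only: mult_1 mult.commute)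
  qed
qed

end

context mma_setup
begin

section \<open>The field and its truncations\<close>

lemma has_int_X: "has_int (sh f u) (X u)"
proof -
  have e: "(\<lambda>(z, s). f (z, real_pt u - s)) = sh f u" by (auto simp: sh_def reflect_def)
  have "\<exists>Z. has_int (sh f u) Z" by (intro has_int_exists L24_L2 L24_sh L24_f)
  then have "has_int (sh f u) (levy_integral M \<Lambda> N (sh f u))"
    unfolding levy_integral_def by (rule someI_ex)
  moreover have m: "X u \<in> borel_measurable M" and ae: "AE \<omega> in M. X u \<omega> = levy_integral M \<Lambda> N (\<lambda>(z, s). f (z, real_pt u - s)) \<omega>"
    using X unfolding mma_field_def by blast+
  moreover have "AE \<omega> in M. levy_integral M \<Lambda> N (sh f u) \<omega> = X u \<omega>"
    using ae unfolding e by eventually_elim simp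
  ultimately show ?thesis by (intro has_int_cong_AE[of "sh f u" _ "X u"])
qed

text \<open>The restrictions of \<open>f\<close> to the cube of side \<open>h\<close> and to its complement.\<close>

definition ft where "ft h p = (if p \<in> far_region h then 0 else f p)"
definition fr where "fr h p = (if p \<in> far_region h then f p else 0)"

lemma restricts_ft[simp]: "restricts (ft h)" and restricts_fr[simp]: "restricts (fr h)"
  unfolding restricts_def ft_def[abs_def] fr_def[abs_def] by auto

lemma qn_fr: "qn (fr h p) = fO h p" by (simp add: fr_def fO_def fF_def)

lemma restricts_qn_le: "restricts g \<Longrightarrow> qn (g p) \<le> fF p"
  by (auto simp: restricts_def fF_def simp del: split_paired_All dest: spec[of _ p])

definition Xt where "Xt h u = (SOME Z. has_int (sh (ft h) u) Z)"

lemma has_int_Xt: "has_int (sh (ft h) u) (Xt h u)"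
proof -
  have "\<exists>Z. has_int (sh (ft h) u) Z" by (intro has_int_exists L24_L2 L24_sh restricts_L24 restricts_ft)
  then show ?thesis unfolding Xt_def by (rule someI_ex)
qed

lemma has_int_residual: "has_int (sh (fr h) u) (\<lambda>\<omega>. X u \<omega> - Xt h u \<omega>)"
proof -
  have "(\<lambda>p. 1 *\<^sub>R sh f u p + (-1) *\<^sub>R sh (ft h) u p) = sh (fr h) u"
    by (auto simp: sh_def ft_def fr_def)
  then show ?thesis using has_int_lincomb[OF has_int_X[of u] has_int_Xt[of h u], of 1 "-1"] by simp
qed

text \<open>Dominates the covariance of products, apart from a constant. Only the first two functions vary: a
truncation error always occurs in one of them.\<close>

definition prod_bound where
  "prod_bound \<phi>1 u1 \<phi>2 u2 u3 u4 = J4 \<phi>1 u1 \<phi>2 u2 fF u3 fF u4 + J2 \<phi>1 u1 fF u3 * J2 \<phi>2 u2 fF u4 + J2 \<phi>1 u1 fF u4 * J2 \<phi>2 u2 fF u3"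

lemma abs_Cov_le:
  assumes g: "restricts g1" "restricts g2" and \<phi>: "profile \<phi>1" "profile \<phi>2" and le: "\<And>p. qn (g1 p) \<le> \<phi>1 p" "\<And>p. qn (g2 p) \<le> \<phi>2 p"
  shows "\<bar>Cov (sh g1 u1) (sh g2 u2)\<bar> \<le> J2 \<phi>1 u1 \<phi>2 u2"
proof -
  have "\<bar>Cov (sh g1 u1) (sh g2 u2)\<bar> \<le> (LINT p|N. \<bar>cov (sh g1 u1 p) (sh g2 u2 p)\<bar>)"
    unfolding Cov_def by (rule integral_abs_bound)
  also have "\<dots> \<le> J2 \<phi>1 u1 \<phi>2 u2" unfolding J2_def
  proof (intro integral_mono integrable_abs integrable_cov J2_integrable \<phi> L24_L2 L24_sh restricts_L24 g)
    fix p
    have "\<bar>cov (sh g1 u1 p) (sh g2 u2 p)\<bar> \<le> qn (sh g1 u1 p) * qn (sh g2 u2 p)" by (rule abs_cov_le)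
    also have "\<dots> \<le> sh \<phi>1 u1 p * sh \<phi>2 u2 p"
      using le profileD(1)[OF \<phi>(1)] by (intro mult_mono) (auto simp: sh_def)
    finally show "\<bar>cov (sh g1 u1 p) (sh g2 u2 p)\<bar> \<le> sh \<phi>1 u1 p * sh \<phi>2 u2 p" .
  qed
  finally show ?thesis .
qed

lemma abs_prod_cov_le:
  assumes g: "restricts g1" "restricts g2" "restricts g3" "restricts g4" and \<phi>: "profile \<phi>1" "profile \<phi>2"
    and le: "\<And>p. qn (g1 p) \<le> \<phi>1 p" "\<And>p. qn (g2 p) \<le> \<phi>2 p"
  shows "\<bar>prod_cov (sh g1 u1) (sh g2 u2) (sh g3 u3) (sh g4 u4)\<bar> \<le> (K4 + 1) * prod_bound \<phi>1 u1 \<phi>2 u2 u3 u4"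
proof -
  have "\<bar>Cum (sh g1 u1) (sh g2 u2) (sh g3 u3) (sh g4 u4)\<bar> \<le> (LINT p|N. \<bar>k4 (sh g1 u1 p) (sh g2 u2 p) (sh g3 u3 p) (sh g4 u4 p)\<bar>)"
    unfolding Cum_def by (rule integral_abs_bound)
  also have "\<dots> \<le> (LINT p|N. K4 * (sh \<phi>1 u1 p * sh \<phi>2 u2 p * sh fF u3 p * sh fF u4 p))"
  proof (intro integral_mono integrable_abs integrable_k4 integrable_mult_right J4_integrable \<phi> profile_fF L24_sh restricts_L24 g)
    fix p
    have "\<bar>k4 (sh g1 u1 p) (sh g2 u2 p) (sh g3 u3 p) (sh g4 u4 p)\<bar> \<le> K4 * (qn (sh g1 u1 p) * qn (sh g2 u2 p) * qn (sh g3 u3 p) * qn (sh g4 u4 p))"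
      by (rule K4(2))
    also have "\<dots> \<le> K4 * (sh \<phi>1 u1 p * sh \<phi>2 u2 p * sh fF u3 p * sh fF u4 p)"
      using le restricts_qn_le[OF g(3)] restricts_qn_le[OF g(4)] profileD(1)[OF \<phi>(1)] profileD(1)[OF \<phi>(2)] profileD(1)[OF profile_fF]
      by (intro mult_left_mono mult_mono K4(1) mult_nonneg_nonneg) (auto simp: sh_def)
    finally show "\<bar>k4 (sh g1 u1 p) (sh g2 u2 p) (sh g3 u3 p) (sh g4 u4 p)\<bar> \<le> K4 * (sh \<phi>1 u1 p * sh \<phi>2 u2 p * sh fF u3 p * sh fF u4 p)" .
  qed
  also have "\<dots> = K4 * J4 \<phi>1 u1 \<phi>2 u2 fF u3 fF u4" by (simp add: J4_def)
  finally have C: "\<bar>Cum (sh g1 u1) (sh g2 u2) (sh g3 u3) (sh g4 u4)\<bar> \<le> K4 * J4 \<phi>1 u1 \<phi>2 u2 fF u3 fF u4" .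
  have 1: "\<bar>Cov (sh g1 u1) (sh g3 u3) * Cov (sh g2 u2) (sh g4 u4)\<bar> \<le> J2 \<phi>1 u1 fF u3 * J2 \<phi>2 u2 fF u4"
    unfolding abs_mult using g \<phi> le by (intro mult_mono abs_Cov_le J2_nonneg restricts_qn_le profile_fF) auto
  have 2: "\<bar>Cov (sh g1 u1) (sh g4 u4) * Cov (sh g2 u2) (sh g3 u3)\<bar> \<le> J2 \<phi>1 u1 fF u4 * J2 \<phi>2 u2 fF u3"
    unfolding abs_mult using g \<phi> le by (intro mult_mono abs_Cov_le J2_nonneg restricts_qn_le profile_fF) auto
  let ?j = "J4 \<phi>1 u1 \<phi>2 u2 fF u3 fF u4" and ?a = "J2 \<phi>1 u1 fF u3 * J2 \<phi>2 u2 fF u4" and ?b = "J2 \<phi>1 u1 fF u4 * J2 \<phi>2 u2 fF u3"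
  have nn: "0 \<le> ?j" "0 \<le> K4 * ?a" "0 \<le> K4 * ?b"
    using \<phi> K4(1) by (auto intro!: J4_nonneg mult_nonneg_nonneg J2_nonneg)
  have "\<bar>prod_cov (sh g1 u1) (sh g2 u2) (sh g3 u3) (sh g4 u4)\<bar> \<le> K4 * ?j + (?a + ?b)"
    unfolding prod_cov_def using C 1 2 by (intro order_trans[OF abs_triangle_ineq] add_mono) auto
  also have "\<dots> \<le> (K4 + 1) * prod_bound \<phi>1 u1 \<phi>2 u2 u3 u4"
    unfolding prod_bound_def using nn by (simp add: algebra_simps)
  finally show ?thesis .
qed

lemma prod_bound_shift: "profile \<phi>1 \<Longrightarrow> profile \<phi>2 \<Longrightarrow> prod_bound \<phi>1 (u1 + a) \<phi>2 (u2 + a) (u3 + a) (u4 + a) = prod_bound \<phi>1 u1 \<phi>2 u2 u3 u4"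
  by (simp add: prod_bound_def J2_shift J4_shift)

lemma prod_bound_nonneg: "profile \<phi>1 \<Longrightarrow> profile \<phi>2 \<Longrightarrow> 0 \<le> prod_bound \<phi>1 u1 \<phi>2 u2 u3 u4"
  unfolding prod_bound_def by (intro add_nonneg_nonneg mult_nonneg_nonneg J2_nonneg J4_nonneg profile_fF)

lemma profile_le: "profile \<phi> \<Longrightarrow> \<phi> p \<le> fF p" by (simp add: profile_def del: split_paired_All)

lemma prod_bound_le: "profile \<phi>1 \<Longrightarrow> profile \<phi>2 \<Longrightarrow> prod_bound \<phi>1 u1 \<phi>2 u2 u3 u4 \<le> prod_bound fF u1 fF u2 u3 u4"
  unfolding prod_bound_def by (intro add_mono mult_mono J2_mono J4_mono J2_nonneg profile_fF profile_le order_refl)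

lemma prod_bound_summable: "(\<lambda>l. prod_bound fF 0 fF a l (l + b)) summable_on UNIV"
proof (rule summable_on_dominated)
  show "(\<lambda>l. J4 fF 0 fF a fF l fF (l + b) + E2 * J2 fF 0 fF l + E2 * J2 fF 0 fF (l + b)) summable_on UNIV"
    by (intro summable_on_add J4_summable summable_on_cmult_right J2_summable summable_on_shift(1)[OF J2_summable])
  fix l
  have "J2 fF 0 fF l * J2 fF a fF (l + b) \<le> J2 fF 0 fF l * E2" "J2 fF 0 fF (l + b) * J2 fF a fF l \<le> J2 fF 0 fF (l + b) * E2"
    by (intro mult_left_mono J2_le_E2 J2_nonneg profile_fF)+
  then show "\<bar>prod_bound fF 0 fF a l (l + b)\<bar> \<le> J4 fF 0 fF a fF l fF (l + b) + E2 * J2 fF 0 fF l + E2 * J2 fF 0 fF (l + b)"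
    using prod_bound_nonneg[OF profile_fF profile_fF, of 0 a l "l + b"] by (simp add: prod_bound_def mult.commute)
qed

lemma fO_tendsto: "(\<lambda>n. sh (fO (real n)) u p) \<longlonglongrightarrow> 0"
proof (rule tendsto_eventually)
  let ?p = "reflect (real_pt u) p"
  obtain k :: nat where k: "2 * norm (snd ?p) < real k" using reals_Archimedean2 by blast
  show "eventually (\<lambda>n. sh (fO (real n)) u p = 0) sequentially"
  proof (rule eventually_sequentiallyI[of k])
    fix n assume n: "k \<le> n"
    have "\<bar>snd ?p $ i\<bar> < real n / 2" for i
    proof -
      have "\<bar>snd ?p $ i\<bar> \<le> norm (snd ?p)" by (rule component_le_norm_cart)
      moreover have "real k \<le> real n" using n by simp
      ultimately show ?thesis using k by linarith
    qed
    then have "?p \<notin> far_region (real n)" by (auto simp: far_region_def not_le)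
    then show "sh (fO (real n)) u p = 0" by (simp add: sh_def fO_def)
  qed
qed

lemma J2_fO_tendsto: "(\<lambda>n. J2 (fO (real n)) u fF v) \<longlonglongrightarrow> 0"
proof -
  have "(\<lambda>n. J2 (fO (real n)) u fF v) \<longlonglongrightarrow> (LINT p|N. 0)" unfolding J2_def
  proof (rule integral_dominated_convergence[where w="\<lambda>p. sh fF u p * sh fF v p"])
    show "AE p in N. (\<lambda>n. sh (fO (real n)) u p * sh fF v p) \<longlonglongrightarrow> 0"
      using tendsto_mult[OF fO_tendsto tendsto_const] by (intro AE_I2) simp
    show "AE p in N. norm (sh (fO (real n)) u p * sh fF v p) \<le> sh fF u p * sh fF v p" for n
      using profileD[OF profile_fO] profileD(1)[OF profile_fF] by (intro AE_I2) (auto simp: abs_mult intro!: mult_right_mono)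
    show "(\<lambda>p. sh (fO (real n)) u p * sh fF v p) \<in> borel_measurable N" for n
      using J2_integrable[OF profile_fO profile_fF] by blast
  qed (use J2_integrable[OF profile_fF profile_fF] in auto)
  then show ?thesis by simp
qed

lemma J4_fO_tendsto: "(\<lambda>n. J4 (fO (real n)) u1 fF u2 fF u3 fF u4) \<longlonglongrightarrow> 0"
proof -
  have "(\<lambda>n. J4 (fO (real n)) u1 fF u2 fF u3 fF u4) \<longlonglongrightarrow> (LINT p|N. 0)" unfolding J4_def
  proof (rule integral_dominated_convergence[where w="\<lambda>p. sh fF u1 p * sh fF u2 p * sh fF u3 p * sh fF u4 p"])
    show "AE p in N. (\<lambda>n. sh (fO (real n)) u1 p * sh fF u2 p * sh fF u3 p * sh fF u4 p) \<longlonglongrightarrow> 0"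
    proof (rule AE_I2)
      fix p
      have "(\<lambda>n. sh (fO (real n)) u1 p * sh fF u2 p * sh fF u3 p * sh fF u4 p) \<longlonglongrightarrow> 0 * sh fF u2 p * sh fF u3 p * sh fF u4 p"
        by (intro tendsto_mult fO_tendsto tendsto_const)
      then show "(\<lambda>n. sh (fO (real n)) u1 p * sh fF u2 p * sh fF u3 p * sh fF u4 p) \<longlonglongrightarrow> 0" by simp
    qed
    show "AE p in N. norm (sh (fO (real n)) u1 p * sh fF u2 p * sh fF u3 p * sh fF u4 p) \<le> sh fF u1 p * sh fF u2 p * sh fF u3 p * sh fF u4 p" for n
      using profileD[OF profile_fO] profileD(1)[OF profile_fF] by (intro AE_I2) (auto simp: abs_mult intro!: mult_right_mono)
    show "(\<lambda>p. sh (fO (real n)) u1 p * sh fF u2 p * sh fF u3 p * sh fF u4 p) \<in> borel_measurable N" for n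
      using J4_integrable[OF profile_fO profile_fF profile_fF profile_fF] by blast
  qed (use J4_integrable[OF profile_fF profile_fF profile_fF profile_fF] in auto)
  then show ?thesis by simp
qed

text \<open>Dominated convergence, as the far part of \<open>f\<close> vanishes pointwise.\<close>

lemma prod_bound_fO_tendsto:
  "(\<lambda>n. prod_bound (fO (real n)) u1 fF u2 u3 u4) \<longlonglongrightarrow> 0" "(\<lambda>n. prod_bound fF u1 (fO (real n)) u2 u3 u4) \<longlonglongrightarrow> 0"
proof -
  have "(\<lambda>n. prod_bound (fO (real n)) u1 fF u2 u3 u4) \<longlonglongrightarrow> 0 + 0 * J2 fF u2 fF u4 + 0 * J2 fF u2 fF u3"
    unfolding prod_bound_def by (intro tendsto_intros J4_fO_tendsto J2_fO_tendsto)
  then show "(\<lambda>n. prod_bound (fO (real n)) u1 fF u2 u3 u4) \<longlonglongrightarrow> 0" by simp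
  have swap: "prod_bound fF u1 (fO h) u2 u3 u4 = prod_bound (fO h) u2 fF u1 u3 u4" for h
    unfolding prod_bound_def J4_def by (simp add: mult_ac)
  have "(\<lambda>n. prod_bound (fO (real n)) u2 fF u1 u3 u4) \<longlonglongrightarrow> 0 + 0 * J2 fF u1 fF u4 + 0 * J2 fF u1 fF u3"
    unfolding prod_bound_def by (intro tendsto_intros J4_fO_tendsto J2_fO_tendsto)
  then show "(\<lambda>n. prod_bound fF u1 (fO (real n)) u2 u3 u4) \<longlonglongrightarrow> 0" unfolding swap by simp
qed

lemma prod_cov_shift:
  assumes "restricts g1" "restricts g2" "restricts g3" "restricts g4"
  shows "prod_cov (sh g1 (u1 + a)) (sh g2 (u2 + a)) (sh g3 (u3 + a)) (sh g4 (u4 + a)) = prod_cov (sh g1 u1) (sh g2 u2) (sh g3 u3) (sh g4 u4)"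
  using assms unfolding prod_cov_def by (simp add: Cov_shift Cum_shift restricts_def)

end

section \<open>Linear combinations of lagged products\<close>

text \<open>The vector \<open>t\<close> is the direction in which the lagged products are projected.\<close>

locale lagged_products = mma_setup M \<Lambda> \<gamma> Sig \<nu> \<pi> f X \<delta> \<beta>
  for M :: "'w measure"
    and \<Lambda> :: "('s::polish_space \<times> (real^'m)) set \<Rightarrow> 'w \<Rightarrow> real^'d"
    and \<gamma> :: "real^'d" and Sig :: "real^'d^'d" and \<nu> :: "(real^'d) measure"
    and \<pi> :: "'s measure" and f :: "'s \<times> (real^'m) \<Rightarrow> real^'d" and X :: "int^'m \<Rightarrow> 'w \<Rightarrow> real" and \<delta> \<beta> :: real +
  fixes k :: "'r::finite \<Rightarrow> int^'m" and t :: "'r \<Rightarrow> real"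
begin

text \<open>The centred linear combination for an integrand \<open>g\<close> and the field \<open>V\<close> that it generates.\<close>

definition Yg where "Yg g V j \<omega> = (\<Sum>q\<in>UNIV. t q * (V j \<omega> * V (j + k q) \<omega> - Cov (sh g 0) (sh g (k q))))"
text \<open>The autocovariance of this field.\<close>

definition cY where "cY g l = (\<Sum>p\<in>UNIV. \<Sum>q\<in>UNIV. t p * t q * prod_cov (sh g 0) (sh g (k p)) (sh g l) (sh g (l + k q)))"
text \<open>A summable majorant of all autocovariances, uniform over truncations.\<close>

definition wB where "wB l = (\<Sum>p\<in>UNIV. \<Sum>q\<in>UNIV. \<bar>t p\<bar> * \<bar>t q\<bar> * ((K4 + 1) * prod_bound fF 0 fF (k p) l (l + k q)))"

lemma Cov_lag: "restricts g \<Longrightarrow> Cov (sh g j) (sh g (j + k q)) = Cov (sh g 0) (sh g (k q))"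
  using Cov_shift[of g g 0 j "k q"] by (simp add: restricts_def add.commute)

lemma Yg_moments:
  assumes g: "restricts g" and V: "\<And>u. has_int (sh g u) (V u)"
  shows "Yg g V j \<in> borel_measurable M" "integrable M (\<lambda>\<omega>. Yg g V j \<omega> * Yg g V l \<omega>)"
    "(LINT \<omega>|M. Yg g V j \<omega> * Yg g V l \<omega>) = cY g (l - j)" "integrable M (Yg g V j)" "(LINT \<omega>|M. Yg g V j \<omega>) = 0"
proof -
  have [measurable]: "V u \<in> borel_measurable M" for u using V by (rule has_int_measurable)
  show [measurable]: "Yg g V j \<in> borel_measurable M" unfolding Yg_def[abs_def] by measurable
  have Lg: "L24 (sh g u)" for u using g by (intro L24_sh restricts_L24)
  let ?y = "\<lambda>j q \<omega>. V j \<omega> * V (j + k q) \<omega> - Cov (sh g 0) (sh g (k q))"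
  note pc = product_covariance[OF Lg Lg Lg Lg V V V V]
  have i: "integrable M (\<lambda>\<omega>. ?y j p \<omega> * ?y l q \<omega>)" and e: "(LINT \<omega>|M. ?y j p \<omega> * ?y l q \<omega>) = prod_cov (sh g 0) (sh g (k p)) (sh g (l - j)) (sh g (l - j + k q))" for j l p q
    using pc(2,3)[of j "j + k p" l "l + k q"] prod_cov_shift[OF g g g g, of 0 j "k p" "l - j" "l - j + k q"]
    by (simp_all add: Cov_lag[OF g] add_ac)
  have prod: "Yg g V j \<omega> * Yg g V l \<omega> = (\<Sum>p\<in>UNIV. \<Sum>q\<in>UNIV. t p * t q * (?y j p \<omega> * ?y l q \<omega>))" for \<omega>
    unfolding Yg_def sum_product by (simp add: mult_ac)
  have i': "integrable M (\<lambda>\<omega>. t p * t q * (?y j p \<omega> * ?y l q \<omega>))" for p q by (intro integrable_mult_right i)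
  show "integrable M (\<lambda>\<omega>. Yg g V j \<omega> * Yg g V l \<omega>)"
    unfolding prod by (intro Bochner_Integration.integrable_sum i')
  have "(LINT \<omega>|M. Yg g V j \<omega> * Yg g V l \<omega>) = (\<Sum>p\<in>UNIV. LINT \<omega>|M. (\<Sum>q\<in>UNIV. t p * t q * (?y j p \<omega> * ?y l q \<omega>)))"
    unfolding prod by (intro Bochner_Integration.integral_sum Bochner_Integration.integrable_sum i')
  also have "\<dots> = (\<Sum>p\<in>UNIV. \<Sum>q\<in>UNIV. LINT \<omega>|M. t p * t q * (?y j p \<omega> * ?y l q \<omega>))"
    by (intro sum.cong refl Bochner_Integration.integral_sum i')
  also have "\<dots> = cY g (l - j)" unfolding cY_def integral_mult_right_zero e ..
  finally show "(LINT \<omega>|M. Yg g V j \<omega> * Yg g V l \<omega>) = cY g (l - j)" .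
  have iy: "integrable M (?y j q)" for q using pc(1)[of j "j + k q"] by simp
  have ey: "(LINT \<omega>|M. ?y j q \<omega>) = 0" for q
    using pc(1)[of j "j + k q"] has_int_second_product[OF Lg Lg V V, of j "j + k q"] by (simp add: Cov_lag[OF g] M.prob_space)
  show "integrable M (Yg g V j)" unfolding Yg_def[abs_def] using iy by (intro Bochner_Integration.integrable_sum integrable_mult_right)
  have "(LINT \<omega>|M. Yg g V j \<omega>) = (\<Sum>q\<in>UNIV. LINT \<omega>|M. t q * ?y j q \<omega>)"
    unfolding Yg_def using iy by (intro Bochner_Integration.integral_sum integrable_mult_right)
  then show "(LINT \<omega>|M. Yg g V j \<omega>) = 0" unfolding integral_mult_right_zero ey by simp
qed

lemma wB_summable: "wB summable_on UNIV"
  unfolding wB_def[abs_def] by (intro infsum_finite_sum(2) summable_on_cmult_right prod_bound_summable) auto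

lemma abs_cY_le: "restricts g \<Longrightarrow> \<bar>cY g l\<bar> \<le> wB l"
  unfolding cY_def wB_def
  by (intro order_trans[OF sum_abs] sum_mono) (auto simp: abs_mult intro!: mult_left_mono abs_prod_cov_le restricts_qn_le)

lemma cY_summable: "restricts g \<Longrightarrow> cY g summable_on UNIV"
  by (rule summable_on_dominated[OF wB_summable]) (rule abs_cY_le)

text \<open>A majorant of the autocovariance of the truncation error. The factor 2 accounts for the two choices
in the second pair of factors, as the error of a product is a sum of two products.\<close>

definition eB where
  "eB h l = (\<Sum>p\<in>UNIV. \<Sum>q\<in>UNIV. \<bar>t p\<bar> * \<bar>t q\<bar> * (2 * (K4 + 1) * (prod_bound (fO h) 0 fF (k p) l (l + k q) + prod_bound fF 0 (fO h) (k p) l (l + k q))))"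

lemma eB_bounds: "eB h summable_on UNIV" "(\<lambda>n. infsum (eB (real n)) UNIV) \<longlonglongrightarrow> 0"
proof -
  have K1: "0 \<le> K4 + 1" using K4(1) by simp
  have b: "\<bar>eB h l\<bar> \<le> 4 * wB l" for h l
  proof -
    have nn: "0 \<le> prod_bound (fO h) 0 fF (k p) l (l + k q) + prod_bound fF 0 (fO h) (k p) l (l + k q)" for p q
      by (intro add_nonneg_nonneg prod_bound_nonneg profile_fF profile_fO)
    have "0 \<le> eB h l" unfolding eB_def using K1 by (intro sum_nonneg mult_nonneg_nonneg nn) auto
    moreover have "eB h l \<le> (\<Sum>p\<in>UNIV. \<Sum>q\<in>UNIV. \<bar>t p\<bar> * \<bar>t q\<bar> * (2 * (K4 + 1) * (prod_bound fF 0 fF (k p) l (l + k q) + prod_bound fF 0 fF (k p) l (l + k q))))"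
      unfolding eB_def using K1 by (intro sum_mono mult_left_mono add_mono prod_bound_le profile_fF profile_fO) auto
    moreover have "\<dots> = 4 * wB l" unfolding wB_def sum_distrib_left by (intro sum.cong refl) (simp add: algebra_simps)
    ultimately show ?thesis by simp
  qed
  have s4: "(\<lambda>l. 4 * wB l) summable_on UNIV" by (intro summable_on_cmult_right wB_summable)
  show "eB h summable_on UNIV" by (rule summable_on_dominated[OF s4]) (rule b)
  have "(\<lambda>n. eB (real n) l) \<longlonglongrightarrow> (\<Sum>p\<in>UNIV. \<Sum>q\<in>UNIV. \<bar>t p\<bar> * \<bar>t q\<bar> * (2 * (K4 + 1) * (0 + 0)))" for l
    unfolding eB_def by (intro tendsto_intros prod_bound_fO_tendsto)
  then have lim: "(\<lambda>n. eB (real n) l) \<longlonglongrightarrow> 0" for l by simp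
  from infsum_dominated_convergence(1)[OF s4 b lim] show "(\<lambda>n. infsum (eB (real n)) UNIV) \<longlonglongrightarrow> 0" by simp
qed

abbreviation "Yf \<equiv> Yg f X"
abbreviation "Yt h \<equiv> Yg (ft h) (Xt h)"

text \<open>By \<open>xx' - yy' = (x - y)x' + y(x' - y')\<close>, the difference is a sum of two centred products, each of
which contains a factor with an integrand supported outside the cube. The Boolean index selects one
of the two.\<close>

lemma Yf_Yt_diff:
  "integrable M (\<lambda>\<omega>. (Yf j \<omega> - Yt h j \<omega>) * (Yf l \<omega> - Yt h l \<omega>))"
  "\<bar>LINT \<omega>|M. (Yf j \<omega> - Yt h j \<omega>) * (Yf l \<omega> - Yt h l \<omega>)\<bar> \<le> eB h (l - j)"
proof -
  let ?R = "\<lambda>u \<omega>. X u \<omega> - Xt h u \<omega>"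
  define G where "G b = (if b then fr h else ft h)" for b :: bool
  define G' where "G' b = (if b then f else fr h)" for b :: bool
  define Z where "Z b = (if b then ?R else Xt h)" for b :: bool
  define Z' where "Z' b = (if b then X else ?R)" for b :: bool
  have G: "restricts (G b)" "restricts (G' b)" for b by (auto simp: G_def G'_def)
  have Z: "has_int (sh (G b) u) (Z b u)" "has_int (sh (G' b) u) (Z' b u)" for b u
    by (auto simp: G_def G'_def Z_def Z'_def has_int_X has_int_Xt has_int_residual)
  have LG: "L24 (sh (G b) u)" "L24 (sh (G' b) u)" for b u by (intro L24_sh restricts_L24 G)+
  have Lf: "L24 (sh f u)" "L24 (sh (ft h) u)" for u by (intro L24_sh restricts_L24 restricts_f restricts_ft)+
  define y where "y b j q \<omega> = Z b j \<omega> * Z' b (j + k q) \<omega> - Cov (sh (G b) j) (sh (G' b) (j + k q))" for b j q \<omega>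
  note pc = product_covariance[OF LG(1) LG(2) LG(1) LG(2) Z(1) Z(2) Z(1) Z(2)]
  have i: "integrable M (\<lambda>\<omega>. y b j p \<omega> * y b' l q \<omega>)" for b b' j l p q unfolding y_def by (rule pc(2))
  have e: "(LINT \<omega>|M. y b j p \<omega> * y b' l q \<omega>) = prod_cov (sh (G b) j) (sh (G' b) (j + k p)) (sh (G b') l) (sh (G' b') (l + k q))" for b b' j l p q
    unfolding y_def by (rule pc(3))
  have CovG: "(LINT \<omega>|M. Z b j \<omega> * Z' b (j + k q) \<omega>) = Cov (sh (G b) j) (sh (G' b) (j + k q))" for b j q
    by (rule has_int_second_product[OF LG Z])
  have split: "X j \<omega> * X (j + k q) \<omega> - Xt h j \<omega> * Xt h (j + k q) \<omega> = Z True j \<omega> * Z' True (j + k q) \<omega> + Z False j \<omega> * Z' False (j + k q) \<omega>" for j q \<omega>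
    by (simp add: Z_def Z'_def algebra_simps)
  have Csplit: "Cov (sh f 0) (sh f (k q)) - Cov (sh (ft h) 0) (sh (ft h) (k q)) = Cov (sh (G True) j) (sh (G' True) (j + k q)) + Cov (sh (G False) j) (sh (G' False) (j + k q))" for j q
  proof -
    have "Cov (sh f 0) (sh f (k q)) - Cov (sh (ft h) 0) (sh (ft h) (k q)) = (LINT \<omega>|M. X j \<omega> * X (j + k q) \<omega>) - (LINT \<omega>|M. Xt h j \<omega> * Xt h (j + k q) \<omega>)"
      using has_int_second_product[OF Lf(1) Lf(1) has_int_X has_int_X, of j "j + k q"] has_int_second_product[OF Lf(2) Lf(2) has_int_Xt has_int_Xt, of j "j + k q"]
      by (simp add: Cov_lag)
    also have "\<dots> = (LINT \<omega>|M. X j \<omega> * X (j + k q) \<omega> - Xt h j \<omega> * Xt h (j + k q) \<omega>)"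
      by (rule Bochner_Integration.integral_diff[symmetric])
        (rule product_covariance(1)[OF Lf(1) Lf(1) Lf(1) Lf(1) has_int_X has_int_X has_int_X has_int_X],
         rule product_covariance(1)[OF Lf(2) Lf(2) Lf(2) Lf(2) has_int_Xt has_int_Xt has_int_Xt has_int_Xt])
    also have "\<dots> = Cov (sh (G True) j) (sh (G' True) (j + k q)) + Cov (sh (G False) j) (sh (G' False) (j + k q))"
      unfolding split CovG[symmetric] by (intro Bochner_Integration.integral_add pc(1))
    finally show ?thesis .
  qed
  have D: "Yf j \<omega> - Yt h j \<omega> = (\<Sum>q\<in>UNIV. t q * (\<Sum>b\<in>UNIV. y b j q \<omega>))" for j \<omega>
  proof -
    have "Yf j \<omega> - Yt h j \<omega> = (\<Sum>q\<in>UNIV. t q * ((X j \<omega> * X (j + k q) \<omega> - Xt h j \<omega> * Xt h (j + k q) \<omega>) - (Cov (sh f 0) (sh f (k q)) - Cov (sh (ft h) 0) (sh (ft h) (k q)))))"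
      unfolding Yg_def sum_subtractf[symmetric] by (intro sum.cong refl) (simp add: algebra_simps)
    also have "\<dots> = (\<Sum>q\<in>UNIV. t q * (\<Sum>b\<in>UNIV. y b j q \<omega>))"
      unfolding split Csplit[of _ j] by (intro sum.cong refl) (simp add: y_def UNIV_bool algebra_simps)
    finally show ?thesis .
  qed
  have DD: "(Yf j \<omega> - Yt h j \<omega>) * (Yf l \<omega> - Yt h l \<omega>) = (\<Sum>p\<in>UNIV. \<Sum>q\<in>UNIV. \<Sum>b\<in>UNIV. \<Sum>b'\<in>UNIV. t p * t q * (y b j p \<omega> * y b' l q \<omega>))" for \<omega>
  proof -
    have "(Yf j \<omega> - Yt h j \<omega>) * (Yf l \<omega> - Yt h l \<omega>) = (\<Sum>p\<in>UNIV. \<Sum>q\<in>UNIV. t p * t q * ((\<Sum>b\<in>UNIV. y b j p \<omega>) * (\<Sum>b'\<in>UNIV. y b' l q \<omega>)))"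
      unfolding D by (subst sum_product) (simp add: mult_ac)
    also have "\<dots> = (\<Sum>p\<in>UNIV. \<Sum>q\<in>UNIV. \<Sum>b\<in>UNIV. \<Sum>b'\<in>UNIV. t p * t q * (y b j p \<omega> * y b' l q \<omega>))"
      unfolding sum_product by (simp only: sum_distrib_left)
    finally show ?thesis .
  qed
  have i': "integrable M (\<lambda>\<omega>. t p * t q * (y b j p \<omega> * y b' l q \<omega>))" for p q b b' by (intro integrable_mult_right i)
  show "integrable M (\<lambda>\<omega>. (Yf j \<omega> - Yt h j \<omega>) * (Yf l \<omega> - Yt h l \<omega>))"
    unfolding DD by (intro Bochner_Integration.integrable_sum i')
  have "(LINT \<omega>|M. (Yf j \<omega> - Yt h j \<omega>) * (Yf l \<omega> - Yt h l \<omega>)) = (\<Sum>p\<in>UNIV. \<Sum>q\<in>UNIV. \<Sum>b\<in>UNIV. \<Sum>b'\<in>UNIV. LINT \<omega>|M. t p * t q * (y b j p \<omega> * y b' l q \<omega>))"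
    unfolding DD by (simp only: Bochner_Integration.integral_sum Bochner_Integration.integrable_sum i')
  also have "\<bar>\<dots>\<bar> \<le> (\<Sum>p\<in>UNIV. \<Sum>q\<in>UNIV. \<Sum>b\<in>UNIV. \<Sum>b'\<in>(UNIV::bool set). \<bar>t p\<bar> * \<bar>t q\<bar> * ((K4 + 1) * (if b then prod_bound (fO h) 0 fF (k p) (l - j) (l - j + k q) else prod_bound fF 0 (fO h) (k p) (l - j) (l - j + k q))))"
  proof (intro order_trans[OF sum_abs] sum_mono)
    fix p q b b'
    have "\<bar>prod_cov (sh (G b) j) (sh (G' b) (j + k p)) (sh (G b') l) (sh (G' b') (l + k q))\<bar> \<le> (K4 + 1) * (if b then prod_bound (fO h) j fF (j + k p) l (l + k q) else prod_bound fF j (fO h) (j + k p) l (l + k q))"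
    proof (cases b)
      case True
      have "\<bar>prod_cov (sh (G b) j) (sh (G' b) (j + k p)) (sh (G b') l) (sh (G' b') (l + k q))\<bar> \<le> (K4 + 1) * prod_bound (fO h) j fF (j + k p) l (l + k q)"
        by (intro abs_prod_cov_le G profile_fF profile_fO restricts_qn_le) (simp add: G_def True qn_fr)
      then show ?thesis using True by simp
    next
      case False
      have "\<bar>prod_cov (sh (G b) j) (sh (G' b) (j + k p)) (sh (G b') l) (sh (G' b') (l + k q))\<bar> \<le> (K4 + 1) * prod_bound fF j (fO h) (j + k p) l (l + k q)"
        by (intro abs_prod_cov_le G profile_fF profile_fO restricts_qn_le) (simp add: G'_def False qn_fr)
      then show ?thesis using False by simp
    qed
    also have "prod_bound (fO h) j fF (j + k p) l (l + k q) = prod_bound (fO h) 0 fF (k p) (l - j) (l - j + k q)"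
      using prod_bound_shift[OF profile_fO[of h] profile_fF, where ?u1.0=0 and a=j and ?u2.0="k p" and ?u3.0="l - j" and ?u4.0="l - j + k q"] by (simp add: add_ac)
    also have "prod_bound fF j (fO h) (j + k p) l (l + k q) = prod_bound fF 0 (fO h) (k p) (l - j) (l - j + k q)"
      using prod_bound_shift[OF profile_fF profile_fO[of h], where ?u1.0=0 and a=j and ?u2.0="k p" and ?u3.0="l - j" and ?u4.0="l - j + k q"] by (simp add: add_ac)
    finally show "\<bar>LINT \<omega>|M. t p * t q * (y b j p \<omega> * y b' l q \<omega>)\<bar> \<le> \<bar>t p\<bar> * \<bar>t q\<bar> * ((K4 + 1) * (if b then prod_bound (fO h) 0 fF (k p) (l - j) (l - j + k q) else prod_bound fF 0 (fO h) (k p) (l - j) (l - j + k q)))"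
      unfolding integral_mult_right_zero e abs_mult by (intro mult_left_mono) auto
  qed
  also have "\<dots> = eB h (l - j)"
    unfolding eB_def by (intro sum.cong refl) (simp add: UNIV_bool algebra_simps)
  finally show "\<bar>LINT \<omega>|M. (Yf j \<omega> - Yt h j \<omega>) * (Yf l \<omega> - Yt h l \<omega>)\<bar> \<le> eB h (l - j)" .
qed

end

context centred_levy_basis
begin

section \<open>Independent blocks for finite range fields\<close>

lemma has_int_zero: "has_int (\<lambda>_. 0) (\<lambda>_. 0)"
proof -
  have "\<exists>Z. has_int (\<lambda>_. 0) Z" by (rule has_int_exists) auto
  then obtain Z where "has_int (\<lambda>_. 0) Z" by blast
  from has_int_scale[OF this, of 0] show ?thesis by simp
qed

lemma has_int_sum:
  assumes "finite I" "\<And>i. i \<in> I \<Longrightarrow> has_int (g i) (Z i)"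
  shows "has_int (\<lambda>p. \<Sum>i\<in>I. c i *\<^sub>R g i p) (\<lambda>\<omega>. \<Sum>i\<in>I. c i * Z i \<omega>)"
  using assms
proof (induction I rule: finite_induct)
  case empty then show ?case using has_int_zero by simp
next
  case (insert i I)
  have "has_int (\<lambda>p. c i *\<^sub>R g i p + 1 *\<^sub>R (\<Sum>i\<in>I. c i *\<^sub>R g i p)) (\<lambda>\<omega>. c i * Z i \<omega> + 1 * (\<Sum>i\<in>I. c i * Z i \<omega>))"
    using insert by (intro has_int_lincomb) auto
  then show ?case using insert.hyps by simp
qed

lemma L24_sum:
  assumes "finite I" "\<And>i. i \<in> I \<Longrightarrow> L24 (g i)"
  shows "L24 (\<lambda>p. \<Sum>i\<in>I. c i *\<^sub>R g i p)"
  using assms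
proof (induction I rule: finite_induct)
  case empty then show ?case by (simp add: L24_def)
next
  case (insert i I)
  have "L24 (\<lambda>p. c i *\<^sub>R g i p + 1 *\<^sub>R (\<Sum>i\<in>I. c i *\<^sub>R g i p))"
    using insert by (intro L24_lincomb) auto
  then show ?case using insert.hyps by simp
qed

text \<open>The additivity that replaces independence: at each point at most one summand is nonzero.\<close>

lemma levy_exponent_disjoint_sum:
  assumes B: "finite B" and disj: "\<And>b b'. b \<in> B \<Longrightarrow> b' \<in> B \<Longrightarrow> b \<noteq> b' \<Longrightarrow> G b = 0 \<or> G b' = 0"
  shows "\<Phi> (\<Sum>b\<in>B. G b) = (\<Sum>b\<in>B. \<Phi> (G b))"
proof (cases "\<exists>b0\<in>B. G b0 \<noteq> 0")
  case True
  then obtain b0 where b0: "b0 \<in> B" "G b0 \<noteq> 0" by blast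
  have "G b = 0" if "b \<in> B - {b0}" for b using disj[of b b0] that b0 by auto
  then have "(\<Sum>b\<in>B - {b0}. G b) = 0" "(\<Sum>b\<in>B - {b0}. \<Phi> (G b)) = 0" by simp_all
  then show ?thesis using sum.remove[OF B b0(1), of G] sum.remove[OF B b0(1), of "\<lambda>b. \<Phi> (G b)"] by simp
qed simp

lemma k4_zero[simp]: "k4 0 b c d = 0" "k4 a 0 c d = 0" "k4 a b 0 d = 0" "k4 a b c 0 = 0"
  by (simp_all add: k4_def)

end

lemma linf_minus: "linf (- l) = linf l"
  by (simp add: linf_def)

text \<open>Replacing \<open>T\<close> by \<open>T'\<close> costs at most the mean square distance in the characteristic function, and
changes the limit of the variance, hence the Gaussian limit, by a comparable amount.\<close>

lemma (in prob_space) clt_by_approximation: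
  fixes T :: "nat \<Rightarrow> 'a \<Rightarrow> real"
  assumes T[measurable]: "\<And>n. T n \<in> borel_measurable M" and T2: "\<And>n. integrable M (\<lambda>\<omega>. (T n \<omega>)\<^sup>2)"
    and v: "(\<lambda>n. LINT \<omega>|M. (T n \<omega>)\<^sup>2) \<longlonglongrightarrow> v"
    and approx: "\<And>e. 0 < e \<Longrightarrow> \<exists>T' v'. (\<forall>n. T' n \<in> borel_measurable M) \<and> (\<forall>n. integrable M (\<lambda>\<omega>. (T' n \<omega>)\<^sup>2)) \<and>
        (\<lambda>n. LINT \<omega>|M. (T' n \<omega>)\<^sup>2) \<longlonglongrightarrow> v' \<and> (\<lambda>n. CLINT \<omega>|M. iexp (T' n \<omega>)) \<longlonglongrightarrow> of_real (exp (- v' / 2)) \<and>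
        eventually (\<lambda>n. (LINT \<omega>|M. (T n \<omega> - T' n \<omega>)\<^sup>2) \<le> e) sequentially"
  shows "(\<lambda>n. CLINT \<omega>|M. iexp (T n \<omega>)) \<longlonglongrightarrow> of_real (exp (- v / 2))"
proof (rule LIMSEQ_I)
  fix r :: real assume r: "0 < r"
  have v0: "0 \<le> v" by (rule LIMSEQ_le_const[OF v]) (auto intro!: integral_nonneg_AE)
  \<comment> \<open>the errors add up to at most \<open>\<eta> + \<eta> + (2\<eta> + \<eta> v)\<close>\<close>
  define \<eta> where "\<eta> = min 1 (r / (v + 8))"
  have eta: "0 < \<eta>" "\<eta> \<le> 1" using r v0 by (auto simp: \<eta>_def)
  have eta_r: "\<eta> * (v + 8) \<le> r"
  proof -
    have "\<eta> * (v + 8) \<le> (r / (v + 8)) * (v + 8)" using v0 by (intro mult_right_mono) (auto simp: \<eta>_def)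
    then show ?thesis using v0 by simp
  qed
  obtain T' v' where T'm[measurable]: "\<And>n. T' n \<in> borel_measurable M" and T'2: "\<And>n. integrable M (\<lambda>\<omega>. (T' n \<omega>)\<^sup>2)"
    and v': "(\<lambda>n. LINT \<omega>|M. (T' n \<omega>)\<^sup>2) \<longlonglongrightarrow> v'" and char: "(\<lambda>n. CLINT \<omega>|M. iexp (T' n \<omega>)) \<longlonglongrightarrow> of_real (exp (- v' / 2))"
    and close: "eventually (\<lambda>n. (LINT \<omega>|M. (T n \<omega> - T' n \<omega>)\<^sup>2) \<le> \<eta>\<^sup>2) sequentially"
    using approx[OF zero_less_power[OF eta(1)], of 2] by blast
  have v'0: "0 \<le> v'" by (rule LIMSEQ_le_const[OF v']) (auto intro!: integral_nonneg_AE)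
  have T1: "integrable M (T n)" "integrable M (T' n)" for n
    using square_integrable_imp_integrable[OF T T2] square_integrable_imp_integrable[OF T'm T'2] by blast+
  have d2: "integrable M (\<lambda>\<omega>. (T n \<omega> - T' n \<omega>)\<^sup>2)" for n
  proof (rule Bochner_Integration.integrable_bound[where f="\<lambda>\<omega>. 2 * (T n \<omega>)\<^sup>2 + 2 * (T' n \<omega>)\<^sup>2"])
    show "integrable M (\<lambda>\<omega>. 2 * (T n \<omega>)\<^sup>2 + 2 * (T' n \<omega>)\<^sup>2)" using T2 T'2 by simp
    have "(x - y)\<^sup>2 \<le> 2 * x\<^sup>2 + 2 * y\<^sup>2" for x y :: real
      using zero_le_power2[of "x + y"] by (simp add: power2_eq_square algebra_simps)
    then show "AE \<omega> in M. norm ((T n \<omega> - T' n \<omega>)\<^sup>2) \<le> norm (2 * (T n \<omega>)\<^sup>2 + 2 * (T' n \<omega>)\<^sup>2)" by (intro AE_I2) simp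
  qed measurable
  have L1: "(LINT \<omega>|M. \<bar>T n \<omega> - T' n \<omega>\<bar>) \<le> \<eta>" if "(LINT \<omega>|M. (T n \<omega> - T' n \<omega>)\<^sup>2) \<le> \<eta>\<^sup>2" for n
  proof -
    \<comment> \<open>Young's inequality instead of Cauchy and Schwarz\<close>
    have "(LINT \<omega>|M. \<bar>T n \<omega> - T' n \<omega>\<bar>) \<le> (LINT \<omega>|M. (T n \<omega> - T' n \<omega>)\<^sup>2 / (2 * \<eta>) + \<eta> / 2)"
    proof (rule integral_mono)
      show "integrable M (\<lambda>\<omega>. \<bar>T n \<omega> - T' n \<omega>\<bar>)" using T1 by simp
      show "integrable M (\<lambda>\<omega>. (T n \<omega> - T' n \<omega>)\<^sup>2 / (2 * \<eta>) + \<eta> / 2)" using d2 by simp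
      fix \<omega>
      have "2 * \<bar>T n \<omega> - T' n \<omega>\<bar> * \<eta> \<le> (T n \<omega> - T' n \<omega>)\<^sup>2 + \<eta>\<^sup>2"
        using sum_squares_bound[of "\<bar>T n \<omega> - T' n \<omega>\<bar>" \<eta>] by simp
      then show "\<bar>T n \<omega> - T' n \<omega>\<bar> \<le> (T n \<omega> - T' n \<omega>)\<^sup>2 / (2 * \<eta>) + \<eta> / 2"
        using eta(1) by (simp add: field_simps power2_eq_square)
    qed
    also have "\<dots> = (LINT \<omega>|M. (T n \<omega> - T' n \<omega>)\<^sup>2) / (2 * \<eta>) + \<eta> / 2"
      using d2 by (simp add: prob_space)
    also have "\<dots> \<le> \<eta>\<^sup>2 / (2 * \<eta>) + \<eta> / 2" using that eta(1) by (intro add_right_mono divide_right_mono) auto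
    also have "\<dots> = \<eta>" using eta(1) by (simp add: power2_eq_square)
    finally show ?thesis .
  qed
  have var: "\<bar>(LINT \<omega>|M. (T n \<omega>)\<^sup>2) - (LINT \<omega>|M. (T' n \<omega>)\<^sup>2)\<bar> \<le> 2 * \<eta> + \<eta> * (LINT \<omega>|M. (T n \<omega>)\<^sup>2)"
    if c: "(LINT \<omega>|M. (T n \<omega> - T' n \<omega>)\<^sup>2) \<le> \<eta>\<^sup>2" for n
  proof -
    have "\<bar>LINT \<omega>|M. (T n \<omega>)\<^sup>2 - (T' n \<omega>)\<^sup>2\<bar> \<le> (LINT \<omega>|M. (1 + 1/\<eta>) * (T n \<omega> - T' n \<omega>)\<^sup>2 + \<eta> * (T n \<omega>)\<^sup>2)"
    proof (rule order_trans[OF integral_abs_bound], rule integral_mono)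
      show "integrable M (\<lambda>\<omega>. \<bar>(T n \<omega>)\<^sup>2 - (T' n \<omega>)\<^sup>2\<bar>)" using T2 T'2 by simp
      show "integrable M (\<lambda>\<omega>. (1 + 1/\<eta>) * (T n \<omega> - T' n \<omega>)\<^sup>2 + \<eta> * (T n \<omega>)\<^sup>2)"
        by (intro Bochner_Integration.integrable_add integrable_mult_right d2 T2)
      fix \<omega>
      have "\<bar>x\<^sup>2 - y\<^sup>2\<bar> \<le> (1 + 1/\<eta>) * (x - y)\<^sup>2 + \<eta> * x\<^sup>2" for x y :: real
      proof -
        have "2 * (\<bar>x\<bar> * \<eta>) * \<bar>x - y\<bar> \<le> (\<bar>x\<bar> * \<eta>)\<^sup>2 + \<bar>x - y\<bar>\<^sup>2" by (rule sum_squares_bound)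
        then have "2 * \<bar>x\<bar> * \<bar>x - y\<bar> * \<eta> \<le> (\<eta> * x\<^sup>2 + (1/\<eta>) * (x - y)\<^sup>2) * \<eta>"
          using eta(1) by (simp add: power_mult_distrib algebra_simps power2_eq_square)
        then have s: "2 * \<bar>x\<bar> * \<bar>x - y\<bar> \<le> \<eta> * x\<^sup>2 + (1/\<eta>) * (x - y)\<^sup>2"
          using eta(1) by (rule mult_right_le_imp_le)
        have "x\<^sup>2 - y\<^sup>2 = 2 * x * (x - y) - (x - y)\<^sup>2" by (simp add: power2_eq_square algebra_simps)
        then have "\<bar>x\<^sup>2 - y\<^sup>2\<bar> \<le> \<bar>2 * x * (x - y)\<bar> + \<bar>(x - y)\<^sup>2\<bar>" by (simp only: abs_triangle_ineq4)
        also have "\<dots> = 2 * \<bar>x\<bar> * \<bar>x - y\<bar> + (x - y)\<^sup>2" by (simp add: abs_mult)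
        also have "\<dots> \<le> \<eta> * x\<^sup>2 + (1/\<eta>) * (x - y)\<^sup>2 + (x - y)\<^sup>2" using s by simp
        finally show ?thesis by (simp add: algebra_simps)
      qed
      then show "\<bar>(T n \<omega>)\<^sup>2 - (T' n \<omega>)\<^sup>2\<bar> \<le> (1 + 1/\<eta>) * (T n \<omega> - T' n \<omega>)\<^sup>2 + \<eta> * (T n \<omega>)\<^sup>2" .
    qed
    also have "\<dots> = (1 + 1/\<eta>) * (LINT \<omega>|M. (T n \<omega> - T' n \<omega>)\<^sup>2) + \<eta> * (LINT \<omega>|M. (T n \<omega>)\<^sup>2)"
      using d2 T2 by simp
    also have "(1 + 1/\<eta>) * (LINT \<omega>|M. (T n \<omega> - T' n \<omega>)\<^sup>2) \<le> (1 + 1/\<eta>) * \<eta>\<^sup>2"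
      using c eta(1) by (intro mult_left_mono) auto
    also have "(1 + 1/\<eta>) * \<eta>\<^sup>2 = \<eta> * \<eta> + \<eta>" using eta(1) by (simp add: field_simps power2_eq_square)
    also have "\<eta> * \<eta> \<le> 1 * \<eta>" using eta by (intro mult_right_mono) auto
    finally show ?thesis using T2 T'2 by simp
  qed
  have vv': "\<bar>v - v'\<bar> \<le> 2 * \<eta> + \<eta> * v"
  proof (rule tendsto_le[OF sequentially_bot])
    show "(\<lambda>n. 2 * \<eta> + \<eta> * (LINT \<omega>|M. (T n \<omega>)\<^sup>2)) \<longlonglongrightarrow> 2 * \<eta> + \<eta> * v" by (intro tendsto_intros v)
    show "(\<lambda>n. \<bar>(LINT \<omega>|M. (T n \<omega>)\<^sup>2) - (LINT \<omega>|M. (T' n \<omega>)\<^sup>2)\<bar>) \<longlonglongrightarrow> \<bar>v - v'\<bar>" by (intro tendsto_intros v v')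
    show "eventually (\<lambda>n. \<bar>(LINT \<omega>|M. (T n \<omega>)\<^sup>2) - (LINT \<omega>|M. (T' n \<omega>)\<^sup>2)\<bar> \<le> 2 * \<eta> + \<eta> * (LINT \<omega>|M. (T n \<omega>)\<^sup>2)) sequentially"
      using close by eventually_elim (rule var)
  qed
  have expd: "\<bar>exp (- a / 2) - exp (- b / 2)\<bar> \<le> \<bar>a - b\<bar>" if "0 \<le> a" "0 \<le> b" for a b :: real
  proof -
    have "cmod (exp (of_real (- a / 2)) - exp (of_real (- b / 2))) \<le> 1 * cmod (of_real (- a / 2) - of_real (- b / 2))"
    proof (rule field_differentiable_bound[where f'=exp and S="{z. Re z \<le> 0}"])
      show "convex {z. Re z \<le> 0}" by (simp add: convex_halfspace_Re_le)
      show "(exp has_field_derivative exp z) (at z within {z. Re z \<le> 0})" for z :: complex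
        by (rule DERIV_subset[OF DERIV_exp]) simp
    qed (use that in auto)
    also have "cmod (exp (of_real (- a / 2)) - exp (of_real (- b / 2))) = \<bar>exp (- a / 2) - exp (- b / 2)\<bar>"
      by (simp only: exp_of_real norm_of_real of_real_diff[symmetric])
    also have "1 * cmod (of_real (- a / 2) - of_real (- b / 2)) = \<bar>- a / 2 - - b / 2\<bar>"
      by (simp only: norm_of_real of_real_diff[symmetric] mult_1)
    finally show ?thesis by argo
  qed
  have "eventually (\<lambda>n. norm ((CLINT \<omega>|M. iexp (T n \<omega>)) - of_real (exp (- v / 2))) < r) sequentially"
    using close tendstoD[OF char eta(1)]
  proof eventually_elim
    case (elim n)
    let ?a = "CLINT \<omega>|M. iexp (T n \<omega>)" and ?b = "CLINT \<omega>|M. iexp (T' n \<omega>)"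
    have "cmod (?a - ?b) \<le> \<eta>"
      by (rule order_trans[OF norm_char_diff_le_L1 L1[OF elim(1)]]) (use T1 in auto)
    moreover have "cmod (?b - of_real (exp (- v' / 2))) < \<eta>" using elim(2) by (simp add: dist_norm)
    moreover have "cmod (of_real (exp (- v' / 2)) - of_real (exp (- v / 2))) \<le> 2 * \<eta> + \<eta> * v"
    proof -
      have "cmod (of_real (exp (- v' / 2)) - of_real (exp (- v / 2))) = \<bar>exp (- v' / 2) - exp (- v / 2)\<bar>"
        by (simp only: norm_of_real of_real_diff[symmetric])
      also have "\<dots> \<le> \<bar>v' - v\<bar>" by (rule expd[OF v'0 v0])
      finally show ?thesis using vv' by (simp add: abs_minus_commute)
    qed
    ultimately have "cmod (?a - of_real (exp (- v / 2))) < \<eta> + \<eta> + (2 * \<eta> + \<eta> * v)"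
      using norm_triangle_ineq[of "?a - ?b" "?b - of_real (exp (- v' / 2))"]
        norm_triangle_ineq[of "?a - of_real (exp (- v' / 2))" "of_real (exp (- v' / 2)) - of_real (exp (- v / 2)) :: complex"] by simp
    also have "\<dots> \<le> r" using eta_r eta(1) by (simp add: algebra_simps)
    finally show ?case .
  qed
  then show "\<exists>no. \<forall>n\<ge>no. norm ((CLINT \<omega>|M. iexp (T n \<omega>)) - of_real (exp (- v / 2))) < r"
    by (simp add: eventually_sequentially)
qed

context lagged_products
begin

text \<open>Shifted copies of a cube of side \<open>h\<close> are disjoint if their centres differ by at least \<open>h\<close> in the
maximum norm.\<close>

lemma support_separated:
  assumes "h \<le> real_of_int (linf (u - v))"
  shows "sh (ft h) u p = 0 \<or> sh (ft h) v p = 0"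
proof (rule ccontr)
  assume n: "\<not> ?thesis"
  obtain i where i: "\<bar>(u - v) $ i\<bar> = linf (u - v)" using linf_attained by blast
  have "\<bar>real_pt u $ i - snd p $ i\<bar> < h / 2" "\<bar>real_pt v $ i - snd p $ i\<bar> < h / 2"
    using n by (auto simp: sh_def ft_def far_region_def reflect_def not_le split: if_splits)
  then have "\<bar>real_of_int (u $ i) - real_of_int (v $ i)\<bar> < h" unfolding real_pt_def vec_lambda_beta by argo
  moreover have "real_of_int (linf (u - v)) = \<bar>real_of_int (u $ i) - real_of_int (v $ i)\<bar>"
    unfolding i[symmetric] by simp
  ultimately show False using assms by simp
qed

definition lagmax where "lagmax = nat (Max (range (\<lambda>q. linf (k q))))"

lemma lagmax: "linf (k q) \<le> int lagmax"
proof -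
  have "linf (k q) \<le> Max (range (\<lambda>q. linf (k q)))" by (rule Max_ge) auto
  then show ?thesis using linf_nonneg[of "k q"] unfolding lagmax_def by linarith
qed

lemma linf_le_add: "linf u \<le> linf (u + v) + linf v"
proof -
  obtain i where "\<bar>u $ i\<bar> = linf u" using linf_attained by blast
  then show ?thesis using component_le_linf[of "u + v" i] component_le_linf[of v i] by simp
qed

lemma cY_ft_zero:
  assumes l: "h + real lagmax \<le> real_of_int (linf l)"
  shows "cY (ft h) l = 0"
proof -
  have "prod_cov (sh (ft h) 0) (sh (ft h) (k p)) (sh (ft h) l) (sh (ft h) (l + k q)) = 0" for p q
  proof -
    have "h \<le> real_of_int (linf (0 - l))" using l linf_nonneg[of l] by (simp add: linf_minus)
    note s1 = support_separated[OF this]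
    have "real_of_int (linf l) \<le> real_of_int (linf (l + k q)) + real lagmax"
      using linf_le_add[of l "k q"] lagmax[of q] by linarith
    then have "h \<le> real_of_int (linf (0 - (l + k q)))" using l by (simp only: diff_0 linf_minus)
    note s2 = support_separated[OF this]
    have "Cum (sh (ft h) 0) (sh (ft h) (k p)) (sh (ft h) l) (sh (ft h) (l + k q)) = (LINT p|N. 0)"
      unfolding Cum_def by (intro Bochner_Integration.integral_cong refl) (metis s1 k4_zero(1) k4_zero(3))
    moreover have "Cov (sh (ft h) 0) (sh (ft h) l) = (LINT p|N. 0)"
      unfolding Cov_def by (intro Bochner_Integration.integral_cong refl) (metis s1 cov_zero)
    moreover have "Cov (sh (ft h) 0) (sh (ft h) (l + k q)) = (LINT p|N. 0)"
      unfolding Cov_def by (intro Bochner_Integration.integral_cong refl) (metis s2 cov_zero)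
    ultimately show ?thesis by (simp add: prod_cov_def)
  qed
  then show ?thesis unfolding cY_def by simp
qed

text \<open>The offset of the block with lattice index \<open>b\<close>; blocks have side \<open>p\<close> and are repeated with period
\<open>q\<close>.\<close>

definition sft :: "nat \<Rightarrow> int^'m \<Rightarrow> int^'m" where "sft q b = (\<chi> i. int q * b $ i)"

definition blk where "blk h p q b \<omega> = (\<Sum>j\<in>lattice_box (int p). Yt h (j + sft q b) \<omega>)"

lemma block_separation:
  assumes b: "b \<noteq> b'" and q: "int p + int d \<le> int q" and j: "\<And>i. \<bar>j $ i - j' $ i\<bar> \<le> int p"
  shows "int d \<le> linf ((j + sft q b) - (j' + sft q b'))"
proof -
  obtain i where i: "b $ i \<noteq> b' $ i" using b by (auto simp: vec_eq_iff)
  have "int q * 1 \<le> int q * \<bar>b $ i - b' $ i\<bar>" using i by (intro mult_left_mono) auto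
  also have "\<dots> = \<bar>int q * b $ i - int q * b' $ i\<bar>" by (simp add: abs_mult flip: right_diff_distrib)
  finally have "int q \<le> \<bar>int q * b $ i - int q * b' $ i\<bar>" by simp
  then have "int d \<le> \<bar>((j + sft q b) - (j' + sft q b')) $ i\<bar>" using j[of i] q by (simp add: sft_def)
  also have "\<dots> \<le> linf ((j + sft q b) - (j' + sft q b'))" by (rule component_le_linf)
  finally show ?thesis .
qed

text \<open>The block sums behave like independent copies of the one at the origin. Each is a fixed function of
finitely many values of the truncated field, and values belonging to different blocks have integrands
with disjoint supports. Hence their joint characteristic function agrees with that of independent
copies on the product space \<open>M^B\<close>, and \<open>joint_law_integral_eq\<close> transports the expectation of a
nonlinear function of these values.\<close>

lemma blk_char:
  assumes B: "finite B" and h: "h \<le> real d" and q: "p + d + 2 * lagmax \<le> q"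
  shows "(CLINT \<omega>|M. iexp (s * (\<Sum>b\<in>B. blk h p q b \<omega>))) = (CLINT \<omega>|M. iexp (s * blk h p q 0 \<omega>)) ^ card B"
proof -
  \<comment> \<open>the sites that enter into the block at the origin, including the lagged ones\<close>
  define V0 where "V0 = (\<lambda>(j, v). j + v) ` (lattice_box (int p) \<times> insert 0 (range k))"
  have V0: "finite V0" unfolding V0_def by (intro finite_imageI finite_cartesian_product) auto
  have jw: "j + w \<in> V0" if "j \<in> lattice_box (int p)" "w \<in> insert 0 (range k)" for j w
    unfolding V0_def using that by (intro image_eqI[of _ _ "(j, w)"]) auto
  have jV: "j \<in> V0" "j + k r \<in> V0" if "j \<in> lattice_box (int p)" for j r
    using jw[OF that, of 0] jw[OF that, of "k r"] by auto
  have Vdiff: "\<bar>v $ i - v' $ i\<bar> \<le> int (p + 2 * lagmax)" if v: "v \<in> V0" "v' \<in> V0" for v v' i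
  proof -
    have bd: "1 - int lagmax \<le> v $ i \<and> v $ i \<le> int p + int lagmax" if "v \<in> V0" for v
    proof -
      obtain j w where jw: "v = j + w" "j \<in> lattice_box (int p)" "w \<in> insert 0 (range k)" using \<open>v \<in> V0\<close> unfolding V0_def by auto
      have "\<bar>w $ i\<bar> \<le> int lagmax" using jw(3) lagmax component_le_linf[of w i] by (auto intro: order_trans)
      moreover have "0 < j $ i" "j $ i \<le> int p" using jw(2) by (auto simp: lattice_box_def)
      ultimately show ?thesis unfolding jw(1) vector_add_component by linarith
    qed
    show ?thesis using bd[OF v(1)] bd[OF v(2)] by linarith
  qed
  let ?I = "B \<times> V0"
  have I: "finite ?I" using B V0 by simp
  let ?M' = "\<Pi>\<^sub>M b\<in>B. M"
  interpret P: product_prob_space "\<lambda>_. M" B by standard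
  have PM': "prob_space ?M'" by (rule P.prob_space_axioms)
  have Xm[measurable]: "Xt h u \<in> borel_measurable M" for u by (rule has_int_measurable[OF has_int_Xt])
  define V where "V i = Xt h (snd i + sft q (fst i))" for i :: "(int^'m) \<times> (int^'m)"
  define V' where "V' i \<omega> = Xt h (snd i) (\<omega> (fst i))" for i :: "(int^'m) \<times> (int^'m)" and \<omega>
  have Vm: "V i \<in> borel_measurable M" for i unfolding V_def by measurable
  have V'm: "V' i \<in> borel_measurable ?M'" if "i \<in> ?I" for i
  proof -
    have "(\<lambda>\<omega>. \<omega> (fst i)) \<in> measurable ?M' M" by (rule measurable_component_singleton) (use that in auto)
    from measurable_compose[OF this Xm] show ?thesis unfolding V'_def[abs_def] .
  qed
  define Cr where "Cr r = Cov (sh (ft h) 0) (sh (ft h) (k r))" for r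
  define F where "F x = (\<Sum>b\<in>B. \<Sum>j\<in>lattice_box (int p). \<Sum>r\<in>UNIV. t r * (x (b, j) * x (b, j + k r) - Cr r))" for x :: "(int^'m) \<times> (int^'m) \<Rightarrow> real"
  have comp: "(\<lambda>x. x i) \<in> borel_measurable (\<Pi>\<^sub>M i\<in>?I. borel)" if "i \<in> ?I" for i
    by (rule measurable_component_singleton[OF that])
  have Fm[measurable]: "F \<in> borel_measurable (\<Pi>\<^sub>M i\<in>?I. borel)"
    unfolding F_def[abs_def]
    by (intro borel_measurable_sum borel_measurable_times borel_measurable_diff borel_measurable_const comp) (auto intro: jV)
  have Gm: "(\<lambda>x. iexp (s * F x)) \<in> borel_measurable (\<Pi>\<^sub>M i\<in>?I. borel)" by measurable
  have char: "(CLINT \<omega>|M. iexp (\<Sum>i\<in>?I. c i * V i \<omega>)) = (CLINT \<omega>|?M'. iexp (\<Sum>i\<in>?I. c i * V' i \<omega>))" for c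
  proof -
    let ?G = "\<lambda>b p. \<Sum>v\<in>V0. c (b, v) *\<^sub>R sh (ft h) (v + sft q b) p"
    let ?Go = "\<lambda>b p. \<Sum>v\<in>V0. c (b, v) *\<^sub>R sh (ft h) v p"
    have Lft: "L24 (sh (ft h) u)" for u by (intro L24_sh restricts_L24 restricts_ft)
    have LG: "L24 (?G b)" "L24 (?Go b)" for b by (intro L24_sum V0 Lft)+
    have ftm[measurable]: "ft h \<in> borel_measurable borel" using restricts_ft[of h] unfolding restricts_def by blast
    have "(CLINT \<omega>|M. iexp (\<Sum>i\<in>?I. c i * V i \<omega>)) = exp (CLINT p|N. \<Phi> (\<Sum>i\<in>?I. c i *\<^sub>R sh (ft h) (snd i + sft q (fst i)) p))"
      unfolding V_def by (intro has_int_char L24_L2 L24_sum has_int_sum I Lft has_int_Xt)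
    also have "(\<lambda>p. \<Phi> (\<Sum>i\<in>?I. c i *\<^sub>R sh (ft h) (snd i + sft q (fst i)) p)) = (\<lambda>p. \<Sum>b\<in>B. \<Phi> (?G b p))"
    proof
      fix x
      have "(\<Sum>i\<in>?I. c i *\<^sub>R sh (ft h) (snd i + sft q (fst i)) x) = (\<Sum>b\<in>B. ?G b x)"
        by (simp add: sum.cartesian_product case_prod_unfold)
      also have "\<Phi> \<dots> = (\<Sum>b\<in>B. \<Phi> (?G b x))"
      proof (rule levy_exponent_disjoint_sum[OF B], rule ccontr)
        fix b b' assume bb: "b \<in> B" "b' \<in> B" "b \<noteq> b'" and n: "\<not> (?G b x = 0 \<or> ?G b' x = 0)"
        then obtain v v' where v: "v \<in> V0" "sh (ft h) (v + sft q b) x \<noteq> 0" "v' \<in> V0" "sh (ft h) (v' + sft q b') x \<noteq> 0"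
          by (metis (no_types, lifting) scaleR_zero_right sum.neutral)
        have "int d \<le> linf ((v + sft q b) - (v' + sft q b'))"
          by (rule block_separation[OF bb(3), where p="p + 2 * lagmax"]) (use q Vdiff[OF v(1,3)] in auto)
        then have "h \<le> real_of_int (linf ((v + sft q b) - (v' + sft q b')))" using h by linarith
        from support_separated[OF this, of x] v show False by blast
      qed
      finally show "\<Phi> (\<Sum>i\<in>?I. c i *\<^sub>R sh (ft h) (snd i + sft q (fst i)) x) = (\<Sum>b\<in>B. \<Phi> (?G b x))" .
    qed
    also have "(CLINT p|N. \<Sum>b\<in>B. \<Phi> (?G b p)) = (\<Sum>b\<in>B. CLINT p|N. \<Phi> (?G b p))"
      by (intro Bochner_Integration.integral_sum integrable_levy_exponent L24_L2 LG)
    \<comment> \<open>stationarity moves each block to the origin\<close>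
    also have "\<dots> = (\<Sum>b\<in>B. CLINT p|N. \<Phi> (?Go b p))"
    proof (rule sum.cong[OF refl])
      fix b
      have "(\<lambda>p. \<Phi> (?G b p)) \<in> borel_measurable borel"
        by (rule measurable_compose[OF L24_measurable[OF LG(1)] measurable_levy_exponent])
      then show "(CLINT p|N. \<Phi> (?G b p)) = (CLINT p|N. \<Phi> (?Go b p))"
        by (rule integral_shift[of _ "sft q b"]) (simp only: sh_shift)
    qed
    also have "exp \<dots> = (\<Prod>b\<in>B. exp (CLINT p|N. \<Phi> (?Go b p)))" by (rule exp_sum[OF B])
    also have "\<dots> = (\<Prod>b\<in>B. CLINT \<omega>|M. iexp (\<Sum>v\<in>V0. c (b, v) * Xt h v \<omega>))"
      by (intro prod.cong refl has_int_char[symmetric] L24_L2 LG has_int_sum V0 has_int_Xt)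
    also have "\<dots> = (CLINT \<omega>|?M'. (\<Prod>b\<in>B. iexp (\<Sum>v\<in>V0. c (b, v) * Xt h v (\<omega> b))))"
      by (intro P.product_integral_prod[symmetric] B M.integrable_iexp) measurable
    also have "\<dots> = (CLINT \<omega>|?M'. iexp (\<Sum>i\<in>?I. c i * V' i \<omega>))"
      by (simp add: V'_def sum.cartesian_product case_prod_unfold exp_sum[OF B, symmetric] flip: sum_distrib_left of_real_sum)
    finally show ?thesis .
  qed
  have FV: "F (\<lambda>i\<in>?I. V i \<omega>) = (\<Sum>b\<in>B. blk h p q b \<omega>)" for \<omega>
    unfolding F_def blk_def Yg_def by (intro sum.cong refl) (simp add: V_def jV Cr_def add_ac)
  have s0: "sft q 0 = 0" by (simp add: sft_def vec_eq_iff)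
  have FV': "F (\<lambda>i\<in>?I. V' i \<omega>) = (\<Sum>b\<in>B. blk h p q 0 (\<omega> b))" for \<omega>
    unfolding F_def blk_def Yg_def by (intro sum.cong refl) (simp add: V'_def jV Cr_def s0)
  have blkm[measurable]: "blk h p q 0 \<in> borel_measurable M"
    unfolding blk_def[abs_def] using Yg_moments(1)[OF restricts_ft has_int_Xt] by measurable
  have "(CLINT \<omega>|M. iexp (s * F (\<lambda>i\<in>?I. V i \<omega>))) = (CLINT \<omega>|?M'. iexp (s * F (\<lambda>i\<in>?I. V' i \<omega>)))"
    by (rule joint_law_integral_eq[OF M.prob_space_axioms PM' I Vm V'm char Gm])
  also have "\<dots> = (CLINT \<omega>|?M'. (\<Prod>b\<in>B. iexp (s * blk h p q 0 (\<omega> b))))"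
    unfolding FV' by (simp add: sum_distrib_left exp_sum[OF B])
  also have "\<dots> = (\<Prod>b\<in>B. CLINT \<omega>|M. iexp (s * blk h p q 0 \<omega>))"
    by (intro P.product_integral_prod B M.integrable_iexp) measurable
  finally show ?thesis unfolding FV by simp
qed

section \<open>The central limit theorem for linear combinations\<close>

lemma div_ratio_tendsto:
  assumes "0 < q"
  shows "(\<lambda>n. real (n div q) / real n) \<longlonglongrightarrow> 1 / real q"
proof -
  have "(\<lambda>n. 1 / real q - real (n mod q) / real q / real n) \<longlonglongrightarrow> 1 / real q - 0"
  proof (intro tendsto_diff tendsto_const Lim_null_comparison[OF always_eventually lim_const_over_n[of 1]] allI)
    fix n
    have "real (n mod q) / real q \<le> 1" using assms by (simp add: less_imp_le)
    from divide_right_mono[OF this, of "real n"] show "norm (real (n mod q) / real q / real n) \<le> 1 / real n" by simp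
  qed
  moreover have "eventually (\<lambda>n. 1 / real q - real (n mod q) / real q / real n = real (n div q) / real n) sequentially"
  proof (rule eventually_sequentiallyI[of 1])
    fix n :: nat assume n: "1 \<le> n"
    have "real n = real q * real (n div q) + real (n mod q)"
      by (metis mult_div_mod_eq of_nat_add of_nat_mult)
    then have "real (n div q) = (real n - real (n mod q)) / real q" using assms by simp
    then show "1 / real q - real (n mod q) / real q / real n = real (n div q) / real n"
      using n assms by (simp add: diff_divide_distrib mult.commute)
  qed
  ultimately show ?thesis by (rule Lim_transform_eventually[THEN tendsto_eq_rhs]) simp
qed

lemma square_sum_integrable:
  assumes "finite J" "\<And>j l. integrable M (\<lambda>\<omega>. D j \<omega> * D l \<omega> :: real)"
  shows "integrable M (\<lambda>\<omega>. (\<Sum>j\<in>J. D j \<omega>)\<^sup>2)"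
  unfolding power2_eq_square sum_product using assms(2) by (intro Bochner_Integration.integrable_sum)

abbreviation "E n \<equiv> (lattice_box (int n) :: (int^'m) set)"
definition "sc n = 1 / sqrt (real (card (E n)))"

lemma sc: "(sc n)\<^sup>2 = 1 / real (card (E n))" "(sc n)\<^sup>2 = 1 / real n ^ CARD('m)"
  by (simp_all add: sc_def power_divide card_lattice_box)

definition "Tn n \<omega> = sc n * (\<Sum>j\<in>E n. Yf j \<omega>)"

text \<open>The variance is a box average of the autocovariance.\<close>

lemma Tn_moments:
  shows "Tn n \<in> borel_measurable M" "integrable M (\<lambda>\<omega>. (Tn n \<omega>)\<^sup>2)"
    "(\<lambda>n. LINT \<omega>|M. (Tn n \<omega>)\<^sup>2) \<longlonglongrightarrow> infsum (cY f) UNIV"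
proof -
  note Y = Yg_moments[OF restricts_f has_int_X]
  show "Tn n \<in> borel_measurable M" unfolding Tn_def[abs_def] using Y(1) by measurable
  show "integrable M (\<lambda>\<omega>. (Tn n \<omega>)\<^sup>2)"
    unfolding Tn_def power_mult_distrib by (intro integrable_mult_right square_sum_integrable Y(2)) simp
  have "(LINT \<omega>|M. (Tn n \<omega>)\<^sup>2) = (\<Sum>j\<in>E n. \<Sum>l\<in>E n. cY f (l - j)) / real (card (E n))" for n
  proof -
    have "(LINT \<omega>|M. (Tn n \<omega>)\<^sup>2) = (sc n)\<^sup>2 * (LINT \<omega>|M. (\<Sum>j\<in>E n. \<Sum>l\<in>E n. Yf j \<omega> * Yf l \<omega>))"
      unfolding Tn_def power_mult_distrib by (simp add: power2_eq_square sum_product)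
    also have "(LINT \<omega>|M. (\<Sum>j\<in>E n. \<Sum>l\<in>E n. Yf j \<omega> * Yf l \<omega>)) = (\<Sum>j\<in>E n. \<Sum>l\<in>E n. cY f (l - j))"
      by (simp only: Bochner_Integration.integral_sum Bochner_Integration.integrable_sum Y(2) Y(3))
    finally show ?thesis by (simp add: sc)
  qed
  then show "(\<lambda>n. LINT \<omega>|M. (Tn n \<omega>)\<^sup>2) \<longlonglongrightarrow> infsum (cY f) UNIV"
    using box_average_double_sum[OF cY_summable[OF restricts_f]] by simp
qed

text \<open>Given \<open>e\<close>, choose the side \<open>d\<close> of the truncation cube by \<open>eB_bounds\<close> and then the side \<open>p\<close> of the
blocks so large that the corridors of width \<open>H\<close> between them take up a small part of the box. For fixed
\<open>d\<close> and \<open>p\<close>, the sum over the blocks converges by \<open>blk_char\<close> and \<open>char_power_limit\<close>, and both errors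
are controlled in mean square by \<open>second_moment_lattice_sum_le\<close>.\<close>

theorem clt_scalar: "(\<lambda>n. CLINT \<omega>|M. iexp (Tn n \<omega>)) \<longlonglongrightarrow> of_real (exp (- infsum (cY f) UNIV / 2))"
proof (rule M.clt_by_approximation[OF Tn_moments])
  fix e :: real assume e: "0 < e"
  define w where "w = infsum wB UNIV"
  have w0: "0 \<le> w" unfolding w_def
    by (intro infsum_nonneg) (rule order_trans[OF abs_ge_zero abs_cY_le[OF restricts_f]])
  have "eventually (\<lambda>n. infsum (eB (real n)) UNIV < e / 8) sequentially"
    using e by (intro order_tendstoD(2)[OF eB_bounds(2)]) simp
  then obtain d where d: "infsum (eB (real d)) UNIV < e / 8" by (auto simp: eventually_sequentially)
  define h where "h = real d"
  \<comment> \<open>a lag enlarges each of two neighbouring blocks, so the corridor is \<open>2 * lagmax\<close> wider than the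
  range of dependence\<close>
  define H where "H = d + 2 * lagmax"
  obtain p :: nat where p: "0 < p" "(1 - (real p / real (p + H)) ^ CARD('m)) * w < e / 8"
  proof -
    have "(\<lambda>p. 1 - real H / real (p + H)) \<longlonglongrightarrow> 1 - 0"
      by (intro tendsto_diff tendsto_const LIMSEQ_ignore_initial_segment[OF lim_const_over_n])
    moreover have "eventually (\<lambda>p. 1 - real H / real (p + H) = real p / real (p + H)) sequentially"
      by (rule eventually_sequentiallyI[of 1]) (simp add: field_simps)
    ultimately have "(\<lambda>p. real p / real (p + H)) \<longlonglongrightarrow> 1"
      by (rule Lim_transform_eventually[THEN tendsto_eq_rhs]) simp
    then have "(\<lambda>p. (1 - (real p / real (p + H)) ^ CARD('m)) * w) \<longlonglongrightarrow> (1 - 1 ^ CARD('m)) * w"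
      by (intro tendsto_intros)
    then have "eventually (\<lambda>p. (1 - (real p / real (p + H)) ^ CARD('m)) * w < e / 8) sequentially"
      using e by (intro order_tendstoD(2)) auto
    then obtain p0 where "\<And>p. p \<ge> p0 \<Longrightarrow> (1 - (real p / real (p + H)) ^ CARD('m)) * w < e / 8"
      by (auto simp: eventually_sequentially)
    then show ?thesis using that[of "max p0 1"] by simp
  qed
  define q where "q = p + H"
  have q0: "0 < q" using p by (simp add: q_def)
  define B where "B n = {b :: int^'m. \<forall>i. b $ i \<in> {0..<int (n div q)}}" for n
  have B: "finite (B n)" "card (B n) = (n div q) ^ CARD('m)" for n
    unfolding B_def using card_vec_set[of "{0..<int (n div q)}"] by auto
  note Y = Yg_moments[OF restricts_ft has_int_Xt]
  let ?W = "blk h p q"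
  define T' where "T' n \<omega> = sc n * (\<Sum>b\<in>B n. ?W b \<omega>)" for n \<omega>
  have Wm[measurable]: "?W b \<in> borel_measurable M" for b unfolding blk_def[abs_def] using Y(1) by measurable
  have WW: "integrable M (\<lambda>\<omega>. ?W b \<omega> * ?W b' \<omega>)" "(LINT \<omega>|M. ?W b \<omega> * ?W b' \<omega>) = (\<Sum>j\<in>lattice_box (int p). \<Sum>l\<in>lattice_box (int p). cY (ft h) ((l + sft q b') - (j + sft q b)))" for b b'
  proof -
    show "integrable M (\<lambda>\<omega>. ?W b \<omega> * ?W b' \<omega>)"
      unfolding blk_def sum_product by (intro Bochner_Integration.integrable_sum Y(2))
    show "(LINT \<omega>|M. ?W b \<omega> * ?W b' \<omega>) = (\<Sum>j\<in>lattice_box (int p). \<Sum>l\<in>lattice_box (int p). cY (ft h) ((l + sft q b') - (j + sft q b)))"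
      unfolding blk_def sum_product by (simp only: Bochner_Integration.integral_sum Bochner_Integration.integrable_sum Y(2) Y(3))
  qed
  define \<sigma> where "\<sigma> = (LINT \<omega>|M. (?W 0 \<omega>)\<^sup>2)"
  have W_same: "(LINT \<omega>|M. ?W b \<omega> * ?W b \<omega>) = \<sigma>" for b
    unfolding \<sigma>_def power2_eq_square WW(2) by simp
  have W_orth: "(LINT \<omega>|M. ?W b \<omega> * ?W b' \<omega>) = 0" if "b \<noteq> b'" for b b'
  proof -
    have "cY (ft h) ((l + sft q b') - (j + sft q b)) = 0" if "j \<in> lattice_box (int p)" "l \<in> lattice_box (int p)" for j l
    proof (rule cY_ft_zero)
      have ji: "\<bar>l $ i - j $ i\<bar> \<le> int p" for i
      proof -
        have "0 < l $ i" "l $ i \<le> int p" "0 < j $ i" "j $ i \<le> int p" using that by (auto simp: lattice_box_def)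
        then show ?thesis by linarith
      qed
      have "int (d + lagmax) \<le> linf ((l + sft q b') - (j + sft q b))"
        by (rule block_separation[OF not_sym[OF \<open>b \<noteq> b'\<close>] _ ji]) (simp add: q_def H_def)
      then show "h + real lagmax \<le> real_of_int (linf ((l + sft q b') - (j + sft q b)))" by (simp add: h_def)
    qed
    then show ?thesis unfolding WW(2) by simp
  qed
  have T'2: "integrable M (\<lambda>\<omega>. (T' n \<omega>)\<^sup>2)" for n
    unfolding T'_def power_mult_distrib by (intro integrable_mult_right square_sum_integrable B WW(1))
  have T'v: "(LINT \<omega>|M. (T' n \<omega>)\<^sup>2) = real (card (B n)) * (sc n)\<^sup>2 * \<sigma>" for n
  proof -
    have "(LINT \<omega>|M. (T' n \<omega>)\<^sup>2) = (sc n)\<^sup>2 * (LINT \<omega>|M. (\<Sum>b\<in>B n. \<Sum>b'\<in>B n. ?W b \<omega> * ?W b' \<omega>))"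
      unfolding T'_def power_mult_distrib by (simp add: power2_eq_square sum_product)
    also have "(LINT \<omega>|M. (\<Sum>b\<in>B n. \<Sum>b'\<in>B n. ?W b \<omega> * ?W b' \<omega>)) = (\<Sum>b\<in>B n. \<Sum>b'\<in>B n. LINT \<omega>|M. ?W b \<omega> * ?W b' \<omega>)"
      by (simp only: Bochner_Integration.integral_sum Bochner_Integration.integrable_sum WW(1))
    also have "\<dots> = (\<Sum>b\<in>B n. \<Sum>b'\<in>B n. if b' = b then \<sigma> else 0)"
      by (intro sum.cong refl) (auto simp: W_same W_orth)
    also have "\<dots> = real (card (B n)) * \<sigma>" using B(1) by (simp add: sum.delta)
    finally show ?thesis by simp
  qed
  have dens: "(\<lambda>n. real (card (B n)) * (sc n)\<^sup>2) \<longlonglongrightarrow> (1 / real q) ^ CARD('m)"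
  proof -
    have "real (card (B n)) * (sc n)\<^sup>2 = (real (n div q) / real n) ^ CARD('m)" for n
      by (simp add: B sc(2) power_divide)
    then show ?thesis using tendsto_power[OF div_ratio_tendsto[OF q0]] by simp
  qed
  define v' where "v' = (1 / real q) ^ CARD('m) * \<sigma>"
  have "(\<lambda>n. LINT \<omega>|M. (T' n \<omega>)\<^sup>2) \<longlonglongrightarrow> v'"
    unfolding T'v v'_def by (intro tendsto_intros dens)
  moreover have "(\<lambda>n. CLINT \<omega>|M. iexp (T' n \<omega>)) \<longlonglongrightarrow> of_real (exp (- v' / 2))"
  proof -
    have sc0: "sc \<longlonglongrightarrow> 0"
    proof -
      have "(\<lambda>n. (sc n)\<^sup>2) \<longlonglongrightarrow> 0"
      proof (rule Lim_null_comparison[OF _ lim_const_over_n[of 1]], rule eventually_sequentiallyI[of 1])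
        fix n :: nat assume n: "1 \<le> n"
        have "real n ^ 1 \<le> real n ^ CARD('m)" using n by (intro power_increasing) (auto simp: Suc_leI)
        then show "norm ((sc n)\<^sup>2) \<le> 1 / real n" using n unfolding sc(2) by (simp add: frac_le)
      qed
      then have "(\<lambda>n. sqrt ((sc n)\<^sup>2)) \<longlonglongrightarrow> sqrt 0" by (intro tendsto_intros)
      moreover have "sqrt ((sc n)\<^sup>2) = sc n" for n by (simp add: sc_def)
      ultimately show ?thesis by simp
    qed
    have mean: "(LINT \<omega>|M. ?W 0 \<omega>) = 0"
      unfolding blk_def by (simp only: Bochner_Integration.integral_sum Y(4) Y(5)) simp
    have "(\<lambda>n. (CLINT \<omega>|M. iexp (sc n * ?W 0 \<omega>)) ^ card (B n)) \<longlonglongrightarrow> of_real (exp (- ((1 / real q) ^ CARD('m)) * (LINT \<omega>|M. (?W 0 \<omega>)\<^sup>2) / 2))"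
      by (rule M.char_power_limit[OF Wm _ mean sc0 dens]) (use WW(1)[of 0 0] in \<open>simp add: power2_eq_square\<close>)
    moreover have "(CLINT \<omega>|M. iexp (T' n \<omega>)) = (CLINT \<omega>|M. iexp (sc n * ?W 0 \<omega>)) ^ card (B n)" for n
      unfolding T'_def by (rule blk_char[OF B(1), where d=d]) (auto simp: h_def q_def H_def)
    ultimately show ?thesis by (simp add: v'_def \<sigma>_def)
  qed
  moreover have "eventually (\<lambda>n. (LINT \<omega>|M. (Tn n \<omega> - T' n \<omega>)\<^sup>2) \<le> e) sequentially"
  proof -
    \<comment> \<open>the sites covered by blocks\<close>
    define U where "U n = (\<lambda>(b, j). j + sft q b) ` (B n \<times> lattice_box (int p))" for n
    have inj: "inj_on (\<lambda>(b, j). j + sft q b) (B n \<times> lattice_box (int p))" for n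
    proof (rule inj_onI, clarify)
      fix b j b' j' assume jj: "j \<in> lattice_box (int p)" "j' \<in> lattice_box (int p)" and eq: "j + sft q b = j' + sft q b'"
      have "b = b'"
      proof (rule ccontr)
        assume "b \<noteq> b'"
        have *: "0 < l $ i \<and> l $ i \<le> int p" if "l \<in> lattice_box (int p)" for l :: "int^'m" and i using that by (auto simp: lattice_box_def)
        have "\<bar>j $ i - j' $ i\<bar> \<le> int (p - 1)" for i using *[OF jj(1), of i] *[OF jj(2), of i] p(1) by linarith
        then have "int 1 \<le> linf ((j + sft q b) - (j' + sft q b'))"
          using p(1) by (intro block_separation[OF \<open>b \<noteq> b'\<close>, where p="p - 1"]) (auto simp: q_def)
        then show False unfolding eq by (simp add: linf_def)
      qed
      then show "b = b' \<and> j = j'" using eq by simp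
    qed
    have U: "finite (U n)" "card (U n) = card (B n) * p ^ CARD('m)" for n
      unfolding U_def using B(1) by (auto simp: card_image[OF inj] card_cartesian_product card_lattice_box)
    have Usub: "U n \<subseteq> E n" for n
    proof
      fix x assume "x \<in> U n"
      then obtain b j where x: "x = j + sft q b" "b \<in> B n" "j \<in> lattice_box (int p)" unfolding U_def by auto
      have "0 < x $ i \<and> x $ i \<le> int n" for i
      proof -
        have b: "0 \<le> b $ i" "b $ i \<le> int (n div q) - 1" using x(2) by (auto simp: B_def)
        have j: "0 < j $ i" "j $ i \<le> int q" using x(3) by (auto simp: lattice_box_def q_def intro: order_trans)
        have "int q * b $ i \<le> int q * (int (n div q) - 1)" using b by (intro mult_left_mono) auto
        also have "\<dots> = int (q * (n div q)) - int q" by (simp add: algebra_simps)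
        also have "\<dots> \<le> int n - int q" using times_div_less_eq_dividend[of q n] by linarith
        finally have "int q * b $ i \<le> int n - int q" .
        moreover have "0 \<le> int q * b $ i" using b by simp
        ultimately show ?thesis unfolding x(1) using j by (simp add: sft_def)
      qed
      then show "x \<in> E n" by (simp add: lattice_box_def)
    qed
    have sumU: "(\<Sum>b\<in>B n. ?W b \<omega>) = (\<Sum>j\<in>U n. Yt h j \<omega>)" for n \<omega>
      unfolding U_def blk_def by (subst sum.reindex[OF inj]) (simp add: sum.cartesian_product case_prod_unfold)
    have err: "(LINT \<omega>|M. (Tn n \<omega> - T' n \<omega>)\<^sup>2) \<le> 2 * infsum (eB h) UNIV + 2 * ((1 - (real p * (real (n div q) / real n)) ^ CARD('m)) * w)" if n: "1 \<le> n" for n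
    proof -
      let ?D = "\<lambda>\<omega>. \<Sum>j\<in>E n. (Yf j \<omega> - Yt h j \<omega>)" and ?R = "\<lambda>\<omega>. \<Sum>j\<in>E n - U n. Yt h j \<omega>"
      have "Tn n \<omega> - T' n \<omega> = sc n * (?D \<omega> + ?R \<omega>)" for \<omega>
        unfolding Tn_def T'_def sumU using sum.subset_diff[OF Usub finite_lattice_box, of "\<lambda>j. Yt h j \<omega>" n]
        by (simp add: sum_subtractf algebra_simps)
      then have le: "(Tn n \<omega> - T' n \<omega>)\<^sup>2 \<le> (sc n)\<^sup>2 * (2 * (?D \<omega>)\<^sup>2 + 2 * (?R \<omega>)\<^sup>2)" for \<omega>
        using sum_squares_bound[of "?D \<omega>" "?R \<omega>"] by (simp add: power_mult_distrib power2_sum mult_left_mono)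
      have iD: "integrable M (\<lambda>\<omega>. (?D \<omega>)\<^sup>2)" by (intro square_sum_integrable Yf_Yt_diff(1)) simp
      have iR: "integrable M (\<lambda>\<omega>. (?R \<omega>)\<^sup>2)" by (intro square_sum_integrable Y(2)) simp
      have "(LINT \<omega>|M. (Tn n \<omega> - T' n \<omega>)\<^sup>2) \<le> (LINT \<omega>|M. (sc n)\<^sup>2 * (2 * (?D \<omega>)\<^sup>2 + 2 * (?R \<omega>)\<^sup>2))"
        by (rule integral_mono_AE') (use le iD iR in auto)
      also have "\<dots> = (sc n)\<^sup>2 * (2 * (LINT \<omega>|M. (?D \<omega>)\<^sup>2) + 2 * (LINT \<omega>|M. (?R \<omega>)\<^sup>2))" using iD iR by simp
      also have "\<dots> \<le> (sc n)\<^sup>2 * (2 * (real (card (E n)) * infsum (eB h) UNIV) + 2 * (real (card (E n - U n)) * w))"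
      proof (intro mult_left_mono add_mono)
        show "(LINT \<omega>|M. (?D \<omega>)\<^sup>2) \<le> real (card (E n)) * infsum (eB h) UNIV"
          by (rule second_moment_lattice_sum_le[OF _ Yf_Yt_diff eB_bounds(1)]) simp
        have "\<bar>LINT \<omega>|M. Yt h j \<omega> * Yt h l \<omega>\<bar> \<le> wB (l - j)" for j l unfolding Y(3) by (rule abs_cY_le[OF restricts_ft])
        then show "(LINT \<omega>|M. (?R \<omega>)\<^sup>2) \<le> real (card (E n - U n)) * w"
          unfolding w_def by (intro second_moment_lattice_sum_le Y(2) wB_summable) auto
      qed auto
      also have "\<dots> = 2 * infsum (eB h) UNIV + 2 * (real (card (E n - U n)) / real (card (E n)) * w)"
      proof -
        have "real (card (E n)) \<noteq> 0" using n by (simp add: card_lattice_box)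
        then show ?thesis unfolding sc(1) by (simp add: field_simps)
      qed
      also have "real (card (E n - U n)) / real (card (E n)) = 1 - (real p * (real (n div q) / real n)) ^ CARD('m)"
      proof -
        have "card (E n - U n) = card (E n) - card (U n)" "card (U n) \<le> card (E n)"
          using Usub U(1) by (simp_all add: card_Diff_subset card_mono)
        then have "real (card (E n - U n)) = real (card (E n)) - real (card (U n))" by simp
        then show ?thesis using n unfolding U(2) B(2) card_lattice_box
          by (simp add: diff_divide_distrib power_mult_distrib power_divide mult.commute)
      qed
      finally show ?thesis .
    qed
    have "(\<lambda>n. 2 * infsum (eB h) UNIV + 2 * ((1 - (real p * (real (n div q) / real n)) ^ CARD('m)) * w)) \<longlonglongrightarrow>
       2 * infsum (eB h) UNIV + 2 * ((1 - (real p * (1 / real q)) ^ CARD('m)) * w)"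
      by (intro tendsto_intros div_ratio_tendsto q0)
    moreover have "2 * infsum (eB h) UNIV + 2 * ((1 - (real p * (1 / real q)) ^ CARD('m)) * w) < e"
      using d p(2) e by (simp add: h_def q_def)
    ultimately have "eventually (\<lambda>n. 2 * infsum (eB h) UNIV + 2 * ((1 - (real p * (real (n div q) / real n)) ^ CARD('m)) * w) < e) sequentially"
      by (rule order_tendstoD(2))
    then show ?thesis using eventually_ge_at_top[of 1] by eventually_elim (use err in \<open>force intro: order_trans less_imp_le\<close>)
  qed
  moreover have "\<forall>n. T' n \<in> borel_measurable M" unfolding T'_def[abs_def] by measurable
  ultimately show "\<exists>T' v'. (\<forall>n. T' n \<in> borel_measurable M) \<and> (\<forall>n. integrable M (\<lambda>\<omega>. (T' n \<omega>)\<^sup>2)) \<and>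
        (\<lambda>n. LINT \<omega>|M. (T' n \<omega>)\<^sup>2) \<longlonglongrightarrow> v' \<and> (\<lambda>n. CLINT \<omega>|M. iexp (T' n \<omega>)) \<longlonglongrightarrow> of_real (exp (- v' / 2)) \<and>
        eventually (\<lambda>n. (LINT \<omega>|M. (Tn n \<omega> - T' n \<omega>)\<^sup>2) \<le> e) sequentially"
    using T'2 by blast
qed

text \<open>As a limit of variances.\<close>

lemma limit_variance_nonneg: "0 \<le> infsum (cY f) UNIV"
  by (rule LIMSEQ_le_const[OF Tn_moments(3)]) (auto intro!: integral_nonneg_AE)

end

section \<open>The limit covariance matrix\<close>

text \<open>Boxes of nonpositive side are empty.\<close>

lemma lattice_box_nat: "lattice_box (int (nat a)) = lattice_box a"
  by (auto simp: lattice_box_def)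

lemma has_sum_vecI:
  fixes F :: "'a \<Rightarrow> ('b::{topological_comm_monoid_add})^'n"
  assumes "\<And>i. ((\<lambda>l. F l $ i) has_sum S $ i) A"
  shows "(F has_sum S) A"
  using assms unfolding has_sum_def by (intro vec_tendstoI) (simp add: sum_component)

lemma borel_measurable_vecI:
  fixes F :: "'a \<Rightarrow> real^'n"
  assumes "\<And>i. (\<lambda>x. F x $ i) \<in> borel_measurable M"
  shows "F \<in> borel_measurable M"
proof (rule borel_measurable_euclidean_space[THEN iffD2], rule ballI)
  fix b :: "real^'n" assume "b \<in> Basis"
  then obtain i where "b = axis i 1" by (auto simp: Basis_vec_def)
  then show "(\<lambda>x. F x \<bullet> b) \<in> borel_measurable M" using assms[of i] by (simp add: inner_axis)
qed

context lagged_products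
begin

definition lagcov where "lagcov p q l = prod_cov (sh f 0) (sh f (k p)) (sh f l) (sh f (l + k q))"
definition Xi :: "real^'r^'r" where "Xi = (\<chi> p q. infsum (lagcov p q) UNIV)"

lemma L24_sh_f: "L24 (sh f u)"
  by (intro L24_sh L24_f)

lemma X_measurable[measurable]: "X u \<in> borel_measurable M"
  by (rule has_int_measurable[OF has_int_X])

lemma integrable_X_product: "integrable M (\<lambda>\<omega>. X u \<omega> * X v \<omega>)"
  by (rule product_covariance(1)[OF L24_sh_f L24_sh_f L24_sh_f L24_sh_f has_int_X has_int_X has_int_X has_int_X])

lemma second_moment_X: "(LINT \<omega>|M. X u \<omega> * X v \<omega>) = Cov (sh f u) (sh f v)"
  by (rule has_int_second_product[OF L24_sh_f L24_sh_f has_int_X has_int_X])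

lemma product_covariance_X:
  "integrable M (\<lambda>\<omega>. (X u \<omega> * X v \<omega> - Cov (sh f u) (sh f v)) * (X u' \<omega> * X v' \<omega> - Cov (sh f u') (sh f v')))"
  "(LINT \<omega>|M. (X u \<omega> * X v \<omega> - Cov (sh f u) (sh f v)) * (X u' \<omega> * X v' \<omega> - Cov (sh f u') (sh f v')))
    = prod_cov (sh f u) (sh f v) (sh f u') (sh f v')"
  using product_covariance[OF L24_sh_f L24_sh_f L24_sh_f L24_sh_f has_int_X has_int_X has_int_X has_int_X] by blast+

lemma Y_vec_component: "Y_vec M X k j \<omega> $ q = X j \<omega> * X (j + k q) \<omega> - Cov (sh f j) (sh f (j + k q))"
  by (simp add: Y_vec_def second_moment_X Cov_lag[OF restricts_f])

lemma Y_vec_square_integrable: "integrable M (\<lambda>\<omega>. (Y_vec M X k j \<omega> $ q)\<^sup>2)"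
  unfolding power2_eq_square Y_vec_component by (rule product_covariance_X(1))

lemma cross_cov_prod_vec: "cross_cov M (prod_vec X k 0) (prod_vec X k l) = (\<chi> p q. lagcov p q l)"
  unfolding cross_cov_def prod_vec_def vec_lambda_beta second_moment_X product_covariance_X(2) lagcov_def by simp

lemma cross_cov_Y_vec: "cross_cov M (Y_vec M X k 0) (Y_vec M X k l) = (\<chi> p q. lagcov p q l)"
proof -
  have "(LINT \<omega>|M. X u \<omega> * X v \<omega> - Cov (sh f u) (sh f v)) = 0" for u v
    by (subst Bochner_Integration.integral_diff) (simp_all add: integrable_X_product second_moment_X M.prob_space)
  then show ?thesis
    unfolding cross_cov_def Y_vec_component diff_0_right product_covariance_X(2) lagcov_def by (simp add: product_covariance_X(2))
qed

lemma lagcov_summable: "lagcov p q summable_on UNIV"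
proof (rule summable_on_dominated)
  show "(\<lambda>l. (K4 + 1) * prod_bound fF 0 fF (k p) l (l + k q)) summable_on UNIV"
    by (intro summable_on_cmult_right prod_bound_summable)
  show "\<bar>lagcov p q l\<bar> \<le> (K4 + 1) * prod_bound fF 0 fF (k p) l (l + k q)" for l
    unfolding lagcov_def by (rule abs_prod_cov_le) (simp_all add: fF_def)
qed

text \<open>Stationarity together with the symmetry between the two products.\<close>

lemma lagcov_minus: "lagcov p q (- l) = lagcov q p l"
proof -
  have swap: "prod_cov g1 g2 g3 g4 = prod_cov g3 g4 g1 g2" for g1 g2 g3 g4
    by (simp add: prod_cov_def Cum_def k4_def mult_ac Cov_sym[of g3] Cov_sym[of g4])
  have "lagcov p q (- l) = prod_cov (sh f (0 + l)) (sh f (k p + l)) (sh f (- l + l)) (sh f (- l + k q + l))"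
    unfolding lagcov_def by (rule prod_cov_shift[symmetric]) simp_all
  also have "\<dots> = prod_cov (sh f l) (sh f (l + k p)) (sh f 0) (sh f (k q))" by (simp add: algebra_simps)
  also have "\<dots> = lagcov q p l" unfolding lagcov_def by (rule swap)
  finally show ?thesis .
qed

lemma Xi_sym: "transpose Xi = Xi"
proof -
  have "infsum (lagcov q p) UNIV = infsum (lagcov p q) UNIV" for p q
  proof -
    have "infsum (\<lambda>l. lagcov p q (- l)) UNIV = infsum (lagcov p q) UNIV"
      by (rule infsum_reindex_bij_betw) (rule bij_uminus)
    then show ?thesis by (simp add: lagcov_minus)
  qed
  then show ?thesis by (simp add: Xi_def transpose_def vec_eq_iff)
qed

text \<open>The quadratic form of \<open>Xi\<close> is a limit variance, which makes the matrix positive semidefinite.\<close>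

lemma Xi_form: "(\<chi> q. t q) \<bullet> (Xi *v (\<chi> q. t q)) = infsum (cY f) UNIV"
proof -
  have s: "(\<lambda>l. t p * t q * lagcov p q l) summable_on UNIV" for p q
    by (intro summable_on_cmult_right lagcov_summable)
  have "infsum (cY f) UNIV = infsum (\<lambda>l. \<Sum>p\<in>UNIV. \<Sum>q\<in>UNIV. t p * t q * lagcov p q l) UNIV"
    by (intro infsum_cong) (simp add: cY_def lagcov_def)
  also have "\<dots> = (\<Sum>p\<in>UNIV. infsum (\<lambda>l. \<Sum>q\<in>UNIV. t p * t q * lagcov p q l) UNIV)"
    by (rule infsum_finite_sum(1)) (simp_all add: infsum_finite_sum(2) s)
  also have "\<dots> = (\<Sum>p\<in>UNIV. \<Sum>q\<in>UNIV. infsum (\<lambda>l. t p * t q * lagcov p q l) UNIV)"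
    by (intro sum.cong refl infsum_finite_sum(1) s) simp
  also have "\<dots> = (\<Sum>p\<in>UNIV. \<Sum>q\<in>UNIV. t p * t q * infsum (lagcov p q) UNIV)"
    by (simp only: infsum_cmult_right'[symmetric])
  also have "\<dots> = (\<chi> q. t q) \<bullet> (Xi *v (\<chi> q. t q))"
    by (simp add: inner_vec_def matrix_vector_mult_def Xi_def sum_distrib_left mult_ac)
  finally show ?thesis by simp
qed

lemma inner_Y_vec: "(\<chi> q. t q) \<bullet> Y_vec M X k j \<omega> = Yf j \<omega>"
  by (simp add: inner_vec_def Y_vec_component Yg_def Cov_lag[OF restricts_f])

lemma scaled_sums_char:
  "(\<lambda>n. CLINT \<omega>|M. iexp ((\<chi> q. t q) \<bullet>
      ((1 / sqrt (real (card (lattice_box (int n - c) :: (int^'m) set)))) *\<^sub>R (\<Sum>j\<in>lattice_box (int n - c). Y_vec M X k j \<omega>))))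
    \<longlonglongrightarrow> of_real (exp (- infsum (cY f) UNIV / 2))"
proof -
  have "filterlim (\<lambda>n. nat (int n - c)) at_top sequentially"
    unfolding filterlim_at_top
  proof
    fix Z :: nat
    show "eventually (\<lambda>n. Z \<le> nat (int n - c)) sequentially"
      by (rule eventually_sequentiallyI[of "Z + nat c"]) linarith
  qed
  note lim = filterlim_compose[OF clt_scalar this]
  have box: "lattice_box (int n - c) = E (nat (int n - c))" for n by (rule lattice_box_nat[symmetric])
  have "Tn (nat (int n - c)) \<omega> = (\<chi> q. t q) \<bullet>
      ((1 / sqrt (real (card (lattice_box (int n - c) :: (int^'m) set)))) *\<^sub>R (\<Sum>j\<in>lattice_box (int n - c). Y_vec M X k j \<omega>))" for n \<omega>
    unfolding box inner_scaleR_right inner_sum_right inner_Y_vec Tn_def sc_def ..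
  with lim show ?thesis by simp
qed

end

section \<open>The moment and decay conditions\<close>

lemma levy_measure_fourth_moment:
  assumes \<nu>: "levy_measure \<nu>" and "0 < \<delta>" and m: "set_integrable \<nu> {x. norm x > 1} (\<lambda>x. norm x powr (4 + \<delta>))"
  shows "integrable \<nu> (\<lambda>x. norm x ^ 4)"
proof -
  have [measurable_cong]: "sets \<nu> = sets borel" and i: "integrable \<nu> (\<lambda>x. min 1 ((norm x)\<^sup>2))"
    using \<nu> by (auto simp: levy_measure_def)
  have m: "integrable \<nu> (\<lambda>x. indicator {x. norm x > 1} x * norm x powr (4 + \<delta>))"
    using m by (simp add: set_integrable_def)
  show ?thesis
  proof (rule Bochner_Integration.integrable_bound[OF Bochner_Integration.integrable_add[OF i m]])
    have "norm x ^ 4 \<le> min 1 ((norm x)\<^sup>2) + indicator {x. norm x > 1} x * norm x powr (4 + \<delta>)" for x :: "real^'a"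
    proof (cases "norm x \<le> 1")
      case True
      then have "norm x ^ 4 \<le> (norm x)\<^sup>2" "norm x ^ 4 \<le> 1" by (auto intro: power_decreasing power_le_one)
      then show ?thesis using True by simp
    next
      case False
      then have "norm x ^ 4 = norm x powr 4" by (simp add: powr_numeral)
      also have "\<dots> \<le> norm x powr (4 + \<delta>)" using False \<open>0 < \<delta>\<close> by (intro powr_mono) auto
      finally show ?thesis using False by (simp add: add_increasing)
    qed
    then show "AE x in \<nu>. norm (norm x ^ 4) \<le> norm (min 1 ((norm x)\<^sup>2) + indicator {x. norm x > 1} x * norm x powr (4 + \<delta>))"
      by (intro AE_I2) (simp add: abs_of_nonneg)
  qed measurable
qed

text \<open>The second bound amounts to \<open>2(1 + \<delta>)(3 + \<delta>) \<ge> (2 + \<delta>)\<^sup>2\<close>.\<close>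

lemma decay_exponent_bounds:
  fixes \<beta> \<delta> m :: real
  assumes d: "0 < \<delta>" and m: "0 < m" and \<beta>: "\<beta> > m * max 2 (1 + 1 / \<delta>) * ((3 + \<delta>) / (2 + \<delta>))"
  shows "\<beta> > m" "2 * \<beta> * \<delta> / (2 + \<delta>) > m"
proof -
  have r: "1 \<le> (3 + \<delta>) / (2 + \<delta>)" using d by simp
  have "m * 1 * 1 \<le> m * max 2 (1 + 1 / \<delta>) * ((3 + \<delta>) / (2 + \<delta>))"
    using m r d by (intro mult_mono) auto
  then show "\<beta> > m" using \<beta> by simp
  have "m * (1 + 1 / \<delta>) * ((3 + \<delta>) / (2 + \<delta>)) \<le> m * max 2 (1 + 1 / \<delta>) * ((3 + \<delta>) / (2 + \<delta>))"
    using m d by (intro mult_right_mono mult_left_mono) auto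
  then have b: "m * (1 + 1 / \<delta>) * ((3 + \<delta>) / (2 + \<delta>)) < \<beta>" using \<beta> by simp
  have c: "0 < 2 * \<delta> / (2 + \<delta>)" using d by simp
  have "1 * (2 + \<delta>)\<^sup>2 \<le> 2 * (\<delta> + 1) * (3 + \<delta>)" using d by (simp add: power2_eq_square algebra_simps)
  then have "1 \<le> 2 * (\<delta> + 1) * (3 + \<delta>) / (2 + \<delta>)\<^sup>2" using d by (subst pos_le_divide_eq) auto
  then have "m * 1 \<le> m * (2 * (\<delta> + 1) * (3 + \<delta>) / (2 + \<delta>)\<^sup>2)" using m by (intro mult_left_mono) auto
  then have "m \<le> m * (2 * (\<delta> + 1) * (3 + \<delta>) / (2 + \<delta>)\<^sup>2)" by simp
  also have "\<dots> = 2 * \<delta> / (2 + \<delta>) * (m * (1 + 1 / \<delta>) * ((3 + \<delta>) / (2 + \<delta>)))"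
    using d by (simp add: divide_simps power2_eq_square)
  also have "\<dots> < 2 * \<delta> / (2 + \<delta>) * \<beta>" by (rule mult_strict_left_mono[OF b c])
  finally show "2 * \<beta> * \<delta> / (2 + \<delta>) > m" by (simp add: mult_ac)
qed

theorem corollary3p24:
  fixes M :: "'w measure"
    and \<Lambda> :: "('s::polish_space \<times> (real^'m)) set \<Rightarrow> 'w \<Rightarrow> real^'d"
    and \<gamma> :: "real^'d" and Sig :: "real^'d^'d" and \<nu> :: "(real^'d) measure"
    and \<pi> :: "'s measure"
    and f :: "'s \<times> (real^'m) \<Rightarrow> real^'d"
    and X :: "int^'m \<Rightarrow> 'w \<Rightarrow> real"
    and \<delta> \<beta> :: real
    and k :: "'r::finite \<Rightarrow> int^'m" and q0 :: 'r and first :: 'm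
  assumes basis: "levy_basis M \<Lambda> \<gamma> Sig \<nu> \<pi>"
    and f_meas: "f \<in> borel_measurable borel"
    and delta: "\<delta> > 0"
    and nu_moment: "set_integrable \<nu> {x. norm x > 1} (\<lambda>x. norm x powr (4 + \<delta>))"
    and centred: "\<gamma> + (LINT x : {x. norm x > 1} | \<nu>. x) = 0"
    and f_L2: "integrable (\<pi> \<Otimes>\<^sub>M lborel) (\<lambda>p. (norm (f p))\<^sup>2)"
    and f_L4: "integrable (\<pi> \<Otimes>\<^sub>M lborel) (\<lambda>p. norm (f p) powr (4 + \<delta>))"
    and X: "mma_field M \<Lambda> \<pi> f X"
    and eta: "eta_hat f Sig \<nu> \<pi> \<in> O[at_top](\<lambda>h. h powr (- \<beta>))"
    and beta: "\<beta> > real CARD('m) * max 2 (1 + 1 / \<delta>) * ((3 + \<delta>) / (2 + \<delta>))"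
    and k0: "k q0 = 0"
    and lags: "\<forall>q. 0 \<le> k q $ first"
  shows "\<exists>\<Xi> :: real^'r^'r.
      (\<forall>j q. integrable M (\<lambda>\<omega>. (Y_vec M X k j \<omega> $ q)\<^sup>2))
    \<and> ((\<lambda>l. cross_cov M (Y_vec M X k 0) (Y_vec M X k l)) has_sum \<Xi>) UNIV
    \<and> ((\<lambda>l. cross_cov M (prod_vec X k 0) (prod_vec X k l)) has_sum \<Xi>) UNIV
    \<and> psd \<Xi>
    \<and> (\<exists>P. normal_law 0 \<Xi> P
        \<and> conv_in_distr M
            (\<lambda>n \<omega>. (1 / sqrt (real (card (lattice_box (int n - max_lag k) :: (int^'m) set))))
                *\<^sub>R (\<Sum>j\<in>lattice_box (int n - max_lag k). Y_vec M X k j \<omega>)) P)"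
proof -
  have \<nu>: "levy_measure \<nu>" using basis by (simp add: levy_basis_def)
  interpret mma_setup M \<Lambda> \<gamma> Sig \<nu> \<pi> f X \<delta> \<beta>
  proof
    show "integrable \<nu> (\<lambda>x. norm x ^ 4)" by (rule levy_measure_fourth_moment[OF \<nu> delta nu_moment])
    show "\<beta> > real CARD('m)" "2 * \<beta> * \<delta> / (2 + \<delta>) > real CARD('m)"
      by (rule decay_exponent_bounds[OF delta _ beta], simp)+
  qed (fact basis centred f_meas delta f_L2 f_L4 X eta)+
  interpret L: lagged_products M \<Lambda> \<gamma> Sig \<nu> \<pi> f X \<delta> \<beta> k t for t
    by standard
  define \<Xi> where "\<Xi> = L.Xi"
  define V where "V n \<omega> = (1 / sqrt (real (card (lattice_box (int n - max_lag k) :: (int^'m) set))))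
    *\<^sub>R (\<Sum>j\<in>lattice_box (int n - max_lag k). Y_vec M X k j \<omega>)" for n \<omega>
  have sums: "((\<lambda>l. \<chi> p q. L.lagcov p q l) has_sum \<Xi>) UNIV"
    by (intro has_sum_vecI) (simp add: \<Xi>_def L.Xi_def L.lagcov_summable has_sum_infsum)
  have form: "u \<bullet> (\<Xi> *v u) = infsum (L.cY (\<lambda>q. u $ q) f) UNIV" for u
    using L.Xi_form[of "\<lambda>q. u $ q"] by (simp add: \<Xi>_def)
  have psd: "psd \<Xi>"
    unfolding psd_def form by (simp add: \<Xi>_def L.Xi_sym L.limit_variance_nonneg)
  then obtain P where P: "normal_law 0 \<Xi> P" using normal_law_exists by blast
  have "char_convergence M P V"
  proof (intro char_convergence.intro char_convergence_axioms.intro)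
    show "prob_space M" by (rule M.prob_space_axioms)
    show "prob_space P" "sets P = sets borel" using P by (simp_all add: normal_law_def)
    show "V n \<in> borel_measurable M" for n
      unfolding V_def by (rule borel_measurable_vecI) (simp add: Y_vec_def)
    show "(\<lambda>n. CLINT \<omega>|M. iexp (u \<bullet> V n \<omega>)) \<longlonglongrightarrow> (CLINT x|P. iexp (u \<bullet> x))" for u
      using P L.scaled_sums_char[of "\<lambda>q. u $ q" "max_lag k"]
      by (simp add: normal_law_def V_def form flip: exp_of_real)
  qed
  then have "conv_in_distr M V P" by (rule char_convergence.conv_in_distr)
  then show ?thesis
    using sums psd P unfolding V_def[abs_def]
    by (intro exI[of _ \<Xi>] conjI exI[of _ P] allI L.Y_vec_square_integrable)
      (simp_all only: L.cross_cov_prod_vec L.cross_cov_Y_vec)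
qed

end
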